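(* Let $P\subset\mathbb{R}^2$ be a set of $n$ sites in the plane, each $p\in P$ having an associated radius $r_p>0$, with radius ratio $\Psi$. For any fixed $t>1$, we can compute a $t$-spanner for the transmission graph $G$ of $P$ in $O(n(\log n+\log\Psi))$ time and $O(n\log\Psi)$ space.
   Context: Transmission graph: given a finite set $P\subset\mathbb{R}^2$ of points (called sites), each $p\in P$ with a radius $r_p>0$, the transmission graph $G$ of $P$ is the directed graph with vertex set $P$ having an edge $pq$ from $p$ to $q$ (for distinct $p,q\in P$) if and only if $|pq|\le r_p$, where $|pq|$ is the Euclidean distance. The edge $pq$ has weight $|pq|$. The input consists of the points and their radii only; $G$ is not given explicitly. $t$-spanner: a subgraph $H\subseteq G$ with vertex set $P$ such that $d_H(p,q)\le t\, d_G(p,q)$ for all $p,q\in P$, where $d_H,d_G$ are the weighted directed shortest path distances in $H$ and $G$ ($\infty$ if no path exists). Radius ratio: $\Psi=\max_{p,q\in P}(r_p/r_q)$. Since $t$ is fixed, the constants in the $O$-notation may depend on $t$. Model of computation: it is assumed that, for a given point and a given $i\ge 0$, the cell containing the point in the axis-parallel grid of squares of diameter $2^i$ (with the origin at a corner of a cell) can be found in constant time. *)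

theory Defs
  imports "HOL-Analysis.Analysis" "Graph_Theory.Graph_Theory"
begin

section \<open>Transmission graphs and spanners\<close>

definition transmission_graph ::
    "(real ^ 2) set \<Rightarrow> (real ^ 2 \<Rightarrow> real) \<Rightarrow> (real ^ 2) pair_pre_digraph" where
  "transmission_graph P r =
     \<lparr> pverts = P, parcs = {(p, q). p \<in> P \<and> q \<in> P \<and> p \<noteq> q \<and> dist p q \<le> r p} \<rparr>"

definition graph_dist :: "(real ^ 2) pair_pre_digraph \<Rightarrow> real ^ 2 \<Rightarrow> real ^ 2 \<Rightarrow> ereal" where
  "graph_dist G = wf_digraph.\<mu> (with_proj G) (\<lambda>(p, q). dist p q)"

definition t_spanner ::
    "real \<Rightarrow> (real ^ 2) pair_pre_digraph \<Rightarrow> (real ^ 2) pair_pre_digraph \<Rightarrow> bool" where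
  "t_spanner t H G \<longleftrightarrow> spanning (with_proj H) (with_proj G) \<and>
     (\<forall>p \<in> pverts G. \<forall>q \<in> pverts G. graph_dist H p q \<le> ereal t * graph_dist G p q)"

definition radius_ratio :: "(real ^ 2) set \<Rightarrow> (real ^ 2 \<Rightarrow> real) \<Rightarrow> real" where
  "radius_ratio P r = Max {r p / r q | p q. p \<in> P \<and> q \<in> P}"


section \<open>A real RAM with a grid operation\<close>

text \<open>
  Programs are while-programs over finitely many named arrays, which hold either natural numbers
  (used for addresses and counters) or exact real numbers. There are no separate registers: a
  scalar variable is cell 0 of some array. Every operation has unit cost.

  Natural numbers cannot be multiplied, no real number can be converted into an address, and the
  constants of a program are rational (a real constant could encode an infinite table). The only
  rounding of reals is the grid operation.
\<close>

type_synonym name = string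

datatype nexp =
    NConst nat
  | NRead name nexp
  | NAdd nexp nexp
  | NSub nexp nexp
  | NHalf nexp

datatype rexp =
    RConst rat
  | RRead name nexp
  | RAdd rexp rexp
  | RSub rexp rexp
  | RMul rexp rexp
  | RDiv rexp rexp
  | RSqrt rexp
  | ROfNat nexp
  | RCell rexp nexp

datatype bexp =
    NLess nexp nexp
  | NEq nexp nexp
  | RLess rexp rexp
  | Not bexp
  | And bexp bexp

datatype com =
    Skip
  | NAssign name nexp nexp
  | RAssign name nexp rexp
  | Seq com com
  | If bexp com com
  | While bexp com

record store =
  nmem :: "name \<Rightarrow> nat \<Rightarrow> nat"
  rmem :: "name \<Rightarrow> nat \<Rightarrow> real"

text \<open>
  The squares of the grid of level \<open>i\<close> have diameter \<open>2 ^ i\<close>, hence side length \<open>2 ^ i / sqrt 2\<close>.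
  The origin is a corner, and cells are half-open. The cell containing the point \<open>(x, y)\<close> has
  column \<open>cell_index x i\<close> and row \<open>cell_index y i\<close>; the machine obtains each in one step.
\<close>

definition cell_index :: "real \<Rightarrow> nat \<Rightarrow> int" where
  "cell_index x i = \<lfloor>x / (2 ^ i / sqrt 2)\<rfloor>"

fun nval :: "nexp \<Rightarrow> store \<Rightarrow> nat" where
  "nval (NConst k) s = k"
| "nval (NRead a e) s = nmem s a (nval e s)"
| "nval (NAdd e f) s = nval e s + nval f s"
| "nval (NSub e f) s = nval e s - nval f s"
| "nval (NHalf e) s = nval e s div 2"

fun rval :: "rexp \<Rightarrow> store \<Rightarrow> real" where
  "rval (RConst c) s = of_rat c"
| "rval (RRead a e) s = rmem s a (nval e s)"
| "rval (RAdd e f) s = rval e s + rval f s"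
| "rval (RSub e f) s = rval e s - rval f s"
| "rval (RMul e f) s = rval e s * rval f s"
| "rval (RDiv e f) s = rval e s / rval f s"
| "rval (RSqrt e) s = sqrt (rval e s)"
| "rval (ROfNat e) s = real (nval e s)"
| "rval (RCell e i) s = real_of_int (cell_index (rval e s) (nval i s))"

fun bval :: "bexp \<Rightarrow> store \<Rightarrow> bool" where
  "bval (NLess e f) s \<longleftrightarrow> nval e s < nval f s"
| "bval (NEq e f) s \<longleftrightarrow> nval e s = nval f s"
| "bval (RLess e f) s \<longleftrightarrow> rval e s < rval f s"
| "bval (Not b) s \<longleftrightarrow> \<not> bval b s"
| "bval (And b c) s \<longleftrightarrow> bval b s \<and> bval c s"

fun ncost :: "nexp \<Rightarrow> nat" where
  "ncost (NConst k) = 1"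
| "ncost (NRead a e) = 1 + ncost e"
| "ncost (NAdd e f) = 1 + ncost e + ncost f"
| "ncost (NSub e f) = 1 + ncost e + ncost f"
| "ncost (NHalf e) = 1 + ncost e"

fun rcost :: "rexp \<Rightarrow> nat" where
  "rcost (RConst c) = 1"
| "rcost (RRead a e) = 1 + ncost e"
| "rcost (RAdd e f) = 1 + rcost e + rcost f"
| "rcost (RSub e f) = 1 + rcost e + rcost f"
| "rcost (RMul e f) = 1 + rcost e + rcost f"
| "rcost (RDiv e f) = 1 + rcost e + rcost f"
| "rcost (RSqrt e) = 1 + rcost e"
| "rcost (ROfNat e) = 1 + ncost e"
| "rcost (RCell e i) = 1 + rcost e + ncost i"

fun bcost :: "bexp \<Rightarrow> nat" where
  "bcost (NLess e f) = 1 + ncost e + ncost f"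
| "bcost (NEq e f) = 1 + ncost e + ncost f"
| "bcost (RLess e f) = 1 + rcost e + rcost f"
| "bcost (Not b) = 1 + bcost b"
| "bcost (And b c) = 1 + bcost b + bcost c"

datatype arr = NArr name | RArr name

type_synonym mem_cell = "arr \<times> nat"

fun nreads :: "nexp \<Rightarrow> store \<Rightarrow> mem_cell set" where
  "nreads (NConst k) s = {}"
| "nreads (NRead a e) s = insert (NArr a, nval e s) (nreads e s)"
| "nreads (NAdd e f) s = nreads e s \<union> nreads f s"
| "nreads (NSub e f) s = nreads e s \<union> nreads f s"
| "nreads (NHalf e) s = nreads e s"

fun rreads :: "rexp \<Rightarrow> store \<Rightarrow> mem_cell set" where
  "rreads (RConst c) s = {}"
| "rreads (RRead a e) s = insert (RArr a, nval e s) (nreads e s)"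
| "rreads (RAdd e f) s = rreads e s \<union> rreads f s"
| "rreads (RSub e f) s = rreads e s \<union> rreads f s"
| "rreads (RMul e f) s = rreads e s \<union> rreads f s"
| "rreads (RDiv e f) s = rreads e s \<union> rreads f s"
| "rreads (RSqrt e) s = rreads e s"
| "rreads (ROfNat e) s = nreads e s"
| "rreads (RCell e i) s = rreads e s \<union> nreads i s"

fun breads :: "bexp \<Rightarrow> store \<Rightarrow> mem_cell set" where
  "breads (NLess e f) s = nreads e s \<union> nreads f s"
| "breads (NEq e f) s = nreads e s \<union> nreads f s"
| "breads (RLess e f) s = rreads e s \<union> rreads f s"
| "breads (Not b) s = breads b s"
| "breads (And b c) s = breads b s \<union> breads c s"

definition nwrite :: "name \<Rightarrow> nat \<Rightarrow> nat \<Rightarrow> store \<Rightarrow> store" where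
  "nwrite a i v s = s\<lparr> nmem := (nmem s)(a := (nmem s a)(i := v)) \<rparr>"

definition rwrite :: "name \<Rightarrow> nat \<Rightarrow> real \<Rightarrow> store \<Rightarrow> store" where
  "rwrite a i v s = s\<lparr> rmem := (rmem s)(a := (rmem s a)(i := v)) \<rparr>"

text \<open>
  \<open>exec c s T A s'\<close>: started in \<open>s\<close>, the program \<open>c\<close> halts in \<open>s'\<close> after time \<open>T\<close>, and \<open>A\<close> is
  the set of memory cells that it has read or written on the way.
\<close>

inductive exec :: "com \<Rightarrow> store \<Rightarrow> nat \<Rightarrow> mem_cell set \<Rightarrow> store \<Rightarrow> bool" where
  Skip: "exec Skip s 1 {} s"
| NAssign: "exec (NAssign a i e) s (1 + ncost i + ncost e)
    (insert (NArr a, nval i s) (nreads i s \<union> nreads e s)) (nwrite a (nval i s) (nval e s) s)"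
| RAssign: "exec (RAssign a i e) s (1 + ncost i + rcost e)
    (insert (RArr a, nval i s) (nreads i s \<union> rreads e s)) (rwrite a (nval i s) (rval e s) s)"
| Seq: "exec c1 s1 T1 A1 s2 \<Longrightarrow> exec c2 s2 T2 A2 s3 \<Longrightarrow>
    exec (Seq c1 c2) s1 (T1 + T2) (A1 \<union> A2) s3"
| IfTrue: "bval b s \<Longrightarrow> exec c1 s T A s' \<Longrightarrow>
    exec (If b c1 c2) s (1 + bcost b + T) (breads b s \<union> A) s'"
| IfFalse: "\<not> bval b s \<Longrightarrow> exec c2 s T A s' \<Longrightarrow>
    exec (If b c1 c2) s (1 + bcost b + T) (breads b s \<union> A) s'"
| WhileFalse: "\<not> bval b s \<Longrightarrow> exec (While b c) s (1 + bcost b) (breads b s) s"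
| WhileTrue: "bval b s1 \<Longrightarrow> exec c s1 T1 A1 s2 \<Longrightarrow> exec (While b c) s2 T2 A2 s3 \<Longrightarrow>
    exec (While b c) s1 (1 + bcost b + T1 + T2) (breads b s1 \<union> A1 \<union> A2) s3"

text \<open>
  Every array is charged from cell 0 up to the largest index in use, so sparse addressing does
  not save space.
\<close>

definition space :: "mem_cell set \<Rightarrow> nat" where
  "space A = card {(a, j). \<exists>i\<ge>j. (a, i) \<in> A}"


section \<open>Computing a spanner from the sites and the radii\<close>

text \<open>
  The input is a list of the sites together with their radii and the number \<open>t\<close>. All other
  memory is zero. The output is a list of \<open>m\<close> edges, given by the indices of their endpoints.
\<close>

definition input_store :: "real \<Rightarrow> (real ^ 2 \<Rightarrow> real) \<Rightarrow> (real ^ 2) list \<Rightarrow> store" where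
  "input_store t r ps =
     \<lparr> nmem = (\<lambda>a i. if a = ''n'' \<and> i = 0 then length ps else 0),
       rmem = (\<lambda>a i. if a = ''t'' \<and> i = 0 then t
                     else if a = ''x'' \<and> i < length ps then ps ! i $ 1
                     else if a = ''y'' \<and> i < length ps then ps ! i $ 2
                     else if a = ''r'' \<and> i < length ps then r (ps ! i)
                     else 0) \<rparr>"

definition input_cells :: "nat \<Rightarrow> mem_cell set" where
  "input_cells n = {(NArr ''n'', 0), (RArr ''t'', 0)} \<union>
     {RArr ''x'', RArr ''y'', RArr ''r''} \<times> {..<n}"

definition output_size :: "store \<Rightarrow> nat" where
  "output_size s = nmem s ''m'' 0"

definition output_cells :: "nat \<Rightarrow> mem_cell set" where
  "output_cells m = insert (NArr ''m'', 0) ({NArr ''src'', NArr ''dst''} \<times> {..<m})"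

definition output_valid :: "nat \<Rightarrow> store \<Rightarrow> bool" where
  "output_valid n s \<longleftrightarrow> (\<forall>k < output_size s. nmem s ''src'' k < n \<and> nmem s ''dst'' k < n)"

definition output_graph :: "(real ^ 2) list \<Rightarrow> store \<Rightarrow> (real ^ 2) pair_pre_digraph" where
  "output_graph ps s = \<lparr> pverts = set ps,
     parcs = {(ps ! nmem s ''src'' k, ps ! nmem s ''dst'' k) | k. k < output_size s} \<rparr>"

text \<open>
  Besides the cells accessed by the program, the space includes all input and output cells.
\<close>

definition computes_spanner ::
    "com \<Rightarrow> real \<Rightarrow> (real ^ 2 \<Rightarrow> real) \<Rightarrow> (real ^ 2) list \<Rightarrow> nat \<Rightarrow> nat \<Rightarrow> bool" where
  "computes_spanner c t r ps T S \<longleftrightarrow> (\<exists>A s.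
     exec c (input_store t r ps) T A s \<and>
     S = space (input_cells (length ps) \<union> A \<union> output_cells (output_size s)) \<and>
     output_valid (length ps) s \<and>
     t_spanner t (output_graph ps s) (transmission_graph (set ps) r))"


section \<open>Sanity checks\<close>

lemma exec_deterministic:
  "exec c s T A s' \<Longrightarrow> exec c s T' A' s'' \<Longrightarrow> T' = T \<and> A' = A \<and> s'' = s'"
proof (induction arbitrary: T' A' s'' rule: exec.induct)
  case (Seq c1 s1 T1 A1 s2 c2 T2 A2 s3)
  from Seq.prems show ?case by cases (use Seq.IH in blast)
next
  case (IfTrue b s c1 T A s' c2)
  from IfTrue.prems show ?case by cases (use IfTrue in blast)+
next
  case (IfFalse b s c2 T A s' c1)
  from IfFalse.prems show ?case by cases (use IfFalse in blast)+
next
  case (WhileTrue b s1 c T1 A1 s2 T2 A2 s3)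
  from WhileTrue.prems show ?case by cases (use WhileTrue in blast)+
qed (auto elim: exec.cases)

lemma finite_nreads: "finite (nreads e s)"
  by (induction e) auto

lemma finite_rreads: "finite (rreads e s)"
  by (induction e) (auto simp: finite_nreads)

lemma finite_breads: "finite (breads b s)"
  by (induction b) (auto simp: finite_nreads finite_rreads)

lemma exec_finite: "exec c s T A s' \<Longrightarrow> finite A"
  by (induction rule: exec.induct) (auto simp: finite_nreads finite_rreads finite_breads)

text \<open>Hence \<^const>\<open>space\<close> never takes the cardinality of an infinite set.\<close>

lemma finite_space:
  fixes A :: "mem_cell set"
  assumes "finite A"
  shows "finite {(a, j). \<exists>i\<ge>j. (a, i) \<in> A}"
proof -
  have "{(a, j). \<exists>i\<ge>j. (a, i) \<in> A} = (\<Union>(a, i)\<in>A. {a} \<times> {..i})"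
    by auto
  then show ?thesis
    using assms by auto
qed

lemma wf_transmission_graph: "wf_digraph (with_proj (transmission_graph P r))"
  by unfold_locales (auto simp: transmission_graph_def)

end

theory Submission
  imports Defs
begin

text \<open>
  The plane of directions is covered by finitely many narrow cones. For each cone the sites are
  rotated so that its axis becomes the \<open>X\<close>-axis, and scaled so that every radius is at least \<open>2 A\<close>
  for a constant \<open>A\<close>. For every edge \<open>p q\<close> in the cone it suffices to emit one edge \<open>w q\<close> with
  \<open>w = p\<close>, or \<open>p w\<close> an edge and \<open>t |p w| + |w q| \<le> t |p q|\<close>: induction on \<open>|p q|\<close> then yields a
  path from \<open>p\<close> to \<open>q\<close> of length at most \<open>t |p q|\<close>.

  If \<open>|p q| \<le> A\<close>, take for \<open>w\<close> the site with the largest \<open>X\<close> in the backward cone of \<open>q\<close>; its radius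
  reaches \<open>q\<close> because it exceeds \<open>|p q|\<close> by a factor of at least two. A merge sort finds these sites.

  Otherwise \<open>A \<sigma> < |p q| \<le> 2 A \<sigma>\<close> for the cell side \<open>\<sigma>\<close> of some grid level, and any site \<open>w\<close> in the
  cell of \<open>p\<close> that reaches \<open>q\<close> will do, as \<open>|p w| \<le> 2 \<sigma>\<close>. Only constantly many offsets between the two cells
  occur. Sites of radius above \<open>4 A \<sigma>\<close> reach every site at such an offset. The sites \<open>w\<close> of one cell with radius
  \<open>\<rho>\<close> in \<open>(A \<sigma>, 4 A \<sigma>]\<close> are searched through the envelope of the right boundaries of their discs, computed by divide and
  conquer. A site has its radius in this range on at most two levels, so all envelopes together cost
  \<open>O(n log n)\<close>, while everything else is linear per level and there are \<open>O(1 + log \<Psi>)\<close> levels.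
\<close>

section \<open>Programs whose counters stay bounded\<close>

text \<open>The criterion leaves the last arc \<open>w q\<close> at factor one and puts the factor
  \<open>t\<close> only on the shorter edge \<open>p w\<close>, so each site needs just boundedly
  many incoming edges per cone and level. The machine shapes the rest. It has no recursion, hence
  divide and conquer runs bottom-up over blocks in two buffers. It cannot turn a real into an
  address, hence cells are neither indexed nor hashed: the sites are listed in the order of their
  cells by a counting sort whose counters are addressed by positions, and all sites are located in
  one simultaneous sweep per offset. Its grid has only levels from 0 on; the scaling makes the
  smallest radius \<open>2 * A\<close>, so that distances up to \<open>A\<close> can be served
  without a grid. Its constants are rational, hence cone axes are integer vectors. Space charges an
  array up to its largest index. Addresses are fixed expressions in stored numbers, so it suffices
  that every stored number is at most \<open>B\<close>, where \<open>B\<close> is linear in the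
  number of sites times the number of levels. This invariant is part of the semantics
  \<open>big\<close>.\<close>

inductive big :: "nat \<Rightarrow> com \<Rightarrow> store \<Rightarrow> nat \<Rightarrow> store \<Rightarrow> bool" for B where
  big_Skip: "big B Skip s 1 s"
| big_NAssign: "nval e s \<le> B \<Longrightarrow> big B (NAssign a i e) s (1 + ncost i + ncost e) (nwrite a (nval i s) (nval e s) s)"
| big_RAssign: "big B (RAssign a i x) s (1 + ncost i + rcost x) (rwrite a (nval i s) (rval x s) s)"
| big_Seq: "big B c1 s1 T1 s2 \<Longrightarrow> big B c2 s2 T2 s3 \<Longrightarrow> big B (Seq c1 c2) s1 (T1 + T2) s3"
| big_IfTrue: "bval b s \<Longrightarrow> big B c1 s T s' \<Longrightarrow> big B (If b c1 c2) s (1 + bcost b + T) s'"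
| big_IfFalse: "\<not> bval b s \<Longrightarrow> big B c2 s T s' \<Longrightarrow> big B (If b c1 c2) s (1 + bcost b + T) s'"
| big_WhileFalse: "\<not> bval b s \<Longrightarrow> big B (While b c) s (1 + bcost b) s"
| big_WhileTrue: "bval b s1 \<Longrightarrow> big B c s1 T1 s2 \<Longrightarrow> big B (While b c) s2 T2 s3 \<Longrightarrow>
    big B (While b c) s1 (1 + bcost b + T1 + T2) s3"

section \<open>Bounding addresses by the numbers stored\<close>

text \<open>\<open>ngrow e\<close> is the factor of \<open>Suc B\<close> that bounds the value of
  \<open>e\<close> when all stored numbers are at most \<open>B\<close>. Truncated subtraction and
  halving never enlarge a value, so they keep the factor of their first operand.\<close>

primrec ngrow :: "nexp \<Rightarrow> nat" where
  "ngrow (NConst k) = k"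
| "ngrow (NRead a e) = 1"
| "ngrow (NAdd e f) = ngrow e + ngrow f"
| "ngrow (NSub e f) = ngrow e"
| "ngrow (NHalf e) = ngrow e"

text \<open>The same kind of factor for the addresses read. Sums replace maxima: only some constant
  depending on the program is wanted, and sums need no case distinctions.\<close>

primrec nidx :: "nexp \<Rightarrow> nat" where
  "nidx (NConst k) = 0"
| "nidx (NRead a e) = ngrow e + nidx e"
| "nidx (NAdd e f) = nidx e + nidx f"
| "nidx (NSub e f) = nidx e + nidx f"
| "nidx (NHalf e) = nidx e"

primrec ridx :: "rexp \<Rightarrow> nat" where
  "ridx (RConst c) = 0"
| "ridx (RRead a e) = ngrow e + nidx e"
| "ridx (RAdd e f) = ridx e + ridx f"
| "ridx (RSub e f) = ridx e + ridx f"
| "ridx (RMul e f) = ridx e + ridx f"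
| "ridx (RDiv e f) = ridx e + ridx f"
| "ridx (RSqrt e) = ridx e"
| "ridx (ROfNat e) = nidx e"
| "ridx (RCell e i) = ridx e + nidx i"

primrec bidx :: "bexp \<Rightarrow> nat" where
  "bidx (NLess e f) = nidx e + nidx f"
| "bidx (NEq e f) = nidx e + nidx f"
| "bidx (RLess e f) = ridx e + ridx f"
| "bidx (Not b) = bidx b"
| "bidx (And b c) = bidx b + bidx c"

primrec cidx :: "com \<Rightarrow> nat" where
  "cidx Skip = 0"
| "cidx (NAssign a i e) = ngrow i + nidx i + nidx e"
| "cidx (RAssign a i e) = ngrow i + nidx i + ridx e"
| "cidx (Seq c d) = cidx c + cidx d"
| "cidx (If b c d) = bidx b + cidx c + cidx d"
| "cidx (While b c) = bidx b + cidx c"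

primrec narr :: "nexp \<Rightarrow> arr set" where
  "narr (NConst k) = {}"
| "narr (NRead a e) = insert (NArr a) (narr e)"
| "narr (NAdd e f) = narr e \<union> narr f"
| "narr (NSub e f) = narr e \<union> narr f"
| "narr (NHalf e) = narr e"

primrec rarr :: "rexp \<Rightarrow> arr set" where
  "rarr (RConst c) = {}"
| "rarr (RRead a e) = insert (RArr a) (narr e)"
| "rarr (RAdd e f) = rarr e \<union> rarr f"
| "rarr (RSub e f) = rarr e \<union> rarr f"
| "rarr (RMul e f) = rarr e \<union> rarr f"
| "rarr (RDiv e f) = rarr e \<union> rarr f"
| "rarr (RSqrt e) = rarr e"
| "rarr (ROfNat e) = narr e"
| "rarr (RCell e i) = rarr e \<union> narr i"

primrec barr :: "bexp \<Rightarrow> arr set" where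
  "barr (NLess e f) = narr e \<union> narr f"
| "barr (NEq e f) = narr e \<union> narr f"
| "barr (RLess e f) = rarr e \<union> rarr f"
| "barr (Not b) = barr b"
| "barr (And b c) = barr b \<union> barr c"

primrec carr :: "com \<Rightarrow> arr set" where
  "carr Skip = {}"
| "carr (NAssign a i e) = insert (NArr a) (narr i \<union> narr e)"
| "carr (RAssign a i e) = insert (RArr a) (narr i \<union> rarr e)"
| "carr (Seq c d) = carr c \<union> carr d"
| "carr (If b c d) = barr b \<union> carr c \<union> carr d"
| "carr (While b c) = barr b \<union> carr c"

lemma finite_narr: "finite (narr e)" by (induction e) auto
lemma finite_rarr: "finite (rarr e)" by (induction e) (auto simp: finite_narr)
lemma finite_barr: "finite (barr e)" by (induction e) (auto simp: finite_narr finite_rarr)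
lemma finite_carr: "finite (carr e)" by (induction e) (auto simp: finite_narr finite_rarr finite_barr)

definition nbnd :: "nat \<Rightarrow> store \<Rightarrow> bool" where
  "nbnd B s \<longleftrightarrow> (\<forall>a i. nmem s a i \<le> B)"

lemma nval_le: "nbnd B s \<Longrightarrow> nval e s \<le> ngrow e * Suc B"
proof (induction e)
  case (NRead a e) then show ?case by (simp add: nbnd_def) (meson le_SucI)
next
  case (NAdd e f) then show ?case by (simp add: add_mult_distrib)
next
  case (NHalf e) then show ?case by simp
qed auto

lemma times_atMost_mono: "X \<subseteq> N \<times> {..k * Suc B} \<Longrightarrow> N \<subseteq> N' \<Longrightarrow> k \<le> k' \<Longrightarrow> X \<subseteq> N' \<times> {..k' * Suc B}"
  for k k' B :: nat
  by (erule order_trans, rule Sigma_mono, assumption) (simp only: atMost_subset_iff mult_le_mono1)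

lemma nreads_sub:
  assumes "nbnd B s" shows "nreads e s \<subseteq> narr e \<times> {..nidx e * Suc B}"
proof (induction e)
  case (NRead a e)
  have "nreads e s \<subseteq> narr (NRead a e) \<times> {..nidx (NRead a e) * Suc B}" by (rule times_atMost_mono[OF NRead.IH]) auto
  moreover have "(NArr a, nval e s) \<in> narr (NRead a e) \<times> {..nidx (NRead a e) * Suc B}"
    using nval_le[OF assms, of e] by (simp add: add_mult_distrib)
  ultimately show ?case by (simp only: nreads.simps insert_subset simp_thms)
next
  case (NAdd e f)
  have "nreads e s \<subseteq> narr (NAdd e f) \<times> {..nidx (NAdd e f) * Suc B}" by (rule times_atMost_mono[OF NAdd.IH(1)]) auto
  moreover have "nreads f s \<subseteq> narr (NAdd e f) \<times> {..nidx (NAdd e f) * Suc B}" by (rule times_atMost_mono[OF NAdd.IH(2)]) auto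
  ultimately show ?case by (simp only: nreads.simps Un_subset_iff simp_thms)
next
  case (NSub e f)
  have "nreads e s \<subseteq> narr (NSub e f) \<times> {..nidx (NSub e f) * Suc B}" by (rule times_atMost_mono[OF NSub.IH(1)]) auto
  moreover have "nreads f s \<subseteq> narr (NSub e f) \<times> {..nidx (NSub e f) * Suc B}" by (rule times_atMost_mono[OF NSub.IH(2)]) auto
  ultimately show ?case by (simp only: nreads.simps Un_subset_iff simp_thms)
qed auto

lemma rreads_sub:
  assumes "nbnd B s" shows "rreads e s \<subseteq> rarr e \<times> {..ridx e * Suc B}"
proof (induction e)
  case (RRead a e)
  have "nreads e s \<subseteq> rarr (RRead a e) \<times> {..ridx (RRead a e) * Suc B}" by (rule times_atMost_mono[OF nreads_sub[OF assms]]) auto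
  moreover have "(RArr a, nval e s) \<in> rarr (RRead a e) \<times> {..ridx (RRead a e) * Suc B}"
    using nval_le[OF assms, of e] by (simp add: add_mult_distrib)
  ultimately show ?case by (simp only: rreads.simps insert_subset simp_thms)
next
  case (RAdd e f)
  have "rreads e s \<subseteq> rarr (RAdd e f) \<times> {..ridx (RAdd e f) * Suc B}" by (rule times_atMost_mono[OF RAdd.IH(1)]) auto
  moreover have "rreads f s \<subseteq> rarr (RAdd e f) \<times> {..ridx (RAdd e f) * Suc B}" by (rule times_atMost_mono[OF RAdd.IH(2)]) auto
  ultimately show ?case by (simp only: rreads.simps Un_subset_iff simp_thms)
next
  case (RSub e f)
  have "rreads e s \<subseteq> rarr (RSub e f) \<times> {..ridx (RSub e f) * Suc B}" by (rule times_atMost_mono[OF RSub.IH(1)]) auto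
  moreover have "rreads f s \<subseteq> rarr (RSub e f) \<times> {..ridx (RSub e f) * Suc B}" by (rule times_atMost_mono[OF RSub.IH(2)]) auto
  ultimately show ?case by (simp only: rreads.simps Un_subset_iff simp_thms)
next
  case (RMul e f)
  have "rreads e s \<subseteq> rarr (RMul e f) \<times> {..ridx (RMul e f) * Suc B}" by (rule times_atMost_mono[OF RMul.IH(1)]) auto
  moreover have "rreads f s \<subseteq> rarr (RMul e f) \<times> {..ridx (RMul e f) * Suc B}" by (rule times_atMost_mono[OF RMul.IH(2)]) auto
  ultimately show ?case by (simp only: rreads.simps Un_subset_iff simp_thms)
next
  case (RDiv e f)
  have "rreads e s \<subseteq> rarr (RDiv e f) \<times> {..ridx (RDiv e f) * Suc B}" by (rule times_atMost_mono[OF RDiv.IH(1)]) auto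
  moreover have "rreads f s \<subseteq> rarr (RDiv e f) \<times> {..ridx (RDiv e f) * Suc B}" by (rule times_atMost_mono[OF RDiv.IH(2)]) auto
  ultimately show ?case by (simp only: rreads.simps Un_subset_iff simp_thms)
next
  case (RCell e f)
  have "rreads e s \<subseteq> rarr (RCell e f) \<times> {..ridx (RCell e f) * Suc B}" by (rule times_atMost_mono[OF RCell.IH(1)]) auto
  moreover have "nreads f s \<subseteq> rarr (RCell e f) \<times> {..ridx (RCell e f) * Suc B}" by (rule times_atMost_mono[OF nreads_sub[OF assms]]) auto
  ultimately show ?case by (simp only: rreads.simps Un_subset_iff simp_thms)
next
  case (ROfNat e) show ?case using nreads_sub[OF assms, of e] by simp
qed auto

lemma breads_sub:
  assumes "nbnd B s" shows "breads e s \<subseteq> barr e \<times> {..bidx e * Suc B}"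
proof (induction e)
  case (NLess e f)
  have "nreads e s \<subseteq> barr (NLess e f) \<times> {..bidx (NLess e f) * Suc B}" by (rule times_atMost_mono[OF nreads_sub[OF assms]]) auto
  moreover have "nreads f s \<subseteq> barr (NLess e f) \<times> {..bidx (NLess e f) * Suc B}" by (rule times_atMost_mono[OF nreads_sub[OF assms]]) auto
  ultimately show ?case by (simp only: breads.simps Un_subset_iff simp_thms)
next
  case (NEq e f)
  have "nreads e s \<subseteq> barr (NEq e f) \<times> {..bidx (NEq e f) * Suc B}" by (rule times_atMost_mono[OF nreads_sub[OF assms]]) auto
  moreover have "nreads f s \<subseteq> barr (NEq e f) \<times> {..bidx (NEq e f) * Suc B}" by (rule times_atMost_mono[OF nreads_sub[OF assms]]) auto
  ultimately show ?case by (simp only: breads.simps Un_subset_iff simp_thms)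
next
  case (RLess e f)
  have "rreads e s \<subseteq> barr (RLess e f) \<times> {..bidx (RLess e f) * Suc B}" by (rule times_atMost_mono[OF rreads_sub[OF assms]]) auto
  moreover have "rreads f s \<subseteq> barr (RLess e f) \<times> {..bidx (RLess e f) * Suc B}" by (rule times_atMost_mono[OF rreads_sub[OF assms]]) auto
  ultimately show ?case by (simp only: breads.simps Un_subset_iff simp_thms)
next
  case (And e f)
  have "breads e s \<subseteq> barr (And e f) \<times> {..bidx (And e f) * Suc B}" by (rule times_atMost_mono[OF And.IH(1)]) auto
  moreover have "breads f s \<subseteq> barr (And e f) \<times> {..bidx (And e f) * Suc B}" by (rule times_atMost_mono[OF And.IH(2)]) auto
  ultimately show ?case by (simp only: breads.simps Un_subset_iff simp_thms)
qed auto

text \<open>Each address is an expression over stored numbers, so the bound on contents maintained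
  by \<open>big\<close> bounds every address by a constant times \<open>Suc B\<close>. The constant
  and the set of arrays depend on the program text alone, which turns the bound into one on
  space.\<close>

lemma big_exec:
  assumes "big B c s T s'" "nbnd B s"
  shows "nbnd B s' \<and> (\<exists>A. exec c s T A s' \<and> A \<subseteq> carr c \<times> {..cidx c * Suc B})"
  using assms
proof (induction rule: big.induct)
  case (big_Skip s) then show ?case using exec.Skip by blast
next
  case (big_NAssign e s a i)
  let ?C = "carr (NAssign a i e) \<times> {..cidx (NAssign a i e) * Suc B}"
  have "nreads i s \<subseteq> ?C" by (rule times_atMost_mono[OF nreads_sub[OF \<open>nbnd B s\<close>]]) auto
  moreover have "nreads e s \<subseteq> ?C" by (rule times_atMost_mono[OF nreads_sub[OF \<open>nbnd B s\<close>]]) auto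
  moreover have "(NArr a, nval i s) \<in> ?C"
    using nval_le[OF \<open>nbnd B s\<close>, of i] by (simp add: add_mult_distrib)
  ultimately have "insert (NArr a, nval i s) (nreads i s \<union> nreads e s) \<subseteq> ?C" by blast
  moreover have "nbnd B (nwrite a (nval i s) (nval e s) s)"
    using big_NAssign by (auto simp: nbnd_def nwrite_def)
  ultimately show ?case using exec.NAssign by blast
next
  case (big_RAssign a i e s)
  let ?C = "carr (RAssign a i e) \<times> {..cidx (RAssign a i e) * Suc B}"
  have "nreads i s \<subseteq> ?C" by (rule times_atMost_mono[OF nreads_sub[OF \<open>nbnd B s\<close>]]) auto
  moreover have "rreads e s \<subseteq> ?C" by (rule times_atMost_mono[OF rreads_sub[OF \<open>nbnd B s\<close>]]) auto
  moreover have "(RArr a, nval i s) \<in> ?C"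
    using nval_le[OF \<open>nbnd B s\<close>, of i] by (simp add: add_mult_distrib)
  ultimately have "insert (RArr a, nval i s) (nreads i s \<union> rreads e s) \<subseteq> ?C" by blast
  moreover have "nbnd B (rwrite a (nval i s) (rval e s) s)"
    using big_RAssign by (auto simp: nbnd_def rwrite_def)
  ultimately show ?case using exec.RAssign by blast
next
  case (big_Seq c1 s1 T1 s2 c2 T2 s3)
  let ?C = "carr (Seq c1 c2) \<times> {..cidx (Seq c1 c2) * Suc B}"
  from big_Seq obtain A1 A2 where A: "exec c1 s1 T1 A1 s2" "A1 \<subseteq> carr c1 \<times> {..cidx c1 * Suc B}"
    "exec c2 s2 T2 A2 s3" "A2 \<subseteq> carr c2 \<times> {..cidx c2 * Suc B}" "nbnd B s3" by blast
  have 1: "A1 \<subseteq> ?C" by (rule times_atMost_mono[OF A(2)]) auto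
  have 2: "A2 \<subseteq> ?C" by (rule times_atMost_mono[OF A(4)]) auto
  have "A1 \<union> A2 \<subseteq> ?C" using 1 2 by blast
  then show ?case using exec.Seq[OF A(1,3)] A(5) by blast
next
  case (big_IfTrue b s c1 T s' c2)
  let ?C = "carr (If b c1 c2) \<times> {..cidx (If b c1 c2) * Suc B}"
  from big_IfTrue obtain A1 where A: "exec c1 s T A1 s'" "A1 \<subseteq> carr c1 \<times> {..cidx c1 * Suc B}" "nbnd B s'" by blast
  have 1: "breads b s \<subseteq> ?C" by (rule times_atMost_mono[OF breads_sub[OF \<open>nbnd B s\<close>]]) auto
  have 2: "A1 \<subseteq> ?C" by (rule times_atMost_mono[OF A(2)]) auto
  have "breads b s \<union> A1 \<subseteq> ?C" using 1 2 by blast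
  then show ?case using exec.IfTrue[OF big_IfTrue(1) A(1)] A(3) by blast
next
  case (big_IfFalse b s c2 T s' c1)
  let ?C = "carr (If b c1 c2) \<times> {..cidx (If b c1 c2) * Suc B}"
  from big_IfFalse obtain A1 where A: "exec c2 s T A1 s'" "A1 \<subseteq> carr c2 \<times> {..cidx c2 * Suc B}" "nbnd B s'" by blast
  have 1: "breads b s \<subseteq> ?C" by (rule times_atMost_mono[OF breads_sub[OF \<open>nbnd B s\<close>]]) auto
  have 2: "A1 \<subseteq> ?C" by (rule times_atMost_mono[OF A(2)]) auto
  have "breads b s \<union> A1 \<subseteq> ?C" using 1 2 by blast
  then show ?case using exec.IfFalse[OF big_IfFalse(1) A(1)] A(3) by blast
next
  case (big_WhileFalse b s c)
  let ?C = "carr (While b c) \<times> {..cidx (While b c) * Suc B}"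
  have 1: "breads b s \<subseteq> ?C" by (rule times_atMost_mono[OF breads_sub[OF \<open>nbnd B s\<close>]]) auto
  have "breads b s \<subseteq> ?C" using 1 by blast
  then show ?case using exec.WhileFalse[OF big_WhileFalse(1)] \<open>nbnd B s\<close> by blast
next
  case (big_WhileTrue b s1 c T1 s2 T2 s3)
  let ?C = "carr (While b c) \<times> {..cidx (While b c) * Suc B}"
  from big_WhileTrue obtain A1 A2 where A: "exec c s1 T1 A1 s2" "A1 \<subseteq> carr c \<times> {..cidx c * Suc B}"
    "exec (While b c) s2 T2 A2 s3" "A2 \<subseteq> carr (While b c) \<times> {..cidx (While b c) * Suc B}" "nbnd B s3" by blast
  have 1: "breads b s1 \<subseteq> ?C" by (rule times_atMost_mono[OF breads_sub[OF \<open>nbnd B s1\<close>]]) auto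
  have 2: "A1 \<subseteq> ?C" by (rule times_atMost_mono[OF A(2)]) auto
  have 3: "A2 \<subseteq> ?C" by (rule times_atMost_mono[OF A(4)]) auto
  have "breads b s1 \<union> A1 \<union> A2 \<subseteq> ?C" using 1 2 3 by blast
  then show ?case using exec.WhileTrue[OF big_WhileTrue(1) A(1,3)] A(5) by blast
qed

text \<open>\<open>N \<times> {..k}\<close> is closed under lowering the index, so it also contains
  the cells that \<open>space\<close> charges below those accessed.\<close>

lemma space_le:
  assumes "A \<subseteq> N \<times> {..k}" "finite N"
  shows "space A \<le> card N * Suc k"
proof -
  have "{(a, j). \<exists>i\<ge>j. (a, i) \<in> A} \<subseteq> N \<times> {..k}" using assms(1) by force
  then have "card {(a, j). \<exists>i\<ge>j. (a, i) \<in> A} \<le> card (N \<times> {..k})"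
    by (rule card_mono[rotated]) (use assms(2) in auto)
  then show ?thesis unfolding space_def card_cartesian_product by simp
qed

section \<open>Frame conditions and time-bounded total correctness\<close>

primrec nw :: "com \<Rightarrow> name set" where
  "nw Skip = {}"
| "nw (NAssign a i e) = {a}"
| "nw (RAssign a i e) = {}"
| "nw (Seq c d) = nw c \<union> nw d"
| "nw (If b c d) = nw c \<union> nw d"
| "nw (While b c) = nw c"

primrec rw :: "com \<Rightarrow> name set" where
  "rw Skip = {}"
| "rw (NAssign a i e) = {}"
| "rw (RAssign a i e) = {a}"
| "rw (Seq c d) = rw c \<union> rw d"
| "rw (If b c d) = rw c \<union> rw d"
| "rw (While b c) = rw c"

text \<open>Framing is read off the program text. The rules for sequences, loops and weakening hand
  it on, so invariants and postconditions mention only what a command changes.\<close>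

definition unch :: "com \<Rightarrow> store \<Rightarrow> store \<Rightarrow> bool" where
  "unch c s s' \<longleftrightarrow> (\<forall>a. a \<notin> nw c \<longrightarrow> nmem s' a = nmem s a) \<and> (\<forall>a. a \<notin> rw c \<longrightarrow> rmem s' a = rmem s a)"

lemma nmem_nwrite [simp]: "nmem (nwrite a i v s) b = (if b = a then (nmem s a)(i := v) else nmem s b)"
  by (simp add: nwrite_def)
lemma rmem_nwrite [simp]: "rmem (nwrite a i v s) = rmem s"
  by (simp add: nwrite_def)
lemma rmem_rwrite [simp]: "rmem (rwrite a i v s) b = (if b = a then (rmem s a)(i := v) else rmem s b)"
  by (simp add: rwrite_def)
lemma nmem_rwrite [simp]: "nmem (rwrite a i v s) = nmem s"
  by (simp add: rwrite_def)

lemma big_unch: "big B c s T s' \<Longrightarrow> unch c s s'"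
  by (induction rule: big.induct) (auto simp: unch_def)

lemma unch_refl: "unch c s s" by (simp add: unch_def)
lemma unch_n: "unch c s s' \<Longrightarrow> a \<notin> nw c \<Longrightarrow> nmem s' a = nmem s a" by (simp add: unch_def)
lemma unch_r: "unch c s s' \<Longrightarrow> a \<notin> rw c \<Longrightarrow> rmem s' a = rmem s a" by (simp add: unch_def)

text \<open>A time-bounded total correctness triple. The counter bound is a premise because
  \<open>big_nbnd\<close> preserves it: it is available again at every later point, where copying a
  stored number needs no further justification.\<close>

definition run :: "nat \<Rightarrow> com \<Rightarrow> store \<Rightarrow> nat \<Rightarrow> (store \<Rightarrow> bool) \<Rightarrow> bool" where
  "run B c s T Q \<longleftrightarrow> (nbnd B s \<longrightarrow> (\<exists>T' s'. big B c s T' s' \<and> T' \<le> T \<and> Q s'))"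

lemma big_nbnd: "big B c s T s' \<Longrightarrow> nbnd B s \<Longrightarrow> nbnd B s'"
  using big_exec by blast

lemma run_nbnd: "(nbnd B s \<Longrightarrow> run B c s T Q) \<Longrightarrow> run B c s T Q"
  by (simp add: run_def)

lemma run_mono: "run B c s T P \<Longrightarrow> T \<le> T' \<Longrightarrow> (\<And>s'. unch c s s' \<Longrightarrow> nbnd B s' \<Longrightarrow> P s' \<Longrightarrow> Q s') \<Longrightarrow> run B c s T' Q"
  unfolding run_def using big_unch big_nbnd by (meson order_trans)

lemma run_seq: "run B c1 s T1 P \<Longrightarrow> (\<And>s'. unch c1 s s' \<Longrightarrow> nbnd B s' \<Longrightarrow> P s' \<Longrightarrow> run B c2 s' T2 Q) \<Longrightarrow> T1 + T2 \<le> T \<Longrightarrow>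
  run B (Seq c1 c2) s T Q"
  unfolding run_def using big_unch big_nbnd by (meson big_Seq add_mono order_trans)

section \<open>Loop-free commands, evaluated symbolically\<close>

primrec lf :: "com \<Rightarrow> bool" where
  "lf Skip = True"
| "lf (NAssign a i e) = True"
| "lf (RAssign a i e) = True"
| "lf (Seq c d) = (lf c \<and> lf d)"
| "lf (If b c d) = (lf c \<and> lf d)"
| "lf (While b c) = False"

text \<open>Loop-free commands are computed by this function, which lets the simplifier find the
  final store; the obligations that remain are collected in \<open>okw\<close>. \<open>While\<close>
  gets a dummy value and is excluded by \<open>lf\<close>.\<close>

primrec fex :: "com \<Rightarrow> store \<Rightarrow> store" where
  "fex Skip s = s"
| "fex (NAssign a i e) s = nwrite a (nval i s) (nval e s) s"
| "fex (RAssign a i e) s = rwrite a (nval i s) (rval e s) s"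
| "fex (Seq c d) s = fex d (fex c s)"
| "fex (If b c d) s = (if bval b s then fex c s else fex d s)"
| "fex (While b c) s = s"

primrec okw :: "nat \<Rightarrow> com \<Rightarrow> store \<Rightarrow> bool" where
  "okw B Skip s = True"
| "okw B (NAssign a i e) s = (nval e s \<le> B)"
| "okw B (RAssign a i e) s = True"
| "okw B (Seq c d) s = (okw B c s \<and> okw B d (fex c s))"
| "okw B (If b c d) s = (if bval b s then okw B c s else okw B d s)"
| "okw B (While b c) s = False"

text \<open>A conditional is charged for both branches, which makes the bound independent of the
  store.\<close>

primrec tmax :: "com \<Rightarrow> nat" where
  "tmax Skip = 1"
| "tmax (NAssign a i e) = 1 + ncost i + ncost e"
| "tmax (RAssign a i e) = 1 + ncost i + rcost e"
| "tmax (Seq c d) = tmax c + tmax d"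
| "tmax (If b c d) = 1 + bcost b + tmax c + tmax d"
| "tmax (While b c) = 0"

lemma big_lf: "lf c \<Longrightarrow> okw B c s \<Longrightarrow> \<exists>T. big B c s T (fex c s) \<and> T \<le> tmax c"
proof (induction c arbitrary: s)
  case (Seq c d)
  then obtain T1 T2 where "big B c s T1 (fex c s)" "T1 \<le> tmax c"
    "big B d (fex c s) T2 (fex d (fex c s))" "T2 \<le> tmax d" by fastforce
  then show ?case using big_Seq by (intro exI[of _ "T1 + T2"]) auto
next
  case (If b c d)
  show ?case
  proof (cases "bval b s")
    case True
    then obtain T where "big B c s T (fex c s)" "T \<le> tmax c" using If by fastforce
    then show ?thesis using big_IfTrue[OF True, of B c T "fex c s" d] True by (auto intro!: exI)
  next
    case False
    then obtain T where "big B d s T (fex d s)" "T \<le> tmax d" using If by fastforce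
    then show ?thesis using big_IfFalse[OF False, of B d T "fex d s" c] False by (auto intro!: exI)
  qed
qed (auto intro: big.intros exI)

lemma run_lf: "lf c \<Longrightarrow> (nbnd B s \<Longrightarrow> okw B c s) \<Longrightarrow> tmax c \<le> T \<Longrightarrow> Q (fex c s) \<Longrightarrow> run B c s T Q"
  unfolding run_def using big_lf[of c B s] by (meson order_trans)

lemma run_lf_seq: "lf c1 \<Longrightarrow> (nbnd B s \<Longrightarrow> okw B c1 s) \<Longrightarrow> (nbnd B (fex c1 s) \<Longrightarrow> run B c2 (fex c1 s) T2 Q) \<Longrightarrow>
    tmax c1 + T2 \<le> T \<Longrightarrow> run B (Seq c1 c2) s T Q"
  by (rule run_seq[where P = "\<lambda>s'. s' = fex c1 s", OF run_lf]) auto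

text \<open>The potential method: every iteration pays for its body and its guard out of
  \<open>\<Phi>\<close>. The payment is positive, so \<open>\<Phi>\<close> also proves termination;
  the final failing guard is paid separately.\<close>

lemma run_while:
  assumes "I s"
    and step: "\<And>s'. I s' \<Longrightarrow> unch c s s' \<Longrightarrow> nbnd B s' \<Longrightarrow> bval b s' \<Longrightarrow>
      \<exists>Tc. run B c s' Tc (\<lambda>s''. I s'' \<and> Tc + bcost b + 1 + \<Phi> s'' \<le> \<Phi> s')"
    and fin: "\<And>s'. I s' \<Longrightarrow> unch c s s' \<Longrightarrow> nbnd B s' \<Longrightarrow> \<not> bval b s' \<Longrightarrow> Q s'"
    and T: "\<Phi> s + bcost b + 1 \<le> T"
  shows "run B (While b c) s T Q"
proof (rule run_nbnd)
  assume "nbnd B s"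
  have "run B (While b c) s' (\<Phi> s' + bcost b + 1) Q" if "I s'" "unch c s s'" "nbnd B s'" for s'
    using that
  proof (induction "\<Phi> s'" arbitrary: s' rule: less_induct)
    case less
    show ?case
    proof (cases "bval b s'")
      case True
      then obtain Tc where "run B c s' Tc (\<lambda>s''. I s'' \<and> Tc + bcost b + 1 + \<Phi> s'' \<le> \<Phi> s')"
        using step less by blast
      then obtain T' s'' where 1: "big B c s' T' s''" "T' \<le> Tc" "I s''" "Tc + bcost b + 1 + \<Phi> s'' \<le> \<Phi> s'"
        unfolding run_def using less by blast
      have "unch c s s''" using big_unch[OF 1(1)] less.prems(2) by (simp add: unch_def)
      moreover have n: "nbnd B s''" using big_nbnd[OF 1(1)] less.prems by blast
      ultimately have "run B (While b c) s'' (\<Phi> s'' + bcost b + 1) Q" using less.hyps[of s''] 1 by simp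
      then obtain T2 s3 where "big B (While b c) s'' T2 s3" "T2 \<le> \<Phi> s'' + bcost b + 1" "Q s3"
        unfolding run_def using n by blast
      then show ?thesis unfolding run_def using big_WhileTrue[OF True 1(1)] 1
        by (intro impI exI[of _ "1 + bcost b + T' + T2"] exI[of _ s3]) auto
    next
      case False
      then show ?thesis unfolding run_def using big_WhileFalse[OF False] fin less.prems
        by (intro impI exI[of _ "1 + bcost b"] exI[of _ s']) auto
    qed
  qed
  from this[OF \<open>I s\<close> unch_refl \<open>nbnd B s\<close>] show "run B (While b c) s T Q" by (rule run_mono) (use T in auto)
qed

definition kw :: "bexp \<Rightarrow> com \<Rightarrow> nat" where "kw b c = tmax c + bcost b + 1"

lemma run_while_lf:
  assumes "I s" "lf c"
    and step: "\<And>s'. I s' \<Longrightarrow> unch c s s' \<Longrightarrow> nbnd B s' \<Longrightarrow> bval b s' \<Longrightarrow>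
      okw B c s' \<and> I (fex c s') \<and> \<psi> (fex c s') < (\<psi> s' :: nat)"
    and fin: "\<And>s'. I s' \<Longrightarrow> unch c s s' \<Longrightarrow> nbnd B s' \<Longrightarrow> \<not> bval b s' \<Longrightarrow> Q s'"
    and T: "kw b c * Suc (\<psi> s) \<le> T"
  shows "run B (While b c) s T Q"
proof (rule run_while[where I = I and \<Phi> = "\<lambda>s. kw b c * \<psi> s"])
  fix s' assume s': "I s'" "unch c s s'" "nbnd B s'" "bval b s'"
  have *: "okw B c s'" "I (fex c s')" "\<psi> (fex c s') < \<psi> s'" using step[OF s'] by auto
  have "kw b c * Suc (\<psi> (fex c s')) \<le> kw b c * \<psi> s'" using *(3) by (intro mult_le_mono2) simp
  then have "tmax c + bcost b + 1 + kw b c * \<psi> (fex c s') \<le> kw b c * \<psi> s'" by (simp add: kw_def)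
  then show "\<exists>Tc. run B c s' Tc (\<lambda>s''. I s'' \<and> Tc + bcost b + 1 + kw b c * \<psi> s'' \<le> kw b c * \<psi> s')"
    using * \<open>lf c\<close> by (intro exI[of _ "tmax c"] run_lf) auto
next
  show "kw b c * \<psi> s + bcost b + 1 \<le> T" using T by (simp add: kw_def)
qed (use assms in auto)

abbreviation V :: "name \<Rightarrow> nexp" where "V a \<equiv> NRead a (NConst 0)"
abbreviation RV :: "name \<Rightarrow> rexp" where "RV a \<equiv> RRead a (NConst 0)"
abbreviation setn :: "name \<Rightarrow> nexp \<Rightarrow> com" where "setn a \<equiv> NAssign a (NConst 0)"
abbreviation setr :: "name \<Rightarrow> rexp \<Rightarrow> com" where "setr a \<equiv> RAssign a (NConst 0)"
abbreviation inc :: "name \<Rightarrow> com" where "inc a \<equiv> setn a (NAdd (V a) (NConst 1))"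
abbreviation Or :: "bexp \<Rightarrow> bexp \<Rightarrow> bexp" where "Or b c \<equiv> Not (And (Not b) (Not c))"
abbreviation seqc :: "com \<Rightarrow> com \<Rightarrow> com" (infixr ";;" 55) where "c ;; d \<equiv> Seq c d"

section \<open>Balanced merging of blocks\<close>

text \<open>Merge sort without recursion: iterating this on singleton blocks leads to a single block
  after \<open>lg n\<close> rounds.\<close>

fun pairup :: "'a list list \<Rightarrow> 'a list list" where
  "pairup (x # y # zs) = (x @ y) # pairup zs"
| "pairup zs = zs"

lemma concat_pairup [simp]: "concat (pairup xs) = concat xs"
  by (induction xs rule: pairup.induct) auto

lemma length_pairup: "length (pairup xs) = (length xs + 1) div 2"
  by (induction xs rule: pairup.induct) auto

lemma nth_pairup:
  "2 * k < length xs \<Longrightarrow> pairup xs ! k = xs ! (2 * k) @ (if 2 * k + 1 < length xs then xs ! (2 * k + 1) else [])"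
proof (induction xs arbitrary: k rule: pairup.induct)
  case (1 x y zs) then show ?case by (cases k) auto
qed auto

lemma distinct_concat_nth_disjoint:
  "distinct (concat xs) \<Longrightarrow> i < length xs \<Longrightarrow> j < length xs \<Longrightarrow> i \<noteq> j \<Longrightarrow> set (xs ! i) \<inter> set (xs ! j) = {}"
proof (induction xs arbitrary: i j)
  case (Cons x xs)
  have *: "set x \<inter> set (xs ! k) = {}" if "k < length xs" for k
    using Cons.prems(1) nth_mem[OF that] by fastforce
  show ?case
  proof (cases i; cases j)
    fix a b assume "i = Suc a" "j = Suc b" then show ?thesis using Cons by auto
  qed (use Cons.prems * in auto)
qed simp

text \<open>The number of rounds, that is, the binary logarithm rounded up; the recursion mirrors
  how \<open>pairup\<close> changes the number of blocks.\<close>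

fun lg :: "nat \<Rightarrow> nat" where
  "lg n = (if n \<le> 1 then 0 else Suc (lg ((n + 1) div 2)))"
declare lg.simps [simp del]

text \<open>The additive 2 absorbs the rounding in \<open>(n + 1) div 2\<close>, so that the bound
  passes through the induction.\<close>

lemma lg_bound: "2 \<le> n \<Longrightarrow> 2 ^ lg n + 2 \<le> 2 * n"
proof (induction n rule: lg.induct)
  case (1 n)
  show ?case
  proof (cases "n = 2")
    case True
    then show ?thesis by (simp add: lg.simps[of 2] lg.simps[of "Suc 0"])
  next
    case False
    then have "2 ^ lg ((n + 1) div 2) + 2 \<le> 2 * ((n + 1) div 2)" using 1 by simp
    moreover have "2 * ((n + 1) div 2) \<le> n + 1" by simp
    ultimately have "2 ^ lg ((n + 1) div 2) + 1 \<le> n" by linarith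
    then show ?thesis using False 1(2) by (subst lg.simps) simp
  qed
qed

lemma lg_mono_aux: "n \<le> 2 ^ k \<Longrightarrow> lg n \<le> k"
proof (induction k arbitrary: n)
  case 0 then show ?case by (simp add: lg.simps)
next
  case (Suc k)
  have "(n + 1) div 2 \<le> 2 ^ k" using Suc.prems by simp
  from Suc.IH[OF this] show ?case by (subst lg.simps) simp
qed

lemma le_two_power_lg: "n \<le> 2 ^ lg n"
proof (induction n rule: lg.induct)
  case (1 n) then show ?case
  proof (cases "n \<le> 1")
    case False
    then have "(n + 1) div 2 \<le> 2 ^ lg ((n + 1) div 2)" using 1 by simp
    then show ?thesis using False by (subst lg.simps) simp
  next
    case True then show ?thesis by (simp add: lg.simps)
  qed
qed

lemma lg_mono: "m \<le> n \<Longrightarrow> lg m \<le> lg n"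
  using lg_mono_aux le_two_power_lg order_trans by blast

section \<open>Bottom-up divide and conquer with an abstract merge step\<close>

text \<open>A site with an interval. For envelopes the interval is the range of ordinates of a
  piece; for sorting the second real is the key.\<close>

type_synonym item = "nat \<times> real \<times> real"

definition segA :: "store \<Rightarrow> nat \<Rightarrow> nat \<Rightarrow> item list" where
  "segA s l u = map (\<lambda>k. (nmem s ''wA'' k, rmem s ''bA'' k, rmem s ''eA'' k)) [l..<u]"
definition segB :: "store \<Rightarrow> nat \<Rightarrow> nat \<Rightarrow> item list" where
  "segB s l u = map (\<lambda>k. (nmem s ''wB'' k, rmem s ''bB'' k, rmem s ''eB'' k)) [l..<u]"

text \<open>Block boundaries lie in \<open>bd\<close>. The merge step receives the left block as
  \<open>i\<close> to \<open>l2\<close>, the right one as \<open>h\<close> to \<open>l3\<close>, and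
  the start of its output as \<open>op0\<close>; a block without partner is merged with an empty
  one.\<close>

definition dc_pre :: com where
  "dc_pre = setn ''i'' (NRead ''bd'' (V ''j''));; setn ''h'' (NRead ''bd'' (NAdd (V ''j'') (NConst 1)));;
    setn ''l2'' (V ''h'');; setn ''op0'' (V ''op'');;
    If (NLess (NAdd (V ''j'') (NConst 1)) (V ''nb''))
      (setn ''l3'' (NRead ''bd'' (NAdd (V ''j'') (NConst 2)))) (setn ''l3'' (V ''h''))"
text \<open>New boundaries overwrite old ones in place. This is safe because the index of the
  boundary written stays below those still to be read.\<close>

definition dc_post :: com where
  "dc_post = inc ''jo'';; NAssign ''bd'' (V ''jo'') (V ''op'');; setn ''j'' (NAdd (V ''j'') (NConst 2))"
definition dc_copy :: com where
  "dc_copy = While (NLess (V ''k'') (V ''op''))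
    (NAssign ''wA'' (V ''k'') (NRead ''wB'' (V ''k''));; RAssign ''bA'' (V ''k'') (RRead ''bB'' (V ''k''));;
     RAssign ''eA'' (V ''k'') (RRead ''eB'' (V ''k''));; inc ''k'')"
definition dc_round :: "com \<Rightarrow> com" where
  "dc_round M = While (NLess (V ''j'') (V ''nb'')) (dc_pre;; M;; dc_post)"
definition dc :: "com \<Rightarrow> com" where
  "dc M = While (NLess (NConst 1) (V ''nb''))
    ((setn ''j'' (NConst 0);; setn ''jo'' (NConst 0);; setn ''op'' (NConst 0));; dc_round M;;
     (setn ''nb'' (V ''jo'');; setn ''k'' (NConst 0));; dc_copy)"

definition dcn :: "name set" where
  "dcn = {''wA'', ''wB'', ''bd'', ''nb'', ''j'', ''jo'', ''op'', ''op0'', ''i'', ''h'', ''l2'', ''l3'', ''k''}"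
definition dcr :: "name set" where
  "dcr = {''bA'', ''eA'', ''bB'', ''eB''}"

text \<open>The merge relations must not depend on the buffers and counters of the driver, so that
  moving items between the buffers preserves them.\<close>

definition eqout :: "store \<Rightarrow> store \<Rightarrow> bool" where
  "eqout s s' \<longleftrightarrow> (\<forall>a. a \<notin> dcn \<longrightarrow> nmem s' a = nmem s a) \<and> (\<forall>a. a \<notin> dcr \<longrightarrow> rmem s' a = rmem s a)"

lemma run_dc_copy:
  assumes "nmem s ''k'' 0 = 0" "nmem s ''op'' 0 = m" "m \<le> B"
  shows "run B dc_copy s (kw (NLess (V ''k'') (V ''op'')) (NAssign ''wA'' (V ''k'') (NRead ''wB'' (V ''k''));; RAssign ''bA'' (V ''k'') (RRead ''bB'' (V ''k''));;
     RAssign ''eA'' (V ''k'') (RRead ''eB'' (V ''k''));; inc ''k'') * Suc m)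
    (\<lambda>s'. \<forall>l u. u \<le> m \<longrightarrow> segA s' l u = segB s l u)"
  unfolding dc_copy_def
proof (rule run_while_lf[where \<psi> = "\<lambda>s. m - nmem s ''k'' 0" and
   I = "\<lambda>s'. nmem s' ''k'' 0 \<le> m \<and> (\<forall>i < nmem s' ''k'' 0. nmem s' ''wA'' i = nmem s ''wB'' i \<and>
      rmem s' ''bA'' i = rmem s ''bB'' i \<and> rmem s' ''eA'' i = rmem s ''eB'' i)"], goal_cases)
  case (3 s')
  have u: "nmem s' ''op'' = nmem s ''op''" "nmem s' ''wB'' = nmem s ''wB''"
    "rmem s' ''bB'' = rmem s ''bB''" "rmem s' ''eB'' = rmem s ''eB''"
    using 3(2) by (simp_all add: unch_def)
  have "nmem s ''wB'' (nmem s' ''k'' 0) \<le> B" using 3(3) u by (metis nbnd_def)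
  then show ?case using 3 u assms by (auto simp: less_Suc_eq nbnd_def)
next
  case (4 s')
  have u: "nmem s' ''op'' = nmem s ''op''" using 4(2) by (simp add: unch_def)
  show ?case using 4 u assms by (auto simp: segA_def segB_def)
qed (use assms in auto)

definition kcopy :: nat where
  "kcopy = kw (NLess (V ''k'') (V ''op'')) (NAssign ''wA'' (V ''k'') (NRead ''wB'' (V ''k''));; RAssign ''bA'' (V ''k'') (RRead ''bB'' (V ''k''));;
     RAssign ''eA'' (V ''k'') (RRead ''eB'' (V ''k''));; inc ''k'')"

text \<open>The contract for a merge step, met by merge sort and by the merging of envelopes.
  \<open>rel s G X\<close> says that the items \<open>X\<close> represent the sites
  \<open>G\<close>; it may look at the store, since merge sort keeps results there, and therefore
  \<open>body\<close> demands that groups disjoint from those merged are not disturbed. The factor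
  two in \<open>rel_len\<close> is the bound on the number of pieces per site of an envelope and
  sizes the buffers.\<close>

locale dcl =
  fixes M :: com and B K :: nat and rel :: "store \<Rightarrow> nat list \<Rightarrow> item list \<Rightarrow> bool" and J :: "store \<Rightarrow> bool"
  assumes nwM: "nw M \<inter> {''bd'', ''nb'', ''j'', ''jo''} = {}"
    and rel_nil: "rel s [] []"
    and rel_len: "rel s G X \<Longrightarrow> length X \<le> 2 * length G"
    and J_eq: "J s \<Longrightarrow> eqout s s' \<Longrightarrow> J s'"
    and rel_eq: "rel s G X \<Longrightarrow> eqout s s' \<Longrightarrow> rel s' G X"
    and body: "\<lbrakk>J s; nmem s ''i'' 0 = i; nmem s ''h'' 0 = l; nmem s ''l2'' 0 = l; nmem s ''l3'' 0 = l3;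
       nmem s ''op'' 0 = p; nmem s ''op0'' 0 = p; i \<le> l; l \<le> l3; l3 \<le> B; rel s G1 (segA s i l); rel s G2 (segA s l l3);
       distinct (G1 @ G2); p + 2 * length (G1 @ G2) \<le> B\<rbrakk> \<Longrightarrow>
     run B M s (K * Suc (l3 - i)) (\<lambda>s'. J s' \<and> p \<le> nmem s' ''op'' 0 \<and>
       rel s' (G1 @ G2) (segB s' p (nmem s' ''op'' 0)) \<and>
       (\<forall>l u. u \<le> p \<longrightarrow> segB s' l u = segB s l u) \<and>
       (\<forall>l' u. u \<le> i \<or> l3 \<le> l' \<longrightarrow> segA s' l' u = segA s l' u) \<and>
       (\<forall>G X. set G \<inter> set (G1 @ G2) = {} \<longrightarrow> rel s G X \<longrightarrow> rel s' G X))"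
begin

definition blocks :: "store \<Rightarrow> nat list list \<Rightarrow> bool" where
  "blocks s Gs \<longleftrightarrow> nmem s ''nb'' 0 = length Gs \<and> nmem s ''bd'' 0 = 0 \<and>
    (\<forall>k<length Gs. nmem s ''bd'' k \<le> nmem s ''bd'' (Suc k) \<and>
       rel s (Gs ! k) (segA s (nmem s ''bd'' k) (nmem s ''bd'' (Suc k))))"

lemma bd_bound:
  assumes "f 0 = 0" "\<forall>k<m. f k \<le> f (Suc k) \<and> length (X k) = f (Suc k) - f k \<and> rel s (Gs ! k) (X k)" "m \<le> length Gs"
  shows "f m \<le> 2 * length (concat (take m Gs))"
  using assms(2,3)
proof (induction m)
  case (Suc m)
  have "f m \<le> 2 * length (concat (take m Gs))" using Suc by auto
  moreover have "f (Suc m) - f m \<le> 2 * length (Gs ! m)" using Suc.prems rel_len by (metis lessI)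
  ultimately show ?case using Suc.prems by (simp add: take_Suc_conv_app_nth)
qed (simp add: assms)

lemma mono_bd: "\<forall>k<m. f k \<le> f (Suc k) \<Longrightarrow> i \<le> j \<Longrightarrow> j \<le> m \<Longrightarrow> (f i :: nat) \<le> f j"
proof (induction j)
  case (Suc j) then show ?case by (cases "i = Suc j") (auto intro: order_trans)
qed simp

definition kstep :: nat where "kstep = tmax dc_pre + tmax dc_post + K + 4 + bcost (NLess (V ''j'') (V ''nb''))"

lemma run_round:
  assumes J: "J s" and bl: "blocks s Gs" and 0: "nmem s ''j'' 0 = 0" "nmem s ''jo'' 0 = 0" "nmem s ''op'' 0 = 0"
    and nb: "2 \<le> length Gs" "length Gs \<le> length (concat Gs)"
    and dis: "distinct (concat Gs)" and B: "2 * length (concat Gs) + 2 \<le> B"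
  shows "run B (dc_round M) s (kstep * (4 * length (concat Gs)))
    (\<lambda>s'. J s' \<and> nmem s' ''jo'' 0 = length (pairup Gs) \<and> nmem s' ''bd'' 0 = 0 \<and>
      nmem s' ''op'' 0 = nmem s' ''bd'' (length (pairup Gs)) \<and> nmem s' ''op'' 0 \<le> 2 * length (concat Gs) \<and>
      (\<forall>k<length (pairup Gs). nmem s' ''bd'' k \<le> nmem s' ''bd'' (Suc k) \<and>
       rel s' (pairup Gs ! k) (segB s' (nmem s' ''bd'' k) (nmem s' ''bd'' (Suc k)))))"
proof -
  define N where "N = length Gs"
  define b0 where "b0 = nmem s ''bd''"
  define Hs where "Hs = pairup Gs"
  have lH: "length Hs = (N + 1) div 2" by (simp add: Hs_def N_def length_pairup)
  have b0: "b0 0 = 0" "\<And>k. k < N \<Longrightarrow> b0 k \<le> b0 (Suc k)"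
    "\<And>k. k < N \<Longrightarrow> rel s (Gs ! k) (segA s (b0 k) (b0 (Suc k)))"
    using bl by (auto simp: blocks_def b0_def N_def)
  have b0N: "b0 N \<le> 2 * length (concat Gs)"
    using bd_bound[of b0 N "\<lambda>k. segA s (b0 k) (b0 (Suc k))" s Gs] b0 by (auto simp: N_def segA_def)
  have b0mono: "i \<le> j \<Longrightarrow> j \<le> N \<Longrightarrow> b0 i \<le> b0 j" for i j using mono_bd[of N b0 i j] b0(2) by blast
  define I where "I = (\<lambda>s'. J s' \<and> nmem s' ''nb'' 0 = N \<and> nmem s' ''j'' 0 = 2 * nmem s' ''jo'' 0 \<and>
     nmem s' ''jo'' 0 \<le> length Hs \<and> nmem s' ''bd'' 0 = 0 \<and>
     (\<forall>k. nmem s' ''j'' 0 \<le> k \<and> k \<le> N \<longrightarrow> nmem s' ''bd'' k = b0 k) \<and>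
     (\<forall>k<N. nmem s' ''j'' 0 \<le> k \<longrightarrow> rel s' (Gs ! k) (segA s' (b0 k) (b0 (Suc k)))) \<and>
     nmem s' ''op'' 0 = nmem s' ''bd'' (nmem s' ''jo'' 0) \<and>
     (\<forall>k<nmem s' ''jo'' 0. nmem s' ''bd'' k \<le> nmem s' ''bd'' (Suc k) \<and>
       rel s' (Hs ! k) (segB s' (nmem s' ''bd'' k) (nmem s' ''bd'' (Suc k)))))"
  \<comment> \<open>Room for the outputs of the remaining groups is reserved, which keeps the write
    index within \<open>B\<close> during the whole round.\<close>
  have opb: "nmem s' ''op'' 0 + 2 * length (concat (drop (nmem s' ''jo'' 0) Hs)) \<le> 2 * length (concat Gs)" if I: "I s'" for s'
  proof -
    let ?m = "nmem s' ''jo'' 0"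
    have "nmem s' ''bd'' ?m \<le> 2 * length (concat (take ?m Hs))"
      by (rule bd_bound[where X = "\<lambda>k. segB s' (nmem s' ''bd'' k) (nmem s' ''bd'' (Suc k))" and s = s'])
         (use I in \<open>auto simp: I_def segB_def\<close>)
    moreover have "length (concat Gs) = length (concat (take ?m Hs)) + length (concat (drop ?m Hs))"
      by (metis append_take_drop_id concat_append concat_pairup length_append Hs_def)
    ultimately show ?thesis using I by (simp add: I_def)
  qed
  \<comment> \<open>Unread blocks plus unread items: merging two blocks with \<open>m\<close> items
    in total lowers this by at least \<open>m + 1\<close>, which pays for the merge and its constant
    overhead.\<close>
  define \<psi> where "\<psi> s' = (N - nmem s' ''j'' 0) + (b0 N - b0 (min N (nmem s' ''j'' 0)))" for s' :: store
  show ?thesis unfolding dc_round_def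
  proof (rule run_while[where I = I and \<Phi> = "\<lambda>s. kstep * \<psi> s"], goal_cases)
    case 1
    show ?case using J bl 0 b0 by (auto simp: I_def N_def b0_def blocks_def)
  next
    case (2 s1)
    note I1 = 2(1)[unfolded I_def]
    define j where "j = nmem s1 ''j'' 0"
    define jo where "jo = nmem s1 ''jo'' 0"
    define p where "p = nmem s1 ''op'' 0"
    have jN: "j < N" using 2(4) I1 by (simp add: j_def)
    have jj: "j = 2 * jo" using I1 by (simp add: j_def jo_def)
    have joH: "jo < length Hs" using jN jj lH by simp
    define G1 where "G1 = Gs ! j"
    define G2 where "G2 = (if Suc j < N then Gs ! Suc j else [])"
    define l where "l = b0 (Suc j)"
    define l3 where "l3 = (if Suc j < N then b0 (Suc (Suc j)) else l)"
    have l3m: "l3 = b0 (min N (j + 2))"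
    proof (cases "Suc j < N")
      case True
      then have "min N (j + 2) = Suc (Suc j)" by simp
      then show ?thesis using True by (simp add: l3_def)
    next
      case False
      then have "N = Suc j" using jN by simp
      then show ?thesis by (simp add: l3_def l_def)
    qed
    have G12: "G1 @ G2 = Hs ! jo" using jN jj by (simp add: Hs_def nth_pairup N_def G1_def G2_def)
    define s2 where "s2 = fex dc_pre s1"
    have s2: "nmem s2 ''i'' 0 = b0 j" "nmem s2 ''h'' 0 = l" "nmem s2 ''l2'' 0 = l" "nmem s2 ''l3'' 0 = l3"
      "nmem s2 ''op'' 0 = p" "nmem s2 ''op0'' 0 = p" and bd2: "nmem s2 ''bd'' = nmem s1 ''bd''"
      and nj2: "nmem s2 ''j'' = nmem s1 ''j''" "nmem s2 ''jo'' = nmem s1 ''jo''" "nmem s2 ''nb'' = nmem s1 ''nb''"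
      and eq2: "eqout s1 s2" and seg2: "segA s2 = segA s1" "segB s2 = segB s1"
      using I1 jN by (auto simp: s2_def dc_pre_def j_def[symmetric] l_def l3_def p_def eqout_def dcn_def dcr_def fun_eq_iff segA_def segB_def not_less_eq)
    have i2: "b0 j \<le> l" "l \<le> l3" using b0mono jN by (auto simp: l_def l3m)
    have ll3: "l3 \<le> b0 N" using b0mono by (simp add: l3m)
    have dG: "distinct (G1 @ G2)" unfolding G12 using dis nth_mem[OF joH] distinct_concat_iff[of Hs] by (simp add: Hs_def)
    have "length (Hs ! jo) \<le> length (concat (drop jo Hs))" using joH by (simp add: Cons_nth_drop_Suc[symmetric])
    then have pB: "p + 2 * length (G1 @ G2) \<le> 2 * length (concat Gs)" using opb[OF 2(1)] G12 by (simp add: p_def jo_def)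
    have r2: "rel s2 G1 (segA s2 (b0 j) l)" "rel s2 G2 (segA s2 l l3)"
    proof -
      show "rel s2 G1 (segA s2 (b0 j) l)" using I1 jN eq2 seg2 by (auto simp: G1_def l_def j_def intro: rel_eq)
      show "rel s2 G2 (segA s2 l l3)"
      proof (cases "Suc j < N")
        case True
        then have "min N (j + 2) = Suc (Suc j)" by simp
        then show ?thesis using I1 True eq2 seg2 by (auto simp: G2_def l_def l3m j_def intro: rel_eq)
      next
        case False
        then have "min N (j + 2) = Suc j" using jN by simp
        then show ?thesis using False by (simp add: G2_def l_def l3m segA_def rel_nil)
      qed
    qed
    have J2: "J s2" using I1 eq2 J_eq by blast
    let ?Q = "\<lambda>s'. J s' \<and> p \<le> nmem s' ''op'' 0 \<and>
       rel s' (G1 @ G2) (segB s' p (nmem s' ''op'' 0)) \<and>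
       (\<forall>l u. u \<le> p \<longrightarrow> segB s' l u = segB s2 l u) \<and>
       (\<forall>l' u. u \<le> b0 j \<or> l3 \<le> l' \<longrightarrow> segA s' l' u = segA s2 l' u) \<and>
       (\<forall>G X. set G \<inter> set (G1 @ G2) = {} \<longrightarrow> rel s2 G X \<longrightarrow> rel s' G X)"
    have rM: "run B M s2 (K * Suc (l3 - b0 j)) ?Q"
      using body[OF J2 s2 i2 _ r2 dG] ll3 b0N B pB by simp
    have fin: "run B dc_post s3 (tmax dc_post) (\<lambda>s''. I s'' \<and> nmem s'' ''j'' 0 = j + 2)" if u3: "unch M s2 s3" and Q3: "?Q s3" for s3
    proof (rule run_lf)
      have k3: "nmem s3 ''bd'' = nmem s1 ''bd''" "nmem s3 ''j'' = nmem s1 ''j''" "nmem s3 ''jo'' = nmem s1 ''jo''" "nmem s3 ''nb'' = nmem s1 ''nb''"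
        using u3 nwM bd2 nj2 by (auto simp: unch_def)
      show "lf dc_post" by (simp add: dc_post_def)
      have q3: "rel s3 (G1 @ G2) (segB s3 p (nmem s3 ''op'' 0))" using Q3 by blast
      have "nmem s3 ''op'' 0 - p \<le> 2 * length (G1 @ G2)" using rel_len[OF q3] by (simp add: segB_def)
      then have op3: "nmem s3 ''op'' 0 \<le> 2 * length (concat Gs)" using pB Q3 by linarith
      show "okw B dc_post s3" using op3 B k3 jN jj joH lH nb N_def
        by (simp add: dc_post_def j_def[symmetric] jo_def[symmetric])
      let ?s = "fex dc_post s3"
      have f: "nmem ?s ''j'' 0 = j + 2" "nmem ?s ''jo'' 0 = Suc jo" "nmem ?s ''op'' = nmem s3 ''op''"
        "nmem ?s ''bd'' = (nmem s1 ''bd'')(Suc jo := nmem s3 ''op'' 0)" "nmem ?s ''nb'' = nmem s1 ''nb''"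
        "eqout s3 ?s" "segA ?s = segA s3" "segB ?s = segB s3"
        using k3 by (auto simp: dc_post_def j_def jo_def eqout_def dcn_def dcr_def segA_def segB_def fun_eq_iff)
      have JF: "J ?s" using Q3 f(6) J_eq by blast
      have relf: "rel ?s G X" if "rel s3 G X" for G X using that f(6) rel_eq by blast
      have old: "rel ?s (Gs ! k) (segA ?s (b0 k) (b0 (Suc k)))" if k: "k < N" "j + 2 \<le> k" for k
      proof -
        have "rel s1 (Gs ! k) (segA s1 (b0 k) (b0 (Suc k)))" using I1 k by (simp add: j_def)
        then have "rel s2 (Gs ! k) (segA s1 (b0 k) (b0 (Suc k)))" using eq2 rel_eq by blast
        moreover have "set (Gs ! k) \<inter> set (G1 @ G2) = {}"
          using distinct_concat_nth_disjoint[OF dis, of k j] distinct_concat_nth_disjoint[OF dis, of k "Suc j"] k jN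
          by (auto simp: G1_def G2_def N_def)
        ultimately have "rel s3 (Gs ! k) (segA s1 (b0 k) (b0 (Suc k)))" using Q3 by blast
        moreover have "segA s3 (b0 k) (b0 (Suc k)) = segA s1 (b0 k) (b0 (Suc k))"
          using Q3 seg2 b0mono[of "min N (j+2)" k] k by (auto simp: l3m)
        ultimately show ?thesis using relf f(7) by simp
      qed
      have pbd: "p = nmem s1 ''bd'' jo" using I1 by (simp add: p_def jo_def)
      have new: "nmem ?s ''bd'' k \<le> nmem ?s ''bd'' (Suc k) \<and> rel ?s (Hs ! k) (segB ?s (nmem ?s ''bd'' k) (nmem ?s ''bd'' (Suc k)))"
        if k: "k < Suc jo" for k
      proof (cases "k = jo")
        case True
        then show ?thesis using Q3 G12 relf f pbd by (simp add: p_def)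
      next
        case False
        then have k: "k < jo" using k by simp
        have 1: "nmem s1 ''bd'' k \<le> nmem s1 ''bd'' (Suc k)" "rel s1 (Hs ! k) (segB s1 (nmem s1 ''bd'' k) (nmem s1 ''bd'' (Suc k)))"
          using I1 k by (auto simp: jo_def)
        have "nmem s1 ''bd'' (Suc k) \<le> p" unfolding pbd
          by (rule mono_bd[of jo]) (use I1 k in \<open>auto simp: jo_def\<close>)
        then have sg: "segB s3 (nmem s1 ''bd'' k) (nmem s1 ''bd'' (Suc k)) = segB s1 (nmem s1 ''bd'' k) (nmem s1 ''bd'' (Suc k))"
          using Q3 seg2 by simp
        have "set (Hs ! k) \<inter> set (G1 @ G2) = {}" unfolding G12
          by (rule distinct_concat_nth_disjoint) (use dis k joH in \<open>auto simp: Hs_def\<close>)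
        then have "rel s3 (Hs ! k) (segB s1 (nmem s1 ''bd'' k) (nmem s1 ''bd'' (Suc k)))"
          using Q3 1 eq2 rel_eq by blast
        then show ?thesis using relf f sg 1 k by simp
      qed
      show "I ?s \<and> nmem ?s ''j'' 0 = j + 2" unfolding I_def
      proof (intro conjI allI impI, goal_cases)
        \<comment> \<open>The boundary just overwritten is \<open>Suc jo\<close>, strictly below the
          next index \<open>2 * jo + 2\<close> to be read.\<close>
        case (6 k)
        have "Suc jo \<noteq> k" using 6 jj by (simp add: f)
        then show ?case using 6 I1 by (simp add: f j_def)
      qed (use JF f I1 jj joH new old in \<open>auto simp: jo_def[symmetric] j_def[symmetric]\<close>)
    qed simp
    have le: "tmax dc_pre + (K * Suc (l3 - b0 j) + tmax dc_post) + bcost (NLess (V ''j'') (V ''nb'')) + 1 + kstep * \<psi> s'' \<le> kstep * \<psi> s1"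
      if "nmem s'' ''j'' 0 = j + 2" for s''
    proof -
      have "Suc (\<psi> s'') + (l3 - b0 j) \<le> \<psi> s1"
        using that jN b0mono[of j N] b0mono[of j "min N (j + 2)"] b0mono[of "min N (j + 2)" N]
        by (simp add: \<psi>_def j_def[symmetric] l3m)
      then have "kstep * (Suc (\<psi> s'') + (l3 - b0 j)) \<le> kstep * \<psi> s1" by (rule mult_le_mono2)
      moreover have "K * (l3 - b0 j) \<le> kstep * (l3 - b0 j)" by (simp add: kstep_def)
      ultimately show ?thesis by (simp add: kstep_def distrib_left distrib_right)
    qed
    show ?case
    proof (rule exI[of _ "tmax dc_pre + (K * Suc (l3 - b0 j) + tmax dc_post)"], rule run_lf_seq)
      show "okw B dc_pre s1" if "nbnd B s1"
        using that by (auto simp: dc_pre_def nbnd_def)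
      show "run B (M;; dc_post) (fex dc_pre s1) (K * Suc (l3 - b0 j) + tmax dc_post)
         (\<lambda>s''. I s'' \<and> tmax dc_pre + (K * Suc (l3 - b0 j) + tmax dc_post) + bcost (NLess (V ''j'') (V ''nb'')) + 1 + kstep * \<psi> s'' \<le> kstep * \<psi> s1)"
        unfolding s2_def[symmetric]
        by (rule run_seq[OF rM], rule run_mono[OF fin]) (use le in auto)
    qed (auto simp: dc_pre_def)
  next
    case (3 s')
    note I1 = 3(1)[unfolded I_def]
    have "\<not> 2 * nmem s' ''jo'' 0 < N" "nmem s' ''jo'' 0 \<le> (N + 1) div 2" using 3(4) I1 lH by simp_all
    then have "nmem s' ''jo'' 0 = length Hs" using lH by linarith
    then show ?case using I1 opb[OF 3(1)] by (simp add: Hs_def[symmetric])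
  next
    case 4
    have "\<psi> s \<le> 3 * length (concat Gs)" using nb b0N 0 b0 by (simp add: \<psi>_def N_def)
    then have "kstep * \<psi> s \<le> kstep * (3 * length (concat Gs))" by (rule mult_le_mono2)
    moreover have "kstep * 1 \<le> kstep * length (concat Gs)" using nb by (intro mult_le_mono2) simp
    moreover have "bcost (NLess (V ''j'') (V ''nb'')) + 1 \<le> kstep" by (simp add: kstep_def)
    ultimately show ?case by linarith
  qed
qed

definition kdc :: nat where "kdc = tmax (setn ''j'' (NConst 0);; setn ''jo'' (NConst 0);; setn ''op'' (NConst 0)) + 4 * kstep
   + tmax (setn ''nb'' (V ''jo'');; setn ''k'' (NConst 0)) + 3 * kcopy + bcost (NLess (NConst 1) (V ''nb'')) + 1"

text \<open>A round takes time linear in the number of sites and lowers \<open>lg nb\<close> by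
  exactly one, so the number of sites times \<open>lg nb\<close> serves as potential. There are at
  most as many blocks as sites, so the overhead per block is covered too.\<close>

lemma run_dc:
  assumes J: "J s" and bl: "blocks s Gs"
    and nb: "length Gs \<le> length (concat Gs)"
    and dis: "distinct (concat Gs)" and B: "2 * length (concat Gs) + 2 \<le> B"
  shows "run B (dc M) s (kdc * (length (concat Gs) * lg (length (concat Gs)) + 1))
    (\<lambda>s'. J s' \<and> rel s' (concat Gs) (segA s' 0 (nmem s' ''bd'' (nmem s' ''nb'' 0))))"
  unfolding dc_def
proof (rule run_while[where I = "\<lambda>s'. J s' \<and> (\<exists>Hs. blocks s' Hs \<and> concat Hs = concat Gs \<and> length Hs \<le> length Gs)"
      and \<Phi> = "\<lambda>s'. kdc * (length (concat Gs) * lg (nmem s' ''nb'' 0))"], goal_cases)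
  case 1 show ?case using J bl by blast
next
  case (2 s1)
  then obtain Hs where J1: "J s1" and Hs: "blocks s1 Hs" "concat Hs = concat Gs" "length Hs \<le> length Gs" by blast
  have n2: "2 \<le> length Hs" using Hs(1) 2(4) by (simp add: blocks_def)
  let ?L = "length (concat Gs)"
  let ?c0 = "setn ''j'' (NConst 0);; setn ''jo'' (NConst 0);; setn ''op'' (NConst 0)"
  let ?c1 = "setn ''nb'' (V ''jo'');; setn ''k'' (NConst 0)"
  let ?s1 = "fex ?c0 s1"
  have e1: "eqout s1 ?s1" by (auto simp: eqout_def dcn_def)
  have J1': "J ?s1" using J_eq[OF J1 e1] .
  have b1: "blocks ?s1 Hs" using Hs(1) rel_eq[OF _ e1] by (auto simp: blocks_def segA_def)
  have Lpos: "2 \<le> ?L" using n2 nb Hs by simp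
  let ?P = "\<lambda>s'. J s' \<and> nmem s' ''jo'' 0 = length (pairup Hs) \<and> nmem s' ''bd'' 0 = 0 \<and>
      nmem s' ''op'' 0 = nmem s' ''bd'' (length (pairup Hs)) \<and> nmem s' ''op'' 0 \<le> 2 * length (concat Hs) \<and>
      (\<forall>k<length (pairup Hs). nmem s' ''bd'' k \<le> nmem s' ''bd'' (Suc k) \<and>
       rel s' (pairup Hs ! k) (segB s' (nmem s' ''bd'' k) (nmem s' ''bd'' (Suc k))))"
  have rr: "run B (dc_round M) ?s1 (kstep * (4 * length (concat Hs))) ?P"
    by (rule run_round[OF J1' b1]) (use Hs n2 nb dis B in auto)
  let ?T = "tmax ?c0 + (kstep * (4 * ?L) + (tmax ?c1 + kcopy * (3 * ?L)))"
  have fin: "run B (?c1;; dc_copy) s2 (tmax ?c1 + kcopy * (3 * ?L))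
     (\<lambda>s'. J s' \<and> blocks s' (pairup Hs))" if P: "?P s2" and nbs: "nbnd B s2" for s2
  proof (rule run_lf_seq)
    let ?s2 = "fex ?c1 s2"
    show "okw B ?c1 s2" using nbs by (simp add: nbnd_def)
    have oB: "nmem s2 ''op'' 0 \<le> 2 * ?L" using P Hs by simp
    have "run B dc_copy ?s2 (kcopy * Suc (nmem s2 ''op'' 0)) (\<lambda>s'. \<forall>l u. u \<le> nmem s2 ''op'' 0 \<longrightarrow> segA s' l u = segB ?s2 l u)"
      unfolding kcopy_def by (rule run_dc_copy) (use oB B in auto)
    then show "run B dc_copy ?s2 (kcopy * (3 * ?L)) (\<lambda>s'. J s' \<and> blocks s' (pairup Hs))"
    proof (rule run_mono)
      show "kcopy * Suc (nmem s2 ''op'' 0) \<le> kcopy * (3 * ?L)" using oB Lpos by (intro mult_le_mono2) simp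
    next
      fix s' assume u: "unch dc_copy ?s2 s'" and Q: "\<forall>l u. u \<le> nmem s2 ''op'' 0 \<longrightarrow> segA s' l u = segB ?s2 l u"
      have e2: "eqout s2 s'" using u by (auto simp: eqout_def unch_def dcn_def dcr_def dc_copy_def)
      have f: "nmem s' ''bd'' = nmem s2 ''bd''" "nmem s' ''nb'' 0 = nmem s2 ''jo'' 0"
        using u by (simp_all add: unch_def dc_copy_def)
      have "rel s' (pairup Hs ! k) (segA s' (nmem s2 ''bd'' k) (nmem s2 ''bd'' (Suc k)))" if k: "k < length (pairup Hs)" for k
      proof -
        have "nmem s2 ''bd'' (Suc k) \<le> nmem s2 ''bd'' (length (pairup Hs))"
          by (rule mono_bd[of "length (pairup Hs)"]) (use P k in auto)
        then have "segA s' (nmem s2 ''bd'' k) (nmem s2 ''bd'' (Suc k)) = segB s2 (nmem s2 ''bd'' k) (nmem s2 ''bd'' (Suc k))"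
          using Q P by (simp add: segB_def)
        then show ?thesis using P k rel_eq[OF _ e2] by auto
      qed
      then show "J s' \<and> blocks s' (pairup Hs)" using P f J_eq[OF _ e2] by (auto simp: blocks_def)
    qed
  qed auto
  have step: "?T + bcost (NLess (NConst 1) (V ''nb'')) + 1 + kdc * (?L * lg (nmem s' ''nb'' 0)) \<le> kdc * (?L * lg (nmem s1 ''nb'' 0))"
    if b: "blocks s' (pairup Hs)" for s'
  proof -
    have "nmem s1 ''nb'' 0 = length Hs" using Hs by (simp add: blocks_def)
    moreover have "nmem s' ''nb'' 0 = (length Hs + 1) div 2" using b by (simp add: blocks_def length_pairup)
    ultimately have "lg (nmem s1 ''nb'' 0) = Suc (lg (nmem s' ''nb'' 0))" using n2 by (simp add: lg.simps[of "length Hs"])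
    moreover have "?T + bcost (NLess (NConst 1) (V ''nb'')) + 1 \<le> kdc * ?L"
    proof -
      have "a + (ks * (4 * L) + (b + kc * (3 * L))) + c + 1 \<le> (a + 4 * ks + b + 3 * kc + c + 1) * L" if "1 \<le> L" for a b c ks kc L :: nat
      proof -
        have "(a + b + c + 1) * 1 \<le> (a + b + c + 1) * L" using that by (rule mult_le_mono2)
        then show ?thesis by (simp add: algebra_simps)
      qed
      note * = this
      show ?thesis unfolding kdc_def by (rule *) (use Lpos in simp)
    qed
    ultimately show ?thesis by (simp add: algebra_simps)
  qed
  show ?case
  proof (rule exI[of _ ?T], rule run_lf_seq)
    have lp: "length (pairup Hs) \<le> length Gs" using Hs by (simp add: length_pairup)
    show "run B (dc_round M;; ?c1;; dc_copy) ?s1 (kstep * (4 * ?L) + (tmax ?c1 + kcopy * (3 * ?L)))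
       (\<lambda>s''. (J s'' \<and> (\<exists>Hs. blocks s'' Hs \<and> concat Hs = concat Gs \<and> length Hs \<le> length Gs)) \<and>
         ?T + bcost (NLess (NConst 1) (V ''nb'')) + 1 + kdc * (?L * lg (nmem s'' ''nb'' 0)) \<le> kdc * (?L * lg (nmem s1 ''nb'' 0)))"
      by (rule run_seq[OF rr], rule run_mono[OF fin]) (use step Hs lp in auto)
  qed (use B in auto)
next
  case (3 s')
  then obtain Hs where J1: "J s'" and Hs: "blocks s' Hs" "concat Hs = concat Gs" "length Hs \<le> length Gs" by blast
  have "length Hs \<le> 1" using 3(4) Hs by (simp add: blocks_def)
  then consider "Hs = []" | G where "Hs = [G]" by (cases Hs) auto
  then show ?case
  proof cases
    case 1
    \<comment> \<open>With no block at all, the boundary \<open>bd 0 = 0\<close> makes the segment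
      empty.\<close>
    then have "segA s' 0 (nmem s' ''bd'' (nmem s' ''nb'' 0)) = []" "concat Gs = []" using Hs by (auto simp: blocks_def segA_def)
    then show ?thesis using J1 by (simp only: rel_nil simp_thms)
  next
    case 2
    then show ?thesis using J1 Hs by (auto simp: blocks_def)
  qed
next
  case 4
  have "lg (nmem s ''nb'' 0) \<le> lg (length (concat Gs))" using bl nb by (intro lg_mono) (simp add: blocks_def)
  then have "kdc * (length (concat Gs) * lg (nmem s ''nb'' 0)) \<le> kdc * (length (concat Gs) * lg (length (concat Gs)))" by simp
  moreover have "bcost (NLess (NConst 1) (V ''nb'')) + 1 \<le> kdc" by (simp add: kdc_def)
  ultimately show ?case unfolding distrib_left by linarith
qed

end

section \<open>Merge sort that records dominating sites\<close>

text \<open>Ties go to the left block, since a left site of equal key still counts as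
  dominating.\<close>

definition ms_take :: bexp where
  "ms_take = And (NLess (V ''i'') (V ''l2''))
     (Not (And (NLess (V ''h'') (V ''l3'')) (RLess (RRead ''eA'' (V ''h'')) (RRead ''eA'' (V ''i'')))))"
text \<open>\<open>cur\<close> and \<open>best\<close> store a site plus one, with zero for none.
  \<open>cur\<close> is a left site of largest \<open>X\<close> among those passed so far in this
  merge.\<close>

definition ms_left :: com where
  "ms_left = NAssign ''wB'' (V ''op'') (NRead ''wA'' (V ''i''));; RAssign ''eB'' (V ''op'') (RRead ''eA'' (V ''i''));;
     If (Or (NEq (V ''cur'') (NConst 0))
           (RLess (RRead ''X'' (NSub (V ''cur'') (NConst 1))) (RRead ''X'' (NRead ''wA'' (V ''i'')))))
       (setn ''cur'' (NAdd (NRead ''wA'' (V ''i'')) (NConst 1))) Skip;; inc ''op'';; inc ''i''"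
definition ms_right :: com where
  "ms_right = NAssign ''wB'' (V ''op'') (NRead ''wA'' (V ''h''));; RAssign ''eB'' (V ''op'') (RRead ''eA'' (V ''h''));;
     If (And (Not (NEq (V ''cur'') (NConst 0)))
           (Or (NEq (NRead ''best'' (NRead ''wA'' (V ''h''))) (NConst 0))
             (RLess (RRead ''X'' (NSub (NRead ''best'' (NRead ''wA'' (V ''h''))) (NConst 1))) (RRead ''X'' (NSub (V ''cur'') (NConst 1))))))
       (NAssign ''best'' (NRead ''wA'' (V ''h'')) (V ''cur'')) Skip;; inc ''op'';; inc ''h''"
definition ms_body :: com where "ms_body = If ms_take ms_left ms_right"
text \<open>Two-dimensional dominance by divide and conquer: the initial order supplies one
  condition, the key the other, and each merge treats the pairs split between its two blocks. With
  the order by \<open>kap X + Y\<close> and the key \<open>kap X - Y\<close> the dominating sites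
  form a backward cone.\<close>

definition ms :: com where
  "ms = setn ''cur'' (NConst 0);; While (Or (NLess (V ''i'') (V ''l2'')) (NLess (V ''h'') (V ''l3''))) ms_body"

definition before :: "'a list \<Rightarrow> 'a \<Rightarrow> 'a \<Rightarrow> bool" where
  "before G p q \<longleftrightarrow> (\<exists>i j. i < j \<and> j < length G \<and> G ! i = p \<and> G ! j = q)"

lemma before_append: "before (G @ H) p q \<longleftrightarrow> before G p q \<or> before H p q \<or> (p \<in> set G \<and> q \<in> set H)"
proof
  assume "before (G @ H) p q"
  then obtain i j where ij: "i < j" "j < length (G @ H)" "(G @ H) ! i = p" "(G @ H) ! j = q" by (auto simp: before_def)
  consider "j < length G" | "i < length G" "length G \<le> j" | "length G \<le> i" using ij by linarith
  then show "before G p q \<or> before H p q \<or> (p \<in> set G \<and> q \<in> set H)"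
  proof cases
    case 1 then show ?thesis using ij by (auto simp: before_def nth_append)
  next
    case 2 then show ?thesis using ij by (auto simp: nth_append)
  next
    case 3
    then have "before H p q" unfolding before_def using ij
      by (intro exI[of _ "i - length G"] exI[of _ "j - length G"]) (auto simp: nth_append)
    then show ?thesis by simp
  qed
next
  assume "before G p q \<or> before H p q \<or> (p \<in> set G \<and> q \<in> set H)"
  then show "before (G @ H) p q"
  proof (elim disjE conjE)
    assume "before G p q" then show ?thesis unfolding before_def by (metis length_append nth_append order.strict_trans trans_less_add1)
  next
    assume "before H p q"
    then obtain i j where "i < j" "j < length H" "H ! i = p" "H ! j = q" by (auto simp: before_def)
    then show ?thesis unfolding before_def
      by (intro exI[of _ "length G + i"] exI[of _ "length G + j"]) auto
  next
    assume "p \<in> set G" "q \<in> set H"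
    then obtain i j where "i < length G" "G ! i = p" "j < length H" "H ! j = q" by (metis in_set_conv_nth)
    then show ?thesis unfolding before_def
      by (intro exI[of _ i] exI[of _ "length G + j"]) (auto simp: nth_append)
  qed
qed

lemma before_set: "before G p q \<Longrightarrow> p \<in> set G \<and> q \<in> set G"
  by (auto simp: before_def)

section \<open>The invariant of one merge, stated without the store\<close>

locale msort_state =
  fixes a :: "nat \<Rightarrow> nat" and e xs :: "nat \<Rightarrow> real" and i0 l l3 p :: nat and best0 :: "nat \<Rightarrow> nat"
  assumes ord: "i0 \<le> l" "l \<le> l3"
    and so: "\<And>k k'. i0 \<le> k \<Longrightarrow> k \<le> k' \<Longrightarrow> k' < l \<Longrightarrow> e k \<le> e k'"
      "\<And>k k'. l \<le> k \<Longrightarrow> k \<le> k' \<Longrightarrow> k' < l3 \<Longrightarrow> e k \<le> e k'"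
    and di: "inj_on a {l..<l3}"
begin

text \<open>When a right site is passed, exactly the left sites of key at most its own have been
  passed. Hence its entry in \<open>best\<close> becomes the better of its old value, which comes
  from within the right block, and \<open>cur\<close>; left sites keep their entries.\<close>

definition MI :: "nat \<Rightarrow> nat \<Rightarrow> nat \<Rightarrow> nat \<Rightarrow> (nat \<Rightarrow> nat) \<Rightarrow> (nat \<Rightarrow> nat) \<Rightarrow> (nat \<Rightarrow> real) \<Rightarrow> bool" where
  "MI i h op cur best wb eb \<longleftrightarrow> i0 \<le> i \<and> i \<le> l \<and> l \<le> h \<and> h \<le> l3 \<and> op = p + (i - i0) + (h - l) \<and>
    mset (map wb [p..<op]) = mset (map a [i0..<i]) + mset (map a [l..<h]) \<and>
    mset (map (\<lambda>k. (wb k, eb k)) [p..<op]) = mset (map (\<lambda>k. (a k, e k)) [i0..<i]) + mset (map (\<lambda>k. (a k, e k)) [l..<h]) \<and>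
    sorted (map eb [p..<op]) \<and>
    (\<forall>x\<in>{p..<op}. (\<forall>k\<in>{i..<l}. eb x \<le> e k) \<and> (\<forall>k\<in>{h..<l3}. eb x \<le> e k)) \<and>
    (\<forall>k'\<in>{i0..<i}. \<forall>k\<in>{h..<l3}. e k' \<le> e k) \<and> (\<forall>k\<in>{l..<h}. \<forall>k'\<in>{i..<l}. e k < e k') \<and>
    (cur = 0 \<longleftrightarrow> i = i0) \<and> (\<forall>c. cur = Suc c \<longrightarrow> c \<in> a ` {i0..<i} \<and> (\<forall>k\<in>{i0..<i}. xs (a k) \<le> xs c)) \<and>
    (\<forall>q. q \<notin> a ` {l..<h} \<longrightarrow> best q = best0 q) \<and>
    (\<forall>k\<in>{l..<h}. (\<forall>c. best (a k) = Suc c \<longrightarrow> best0 (a k) = Suc c \<or> (\<exists>k'\<in>{i0..<l}. a k' = c \<and> e k' \<le> e k)) \<and>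
      (\<forall>k'\<in>{i0..<l}. e k' \<le> e k \<longrightarrow> (\<exists>c. best (a k) = Suc c \<and> xs (a k') \<le> xs c)) \<and>
      (\<forall>c. best0 (a k) = Suc c \<longrightarrow> (\<exists>c'. best (a k) = Suc c' \<and> xs c \<le> xs c')))"

lemma MI_init: "MI i0 l p 0 best0 wb eb"
  using ord by (auto simp: MI_def)

lemma map_upd_upt: "map (f(n := v)) [m..<n] = map f [m..<n]" by auto

lemma MI_left:
  assumes M: "MI i h op cur best wb eb" and t: "i < l" "\<not> (h < l3 \<and> e h < e i)"
  defines "cur' \<equiv> (if cur = 0 \<or> xs (cur - 1) < xs (a i) then Suc (a i) else cur)"
  shows "MI (Suc i) h (Suc op) cur' best (wb(op := a i)) (eb(op := e i))"
proof -
  have b: "i0 \<le> i" "l \<le> h" "h \<le> l3" "p \<le> op" using M by (auto simp: MI_def)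
  have F1: "\<forall>x\<in>{p..<op}. (\<forall>k\<in>{i..<l}. eb x \<le> e k) \<and> (\<forall>k\<in>{h..<l3}. eb x \<le> e k)"
    and F2: "\<forall>k'\<in>{i0..<i}. \<forall>k\<in>{h..<l3}. e k' \<le> e k" and F3: "\<forall>k\<in>{l..<h}. \<forall>k'\<in>{i..<l}. e k < e k'"
    and F4: "\<forall>q. q \<notin> a ` {l..<h} \<longrightarrow> best q = best0 q"
    and F5: "\<forall>k\<in>{l..<h}. (\<forall>c. best (a k) = Suc c \<longrightarrow> best0 (a k) = Suc c \<or> (\<exists>k'\<in>{i0..<l}. a k' = c \<and> e k' \<le> e k)) \<and>
      (\<forall>k'\<in>{i0..<l}. e k' \<le> e k \<longrightarrow> (\<exists>c. best (a k) = Suc c \<and> xs (a k') \<le> xs c)) \<and>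
      (\<forall>c. best0 (a k) = Suc c \<longrightarrow> (\<exists>c'. best (a k) = Suc c' \<and> xs c \<le> xs c'))"
    and F6: "mset (map wb [p..<op]) = mset (map a [i0..<i]) + mset (map a [l..<h])"
      "mset (map (\<lambda>k. (wb k, eb k)) [p..<op]) = mset (map (\<lambda>k. (a k, e k)) [i0..<i]) + mset (map (\<lambda>k. (a k, e k)) [l..<h])"
      "sorted (map eb [p..<op])" "op = p + (i - i0) + (h - l)"
    and F7: "cur = 0 \<longleftrightarrow> i = i0" "\<forall>c. cur = Suc c \<longrightarrow> c \<in> a ` {i0..<i} \<and> (\<forall>k\<in>{i0..<i}. xs (a k) \<le> xs c)"
    using M unfolding MI_def by - (elim conjE, assumption)+
  have 1: "e i \<le> e k" if "k \<in> {h..<l3}" for k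
    using t(2) so(2)[of h k] that b by force
  have 2: "e i \<le> e k" if "k \<in> {Suc i..<l}" for k using so(1)[of i k] that b by auto
  have eqs: "[p..<Suc op] = [p..<op] @ [op]" "[i0..<Suc i] = [i0..<i] @ [i]" using b by auto
  have 3: "(\<lambda>k. ((wb(op := a i)) k, (eb(op := e i)) k)) = (\<lambda>k. (wb k, eb k))(op := (a i, e i))" by auto
  have cur: "(cur' = 0 \<longleftrightarrow> Suc i = i0) \<and> (\<forall>c. cur' = Suc c \<longrightarrow> c \<in> a ` {i0..<Suc i} \<and> (\<forall>k\<in>{i0..<Suc i}. xs (a k) \<le> xs c))"
  proof (cases cur)
    case 0
    then have "i = i0" using M by (simp add: MI_def)
    then show ?thesis using 0 by (auto simp: cur'_def)
  next
    case (Suc c)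
    then have "c \<in> a ` {i0..<i}" "\<forall>k\<in>{i0..<i}. xs (a k) \<le> xs c" using M by (auto simp: MI_def)
    note c = this
    have ins: "{i0..<Suc i} = insert i {i0..<i}" using b by auto
    show ?thesis
    proof (cases "xs c < xs (a i)")
      case True
      then have "xs (a k) \<le> xs (a i)" if "k \<in> {i0..<i}" for k using c(2) that by fastforce
      then show ?thesis using Suc True b by (simp add: cur'_def ins)
    next
      case False
      then show ?thesis using Suc c b by (simp add: cur'_def ins)
    qed
  qed
  have so': "sorted (map (eb(op := e i)) [p..<Suc op])"
    using F1 F6(3) t(1) unfolding eqs(1) map_append map_upd_upt sorted_append by simp
  have ins: "{p..<Suc op} = insert op {p..<op}" "{i0..<Suc i} = insert i {i0..<i}" using b by auto
  have F1': "\<forall>x\<in>{p..<Suc op}. (\<forall>k\<in>{Suc i..<l}. (eb(op := e i)) x \<le> e k) \<and> (\<forall>k\<in>{h..<l3}. (eb(op := e i)) x \<le> e k)"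
    unfolding ins using F1 1 2 by simp
  have F2': "\<forall>k'\<in>{i0..<Suc i}. \<forall>k\<in>{h..<l3}. e k' \<le> e k" unfolding ins using F2 1 by simp
  have F6': "mset (map (wb(op := a i)) [p..<Suc op]) = mset (map a [i0..<Suc i]) + mset (map a [l..<h])"
      "mset (map (\<lambda>k. ((wb(op := a i)) k, (eb(op := e i)) k)) [p..<Suc op]) =
       mset (map (\<lambda>k. (a k, e k)) [i0..<Suc i]) + mset (map (\<lambda>k. (a k, e k)) [l..<h])"
    using F6(1,2) unfolding 3 eqs map_append map_upd_upt mset_append by simp_all
  have F3': "\<forall>k\<in>{l..<h}. \<forall>k'\<in>{Suc i..<l}. e k < e k'" using F3 by simp
  have le: "i0 \<le> Suc i" "Suc i \<le> l" "Suc op = p + (Suc i - i0) + (h - l)" using b t(1) F6(4) by auto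
  show ?thesis unfolding MI_def
    by (intro conjI; fact le b F6' so' F1' F2' F3' F4 F5 cur[THEN conjunct1] cur[THEN conjunct2])
qed

lemma MI_right:
  assumes M: "MI i h op cur best wb eb" and t: "h < l3" "i < l \<Longrightarrow> e h < e i"
  defines "best' \<equiv> (if cur \<noteq> 0 \<and> (best (a h) = 0 \<or> xs (best (a h) - 1) < xs (cur - 1)) then best(a h := cur) else best)"
  shows "MI i (Suc h) (Suc op) cur best' (wb(op := a h)) (eb(op := e h))"
proof -
  have b: "i0 \<le> i" "i \<le> l" "l \<le> h" "h \<le> l3" "p \<le> op" using M by (auto simp: MI_def)
  have F1: "\<forall>x\<in>{p..<op}. (\<forall>k\<in>{i..<l}. eb x \<le> e k) \<and> (\<forall>k\<in>{h..<l3}. eb x \<le> e k)"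
    and F2: "\<forall>k'\<in>{i0..<i}. \<forall>k\<in>{h..<l3}. e k' \<le> e k" and F3: "\<forall>k\<in>{l..<h}. \<forall>k'\<in>{i..<l}. e k < e k'"
    and F4: "\<forall>q. q \<notin> a ` {l..<h} \<longrightarrow> best q = best0 q"
    and F5: "\<forall>k\<in>{l..<h}. (\<forall>c. best (a k) = Suc c \<longrightarrow> best0 (a k) = Suc c \<or> (\<exists>k'\<in>{i0..<l}. a k' = c \<and> e k' \<le> e k)) \<and>
      (\<forall>k'\<in>{i0..<l}. e k' \<le> e k \<longrightarrow> (\<exists>c. best (a k) = Suc c \<and> xs (a k') \<le> xs c)) \<and>
      (\<forall>c. best0 (a k) = Suc c \<longrightarrow> (\<exists>c'. best (a k) = Suc c' \<and> xs c \<le> xs c'))"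
    and F6: "mset (map wb [p..<op]) = mset (map a [i0..<i]) + mset (map a [l..<h])"
      "mset (map (\<lambda>k. (wb k, eb k)) [p..<op]) = mset (map (\<lambda>k. (a k, e k)) [i0..<i]) + mset (map (\<lambda>k. (a k, e k)) [l..<h])"
      "sorted (map eb [p..<op])" "op = p + (i - i0) + (h - l)"
    and F7: "cur = 0 \<longleftrightarrow> i = i0" "\<forall>c. cur = Suc c \<longrightarrow> c \<in> a ` {i0..<i} \<and> (\<forall>k\<in>{i0..<i}. xs (a k) \<le> xs c)"
    using M unfolding MI_def by - (elim conjE, assumption)+
  have 1: "e h < e k" if "k \<in> {i..<l}" for k
    using t(2) so(1)[of i k] that b by force
  have 2: "e h \<le> e k" if "k \<in> {Suc h..<l3}" for k using so(2)[of h k] that b by auto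
  have eqs: "[p..<Suc op] = [p..<op] @ [op]" "[l..<Suc h] = [l..<h] @ [h]" using b by auto
  have 3: "(\<lambda>k. ((wb(op := a h)) k, (eb(op := e h)) k)) = (\<lambda>k. (wb k, eb k))(op := (a h, e h))" by auto
  have so': "sorted (map (eb(op := e h)) [p..<Suc op])"
    using F1 F6(3) t(1) unfolding eqs(1) map_append map_upd_upt sorted_append by simp
  \<comment> \<open>Sites of the right block are distinct, so this write leaves the entries of those
    passed before intact.\<close>
  have ne: "a k \<noteq> a h" if "k \<in> {l..<h}" for k
    using inj_onD[OF di, of k h] that t(1) b by auto
  then have "a h \<notin> a ` {l..<h}" by (metis imageE)
  then have b0: "best (a h) = best0 (a h)" using F4 by blast
  have same: "best' (a k) = best (a k)" if "k \<in> {l..<h}" for k using ne[OF that] by (simp add: best'_def)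
  have cur: "(cur = 0 \<longleftrightarrow> i = i0)" "\<And>c. cur = Suc c \<Longrightarrow> c \<in> a ` {i0..<i} \<and> (\<forall>k\<in>{i0..<i}. xs (a k) \<le> xs c)"
    using F7 by blast+
  have le_i: "e k' \<le> e h" if "k' \<in> {i0..<i}" for k' using F2 t(1) that by simp
  \<comment> \<open>Every left site of key at most that of the right head has been passed, so
    \<open>cur\<close> already accounts for it.\<close>
  have lt_i: "k' \<in> {i0..<i}" if "k' \<in> {i0..<l}" "e k' \<le> e h" for k' using 1[of k'] that by force
  have bh: "(\<forall>c. best' (a h) = Suc c \<longrightarrow> best0 (a h) = Suc c \<or> (\<exists>k'\<in>{i0..<l}. a k' = c \<and> e k' \<le> e h)) \<and>
      (\<forall>k'\<in>{i0..<l}. e k' \<le> e h \<longrightarrow> (\<exists>c. best' (a h) = Suc c \<and> xs (a k') \<le> xs c)) \<and>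
      (\<forall>c. best0 (a h) = Suc c \<longrightarrow> (\<exists>c'. best' (a h) = Suc c' \<and> xs c \<le> xs c'))"
  proof (cases cur)
    case 0
    then have "i = i0" using cur by simp
    then have "\<not> e k' \<le> e h" if "k' \<in> {i0..<l}" for k' using lt_i[OF that] by auto
    then show ?thesis using 0 b0 by (simp add: best'_def)
  next
    case (Suc c)
    then have c: "c \<in> a ` {i0..<i}" "\<And>k. k \<in> {i0..<i} \<Longrightarrow> xs (a k) \<le> xs c" using cur(2) by auto
    then obtain kc where kc: "kc \<in> {i0..<i}" "c = a kc" by blast
    have kc': "kc \<in> {i0..<l}" "e kc \<le> e h" using kc le_i b by auto
    show ?thesis
    proof (cases "best (a h) = 0 \<or> xs (best (a h) - 1) < xs c")
      case True
      then have "best' (a h) = Suc c" using Suc by (simp add: best'_def)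
      then show ?thesis using c(2) lt_i kc kc' True b0 by auto
    next
      case False
      then obtain d where d: "best (a h) = Suc d" "xs c \<le> xs d" by (cases "best (a h)") auto
      have "best' (a h) = Suc d" using False Suc d by (simp add: best'_def)
      moreover have "xs (a k') \<le> xs d" if "k' \<in> {i0..<l}" "e k' \<le> e h" for k'
        using c(2)[OF lt_i[OF that]] d(2) by linarith
      ultimately show ?thesis using d b0 by auto
    qed
  qed
  have ins: "{p..<Suc op} = insert op {p..<op}" "{l..<Suc h} = insert h {l..<h}" using b by auto
  have F1': "\<forall>x\<in>{p..<Suc op}. (\<forall>k\<in>{i..<l}. (eb(op := e h)) x \<le> e k) \<and> (\<forall>k\<in>{Suc h..<l3}. (eb(op := e h)) x \<le> e k)"
    unfolding ins using F1 less_imp_le[OF 1] 2 by simp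
  have F2': "\<forall>k'\<in>{i0..<i}. \<forall>k\<in>{Suc h..<l3}. e k' \<le> e k" using F2 by simp
  have F3': "\<forall>k\<in>{l..<Suc h}. \<forall>k'\<in>{i..<l}. e k < e k'" unfolding ins using F3 1 by simp
  have F4': "\<forall>q. q \<notin> a ` {l..<Suc h} \<longrightarrow> best' q = best0 q" unfolding ins using F4 by (simp add: best'_def)
  have F5': "\<forall>k\<in>{l..<Suc h}. (\<forall>c. best' (a k) = Suc c \<longrightarrow> best0 (a k) = Suc c \<or> (\<exists>k'\<in>{i0..<l}. a k' = c \<and> e k' \<le> e k)) \<and>
      (\<forall>k'\<in>{i0..<l}. e k' \<le> e k \<longrightarrow> (\<exists>c. best' (a k) = Suc c \<and> xs (a k') \<le> xs c)) \<and>
      (\<forall>c. best0 (a k) = Suc c \<longrightarrow> (\<exists>c'. best' (a k) = Suc c' \<and> xs c \<le> xs c'))"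
    unfolding ins ball_simps(7) using bh F5 same by (simp only: simp_thms cong: ball_cong)
  have F6': "mset (map (wb(op := a h)) [p..<Suc op]) = mset (map a [i0..<i]) + mset (map a [l..<Suc h])"
      "mset (map (\<lambda>k. ((wb(op := a h)) k, (eb(op := e h)) k)) [p..<Suc op]) =
       mset (map (\<lambda>k. (a k, e k)) [i0..<i]) + mset (map (\<lambda>k. (a k, e k)) [l..<Suc h])"
    using F6(1,2) unfolding 3 eqs map_append map_upd_upt mset_append by simp_all
  have le: "l \<le> Suc h" "Suc h \<le> l3" "Suc op = p + (i - i0) + (Suc h - l)" using b t(1) F6(4) by auto
  show ?thesis unfolding MI_def
    by (intro conjI; fact le b F6' so' F1' F2' F3' F4' F5' F7)
qed

end


context msort_state begin
lemma MI_D: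
  assumes M: "MI i h op cur best wb eb"
  shows "i0 \<le> i" "i \<le> l" "l \<le> h" "h \<le> l3" "op = p + (i - i0) + (h - l)"
    "mset (map wb [p..<op]) = mset (map a [i0..<i]) + mset (map a [l..<h])"
    "mset (map (\<lambda>k. (wb k, eb k)) [p..<op]) = mset (map (\<lambda>k. (a k, e k)) [i0..<i]) + mset (map (\<lambda>k. (a k, e k)) [l..<h])"
    "sorted (map eb [p..<op])"
    "\<forall>q. q \<notin> a ` {l..<h} \<longrightarrow> best q = best0 q"
    "\<forall>k\<in>{l..<h}. (\<forall>c. best (a k) = Suc c \<longrightarrow> best0 (a k) = Suc c \<or> (\<exists>k'\<in>{i0..<l}. a k' = c \<and> e k' \<le> e k)) \<and>
      (\<forall>k'\<in>{i0..<l}. e k' \<le> e k \<longrightarrow> (\<exists>c. best (a k) = Suc c \<and> xs (a k') \<le> xs c)) \<and>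
      (\<forall>c. best0 (a k) = Suc c \<longrightarrow> (\<exists>c'. best (a k) = Suc c' \<and> xs c \<le> xs c'))"
  using M unfolding MI_def by - (elim conjE, assumption)+
end


text \<open>\<open>best q\<close> is maximal in \<open>xs\<close> among the sites that precede
  \<open>q\<close> in \<open>G\<close> and have key at most that of \<open>q\<close>; the list
  \<open>G\<close> keeps the order before sorting.\<close>

definition bok :: "(nat \<Rightarrow> nat) \<Rightarrow> (nat \<Rightarrow> real) \<Rightarrow> (nat \<Rightarrow> real) \<Rightarrow> nat list \<Rightarrow> bool" where
  "bok best key xs G \<longleftrightarrow> (\<forall>q\<in>set G. \<forall>p. best q = Suc p \<longrightarrow> before G p q \<and> key p \<le> key q) \<and>
    (\<forall>p q. before G p q \<longrightarrow> key p \<le> key q \<longrightarrow> (\<exists>p'. best q = Suc p' \<and> xs p \<le> xs p'))"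

text \<open>\<open>G\<close> is the block in its original order, \<open>X\<close> the same block
  sorted by key.\<close>

definition msrel :: "(nat \<Rightarrow> real) \<Rightarrow> (nat \<Rightarrow> real) \<Rightarrow> nat \<Rightarrow> store \<Rightarrow> nat list \<Rightarrow> item list \<Rightarrow> bool" where
  "msrel key xs n s G X \<longleftrightarrow> set G \<subseteq> {..<n} \<and> sorted (map (snd \<circ> snd) X) \<and> mset (map fst X) = mset G \<and>
     (\<forall>x\<in>set X. snd (snd x) = key (fst x)) \<and> bok (nmem s ''best'') key xs G"

definition kms :: nat where
  "kms = tmax (setn ''cur'' (NConst 0)) + kw (Or (NLess (V ''i'') (V ''l2'')) (NLess (V ''h'') (V ''l3''))) ms_body"

lemma bok_cong: "(\<And>q. q \<in> set G \<Longrightarrow> best' q = best q) \<Longrightarrow> bok best key xs G \<Longrightarrow> bok best' key xs G"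
  unfolding bok_def using before_set by metis

lemma run_ms:
  assumes n: "n \<le> B" and X: "rmem s ''X'' = xs"
    and st: "nmem s ''i'' 0 = i0" "nmem s ''h'' 0 = l" "nmem s ''l2'' 0 = l" "nmem s ''l3'' 0 = l3"
       "nmem s ''op'' 0 = p" and le: "i0 \<le> l" "l \<le> l3" "l3 \<le> B"
    and r1: "msrel key xs n s G1 (segA s i0 l)" and r2: "msrel key xs n s G2 (segA s l l3)"
    and dis: "distinct (G1 @ G2)" and pB: "p + 2 * length (G1 @ G2) \<le> B"
  shows "run B ms s (kms * Suc (l3 - i0)) (\<lambda>s'. rmem s' ''X'' = xs \<and> p \<le> nmem s' ''op'' 0 \<and>
       msrel key xs n s' (G1 @ G2) (segB s' p (nmem s' ''op'' 0)) \<and>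
       (\<forall>l u. u \<le> p \<longrightarrow> segB s' l u = segB s l u) \<and>
       (\<forall>l' u. u \<le> i0 \<or> l3 \<le> l' \<longrightarrow> segA s' l' u = segA s l' u) \<and>
       (\<forall>G X. set G \<inter> set (G1 @ G2) = {} \<longrightarrow> msrel key xs n s G X \<longrightarrow> msrel key xs n s' G X))"
proof -
  let ?a = "nmem s ''wA''" and ?e = "rmem s ''eA''"
  have m1: "mset (map ?a [i0..<l]) = mset G1" and m2: "mset (map ?a [l..<l3]) = mset G2"
    using r1 r2 by (simp_all add: msrel_def segA_def comp_def)
  have S1: "?a ` {i0..<l} = set G1" using arg_cong[OF m1, of set_mset] by simp
  have S2: "?a ` {l..<l3} = set G2" using arg_cong[OF m2, of set_mset] by simp
  have d2: "distinct (map ?a [l..<l3])" using dis m2 by (metis distinct_append mset_eq_imp_distinct_iff)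
  have ek: "?e k = key (?a k)" if "k \<in> {i0..<l3}" for k
  proof (cases "k < l")
    case True then show ?thesis using r1 that by (auto simp: msrel_def segA_def)
  next
    case False then show ?thesis using r2 that by (auto simp: msrel_def segA_def)
  qed
  have an: "?a k < n" if "k \<in> {i0..<l3}" for k
  proof (cases "k < l")
    case True then show ?thesis using r1 that S1 by (auto simp: msrel_def)
  next
    case False then show ?thesis using r2 that S2 by (auto simp: msrel_def)
  qed
  have len: "length G1 = l - i0" "length G2 = l3 - l" using arg_cong[OF m1, of size] arg_cong[OF m2, of size] by auto
  interpret msort_state ?a ?e xs i0 l l3 p "nmem s ''best''"
  proof
    have "sorted (map ?e [i0..<l])" using r1 by (simp add: msrel_def segA_def comp_def)
    then show "?e k \<le> ?e k'" if "i0 \<le> k" "k \<le> k'" "k' < l" for k k'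
      using sorted_nth_mono[of "map ?e [i0..<l]" "k - i0" "k' - i0"] that by simp
    have "sorted (map ?e [l..<l3])" using r2 by (simp add: msrel_def segA_def comp_def)
    then show "?e k \<le> ?e k'" if "l \<le> k" "k \<le> k'" "k' < l3" for k k'
      using sorted_nth_mono[of "map ?e [l..<l3]" "k - l" "k' - l"] that by simp
    show "inj_on ?a {l..<l3}" using d2 by (simp add: distinct_map)
  qed (use le in auto)
  define Inv where "Inv = (\<lambda>s' :: store. MI (nmem s' ''i'' 0) (nmem s' ''h'' 0) (nmem s' ''op'' 0) (nmem s' ''cur'' 0) (nmem s' ''best'')
     (nmem s' ''wB'') (rmem s' ''eB'') \<and> (\<forall>k<p. nmem s' ''wB'' k = nmem s ''wB'' k \<and> rmem s' ''eB'' k = rmem s ''eB'' k) \<and>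
     rmem s' ''bB'' = rmem s ''bB'')"
  let ?c = "Or (NLess (V ''i'') (V ''l2'')) (NLess (V ''h'') (V ''l3''))"
  let ?s = "fex (setn ''cur'' (NConst 0)) s"
  show ?thesis unfolding ms_def
  proof (rule run_lf_seq[OF _ _ run_while_lf[where I = Inv and \<psi> = "\<lambda>s'. (l - nmem s' ''i'' 0) + (l3 - nmem s' ''h'' 0)"
     and T = "kw ?c ms_body * Suc (l3 - i0)"]], goal_cases)
    case 3
    then show ?case using MI_init st le by (auto simp: Inv_def)
  next
    case (5 s')
    have u: "nmem s' ''wA'' = ?a" "rmem s' ''eA'' = ?e" "rmem s' ''X'' = xs" "nmem s' ''l2'' 0 = l" "nmem s' ''l3'' 0 = l3"
      using 5(3) st X by (simp_all add: unch_def ms_body_def ms_left_def ms_right_def)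
    define i where "i = nmem s' ''i'' 0"
    define h where "h = nmem s' ''h'' 0"
    define op where "op = nmem s' ''op'' 0"
    define cur where "cur = nmem s' ''cur'' 0"
    have I: "MI i h op cur (nmem s' ''best'') (nmem s' ''wB'') (rmem s' ''eB'')"
      and fr: "\<forall>k<p. nmem s' ''wB'' k = nmem s ''wB'' k \<and> rmem s' ''eB'' k = rmem s ''eB'' k" "rmem s' ''bB'' = rmem s ''bB''"
      using 5(2) by (auto simp: Inv_def i_def h_def op_def cur_def)
    have b: "i0 \<le> i" "i \<le> l" "l \<le> h" "h \<le> l3" "p \<le> op" "op = p + (i - i0) + (h - l)" using MI_D(1-5)[OF I] by auto
    have c: "i < l \<or> h < l3" using 5(5) u by (auto simp: i_def h_def)
    have opB: "Suc op \<le> B" using b c pB len le by auto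
    show ?case
    proof (cases "i < l \<and> \<not> (h < l3 \<and> ?e h < ?e i)")
      case True
      then have t: "bval ms_take s'" using u by (simp add: ms_take_def i_def h_def)
      have aB: "Suc (?a i) \<le> B" "?a i \<le> B" using an[of i] True b n le by auto
      show ?thesis using True MI_left[OF I] t u fr b opB aB le 
        by (auto simp: Inv_def ms_body_def ms_left_def i_def[symmetric] h_def[symmetric] op_def[symmetric] cur_def[symmetric])
    next
      case False
      then have h: "h < l3" "i < l \<Longrightarrow> ?e h < ?e i" using c by auto
      have t: "\<not> bval ms_take s'" using False u by (auto simp: ms_take_def i_def h_def)
      have aB: "?a h \<le> B" using an[of h] h b n by auto
      have cB: "cur \<le> B" using 5(4) by (simp add: cur_def nbnd_def)
      show ?thesis using h MI_right[OF I h] t u fr b opB aB le cB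
        by (auto simp: Inv_def ms_body_def ms_right_def i_def[symmetric] h_def[symmetric] op_def[symmetric] cur_def[symmetric])
    qed
  next
    case (6 s')
    have u: "nmem s' ''wA'' = ?a" "rmem s' ''eA'' = ?e" "rmem s' ''X'' = xs" "nmem s' ''l2'' 0 = l" "nmem s' ''l3'' 0 = l3" "rmem s' ''bA'' = rmem s ''bA''"
      using 6(3) st X by (simp_all add: unch_def ms_body_def ms_left_def ms_right_def)
    have il: "nmem s' ''i'' 0 = l" "nmem s' ''h'' 0 = l3" using MI_D(1-4)[of "nmem s' ''i'' 0" "nmem s' ''h'' 0"] 6(2,5) u by (auto simp: Inv_def)
    define op where "op = nmem s' ''op'' 0"
    define best where "best = nmem s' ''best''"
    define cur where "cur = nmem s' ''cur'' 0"
    let ?wb = "nmem s' ''wB''" and ?eb = "rmem s' ''eB''"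
    have M: "MI l l3 op cur best ?wb ?eb" using 6(2) il by (simp add: Inv_def op_def best_def cur_def)
    have b: "bok (nmem s ''best'') key xs G1" "bok (nmem s ''best'') key xs G2" using r1 r2 by (auto simp: msrel_def)
    have bs: "best q = nmem s ''best'' q" if "q \<notin> set G2" for q using MI_D(9)[OF M] that S2 by simp
    have bk: "(\<forall>c. best q = Suc c \<longrightarrow> nmem s ''best'' q = Suc c \<or> (c \<in> set G1 \<and> key c \<le> key q)) \<and>
      (\<forall>c'\<in>set G1. key c' \<le> key q \<longrightarrow> (\<exists>c. best q = Suc c \<and> xs c' \<le> xs c)) \<and>
      (\<forall>c. nmem s ''best'' q = Suc c \<longrightarrow> (\<exists>c'. best q = Suc c' \<and> xs c \<le> xs c'))" if q: "q \<in> set G2" for q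
    proof -
      obtain k where k: "q = ?a k" "k \<in> {l..<l3}" using q S2 by blast
      have kq: "?e k = key q" using ek[of k] k le by simp
      have *: "(\<forall>c. best q = Suc c \<longrightarrow> nmem s ''best'' q = Suc c \<or> (\<exists>k'\<in>{i0..<l}. ?a k' = c \<and> ?e k' \<le> ?e k)) \<and>
      (\<forall>k'\<in>{i0..<l}. ?e k' \<le> ?e k \<longrightarrow> (\<exists>c. best q = Suc c \<and> xs (?a k') \<le> xs c)) \<and>
      (\<forall>c. nmem s ''best'' q = Suc c \<longrightarrow> (\<exists>c'. best q = Suc c' \<and> xs c \<le> xs c'))"
        using MI_D(10)[OF M] k by simp
      have ek': "?e k' = key (?a k')" if "k' \<in> {i0..<l}" for k' using ek that le by simp
      show ?thesis unfolding S1[symmetric] using * ek' kq by fastforce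
    qed
    have bokF: "bok best key xs (G1 @ G2)" unfolding bok_def
    proof (intro conjI ballI allI impI)
      fix q p assume q: "q \<in> set (G1 @ G2)" and bq: "best q = Suc p"
      show "before (G1 @ G2) p q" "key p \<le> key q"
      proof -
        have "before (G1 @ G2) p q \<and> key p \<le> key q"
        proof (cases "q \<in> set G2")
          case False
          then show ?thesis using bq bs[OF False] b(1) q by (auto simp: bok_def before_append)
        next
          case True
          then consider "nmem s ''best'' q = Suc p" | "p \<in> set G1" "key p \<le> key q" using bk bq by blast
          then show ?thesis using b(2) True by cases (auto simp: bok_def before_append)
        qed
        then show "before (G1 @ G2) p q" "key p \<le> key q" by auto
      qed
    next
      fix p q assume bf: "before (G1 @ G2) p q" and k: "key p \<le> key q"
      from bf consider "before G1 p q" | "before G2 p q" | "p \<in> set G1" "q \<in> set G2" by (auto simp: before_append)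
      then show "\<exists>p'. best q = Suc p' \<and> xs p \<le> xs p'"
      proof cases
        case 1
        then have "q \<notin> set G2" using before_set[OF 1] dis by auto
        then show ?thesis using 1 b(1) k bs by (simp add: bok_def)
      next
        case 2
        then obtain c where "nmem s ''best'' q = Suc c" "xs p \<le> xs c" using 2 b(2) k unfolding bok_def by blast
        moreover have "q \<in> set G2" using before_set[OF 2] by simp
        ultimately obtain c' where "best q = Suc c'" "xs c \<le> xs c'" using bk by blast
        then show ?thesis using \<open>xs p \<le> xs c\<close> by auto
      next
        case 3 then show ?thesis using bk[OF 3(2)] k by blast
      qed
    qed
    have mp: "mset (map (\<lambda>k. (?wb k, ?eb k)) [p..<op]) = mset (map (\<lambda>k. (?a k, ?e k)) [i0..<l]) + mset (map (\<lambda>k. (?a k, ?e k)) [l..<l3])"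
      by (rule MI_D(7)[OF M])
    have mw: "mset (map ?wb [p..<op]) = mset G1 + mset G2" using MI_D(6)[OF M] m1 m2 by simp
    have keyF: "?eb x = key (?wb x)" if x: "x \<in> {p..<op}" for x
    proof -
      have "(?wb x, ?eb x) \<in># mset (map (\<lambda>k. (?wb k, ?eb k)) [p..<op])" using x by auto
      then have "(?wb x, ?eb x) \<in> (\<lambda>k. (?a k, ?e k)) ` {i0..<l3}" unfolding mp using le by auto
      then show ?thesis using ek by auto
    qed
    have sF: "sorted (map ?eb [p..<op])" by (rule MI_D(8)[OF M])
    have relF: "msrel key xs n s' (G1 @ G2) (segB s' p op)"
      using r1 r2 sF keyF bokF mw by (auto simp: msrel_def segB_def comp_def best_def)
    have fr: "segB s' l' u = segB s l' u" if "u \<le> p" for l' u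
      using that 6(2) by (auto simp: Inv_def segB_def)
    have frA: "segA s' = segA s" using u by (simp add: segA_def fun_eq_iff)
    have oth: "msrel key xs n s' G X" if "set G \<inter> set (G1 @ G2) = {}" "msrel key xs n s G X" for G X
    proof -
      have "bok best key xs G"
        by (rule bok_cong[of G _ "nmem s ''best''"]) (use that bs in \<open>auto simp: msrel_def\<close>)
      then show ?thesis using that by (simp add: msrel_def best_def)
    qed
    show ?case using relF fr frA oth u MI_D(5)[OF M] by (simp add: op_def[symmetric])
  next
    case 7 then show ?case using st le by simp
  next
    case 8
    have "tmax (setn ''cur'' (NConst 0)) * 1 \<le> tmax (setn ''cur'' (NConst 0)) * Suc (l3 - i0)" by (rule mult_le_mono2) simp
    then show ?case unfolding kms_def add_mult_distrib by simp
  qed (auto simp: ms_body_def ms_left_def ms_right_def)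
qed

lemma dcl_ms: "n \<le> B \<Longrightarrow> dcl ms B kms (msrel key xs n) (\<lambda>s. rmem s ''X'' = xs)"
proof (unfold_locales, goal_cases)
  case 1 then show ?case by (simp add: ms_def ms_body_def ms_left_def ms_right_def)
next
  case (2 s) then show ?case by (simp add: msrel_def bok_def before_def)
next
  case (3 s G X)
  then have "size (mset (map fst X)) = size (mset G)" by (simp add: msrel_def)
  then show ?case by simp
next
  case (4 s s') then show ?case by (simp add: eqout_def dcr_def)
next
  case (5 s G X s')
  then have "nmem s' ''best'' = nmem s ''best''" by (simp add: eqout_def dcn_def)
  then show ?case using 5 by (simp add: msrel_def)
next
  case (6 s i l l3 p G1 G2) then show ?case by (intro run_ms) auto
qed

section \<open>Envelopes of circular arcs\<close>

text \<open>Every position either is the first occurrence of its letter or comes right after a last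
  occurrence. Otherwise an earlier copy of its letter, its predecessor, the position itself and a
  later copy of the predecessor would form the forbidden pattern abab.\<close>

lemma davenport_schinzel:
  assumes ne: "\<And>i. Suc i < length ws \<Longrightarrow> ws ! i \<noteq> ws ! Suc i"
    and no: "\<And>i j k m. i < j \<Longrightarrow> j < k \<Longrightarrow> k < m \<Longrightarrow> m < length ws \<Longrightarrow> ws ! i = ws ! k \<Longrightarrow> ws ! j = ws ! m \<Longrightarrow> ws ! i = ws ! j"
  shows "length ws \<le> 2 * card (set ws)"
proof -
  define F where "F = {i. i < length ws \<and> (\<forall>j<i. ws ! j \<noteq> ws ! i)}"
  define L where "L = {i. i < length ws \<and> (\<forall>j<length ws. i < j \<longrightarrow> ws ! j \<noteq> ws ! i)}"
  have inj: "inj_on ((!) ws) F" "inj_on ((!) ws) L"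
    unfolding inj_on_def F_def L_def by (metis (mono_tags, lifting) linorder_neqE_nat mem_Collect_eq)+
  have fin: "finite F" "finite L" by (auto simp: F_def L_def)
  have "card F \<le> card (set ws)" "card L \<le> card (set ws)"
    by (rule card_inj_on_le[OF inj(1)] card_inj_on_le[OF inj(2)]; auto simp: F_def L_def)+
  moreover have "{..<length ws} \<subseteq> F \<union> Suc ` L"
  proof
    fix i assume i: "i \<in> {..<length ws}"
    show "i \<in> F \<union> Suc ` L"
    proof (rule ccontr)
      assume n: "i \<notin> F \<union> Suc ` L"
      then obtain j where j: "j < i" "ws ! j = ws ! i" using i by (auto simp: F_def)
      then obtain i' where i': "i = Suc i'" by (cases i) auto
      then have "i' \<notin> L" using n by auto
      then obtain m where m: "m < length ws" "i' < m" "ws ! m = ws ! i'" using i i' by (auto simp: L_def)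
      have "ws ! i' \<noteq> ws ! i" using ne[of i'] i i' by auto
      moreover have "m \<noteq> i" using m calculation by auto
      moreover have "j \<noteq> i'" using j calculation by auto
      ultimately show False using no[of j i' i m] j m i' by auto
    qed
  qed
  then have "length ws \<le> card (F \<union> Suc ` L)" using card_mono[of "F \<union> Suc ` L" "{..<length ws}"] fin by simp
  ultimately show ?thesis using card_Un_le[of F "Suc ` L"] card_image_le[OF fin(2), of Suc] by linarith
qed

section \<open>Crossings of two arcs\<close>

text \<open>The ordinates where the circles about \<open>p\<close> and \<open>q\<close> meet, by the
  formula for the radical line; \<open>\<sigma> = 1\<close> or \<open>-1\<close> selects the point.
  If the circles do not meet, the value is not a crossing, but as a cut between pieces it does no
  harm.\<close>

definition root1 :: "(nat \<Rightarrow> real) \<Rightarrow> (nat \<Rightarrow> real) \<Rightarrow> (nat \<Rightarrow> real) \<Rightarrow> real \<Rightarrow> nat \<Rightarrow> nat \<Rightarrow> real" where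
  "root1 X Y \<rho> \<sigma> p q = (let dx = X q - X p; dy = Y q - Y p; d2 = dx * dx + dy * dy; K = \<rho> p * \<rho> p - \<rho> q * \<rho> q + d2
    in Y p + (dy * K / 2 + \<sigma> * (dx * sqrt (d2 * (\<rho> p * \<rho> p) - K * K / 4))) / d2)"

text \<open>By \<open>dom\<close> every disc reaches across the whole strip from \<open>lo\<close>
  to \<open>hi\<close> of its cell. So the right boundaries of the discs of one cell are functions
  on one common interval, and any two of them cross there at most twice.\<close>

locale arcs =
  fixes X Y \<rho> :: "nat \<Rightarrow> real" and cid :: "nat \<Rightarrow> nat" and lo hi :: "nat \<Rightarrow> real" and U :: "nat set"
  assumes lohi: "w \<in> U \<Longrightarrow> lo (cid w) < hi (cid w)"
    and dom: "w \<in> U \<Longrightarrow> lo (cid w) \<le> y \<Longrightarrow> y \<le> hi (cid w) \<Longrightarrow> \<bar>y - Y w\<bar> < \<rho> w"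
    and dist: "v \<in> U \<Longrightarrow> w \<in> U \<Longrightarrow> X v = X w \<Longrightarrow> Y v = Y w \<Longrightarrow> v = w"
begin

definition f :: "nat \<Rightarrow> real \<Rightarrow> real" where
  "f w y = X w + sqrt (\<rho> w * \<rho> w - (y - Y w) * (y - Y w))"

text \<open>Subtracting the two circle equations fixes the inner product of \<open>(u, v)\<close>
  with \<open>(dx, dy)\<close>, and the circle itself then fixes the square of their determinant.
  The two signs of the determinant give the two roots.\<close>

lemma f_root:
  assumes p: "p \<in> U" and q: "q \<in> U" and c: "cid p = cid q" and pq: "p \<noteq> q"
    and y: "lo (cid p) \<le> y" "y \<le> hi (cid p)" and eq: "f p y = f q y"
  shows "y = root1 X Y \<rho> 1 p q \<or> y = root1 X Y \<rho> (-1) p q"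
proof -
  define dx dy where "dx = X q - X p" and "dy = Y q - Y p"
  define d2 where "d2 = dx * dx + dy * dy"
  define K where "K = \<rho> p * \<rho> p - \<rho> q * \<rho> q + d2"
  define u v where "u = f p y - X p" and "v = y - Y p"
  have sq: "(f w y - X w) * (f w y - X w) + (y - Y w) * (y - Y w) = \<rho> w * \<rho> w" if "w \<in> U" "cid w = cid p" for w
  proof -
    have "\<bar>y - Y w\<bar> < \<rho> w" using dom[of w y] that y by simp
    then have "(y - Y w) * (y - Y w) \<le> \<rho> w * \<rho> w" using abs_le_square_iff[of "y - Y w" "\<rho> w"] by (simp add: power2_eq_square)
    then show ?thesis by (simp add: f_def)
  qed
  have 1: "u * u + v * v = \<rho> p * \<rho> p" using sq[OF p] by (simp add: u_def v_def)
  have 2: "(u - dx) * (u - dx) + (v - dy) * (v - dy) = \<rho> q * \<rho> q" using sq[OF q] c eq by (simp add: u_def v_def dx_def dy_def)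
  have d2: "d2 > 0"
  proof -
    have "dx \<noteq> 0 \<or> dy \<noteq> 0" using dist[OF p q] pq by (auto simp: dx_def dy_def)
    then show ?thesis using sum_squares_gt_zero_iff[of dx dy] by (simp add: d2_def)
  qed
  have 3: "2 * (dx * u + dy * v) = K" using 1 2 by (simp add: K_def d2_def algebra_simps)
  \<comment> \<open>Lagrange's identity for \<open>(u, v)\<close> and
    \<open>(dx, dy)\<close>.\<close>
  have 4: "(v * dx - u * dy) * (v * dx - u * dy) = d2 * (\<rho> p * \<rho> p) - K * K / 4"
    unfolding 1[symmetric] 3[symmetric] by (simp add: d2_def field_simps)
  \<comment> \<open>Resolves \<open>(u, v)\<close> along \<open>(dx, dy)\<close> and along its
    normal.\<close>
  have 5: "v * d2 = dy * K / 2 + dx * (v * dx - u * dy)" unfolding 3[symmetric] by (simp add: d2_def algebra_simps)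
  have 6: "sqrt (d2 * (\<rho> p * \<rho> p) - K * K / 4) = \<bar>v * dx - u * dy\<bar>" unfolding 4[symmetric] by (rule real_sqrt_abs2)
  have "v = (dy * K / 2 + dx * (v * dx - u * dy)) / d2" using 5 d2 by (simp add: field_simps)
  then have yv: "y = Y p + (dy * K / 2 + dx * (v * dx - u * dy)) / d2" by (simp add: v_def)
  have r: "root1 X Y \<rho> \<sigma> p q = Y p + (dy * K / 2 + \<sigma> * (dx * \<bar>v * dx - u * dy\<bar>)) / d2" for \<sigma>
    unfolding root1_def Let_def dx_def[symmetric] dy_def[symmetric] d2_def[symmetric] K_def[symmetric] 6 ..
  show ?thesis
  proof (cases "v * dx - u * dy \<ge> 0")
    case True
    then have "y = root1 X Y \<rho> 1 p q" unfolding r using yv by simp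
    then show ?thesis ..
  next
    case False
    then have "- 1 * (dx * \<bar>v * dx - u * dy\<bar>) = dx * (v * dx - u * dy)" by (simp add: abs_if algebra_simps)
    then have "y = root1 X Y \<rho> (-1) p q" unfolding r using yv by (simp only:)
    then show ?thesis ..
  qed
qed

lemma f_cont: "w \<in> U \<Longrightarrow> continuous_on {lo (cid w)..hi (cid w)} (f w)"
  unfolding f_def by (intro continuous_intros)

lemma f_ivt:
  assumes "p \<in> U" "q \<in> U" "cid p = cid q" "lo (cid p) \<le> a" "a < b" "b \<le> hi (cid p)"
    and "(f p a - f q a) * (f p b - f q b) < 0"
  shows "\<exists>y. a < y \<and> y < b \<and> f p y = f q y"
proof -
  have c: "continuous_on {a..b} (\<lambda>y. f p y - f q y)"
    using f_cont[of p] f_cont[of q] assms by (intro continuous_on_diff; auto intro: continuous_on_subset)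
  have "\<exists>y. a \<le> y \<and> y \<le> b \<and> f p y - f q y = 0"
  proof (cases "f p a - f q a < 0")
    case True
    then have "f p b - f q b > 0" using assms(7) by (simp add: mult_less_0_iff)
    then show ?thesis using IVT'[OF _ _ _ c, of 0] True assms by auto
  next
    case False
    then have "f p a - f q a > 0" "f p b - f q b < 0" using assms(7) by (auto simp: mult_less_0_iff)
    then show ?thesis using IVT2'[OF _ _ _ c, of 0] assms by auto
  qed
  then obtain y where y: "a \<le> y" "y \<le> b" "f p y = f q y" by auto
  then have "y \<noteq> a" "y \<noteq> b" using assms(7) by auto
  then show ?thesis using y by (intro exI[of _ y]) auto
qed

text \<open>A violation at \<open>y\<close> and the comparison at the midpoint would have opposite
  signs and force a crossing strictly between the two.\<close>

lemma f_no_root_le: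
  assumes U: "p \<in> U" "q \<in> U" "cid p = cid q" and ab: "lo (cid p) \<le> a" "b \<le> hi (cid p)"
    and nr: "\<And>z. p \<noteq> q \<Longrightarrow> a < z \<Longrightarrow> z < b \<Longrightarrow> f p z \<noteq> f q z"
    and mid: "a < b" "f q ((a + b) / 2) \<le> f p ((a + b) / 2)" and y: "a \<le> y" "y \<le> b"
  shows "f q y \<le> f p y"
proof (rule ccontr)
  assume n: "\<not> f q y \<le> f p y"
  then have pq: "p \<noteq> q" by auto
  define m where "m = (a + b) / 2"
  have m: "a < m" "m < b" using mid by (auto simp: m_def)
  have "f p m \<noteq> f q m" using nr pq m by blast
  then have mlt: "f q m < f p m" using mid(2) unfolding m_def[symmetric] by linarith
  have "y \<noteq> m" using n mlt by auto
  then consider "y < m" | "m < y" by linarith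
  then show False
  proof cases
    case 1
    then obtain z where "y < z" "z < m" "f p z = f q z"
      using f_ivt[OF U, of y m] n mlt y ab m by (auto simp: mult_neg_pos)
    then show False using nr[OF pq, of z] y m by auto
  next
    case 2
    then obtain z where "m < z" "z < y" "f p z = f q z"
      using f_ivt[OF U, of m y] n mlt y ab m by (auto simp: mult_pos_neg)
    then show False using nr[OF pq, of z] y m by auto
  qed
qed

section \<open>Envelopes as lists of pieces\<close>

definition cells :: "item list \<Rightarrow> nat set" where "cells xs = cid ` fst ` set xs"

lemma cells_simps [simp]: "cells [] = {}" "cells (x # xs) = insert (cid (fst x)) (cells xs)"
  by (auto simp: cells_def)

definition piece :: "nat list \<Rightarrow> item \<Rightarrow> bool" where
  "piece G it \<longleftrightarrow> (case it of (w, b, e) \<Rightarrow> w \<in> set G \<and> lo (cid w) \<le> b \<and> b < e \<and> e \<le> hi (cid w) \<and>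
     (\<forall>y p. b \<le> y \<longrightarrow> y \<le> e \<longrightarrow> p \<in> set G \<longrightarrow> cid p = cid w \<longrightarrow> f p y \<le> f w y))"

definition adj :: "item \<Rightarrow> item \<Rightarrow> bool" where
  "adj x y \<longleftrightarrow> (case x of (w, b, e) \<Rightarrow> case y of (w', b', e') \<Rightarrow> w \<noteq> w' \<and>
     (cid w = cid w' \<and> e = b' \<or> cid w < cid w' \<and> e = hi (cid w) \<and> b' = lo (cid w')))"

definition atend :: "item list \<Rightarrow> bool" where
  "atend xs \<longleftrightarrow> (xs \<noteq> [] \<longrightarrow> (case last xs of (w, b, e) \<Rightarrow> e = hi (cid w)))"

text \<open>The upper envelopes of all cells are strung together in one list by increasing cell
  number, so a single divide and conquer serves all cells of a level at once.\<close>

definition env :: "nat list \<Rightarrow> item list \<Rightarrow> bool" where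
  "env G xs \<longleftrightarrow> set G \<subseteq> U \<and> (\<forall>it\<in>set xs. piece G it) \<and> successively adj xs \<and> atend xs \<and>
     (\<forall>w b e xs'. xs = (w, b, e) # xs' \<longrightarrow> b = lo (cid w)) \<and> cid ` set G \<subseteq> cells xs"

lemma adj_sorted:
  assumes "successively adj xs" "\<forall>(w, b, e)\<in>set xs. b < e"
  shows "sorted_wrt (\<lambda>(w, b, e) (w', b', e'). cid w < cid w' \<or> cid w = cid w' \<and> e \<le> b') xs"
  using assms
proof (induction xs rule: induct_list012)
  case (3 x y zs)
  obtain w b e w' b' e' where xy: "x = (w, b, e)" "y = (w', b', e')" by (metis prod_cases3)
  have IH: "sorted_wrt (\<lambda>(w, b, e) (w', b', e'). cid w < cid w' \<or> cid w = cid w' \<and> e \<le> b') (y # zs)" using 3 by auto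
  have "case z of (w'', b'', e'') \<Rightarrow> cid w < cid w'' \<or> cid w = cid w'' \<and> e \<le> b''" if "z \<in> set zs" for z
  proof -
    obtain w'' b'' e'' where z: "z = (w'', b'', e'')" by (metis prod_cases3)
    have "cid w' < cid w'' \<or> cid w' = cid w'' \<and> e' \<le> b''" using IH that by (auto simp: xy z)
    then show ?thesis using 3(3,4) by (auto simp: xy z adj_def)
  qed
  then show ?case using IH 3(3) by (auto simp: xy adj_def)
qed auto

text \<open>Two different arcs agree in at most two points, whereas an interval is infinite.\<close>

lemma piece_strict:
  assumes "a \<in> U" "c \<in> U" "cid a = cid c" "a \<noteq> c" "lo (cid a) \<le> b" "b < e" "e \<le> hi (cid a)"
    and "\<And>y. b \<le> y \<Longrightarrow> y \<le> e \<Longrightarrow> f c y \<le> f a y"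
  shows "\<exists>y. b < y \<and> y < e \<and> f c y < f a y"
proof (rule ccontr)
  assume "\<not> ?thesis"
  then have "f a y = f c y" if "b < y" "y < e" for y using assms(8)[of y] that by force
  then have "y \<in> {root1 X Y \<rho> 1 a c, root1 X Y \<rho> (-1) a c}" if "b < y" "y < e" for y
    using f_root[OF assms(1-4), of y] assms(5-7) that by simp
  then have "{b<..<e} \<subseteq> {root1 X Y \<rho> 1 a c, root1 X Y \<rho> (-1) a c}"
    by (intro subsetI) (simp only: greaterThanLessThan_iff)
  then have "finite {b<..<e}" by (rule finite_subset) simp
  then show False using infinite_Ioo[OF assms(6)] by blast
qed

text \<open>If two sites alternated as abab, their arcs would change order three times and cross
  three times, which \<open>f_root\<close> forbids. So the sites of the pieces form a
  Davenport-Schinzel sequence of order two.\<close>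

lemma pieces_length:
  assumes GU: "set G \<subseteq> U" and pcs: "\<forall>it\<in>set xs. piece G it" and suc: "successively adj xs"
  shows "length xs \<le> 2 * length G"
proof -
  let ?ws = "map fst xs"
  have pc: "piece G (xs ! i)" if "i < length xs" for i using pcs that by auto
  have so: "sorted_wrt (\<lambda>(w, b, e) (w', b', e'). cid w < cid w' \<or> cid w = cid w' \<and> e \<le> b') xs"
    by (rule adj_sorted[OF suc]) (use pcs in \<open>auto simp: piece_def\<close>)
  have so: "cid (fst (xs ! i)) < cid (fst (xs ! j)) \<or> cid (fst (xs ! i)) = cid (fst (xs ! j)) \<and> snd (snd (xs ! i)) \<le> fst (snd (xs ! j))"
    if "i < j" "j < length xs" for i j
    using sorted_wrt_nth_less[OF so that] by (simp add: case_prod_unfold)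
  have "length ?ws \<le> 2 * card (set ?ws)"
  proof (rule davenport_schinzel)
    fix i assume i: "Suc i < length ?ws"
    have "adj (xs ! i) (xs ! Suc i)" using suc i by (auto simp: successively_conv_nth)
    then show "?ws ! i \<noteq> ?ws ! Suc i" using i by (auto simp: adj_def case_prod_unfold)
  next
    fix i j k m assume ijk: "i < j" "j < k" "k < m" "m < length ?ws" "?ws ! i = ?ws ! k" "?ws ! j = ?ws ! m"
    show "?ws ! i = ?ws ! j"
    proof (rule ccontr)
      assume ne: "?ws ! i \<noteq> ?ws ! j"
      define a c where "a = fst (xs ! i)" and "c = fst (xs ! j)"
      have w: "fst (xs ! i) = a" "fst (xs ! j) = c" "fst (xs ! k) = a" "fst (xs ! m) = c" "a \<noteq> c"
        using ijk ne by (auto simp: a_def c_def)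
      \<comment> \<open>Cell numbers are monotone along the list, so an occurrence of
        \<open>c\<close> between two of \<open>a\<close> lies in the same cell.\<close>
      have ci: "cid a = cid c" using so[of i j] so[of j k] ijk w by auto
      obtain b1 e1 where x1: "xs ! i = (a, b1, e1)" using w by (metis prod.collapse)
      obtain b2 e2 where x2: "xs ! j = (c, b2, e2)" using w by (metis prod.collapse)
      obtain b3 e3 where x3: "xs ! k = (a, b3, e3)" using w by (metis prod.collapse)
      obtain b4 e4 where x4: "xs ! m = (c, b4, e4)" using w by (metis prod.collapse)
      have P: "piece G (a, b1, e1)" "piece G (c, b2, e2)" "piece G (a, b3, e3)" "piece G (c, b4, e4)"
        using pc[of i] pc[of j] pc[of k] pc[of m] ijk x1 x2 x3 x4 by auto
      have aU: "a \<in> U" "c \<in> U" using P GU by (auto simp: piece_def)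
      have or: "e1 \<le> b2" "e2 \<le> b3" "e3 \<le> b4" using so[of i j] so[of j k] so[of k m] ijk x1 x2 x3 x4 ci by auto
      obtain y1 where y1: "b1 < y1" "y1 < e1" "f c y1 < f a y1" using piece_strict[of a c b1 e1] P aU ci w by (auto simp: piece_def)
      obtain y2 where y2: "b2 < y2" "y2 < e2" "f a y2 < f c y2" using piece_strict[of c a b2 e2] P aU ci w by (auto simp: piece_def)
      obtain y3 where y3: "b3 < y3" "y3 < e3" "f c y3 < f a y3" using piece_strict[of a c b3 e3] P aU ci w by (auto simp: piece_def)
      obtain y4 where y4: "b4 < y4" "y4 < e4" "f a y4 < f c y4" using piece_strict[of c a b4 e4] P aU ci w by (auto simp: piece_def)
      have rg: "lo (cid a) \<le> b1" "e4 \<le> hi (cid a)" using P ci by (auto simp: piece_def)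
      obtain z1 where z1: "y1 < z1" "z1 < y2" "f a z1 = f c z1"
        using f_ivt[OF aU ci, of y1 y2] y1 y2 y3 y4 or rg by (auto simp: mult_pos_neg)
      obtain z2 where z2: "y2 < z2" "z2 < y3" "f a z2 = f c z2"
        using f_ivt[OF aU ci, of y2 y3] y1 y2 y3 y4 or rg by (auto simp: mult_neg_pos)
      obtain z3 where z3: "y3 < z3" "z3 < y4" "f a z3 = f c z3"
        using f_ivt[OF aU ci, of y3 y4] y1 y2 y3 y4 or rg by (auto simp: mult_pos_neg)
      have rt: "z \<in> {root1 X Y \<rho> 1 a c, root1 X Y \<rho> (-1) a c}" if "y1 < z" "z < y4" "f a z = f c z" for z
        using f_root[OF aU ci w(5), of z] that y1 y4 rg by simp
      have "z1 \<in> {root1 X Y \<rho> 1 a c, root1 X Y \<rho> (-1) a c}" "z2 \<in> {root1 X Y \<rho> 1 a c, root1 X Y \<rho> (-1) a c}"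
        "z3 \<in> {root1 X Y \<rho> 1 a c, root1 X Y \<rho> (-1) a c}"
        using rt[of z1] rt[of z2] rt[of z3] z1 z2 z3 y1 y2 y3 y4 or by auto
      then show False using z1 z2 z3 by auto
    qed
  qed
  also have "card (set ?ws) \<le> card (set G)" using pcs by (intro card_mono) (auto simp: piece_def)
  also have "card (set G) \<le> length G" by (rule card_length)
  finally show ?thesis by simp
qed

lemma env_length: "env G xs \<Longrightarrow> length xs \<le> 2 * length G"
  by (rule pieces_length) (auto simp: env_def)

section \<open>Merging two envelopes, one elementary interval at a time\<close>

definition push :: "item list \<Rightarrow> item \<Rightarrow> item list" where
  "push xs it = (if xs \<noteq> [] \<and> fst (last xs) = fst it then butlast xs @ [(fst it, fst (snd (last xs)), snd (snd it))] else xs @ [it])"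

text \<open>The end of the elementary interval that starts at \<open>b\<close>. Cutting at the
  candidate crossings as well as at the piece ends makes the order of the two arcs constant up to
  there.\<close>

definition ovend :: "real \<Rightarrow> nat \<Rightarrow> nat \<Rightarrow> real \<Rightarrow> real \<Rightarrow> real" where
  "ovend b p q e1 e2 = (let e = if e2 < e1 then e2 else e1; r = root1 X Y \<rho> 1 p q; r' = root1 X Y \<rho> (-1) p q;
     e = (if b < r \<and> r < e then r else e) in if b < r' \<and> r' < e then r' else e)"

lemma ovend:
  assumes "b < e1" "b < e2"
  shows "b < ovend b p q e1 e2" "ovend b p q e1 e2 \<le> e1" "ovend b p q e1 e2 \<le> e2"
    "\<sigma> \<in> {1, -1} \<Longrightarrow> \<not> (b < root1 X Y \<rho> \<sigma> p q \<and> root1 X Y \<rho> \<sigma> p q < ovend b p q e1 e2)"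
    "ovend b p q e1 e2 < e1 \<Longrightarrow> ovend b p q e1 e2 < e2 \<Longrightarrow> ovend b p q e1 e2 \<in> {root1 X Y \<rho> 1 p q, root1 X Y \<rho> (-1) p q}"
  using assms by (auto simp: ovend_def Let_def split: if_splits)

definition win :: "real \<Rightarrow> real \<Rightarrow> nat \<Rightarrow> nat \<Rightarrow> nat" where
  "win b e p q = (if f p ((b + e) / 2) < f q ((b + e) / 2) then q else p)"

text \<open>The condition under which a piece of \<open>p\<close> starting at \<open>b\<close>
  continues \<open>zs\<close> without a gap.\<close>

definition jn :: "item list \<Rightarrow> nat \<Rightarrow> real \<Rightarrow> bool" where
  "jn zs p b \<longleftrightarrow> (if zs = [] then b = lo (cid p) else (case last zs of (w, b', e') \<Rightarrow>
     cid w = cid p \<and> e' = b \<or> cid w < cid p \<and> e' = hi (cid w) \<and> b = lo (cid p)))"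

definition okO :: "nat list \<Rightarrow> item list \<Rightarrow> bool" where
  "okO G zs \<longleftrightarrow> (\<forall>it\<in>set zs. piece G it) \<and> successively adj zs \<and>
     (\<forall>w b e zs'. zs = (w, b, e) # zs' \<longrightarrow> b = lo (cid w))"

lemma push_ok:
  assumes O: "okO G zs" and it: "piece G (w, b, e)" and j: "jn zs w b"
  shows "okO G (push zs (w, b, e))" "last (push zs (w, b, e)) = (w, b', e') \<Longrightarrow> e' = e" 
    "fst (last (push zs (w, b, e))) = w" "snd (snd (last (push zs (w, b, e)))) = e" "push zs (w, b, e) \<noteq> []"
    "cells (push zs (w, b, e)) = insert (cid w) (cells zs)"
proof -
  show 2: "fst (last (push zs (w, b, e))) = w" "snd (snd (last (push zs (w, b, e)))) = e" "push zs (w, b, e) \<noteq> []"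
    by (auto simp: push_def)
  then show "last (push zs (w, b, e)) = (w, b', e') \<Longrightarrow> e' = e" by auto
  show "cells (push zs (w, b, e)) = insert (cid w) (cells zs)"
  proof (cases "zs \<noteq> [] \<and> fst (last zs) = w")
    case True
    then obtain ys y where "zs = ys @ [y]" "fst y = w" by (metis append_butlast_last_id)
    then show ?thesis by (auto simp: push_def cells_def)
  next
    case False then show ?thesis by (auto simp: push_def cells_def)
  qed
  show "okO G (push zs (w, b, e))"
  proof (cases "zs \<noteq> [] \<and> fst (last zs) = w")
    case True
    then obtain ys b0 e0 where zs: "zs = ys @ [(w, b0, e0)]" by (metis append_butlast_last_id prod.collapse)
    have p: "push zs (w, b, e) = ys @ [(w, b0, e)]" by (simp add: push_def zs)
    \<comment> \<open>The last piece has the same site, hence the same cell, which leaves only the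
      abutting case of \<open>jn\<close>.\<close>
    have e0: "e0 = b" using j by (simp add: jn_def zs)
    have p0: "piece G (w, b0, e0)" using O by (simp add: okO_def zs)
    have "piece G (w, b0, e)" unfolding piece_def
    proof (clarsimp, intro conjI allI impI)
      fix y p assume y: "b0 \<le> y" "y \<le> e" and pG: "p \<in> set G" "cid p = cid w"
      show "f p y \<le> f w y"
      proof (cases "y \<le> b")
        case True then show ?thesis using p0 e0 y pG by (auto simp: piece_def)
      next
        case False then show ?thesis using it y pG by (auto simp: piece_def)
      qed
    qed (use it p0 e0 in \<open>auto simp: piece_def\<close>)
    moreover have "successively adj (ys @ [(w, b0, e)])"
      using O by (auto simp: okO_def zs successively_append_iff adj_def case_prod_unfold)
    moreover have "b1 = lo (cid w1)" if "ys @ [(w, b0, e)] = (w1, b1, e1) # zs'" for w1 b1 e1 zs'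
    proof (cases ys)
      case Nil then show ?thesis using that O by (auto simp: okO_def zs)
    next
      case (Cons a list) then show ?thesis using that O by (cases a) (auto simp: okO_def zs)
    qed
    ultimately show ?thesis using O unfolding p by (auto simp: okO_def zs)
  next
    case False
    then have p: "push zs (w, b, e) = zs @ [(w, b, e)]" by (auto simp: push_def)
    have "successively adj (zs @ [(w, b, e)])"
      using O j False by (auto simp: okO_def successively_append_iff adj_def case_prod_unfold jn_def)
    moreover have "b1 = lo (cid w1)" if "zs @ [(w, b, e)] = (w1, b1, e1) # zs'" for w1 b1 e1 zs'
    proof (cases zs)
      case Nil then show ?thesis using that j by (auto simp: jn_def)
    next
      case (Cons a list) then show ?thesis using that O by (cases a) (auto simp: okO_def)
    qed
    ultimately show ?thesis using O it unfolding p by (auto simp: okO_def)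
  qed
qed

definition rest :: "nat list \<Rightarrow> item list \<Rightarrow> bool" where
  "rest G xs \<longleftrightarrow> (\<forall>it\<in>set xs. piece G it) \<and> successively adj xs \<and> atend xs"

text \<open>The head of a list continues the output directly, except when the other list must first
  finish a smaller cell; then it starts its own cell.\<close>

definition nx :: "item list \<Rightarrow> item list \<Rightarrow> item list \<Rightarrow> bool" where
  "nx xs ys zs \<longleftrightarrow> (\<forall>p b e xs'. xs = (p, b, e) # xs' \<longrightarrow>
     (if ys = [] \<or> cid p \<le> cid (fst (hd ys)) then jn zs p b else b = lo (cid p)))"

text \<open>A site whose cell has left its own list lies in a smaller cell than any still unread in
  the other list. So a piece copied from one list alone cannot be beaten by a forgotten
  site.\<close>

definition cov :: "nat list \<Rightarrow> item list \<Rightarrow> item list \<Rightarrow> bool" where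
  "cov G xs ys \<longleftrightarrow> (\<forall>g\<in>set G. cid g \<in> cells xs \<or> (\<forall>c\<in>cells ys. cid g < c))"

definition ME :: "nat list \<Rightarrow> nat list \<Rightarrow> item list \<Rightarrow> item list \<Rightarrow> item list \<Rightarrow> bool" where
  "ME G1 G2 xs ys zs \<longleftrightarrow> set (G1 @ G2) \<subseteq> U \<and> rest G1 xs \<and> rest G2 ys \<and> okO (G1 @ G2) zs \<and> nx xs ys zs \<and> nx ys xs zs \<and>
    cov G1 xs ys \<and> cov G2 ys xs \<and> (xs = [] \<and> ys = [] \<longrightarrow> atend zs) \<and>
    cid ` set (G1 @ G2) \<subseteq> cells xs \<union> cells ys \<union> cells zs"

lemma okO_cong: "set G = set H \<Longrightarrow> okO G zs = okO H zs"
  by (simp add: okO_def piece_def)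

lemma ME_sym: "ME G1 G2 xs ys zs \<Longrightarrow> ME G2 G1 ys xs zs"
  unfolding ME_def using okO_cong[of "G1 @ G2" "G2 @ G1" zs] by (auto simp: Un_commute)

lemma env_nx: "env G2 ys \<Longrightarrow> nx ys xs []"
  by (auto simp: nx_def env_def jn_def)

lemma ME_init: assumes "env G1 xs" "env G2 ys" shows "ME G1 G2 xs ys []"
proof -
  have "okO (G1 @ G2) []" "atend []" by (auto simp: okO_def atend_def)
  moreover have "cov G1 xs ys" "cov G2 ys xs" using assms by (auto simp: env_def cov_def)
  moreover have "rest G1 xs" "rest G2 ys" "set (G1 @ G2) \<subseteq> U" using assms by (auto simp: env_def rest_def)
  moreover have "cid ` set (G1 @ G2) \<subseteq> cells xs \<union> cells ys \<union> cells []" using assms by (auto simp: env_def)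
  ultimately show ?thesis unfolding ME_def using env_nx[OF assms(1)] env_nx[OF assms(2)] by simp
qed

lemma ME_fin: "ME G1 G2 [] [] zs \<Longrightarrow> env (G1 @ G2) zs"
  unfolding ME_def env_def okO_def by simp

lemma rest_hd: "rest G (x # xs) \<Longrightarrow> rest G xs"
  by (cases xs) (auto simp: rest_def atend_def)

lemma rest_sorted:
  assumes "rest G ((w, b, e) # xs)" "c \<in> cells xs" shows "cid w \<le> c"
proof -
  obtain it where it: "it \<in> set xs" "c = cid (fst it)" using assms(2) by (auto simp: cells_def)
  have "sorted_wrt (\<lambda>(w, b, e) (w', b', e'). cid w < cid w' \<or> cid w = cid w' \<and> e \<le> b') ((w, b, e) # xs)"
    by (rule adj_sorted) (use assms(1) in \<open>auto simp: rest_def piece_def\<close>)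
  then show ?thesis using it by (cases it) auto
qed

lemma rest_next:
  assumes "rest G ((w, b, e) # xs)"
  shows "xs = [] \<and> e = hi (cid w) \<or> (\<exists>w' e' xs'. xs = (w', e, e') # xs' \<and> cid w' = cid w \<and> e < hi (cid w)) \<or>
    (\<exists>w' e' xs'. xs = (w', lo (cid w'), e') # xs' \<and> cid w < cid w' \<and> e = hi (cid w) \<and> (\<forall>c\<in>cells xs. cid w < c))"
proof (cases xs)
  case Nil then show ?thesis using assms by (auto simp: rest_def atend_def)
next
  case (Cons x xs')
  obtain w' b' e' where x: "x = (w', b', e')" by (metis prod_cases3)
  have a: "adj (w, b, e) (w', b', e')" using assms by (simp add: rest_def Cons x)
  have p: "piece G (w', b', e')" using assms by (simp add: rest_def Cons x)
  have s: "cid w' \<le> c" if "c \<in> cells xs'" for c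
    using rest_sorted[of G w' b' e' xs'] rest_hd[OF assms] that by (simp add: Cons x)
  show ?thesis
  proof (cases "cid w = cid w'")
    case True then show ?thesis using a p by (auto simp: adj_def Cons x piece_def)
  next
    case False
    then have 1: "cid w < cid w'" "e = hi (cid w)" "b' = lo (cid w')" using a by (auto simp: adj_def)
    moreover have "\<forall>c\<in>cells xs. cid w < c" using s 1(1) by (fastforce simp: Cons x)
    ultimately show ?thesis by (simp add: Cons x)
  qed
qed

text \<open>If the cell of the head comes before all cells left in the other list,
  \<open>cov\<close> shows that no site of the other group lies in this cell, so the piece is
  unchallenged.\<close>

lemma ME_copy:
  assumes M: "ME G1 G2 ((w, b, e) # xs) ys zs" and c: "ys = [] \<or> cid w < cid (fst (hd ys))"
  shows "ME G1 G2 xs ys (push zs (w, b, e))"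
proof -
  have M': "set (G1 @ G2) \<subseteq> U" "rest G1 ((w, b, e) # xs)" "rest G2 ys" "okO (G1 @ G2) zs" "nx ((w, b, e) # xs) ys zs"
    "nx ys ((w, b, e) # xs) zs" "cov G1 ((w, b, e) # xs) ys" "cov G2 ys ((w, b, e) # xs)"
    "cid ` set (G1 @ G2) \<subseteq> cells ((w, b, e) # xs) \<union> cells ys \<union> cells zs"
    using M unfolding ME_def by - (elim conjE, assumption)+
  have gt: "cid w < c'" if "c' \<in> cells ys" for c'
  proof (cases ys)
    case Nil then show ?thesis using that by simp
  next
    case (Cons y ys')
    obtain q b' e' where y: "y = (q, b', e')" by (metis prod_cases3)
    have "cid w < cid q" using c by (simp add: Cons y)
    moreover have "cid q \<le> c'" using that rest_sorted[of G2 q b' e' ys' c'] M'(3) by (auto simp: Cons y)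
    ultimately show ?thesis by simp
  qed
  have n2: "cid g \<noteq> cid w" if "g \<in> set G2" for g
    using M'(8) that gt unfolding cov_def by fastforce
  have pc: "piece (G1 @ G2) (w, b, e)"
    using M'(2) n2 by (auto simp: rest_def piece_def)
  have j: "jn zs w b" using M'(5) c by (auto simp: nx_def)
  note P = push_ok[OF M'(4) pc j]
  let ?zs = "push zs (w, b, e)"
  obtain b0 where l: "last ?zs = (w, b0, e)" using P(3,4) by (metis prod.collapse)
  have jz: "jn ?zs p b' \<longleftrightarrow> cid w = cid p \<and> e = b' \<or> cid w < cid p \<and> e = hi (cid w) \<and> b' = lo (cid p)" for p b'
    using P(5) l by (simp add: jn_def)
  note nxt = rest_next[OF M'(2)]
  have nx1: "nx xs ys ?zs" using nxt c by (auto simp: nx_def jz)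
  have nx2: "nx ys xs ?zs"
  proof -
    have "if xs = [] \<or> cid q \<le> cid (fst (hd xs)) then jn ?zs q b' else b' = lo (cid q)" if "ys = (q, b', e') # ys'" for q b' e' ys'
    proof -
      have lt: "cid w < cid q" using c that by simp
      then have "b' = lo (cid q)" using M'(6) that by (auto simp: nx_def)
      then show ?thesis using nxt lt by (auto simp: jz)
    qed
    then show ?thesis unfolding nx_def by blast
  qed
  have c1: "cov G1 xs ys" using M'(7) gt by (auto simp: cov_def)
  have c2: "cov G2 ys xs" using M'(8) by (auto simp: cov_def)
  have at: "atend ?zs" if "xs = []" using nxt that l by (simp add: atend_def)
  have ce: "cid ` set (G1 @ G2) \<subseteq> cells xs \<union> cells ys \<union> cells ?zs" using M'(9) P(6) by auto
  show ?thesis unfolding ME_def using M'(1,3) rest_hd[OF M'(2)] P(1) nx1 nx2 c1 c2 at ce by simp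
qed

lemma trim_next:
  assumes r: "rest G ((w, b, e1) # xs)" and e: "b < e" "e \<le> e1"
  defines "xs' \<equiv> (if e < e1 then (w, e, e1) # xs else xs)"
  shows "rest G xs'" "cells xs' \<subseteq> cells ((w, b, e1) # xs)" "cells xs \<subseteq> cells xs'"
    "e = hi (cid w) \<Longrightarrow> xs' = [] \<or> (\<exists>w' e' xs''. xs' = (w', lo (cid w'), e') # xs'' \<and> cid w < cid w' \<and> (\<forall>c\<in>cells xs'. cid w < c))"
    "e \<noteq> hi (cid w) \<Longrightarrow> \<exists>w' e' xs''. xs' = (w', e, e') # xs'' \<and> cid w' = cid w"
proof -
  have p: "piece G (w, b, e1)" using r by (simp add: rest_def)
  have e1: "e1 \<le> hi (cid w)" using p by (simp add: piece_def)
  show "rest G xs'"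
  proof (cases "e < e1")
    case True
    have "piece G (w, e, e1)" using p e True by (auto simp: piece_def)
    then have "rest G ((w, e, e1) # xs)" using r
      by (cases xs) (auto simp: rest_def adj_def atend_def)
    then show ?thesis using True by (simp add: xs'_def)
  next
    case False then show ?thesis using rest_hd[OF r] by (simp add: xs'_def)
  qed
  show "cells xs' \<subseteq> cells ((w, b, e1) # xs)" "cells xs \<subseteq> cells xs'" by (auto simp: xs'_def)
  note nxt = rest_next[OF r]
  show "xs' = [] \<or> (\<exists>w' e' xs''. xs' = (w', lo (cid w'), e') # xs'' \<and> cid w < cid w' \<and> (\<forall>c\<in>cells xs'. cid w < c))" if "e = hi (cid w)"
    using that e e1 nxt by (auto simp: xs'_def)
  show "\<exists>w' e' xs''. xs' = (w', e, e') # xs'' \<and> cid w' = cid w" if "e \<noteq> hi (cid w)"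
    using that e e1 nxt by (auto simp: xs'_def)
qed

text \<open>Both heads continue the same output end, so they start together. No crossing lies inside
  the elementary interval; the winner at its midpoint therefore dominates both heads on all of it
  and, since each head dominates its own group, all sites of the cell.\<close>

lemma ME_over:
  assumes M: "ME G1 G2 ((p, b, e1) # xs) ((q, b', e2) # ys) zs" and c: "cid p = cid q"
  defines "e \<equiv> ovend b p q e1 e2"
  defines "xs' \<equiv> (if e < e1 then (p, e, e1) # xs else xs)"
  defines "ys' \<equiv> (if e < e2 then (q, e, e2) # ys else ys)"
  shows "b' = b" "ME G1 G2 xs' ys' (push zs (win b e p q, b, e))"
proof -
  have M': "set (G1 @ G2) \<subseteq> U" "rest G1 ((p, b, e1) # xs)" "rest G2 ((q, b', e2) # ys)" "okO (G1 @ G2) zs"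
    "nx ((p, b, e1) # xs) ((q, b', e2) # ys) zs"
    "nx ((q, b', e2) # ys) ((p, b, e1) # xs) zs" "cov G1 ((p, b, e1) # xs) ((q, b', e2) # ys)" "cov G2 ((q, b', e2) # ys) ((p, b, e1) # xs)"
    "cid ` set (G1 @ G2) \<subseteq> cells ((p, b, e1) # xs) \<union> cells ((q, b', e2) # ys) \<union> cells zs"
    using M unfolding ME_def by - (elim conjE, assumption)+
  have jp: "jn zs p b" "jn zs q b'" using M'(5,6) c by (auto simp: nx_def)
  show bb: "b' = b" using jp c by (auto simp: jn_def split: if_splits prod.splits)
  have pc: "piece G1 (p, b, e1)" "piece G2 (q, b, e2)" using M'(2,3) bb by (auto simp: rest_def)
  have lt: "b < e1" "b < e2" using pc by (auto simp: piece_def)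
  note ov = ovend[OF lt, where p = p and q = q, folded e_def]
  have pU: "p \<in> U" "q \<in> U" using pc M'(1) by (auto simp: piece_def)
  have rg: "lo (cid p) \<le> b" "e \<le> hi (cid p)" using pc ov by (auto simp: piece_def)
  have nr: "f p z \<noteq> f q z" if "p \<noteq> q" "b < z" "z < e" for z
    using f_root[OF pU c that(1), of z] that ov(4)[where \<sigma> = 1] ov(4)[where \<sigma> = "-1"] rg by auto
  define w where "w = win b e p q"
  have wc: "cid w = cid p" using c by (simp add: w_def win_def)
  have w12: "f p y \<le> f w y" "f q y \<le> f w y" if y: "b \<le> y" "y \<le> e" for y
  proof -
    have "f p y \<le> f w y \<and> f q y \<le> f w y"
    proof (cases "f p ((b + e) / 2) < f q ((b + e) / 2)")
      case True
      have "f p y \<le> f q y"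
        by (rule f_no_root_le[OF pU(2,1) c[symmetric]]) (use rg c nr ov(1) True y in \<open>auto simp: eq_commute[of "f q _"]\<close>)
      then show ?thesis using True by (simp add: w_def win_def)
    next
      case False
      have "f q y \<le> f p y"
        by (rule f_no_root_le[OF pU c]) (use rg nr ov(1) False y in auto)
      then show ?thesis using False by (simp add: w_def win_def)
    qed
    then show "f p y \<le> f w y" "f q y \<le> f w y" by auto
  qed
  have wG: "w \<in> set G1 \<or> w \<in> set G2" using pc by (auto simp: w_def win_def piece_def)
  have wm: "f g y \<le> f w y" if y: "b \<le> y" "y \<le> e" and g: "g \<in> set G1 \<or> g \<in> set G2" "cid g = cid w" for g y
    using g(1)
  proof
    assume "g \<in> set G1"
    then have "f g y \<le> f p y" using pc(1) y ov g(2) wc by (auto simp: piece_def)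
    then show ?thesis using w12[OF y] by linarith
  next
    assume "g \<in> set G2"
    then have "f g y \<le> f q y" using pc(2) y ov g(2) wc c by (auto simp: piece_def)
    then show ?thesis using w12[OF y] by linarith
  qed
  have pw: "piece (G1 @ G2) (w, b, e)"
    using wG wm rg ov(1) wc by (simp add: piece_def)
  have jw: "jn zs w b" using jp(1) wc by (simp add: jn_def)
  define Z where "Z = push zs (w, b, e)"
  note P = push_ok[OF M'(4) pw jw, folded Z_def]
  obtain b0 where l: "last Z = (w, b0, e)" using P(3,4) by (metis prod.collapse)
  have jz: "jn Z v b' \<longleftrightarrow> cid w = cid v \<and> e = b' \<or> cid w < cid v \<and> e = hi (cid w) \<and> b' = lo (cid v)" for v b'
    using P(5) l by (simp add: jn_def)
  note T1 = trim_next[OF M'(2) ov(1,2), folded xs'_def]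
  note T2 = trim_next[OF M'(3)[unfolded bb] ov(1,3), folded ys'_def]
  have nx: "nx xs' ys' Z" "nx ys' xs' Z" "cov G1 xs' ys'" "cov G2 ys' xs'" "xs' = [] \<longrightarrow> atend Z"
  proof -
    have "nx xs' ys' Z \<and> nx ys' xs' Z \<and> cov G1 xs' ys' \<and> cov G2 ys' xs' \<and> (xs' = [] \<longrightarrow> atend Z)"
    proof (cases "e = hi (cid p)")
      case True
      have s: "xs' = [] \<or> (\<exists>w' e' xs''. xs' = (w', lo (cid w'), e') # xs'' \<and> cid p < cid w' \<and> (\<forall>c\<in>cells xs'. cid p < c))"
        "ys' = [] \<or> (\<exists>w' e' xs''. ys' = (w', lo (cid w'), e') # xs'' \<and> cid p < cid w' \<and> (\<forall>c\<in>cells ys'. cid p < c))"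
        using T1(4) T2(4) True c by auto
      have "nx xs' ys' Z" using s(1) True wc by (auto simp: nx_def jz)
      moreover have "nx ys' xs' Z" using s(2) True wc by (auto simp: nx_def jz)
      moreover have "cid p < c'" if "c' \<in> cells xs' \<or> c' \<in> cells ys'" for c' using s that by auto
      then have "cov G1 xs' ys' \<and> cov G2 ys' xs'" using M'(7,8) T1(2,3) T2(2,3) c unfolding cov_def by fastforce
      moreover have "atend Z" using l True wc by (simp add: atend_def)
      ultimately show ?thesis by blast
    next
      case False
      obtain w1 e1' r1 where x: "xs' = (w1, e, e1') # r1" "cid w1 = cid p" using T1(5) False by blast
      obtain w2 e2' r2 where y: "ys' = (w2, e, e2') # r2" "cid w2 = cid p" using T2(5) False c by metis
      have "cov G1 xs' ys' \<and> cov G2 ys' xs'" using M'(7,8) T1(2,3) T2(2,3) x y c unfolding cov_def by fastforce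
      then show ?thesis using x y wc by (auto simp: nx_def jz)
    qed
    then show "nx xs' ys' Z" "nx ys' xs' Z" "cov G1 xs' ys'" "cov G2 ys' xs'" "xs' = [] \<longrightarrow> atend Z" by blast+
  qed
  have ce: "cid ` set (G1 @ G2) \<subseteq> cells xs' \<union> cells ys' \<union> cells Z"
    using M'(9) P(6) T1(3) T2(3) wc c by auto
  show "ME G1 G2 xs' ys' (push zs (win b e p q, b, e))"
    unfolding ME_def w_def[symmetric] Z_def[symmetric] using M'(1) T1(1) T2(1) P(1) nx ce by simp
qed

end

section \<open>Merging two envelopes\<close>

text \<open>The test against \<open>op0\<close> keeps a new piece from being fused with the last
  piece of the preceding block.\<close>

definition me_push :: com where
  "me_push = If (And (NLess (V ''op0'') (V ''op'')) (NEq (NRead ''wB'' (NSub (V ''op'') (NConst 1))) (V ''w'')))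
     (RAssign ''eB'' (NSub (V ''op'') (NConst 1)) (RV ''ee''))
     (NAssign ''wB'' (V ''op'') (V ''w'');; RAssign ''bB'' (V ''op'') (RV ''bb'');; RAssign ''eB'' (V ''op'') (RV ''ee'');; inc ''op'')"

definition me_root :: "rat \<Rightarrow> com" where
  "me_root \<sigma> = (setr ''rt'' (RAdd (RRead ''Y'' (V ''p'')) (RDiv (RAdd (RDiv (RMul (RV ''dy'') (RV ''K'')) (RConst 2))
      (RMul (RConst \<sigma>) (RMul (RV ''dx'') (RV ''sq'')))) (RV ''d2'')));;
    If (And (RLess (RV ''bb'') (RV ''rt'')) (RLess (RV ''rt'') (RV ''ee''))) (setr ''ee'' (RV ''rt'')) Skip)"

definition rf :: "name \<Rightarrow> rexp" where
  "rf p = RAdd (RRead ''X'' (V p)) (RSqrt (RSub (RMul (RRead ''ro'' (V p)) (RRead ''ro'' (V p)))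
     (RMul (RSub (RV ''md'') (RRead ''Y'' (V p))) (RSub (RV ''md'') (RRead ''Y'' (V p))))))"

definition me_prep1 :: com where
  "me_prep1 = (setn ''p'' (NRead ''wA'' (V ''i''));; setn ''q'' (NRead ''wA'' (V ''h''));; setr ''bb'' (RRead ''bA'' (V ''i''));;
     setr ''dx'' (RSub (RRead ''X'' (V ''q'')) (RRead ''X'' (V ''p'')));;
     setr ''dy'' (RSub (RRead ''Y'' (V ''q'')) (RRead ''Y'' (V ''p'')));;
     setr ''d2'' (RAdd (RMul (RV ''dx'') (RV ''dx'')) (RMul (RV ''dy'') (RV ''dy'')));;
     setr ''K'' (RAdd (RSub (RMul (RRead ''ro'' (V ''p'')) (RRead ''ro'' (V ''p''))) (RMul (RRead ''ro'' (V ''q'')) (RRead ''ro'' (V ''q'')))) (RV ''d2''));;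
     setr ''sq'' (RSqrt (RSub (RMul (RV ''d2'') (RMul (RRead ''ro'' (V ''p'')) (RRead ''ro'' (V ''p'')))) (RDiv (RMul (RV ''K'') (RV ''K'')) (RConst 4))));;
     If (RLess (RRead ''eA'' (V ''h'')) (RRead ''eA'' (V ''i''))) (setr ''ee'' (RRead ''eA'' (V ''h''))) (setr ''ee'' (RRead ''eA'' (V ''i''))))"

definition me_prep2 :: com where
  "me_prep2 = (setr ''md'' (RDiv (RAdd (RV ''bb'') (RV ''ee'')) (RConst 2));;
     If (RLess (rf ''p'') (rf ''q'')) (setn ''w'' (V ''q'')) (setn ''w'' (V ''p'')))"

definition me_prep :: com where
  "me_prep = (me_prep1;; me_root 1;; me_root (-1);; me_prep2)"

lemma fex_unch: "unch c s (fex c s)"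
  by (induction c arbitrary: s) (auto simp: unch_def)

definition me_adv :: "name \<Rightarrow> com" where
  "me_adv i = If (RLess (RV ''ee'') (RRead ''eA'' (V i))) (RAssign ''bA'' (V i) (RV ''ee'')) (inc i)"

definition me_copy :: "name \<Rightarrow> com" where
  "me_copy i = (setn ''w'' (NRead ''wA'' (V i));; setr ''bb'' (RRead ''bA'' (V i));; setr ''ee'' (RRead ''eA'' (V i));; me_push;; inc i)"

definition me_body :: com where
  "me_body = If (And (And (NLess (V ''i'') (V ''l2'')) (NLess (V ''h'') (V ''l3'')))
        (NEq (NRead ''cid'' (NRead ''wA'' (V ''i''))) (NRead ''cid'' (NRead ''wA'' (V ''h'')))))
     (me_prep;; me_push;; me_adv ''i'';; me_adv ''h'')
     (If (And (NLess (V ''i'') (V ''l2'')) (Or (Not (NLess (V ''h'') (V ''l3'')))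
        (NLess (NRead ''cid'' (NRead ''wA'' (V ''i''))) (NRead ''cid'' (NRead ''wA'' (V ''h''))))))
       (me_copy ''i'') (me_copy ''h''))"

definition me :: com where
  "me = While (Or (NLess (V ''i'') (V ''l2'')) (NLess (V ''h'') (V ''l3''))) me_body"

lemma segB_snoc: "p \<le> op \<Longrightarrow> segB s p (Suc op) = segB s p op @ [(nmem s ''wB'' op, rmem s ''bB'' op, rmem s ''eB'' op)]"
  by (simp add: segB_def)

lemma segA_Cons: "i < l \<Longrightarrow> segA s i l = (nmem s ''wA'' i, rmem s ''bA'' i, rmem s ''eA'' i) # segA s (Suc i) l"
  by (simp add: segA_def upt_conv_Cons)

lemma segA_Nil: "l \<le> i \<Longrightarrow> segA s i l = []"
  by (simp add: segA_def)

lemma segB_cong: "(\<And>k. l \<le> k \<Longrightarrow> k < u \<Longrightarrow> nmem s' ''wB'' k = nmem s ''wB'' k \<and> rmem s' ''bB'' k = rmem s ''bB'' k \<and> rmem s' ''eB'' k = rmem s ''eB'' k)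
  \<Longrightarrow> segB s' l u = segB s l u"
  by (simp add: segB_def)

lemma segA_cong: "(\<And>k. l \<le> k \<Longrightarrow> k < u \<Longrightarrow> nmem s' ''wA'' k = nmem s ''wA'' k \<and> rmem s' ''bA'' k = rmem s ''bA'' k \<and> rmem s' ''eA'' k = rmem s ''eA'' k)
  \<Longrightarrow> segA s' l u = segA s l u"
  by (simp add: segA_def)

context arcs begin

lemma fex_push:
  assumes "nmem s ''op0'' 0 = p" "p \<le> nmem s ''op'' 0"
  defines "s' \<equiv> fex me_push s"
  shows "segB s' p (nmem s' ''op'' 0) = push (segB s p (nmem s ''op'' 0)) (nmem s ''w'' 0, rmem s ''bb'' 0, rmem s ''ee'' 0)"
    "p \<le> nmem s' ''op'' 0" "\<And>l u. u \<le> p \<Longrightarrow> segB s' l u = segB s l u"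
    "nmem s' ''op'' 0 \<le> B \<Longrightarrow> nmem s ''w'' 0 \<le> B \<Longrightarrow> okw B me_push s"
    "unch me_push s s'" "lf me_push"
proof -
  let ?op = "nmem s ''op'' 0"
  show "lf me_push" by (simp add: me_push_def)
  show "unch me_push s s'" unfolding s'_def by (rule fex_unch)
  have "segB s' p (nmem s' ''op'' 0) = push (segB s p ?op) (nmem s ''w'' 0, rmem s ''bb'' 0, rmem s ''ee'' 0) \<and> p \<le> nmem s' ''op'' 0 \<and>
    (\<forall>l u. u \<le> p \<longrightarrow> segB s' l u = segB s l u) \<and> (nmem s' ''op'' 0 \<le> B \<longrightarrow> nmem s ''w'' 0 \<le> B \<longrightarrow> okw B me_push s)"
  proof (cases "p < ?op")
    case True
    then obtain m where m: "?op = Suc m" "p \<le> m" by (cases ?op) auto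
    have ne: "segB s p (Suc m) = segB s p m @ [(nmem s ''wB'' m, rmem s ''bB'' m, rmem s ''eB'' m)]" using m by (simp add: segB_snoc)
    show ?thesis
    proof (cases "nmem s ''wB'' m = nmem s ''w'' 0")
      case True
      have s': "s' = rwrite ''eB'' m (rmem s ''ee'' 0) s" using True m assms by (simp add: s'_def me_push_def)
      have "segB s' p m = segB s p m" by (rule segB_cong) (auto simp: s')
      then have "segB s' p (Suc m) = segB s p m @ [(nmem s ''wB'' m, rmem s ''bB'' m, rmem s ''ee'' 0)]" using m by (simp add: segB_snoc s')
      moreover have "segB s' l u = segB s l u" if "u \<le> p" for l u by (rule segB_cong) (use that m in \<open>auto simp: s'\<close>)
      ultimately show ?thesis using m True assms(1,2) by (simp add: s' ne push_def me_push_def)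
    next
      case False
      have s': "nmem s' ''wB'' = (nmem s ''wB'')(?op := nmem s ''w'' 0)" "rmem s' ''bB'' = (rmem s ''bB'')(?op := rmem s ''bb'' 0)"
        "rmem s' ''eB'' = (rmem s ''eB'')(?op := rmem s ''ee'' 0)" "nmem s' ''op'' 0 = Suc ?op" "okw B me_push s \<longleftrightarrow> nmem s ''w'' 0 \<le> B \<and> Suc ?op \<le> B"
        using False m assms by (simp_all add: s'_def me_push_def)
      have "segB s' p ?op = segB s p ?op" by (rule segB_cong) (auto simp: s')
      then have "segB s' p (Suc ?op) = segB s p ?op @ [(nmem s ''w'' 0, rmem s ''bb'' 0, rmem s ''ee'' 0)]" using assms(2) by (simp add: segB_snoc s')
      moreover have "segB s' l u = segB s l u" if "u \<le> p" for l u by (rule segB_cong) (use that m in \<open>auto simp: s'\<close>)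
      ultimately show ?thesis using m False assms(1,2) by (simp add: s' ne push_def)
    qed
  next
    case False
    have s': "nmem s' ''wB'' = (nmem s ''wB'')(?op := nmem s ''w'' 0)" "rmem s' ''bB'' = (rmem s ''bB'')(?op := rmem s ''bb'' 0)"
      "rmem s' ''eB'' = (rmem s ''eB'')(?op := rmem s ''ee'' 0)" "nmem s' ''op'' 0 = Suc ?op" "okw B me_push s \<longleftrightarrow> nmem s ''w'' 0 \<le> B \<and> Suc ?op \<le> B"
      using False assms by (simp_all add: s'_def me_push_def)
    have "segB s' p ?op = segB s p ?op" by (rule segB_cong) (auto simp: s')
    then have "segB s' p (Suc ?op) = segB s p ?op @ [(nmem s ''w'' 0, rmem s ''bb'' 0, rmem s ''ee'' 0)]" using assms(2) by (simp add: segB_snoc s')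
    moreover have "segB s' l u = segB s l u" if "u \<le> p" for l u by (rule segB_cong) (use that assms(2) in \<open>auto simp: s'\<close>)
    moreover have "segB s p ?op = []" using False by (simp add: segB_def)
    ultimately show ?thesis using False assms(1,2) by (simp add: s' push_def)
  qed
  then show "segB s' p (nmem s' ''op'' 0) = push (segB s p (nmem s ''op'' 0)) (nmem s ''w'' 0, rmem s ''bb'' 0, rmem s ''ee'' 0)"
    "p \<le> nmem s' ''op'' 0" "\<And>l u. u \<le> p \<Longrightarrow> segB s' l u = segB s l u"
    "nmem s' ''op'' 0 \<le> B \<Longrightarrow> nmem s ''w'' 0 \<le> B \<Longrightarrow> okw B me_push s" by auto
qed

lemma fex_root:
  assumes st: "rmem s ''Y'' = Y"
  shows "rmem (fex (me_root \<sigma>) s) ''ee'' 0 = (let r = Y (nmem s ''p'' 0) + (rmem s ''dy'' 0 * rmem s ''K'' 0 / 2 +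
     of_rat \<sigma> * (rmem s ''dx'' 0 * rmem s ''sq'' 0)) / rmem s ''d2'' 0 in
     if rmem s ''bb'' 0 < r \<and> r < rmem s ''ee'' 0 then r else rmem s ''ee'' 0)"
  by (simp add: me_root_def st Let_def)

lemma root_unch: "a \<notin> {''rt'', ''ee''} \<Longrightarrow> rmem (fex (me_root \<sigma>) s) a = rmem s a" "nmem (fex (me_root \<sigma>) s) = nmem s"
  using fex_unch[of "me_root \<sigma>" s] by (auto simp: unch_def me_root_def)

lemma fex_prep:
  assumes st: "rmem s ''X'' = X" "rmem s ''Y'' = Y" "rmem s ''ro'' = \<rho>"
  defines "s' \<equiv> fex me_prep s"
  defines "p \<equiv> nmem s ''wA'' (nmem s ''i'' 0)" and "q \<equiv> nmem s ''wA'' (nmem s ''h'' 0)"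
    and "b \<equiv> rmem s ''bA'' (nmem s ''i'' 0)"
  defines "e \<equiv> ovend b p q (rmem s ''eA'' (nmem s ''i'' 0)) (rmem s ''eA'' (nmem s ''h'' 0))"
  shows "rmem s' ''ee'' 0 = e" "rmem s' ''bb'' 0 = b" "nmem s' ''w'' 0 = win b e p q" "unch me_prep s s'" "lf me_prep" "nbnd B s \<Longrightarrow> okw B me_prep s"
proof -
  show "lf me_prep" by (simp add: me_prep_def me_prep1_def me_prep2_def me_root_def)
  show "unch me_prep s s'" unfolding s'_def by (rule fex_unch)
  define s1 where "s1 = fex me_prep1 s"
  define s2 where "s2 = fex (me_root 1) s1"
  define s3 where "s3 = fex (me_root (-1)) s2"
  have s': "s' = fex me_prep2 s3" by (simp add: s'_def me_prep_def s1_def s2_def s3_def)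
  have u1: "rmem s1 a = rmem s a" if "a \<in> {''X'', ''Y'', ''ro''}" for a
    using fex_unch[of me_prep1 s] that by (auto simp: unch_def me_prep1_def s1_def)
  define DX DY where "DX = X q - X p" and "DY = Y q - Y p"
  define D2 where "D2 = DX * DX + DY * DY"
  define K where "K = \<rho> p * \<rho> p - \<rho> q * \<rho> q + D2"
  define S where "S = sqrt (D2 * (\<rho> p * \<rho> p) - K * K / 4)"
  define E where "E = (if rmem s ''eA'' (nmem s ''h'' 0) < rmem s ''eA'' (nmem s ''i'' 0) then rmem s ''eA'' (nmem s ''h'' 0) else rmem s ''eA'' (nmem s ''i'' 0))"
  define R1 R2 where "R1 = root1 X Y \<rho> 1 p q" and "R2 = root1 X Y \<rho> (-1) p q"
  have v1: "nmem s1 ''p'' 0 = p" "nmem s1 ''q'' 0 = q" "rmem s1 ''bb'' 0 = b" "rmem s1 ''dx'' 0 = DX"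
    "rmem s1 ''dy'' 0 = DY" "rmem s1 ''d2'' 0 = D2" "rmem s1 ''K'' 0 = K" "rmem s1 ''sq'' 0 = S" "rmem s1 ''ee'' 0 = E"
    by (simp_all add: s1_def me_prep1_def st p_def q_def b_def DX_def DY_def D2_def K_def S_def E_def)
  have r: "Y p + (DY * K / 2 + 1 * (DX * S)) / D2 = R1" "Y p + (DY * K / 2 + - 1 * (DX * S)) / D2 = R2"
    unfolding R1_def R2_def root1_def Let_def DX_def[symmetric] DY_def[symmetric] D2_def[symmetric] K_def[symmetric] S_def[symmetric] by simp_all
  have y1: "rmem s1 ''Y'' = Y" and y2: "rmem s2 ''Y'' = Y" using u1 st by (simp_all add: s2_def root_unch)
  have e2: "rmem s2 ''ee'' 0 = (if b < R1 \<and> R1 < E then R1 else E)"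
    unfolding s2_def fex_root[OF y1] v1 of_rat_1 r Let_def ..
  have v2: "nmem s2 ''p'' 0 = p" "nmem s2 ''q'' 0 = q" "rmem s2 ''bb'' 0 = b" "rmem s2 ''dx'' 0 = DX"
    "rmem s2 ''dy'' 0 = DY" "rmem s2 ''d2'' 0 = D2" "rmem s2 ''K'' 0 = K" "rmem s2 ''sq'' 0 = S"
    by (simp_all add: s2_def root_unch v1)
  have "rmem s3 ''ee'' 0 = (let ee = (if b < R1 \<and> R1 < E then R1 else E) in if b < R2 \<and> R2 < ee then R2 else ee)"
    unfolding s3_def fex_root[OF y2] v2 e2 of_rat_neg_one r Let_def ..
  then have e: "rmem s3 ''ee'' 0 = e"
    unfolding e_def ovend_def R1_def R2_def E_def Let_def .
  have v3: "nmem s3 ''p'' 0 = p" "nmem s3 ''q'' 0 = q" "rmem s3 ''bb'' 0 = b" "rmem s3 ''X'' = X" "rmem s3 ''Y'' = Y" "rmem s3 ''ro'' = \<rho>"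
    by (simp_all add: s3_def s2_def root_unch v1 u1 st)
  show "rmem s' ''ee'' 0 = e" "rmem s' ''bb'' 0 = b" "nmem s' ''w'' 0 = win b e p q"
    by (simp_all add: s' me_prep2_def rf_def e v3 win_def f_def)
  show "okw B me_prep s" if n: "nbnd B s"
  proof -
    have l1: "lf me_prep1" by (simp add: me_prep1_def)
    have o1: "okw B me_prep1 s" using n by (simp add: me_prep1_def nbnd_def)
    have n1: "nmem s1 a i \<le> B" for a i using big_lf[OF l1 o1] big_nbnd n by (metis nbnd_def s1_def)
    have "okw B me_prep2 s3" using n1[of "''p''" 0] n1[of "''q''" 0] by (simp add: me_prep2_def rf_def v3 v1)
    then show ?thesis using o1 by (simp add: me_prep_def s1_def[symmetric] s2_def[symmetric] s3_def[symmetric]) (simp add: me_root_def)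
  qed
qed

end


lemma fex_adv:
  assumes ia: "ia \<in> {''i'', ''h''}" and n: "nmem s ia 0 = n" "n < u"
  defines "s' \<equiv> fex (me_adv ia) s" and "e \<equiv> rmem s ''ee'' 0"
  shows "segA s' (nmem s' ia 0) u = (if e < rmem s ''eA'' n then (nmem s ''wA'' n, e, rmem s ''eA'' n) # segA s (Suc n) u else segA s (Suc n) u)"
    "nmem s' ia 0 = (if e < rmem s ''eA'' n then n else Suc n)"
    "\<And>l u. u \<le> n \<or> n < l \<Longrightarrow> segA s' l u = segA s l u"
    "segB s' = segB s" "rmem s' ''bA'' = (if e < rmem s ''eA'' n then (rmem s ''bA'')(n := e) else rmem s ''bA'')"
    "unch (me_adv ia) s s'" "lf (me_adv ia)" "u \<le> B \<Longrightarrow> okw B (me_adv ia) s"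
proof -
  show "unch (me_adv ia) s s'" unfolding s'_def by (rule fex_unch)
  then have u: "rmem s' ''eA'' = rmem s ''eA''" "nmem s' ''wA'' = nmem s ''wA''" "nmem s' ''wB'' = nmem s ''wB''"
    "rmem s' ''bB'' = rmem s ''bB''" "rmem s' ''eB'' = rmem s ''eB''"
    using ia by (auto simp: unch_def me_adv_def)
  show 2: "nmem s' ia 0 = (if e < rmem s ''eA'' n then n else Suc n)"
    using ia n by (auto simp: s'_def me_adv_def e_def)
  show bA: "rmem s' ''bA'' = (if e < rmem s ''eA'' n then (rmem s ''bA'')(n := e) else rmem s ''bA'')"
    using ia n by (auto simp: s'_def me_adv_def e_def)
  show 3: "segA s' l u = segA s l u" if "u \<le> n \<or> n < l" for l u
    by (rule segA_cong) (use that u bA in auto)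
  show "segA s' (nmem s' ia 0) u = (if e < rmem s ''eA'' n then (nmem s ''wA'' n, e, rmem s ''eA'' n) # segA s (Suc n) u else segA s (Suc n) u)"
    using 2 3[of u "Suc n"] n(2) bA u by (simp add: segA_Cons[of n u s'])
  show "segB s' = segB s" using u by (simp add: segB_def fun_eq_iff)
  show "lf (me_adv ia)" by (simp add: me_adv_def)
  show "okw B (me_adv ia) s" if "u \<le> B" using n that ia by (auto simp: me_adv_def)
qed

definition kme :: nat where
  "kme = kw (Or (NLess (V ''i'') (V ''l2'')) (NLess (V ''h'') (V ''l3''))) me_body * 3"

section \<open>Time of merging two envelopes\<close>

context arcs begin

definition nroots :: "real \<Rightarrow> nat \<Rightarrow> nat \<Rightarrow> nat" where
  "nroots b p q = (if b < root1 X Y \<rho> 1 p q then 1 else 0) + (if b < root1 X Y \<rho> (-1) p q then 1 else 0)"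

lemma nroots_le: "nroots b p q \<le> 2" by (simp add: nroots_def)

text \<open>A cut strictly inside both pieces sits at a crossing value, which no longer lies beyond
  the new start.\<close>

lemma nroots_less:
  assumes "b < e1" "b < e2" "ovend b p q e1 e2 < e1" "ovend b p q e1 e2 < e2"
  shows "nroots (ovend b p q e1 e2) p q < nroots b p q"
proof -
  define e where "e = ovend b p q e1 e2"
  have "b < e" using ovend(1)[OF assms(1,2)] by (simp add: e_def)
  moreover have "e = root1 X Y \<rho> 1 p q \<or> e = root1 X Y \<rho> (-1) p q" using ovend(5)[OF assms(1,2), of p q] assms(3,4) by (auto simp: e_def)
  ultimately show ?thesis unfolding e_def[symmetric] by (auto simp: nroots_def)
qed

text \<open>An overlap step that finishes neither piece uses up one of the at most two crossing
  values of the pair of heads. The weight 3 makes the loss of a piece outweigh the two crossing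
  values that a new pair may bring.\<close>

definition meas :: "item list \<Rightarrow> item list \<Rightarrow> nat" where
  "meas xs ys = 3 * (length xs + length ys) + (case xs of [] \<Rightarrow> 0 | (p, b, e) # _ \<Rightarrow> case ys of [] \<Rightarrow> 0 | (q, b', e') # _ \<Rightarrow> nroots b p q)"

lemma meas_le: "meas xs ys \<le> 3 * (length xs + length ys) + 2"
  using nroots_le by (simp add: meas_def split: list.split prod.split)

lemma meas_ge: "3 * (length xs + length ys) \<le> meas xs ys"
  by (simp add: meas_def)

lemma meas_less:
  assumes "length xs' + length ys' < length xs + length ys"
  shows "meas xs' ys' < meas xs ys"
proof -
  have "m < n" if "a < b" "m \<le> 3 * a + 2" "3 * b \<le> n" for a b m n :: nat
    using that by presburger
  from this[OF assms meas_le meas_ge] show ?thesis .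
qed

definition envrel :: "store \<Rightarrow> nat list \<Rightarrow> item list \<Rightarrow> bool" where "envrel s G xs = env G xs"

definition stat :: "store \<Rightarrow> bool" where
  "stat s \<longleftrightarrow> rmem s ''X'' = X \<and> rmem s ''Y'' = Y \<and> rmem s ''ro'' = \<rho> \<and> nmem s ''cid'' = cid"

lemma ME_len: "ME G1 G2 xs ys zs \<Longrightarrow> length zs \<le> 2 * length (G1 @ G2)"
  by (rule pieces_length) (auto simp: ME_def okO_def)

lemma run_me:
  assumes J: "stat s"
    and st: "nmem s ''i'' 0 = i0" "nmem s ''h'' 0 = l" "nmem s ''l2'' 0 = l" "nmem s ''l3'' 0 = l3"
       "nmem s ''op'' 0 = p" "nmem s ''op0'' 0 = p" and le: "i0 \<le> l" "l \<le> l3" "l3 \<le> B"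
    and r1: "env G1 (segA s i0 l)" and r2: "env G2 (segA s l l3)"
    and pB: "p + 2 * length (G1 @ G2) \<le> B"
  shows "run B me s (kme * Suc (l3 - i0)) (\<lambda>s'. stat s' \<and> p \<le> nmem s' ''op'' 0 \<and>
       env (G1 @ G2) (segB s' p (nmem s' ''op'' 0)) \<and>
       (\<forall>l u. u \<le> p \<longrightarrow> segB s' l u = segB s l u) \<and>
       (\<forall>l' u. u \<le> i0 \<or> l3 \<le> l' \<longrightarrow> segA s' l' u = segA s l' u))"
proof -
  define Inv where "Inv = (\<lambda>s' :: store. ME G1 G2 (segA s' (nmem s' ''i'' 0) l) (segA s' (nmem s' ''h'' 0) l3) (segB s' p (nmem s' ''op'' 0)) \<and>
    i0 \<le> nmem s' ''i'' 0 \<and> nmem s' ''i'' 0 \<le> l \<and> l \<le> nmem s' ''h'' 0 \<and> nmem s' ''h'' 0 \<le> l3 \<and> p \<le> nmem s' ''op'' 0 \<and>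
    (\<forall>l u. u \<le> p \<longrightarrow> segB s' l u = segB s l u) \<and> (\<forall>l' u. u \<le> i0 \<or> l3 \<le> l' \<longrightarrow> segA s' l' u = segA s l' u))"
  define \<psi> where "\<psi> = (\<lambda>s' :: store. meas (segA s' (nmem s' ''i'' 0) l) (segA s' (nmem s' ''h'' 0) l3))"
  let ?c = "Or (NLess (V ''i'') (V ''l2'')) (NLess (V ''h'') (V ''l3''))"
  show ?thesis unfolding me_def
  proof (rule run_while_lf[where I = Inv and \<psi> = \<psi>], goal_cases)
    case 1
    show ?case using ME_init[OF r1 r2] st le by (simp add: Inv_def) (simp add: segB_def)
  next
    case 2 show ?case by (simp add: me_body_def me_copy_def me_prep_def me_prep1_def me_prep2_def me_root_def me_push_def me_adv_def)
  next
    case (3 s1)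
    have u: "stat s1" "nmem s1 ''l2'' 0 = l" "nmem s1 ''l3'' 0 = l3" "nmem s1 ''op0'' 0 = p"
      using 3(2) J st by (auto simp: unch_def stat_def me_body_def me_copy_def me_prep_def me_prep1_def me_prep2_def me_root_def me_push_def me_adv_def)
    define i where "i = nmem s1 ''i'' 0"
    define h where "h = nmem s1 ''h'' 0"
    define op where "op = nmem s1 ''op'' 0"
    have M: "ME G1 G2 (segA s1 i l) (segA s1 h l3) (segB s1 p op)" and
      b: "i0 \<le> i" "i \<le> l" "l \<le> h" "h \<le> l3" "p \<le> op" and
      frB: "\<And>l u. u \<le> p \<Longrightarrow> segB s1 l u = segB s l u" and frA: "\<And>l' u. u \<le> i0 \<or> l3 \<le> l' \<Longrightarrow> segA s1 l' u = segA s l' u"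
      using 3(1) by (auto simp: Inv_def i_def h_def op_def)
    have c: "i < l \<or> h < l3" using 3(4) u by (auto simp: i_def h_def)
    \<comment> \<open>Even a partial output obeys the bound on the number of pieces, so the write
      index never leaves the space reserved for the block.\<close>
    have opB: "op' \<le> B" if "ME G1 G2 xs ys (segB s' p op')" for xs ys s' op'
      using ME_len[OF that] pB by (simp add: segB_def)
    define P where "P = nmem s1 ''wA'' i"
    define Q where "Q = nmem s1 ''wA'' h"
    have PQ: "P \<le> B" "Q \<le> B" using 3(3) by (auto simp: P_def Q_def nbnd_def)
    show ?case
    proof (cases "i < l \<and> h < l3 \<and> cid P = cid Q")
      case True
      then have il: "i < l" "h < l3" "cid P = cid Q" by auto
      have bt: "fex me_body s1 = fex (me_adv ''h'') (fex (me_adv ''i'') (fex me_push (fex me_prep s1)))"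
        "okw B me_body s1 \<longleftrightarrow> okw B (me_prep;; me_push;; me_adv ''i'';; me_adv ''h'') s1"
        using True u by (auto simp: me_body_def stat_def i_def h_def P_def Q_def)
      define sa where "sa = fex me_prep s1"
      define sb where "sb = fex me_push sa"
      define sc where "sc = fex (me_adv ''i'') sb"
      define sd where "sd = fex (me_adv ''h'') sc"
      define bb e1 e2 where "bb = rmem s1 ''bA'' i" and "e1 = rmem s1 ''eA'' i" and "e2 = rmem s1 ''eA'' h"
      define e where "e = ovend bb P Q e1 e2"
      have prep: "rmem sa ''ee'' 0 = e" "rmem sa ''bb'' 0 = bb" "nmem sa ''w'' 0 = win bb e P Q" "unch me_prep s1 sa"
        "lf me_prep" "okw B me_prep s1"
        using fex_prep[of s1] u 3(3) unfolding sa_def e_def bb_def e1_def e2_def P_def Q_def i_def h_def by (auto simp: stat_def)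
      have ua: "nmem sa a = nmem s1 a" if "a \<notin> {''p'', ''q'', ''w''}" for a
        using prep(4) that by (auto simp: unch_def me_prep_def me_prep1_def me_prep2_def me_root_def)
      have ura: "rmem sa a = rmem s1 a" if "a \<notin> {''bb'', ''dx'', ''dy'', ''d2'', ''K'', ''sq'', ''ee'', ''rt'', ''md''}" for a
        using prep(4) that by (auto simp: unch_def me_prep_def me_prep1_def me_prep2_def me_root_def)
      have sga: "segA sa = segA s1" "segB sa = segB s1" by (simp_all add: segA_def segB_def fun_eq_iff ua ura)
      have opa: "nmem sa ''op0'' 0 = p" "p \<le> nmem sa ''op'' 0" "nmem sa ''op'' 0 = op" using b u by (simp_all add: ua op_def[symmetric])
      note pu = fex_push[OF opa(1,2), folded sb_def]
      have ub: "nmem sb a = nmem sa a" if "a \<notin> {''wB'', ''op''}" for a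
        using pu(5) that by (auto simp: unch_def me_push_def)
      have urb: "rmem sb a = rmem sa a" if "a \<notin> {''bB'', ''eB''}" for a
        using pu(5) that by (auto simp: unch_def me_push_def)
      have sgb: "segA sb = segA s1" by (simp add: segA_def fun_eq_iff ua ura ub urb)
      have ib: "nmem sb ''i'' 0 = i" by (simp add: ub ua i_def)
      have eb: "rmem sb ''ee'' 0 = e" "rmem sb ''eA'' = rmem s1 ''eA''" "nmem sb ''wA'' = nmem s1 ''wA''" by (simp_all add: urb ura ub ua prep)
      note a1 = fex_adv[of "''i''", OF _ ib il(1), folded sc_def, unfolded eb sgb, simplified]
      have uc: "nmem sc a = nmem sb a" if "a \<noteq> ''i''" for a using a1(6) that by (auto simp: unch_def me_adv_def)
      have urc: "rmem sc a = rmem sb a" if "a \<noteq> ''bA''" for a using a1(6) that by (auto simp: unch_def me_adv_def)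
      have ic: "nmem sc ''h'' 0 = h" by (simp add: uc ub ua h_def)
      have ec: "rmem sc ''ee'' 0 = e" "rmem sc ''eA'' = rmem s1 ''eA''" "nmem sc ''wA'' = nmem s1 ''wA''" by (simp_all add: urc uc eb)
      note a2 = fex_adv[of "''h''", OF _ ic il(2), folded sd_def, unfolded ec, simplified]
      have ud: "nmem sd a = nmem sc a" if "a \<noteq> ''h''" for a using a2(6) that by (auto simp: unch_def me_adv_def)
      have urd: "rmem sd a = rmem sc a" if "a \<noteq> ''bA''" for a using a2(6) that by (auto simp: unch_def me_adv_def)
      define xs' where "xs' = (if e < e1 then (P, e, e1) # segA s1 (Suc i) l else segA s1 (Suc i) l)"
      define ys' where "ys' = (if e < e2 then (Q, e, e2) # segA s1 (Suc h) l3 else segA s1 (Suc h) l3)"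
      have hi': "i < h" using il b by simp
      have X: "segA sd (nmem sd ''i'' 0) l = xs'"
      proof -
        have "segA sd (nmem sd ''i'' 0) l = segA sc (nmem sc ''i'' 0) l" using a2(3)[of l] b by (simp add: ud)
        then show ?thesis using a1(1) by (simp add: xs'_def P_def e1_def)
      qed
      have Y: "segA sd (nmem sd ''h'' 0) l3 = ys'"
        using a2(1) a1(3)[of l3 "Suc h"] hi' by (simp add: ys'_def Q_def e2_def)
      have xs: "segA s1 i l = (P, bb, e1) # segA s1 (Suc i) l" using il by (simp add: segA_Cons P_def bb_def e1_def)
      have ys: "segA s1 h l3 = (Q, rmem s1 ''bA'' h, e2) # segA s1 (Suc h) l3" using il by (simp add: segA_Cons Q_def e2_def)
      note ov = ME_over[OF M[unfolded xs ys] il(3), folded e_def, folded xs'_def ys'_def]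
      have opd: "nmem sd ''op'' 0 = nmem sb ''op'' 0" by (simp add: ud uc)
      have sgd: "segB sd = segB sb" using a1(4) a2(4) by simp
      have Z: "segB sd p (nmem sd ''op'' 0) = push (segB s1 p op) (win bb e P Q, bb, e)"
        using pu(1) by (simp add: sgd opd sga prep opa)
      have M': "ME G1 G2 (segA sd (nmem sd ''i'' 0) l) (segA sd (nmem sd ''h'' 0) l3) (segB sd p (nmem sd ''op'' 0))"
        unfolding X Y Z by (rule ov(2))
      have opB': "nmem sb ''op'' 0 \<le> B" using opB[OF M'] opd by simp
      have wB: "nmem sa ''w'' 0 \<le> B" using PQ by (simp add: prep win_def)
      have idx: "nmem sd ''i'' 0 = (if e < e1 then i else Suc i)" "nmem sd ''h'' 0 = (if e < e2 then h else Suc h)"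
        using a1(2) a2(2) by (simp_all add: ud e1_def e2_def)
      have Inv: "Inv sd" unfolding Inv_def
      proof (intro conjI allI impI)
        show "segB sd l' u = segB s l' u" if "u \<le> p" for l' u using pu(3)[OF that] frB[OF that] by (simp add: sgd sga)
        show "segA sd l' u = segA s l' u" if o: "u \<le> i0 \<or> l3 \<le> l'" for l' u
        proof -
          have "u \<le> i \<or> i < l'" "u \<le> h \<or> h < l'" using o b il by auto
          then have "segA sd l' u = segA s1 l' u" using a1(3) a2(3) by simp
          then show ?thesis using frA[OF o] by simp
        qed
      qed (use M' idx b il pu(2) opd in auto)
      have ps: "\<psi> sd < \<psi> s1"
      proof -
        have "meas xs' ys' < meas (segA s1 i l) (segA s1 h l3)"
        proof (cases "e < e1 \<and> e < e2")
          \<comment> \<open>Neither piece is finished, so the pair of heads stays and the cut has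
            used up one of its crossing values.\<close>
          case True
          have "piece G1 (P, bb, e1)" "piece G2 (Q, bb, e2)" using M unfolding xs ys ov(1) by (auto simp: ME_def rest_def)
          then have "bb < e1" "bb < e2" by (auto simp: piece_def)
          then have "nroots e P Q < nroots bb P Q" using nroots_less True by (simp add: e_def)
          then show ?thesis using True unfolding xs ys by (simp add: meas_def xs'_def ys'_def)
        next
          case False
          have "length xs' + length ys' < length (segA s1 i l) + length (segA s1 h l3)"
            using False unfolding xs ys by (auto simp: xs'_def ys'_def)
          then show ?thesis by (rule meas_less)
        qed
        then show ?thesis unfolding \<psi>_def X Y by (simp add: i_def h_def)
      qed
      have "okw B (me_prep;; me_push;; me_adv ''i'';; me_adv ''h'') s1"
        using prep(6) pu(4)[OF opB' wB] a1(8) a2(8) le by (simp add: sa_def[symmetric] sb_def[symmetric] sc_def[symmetric])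
      then show ?thesis using Inv ps unfolding bt sa_def[symmetric] sb_def[symmetric] sc_def[symmetric] sd_def[symmetric] by simp
    next
      case nb: False
      \<comment> \<open>Both copy cases are treated at once: \<open>il\<close> tells which list
        supplies the piece, and \<open>ME_sym\<close> reduces the second case to the first.\<close>
      define il where "il \<longleftrightarrow> i < l \<and> (\<not> h < l3 \<or> cid P < cid Q)"
      define ia where "ia = (if il then ''i'' else ''h'')"
      define n where "n = (if il then i else h)"
      have body: "fex me_body s1 = fex (me_copy ia) s1" "okw B me_body s1 = okw B (me_copy ia) s1"
        using nb u by (auto simp: me_body_def stat_def i_def h_def P_def Q_def ia_def il_def)
      have n: "nmem s1 ia 0 = n" "ia \<in> {''i'', ''h''}" by (auto simp: ia_def n_def i_def h_def)
      define s0 where "s0 = fex (setn ''w'' (NRead ''wA'' (V ia));; setr ''bb'' (RRead ''bA'' (V ia));; setr ''ee'' (RRead ''eA'' (V ia))) s1"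
      have s0: "nmem s0 ''w'' 0 = nmem s1 ''wA'' n" "rmem s0 ''bb'' 0 = rmem s1 ''bA'' n" "rmem s0 ''ee'' 0 = rmem s1 ''eA'' n"
        using n by (auto simp: s0_def)
      have u0: "nmem s0 a = nmem s1 a" if "a \<noteq> ''w''" for a using that by (simp add: s0_def)
      have ur0: "rmem s0 a = rmem s1 a" if "a \<notin> {''bb'', ''ee''}" for a using that by (simp add: s0_def)
      have sg0: "segA s0 = segA s1" "segB s0 = segB s1" by (simp_all add: segA_def segB_def fun_eq_iff u0 ur0)
      have op0: "nmem s0 ''op0'' 0 = p" "p \<le> nmem s0 ''op'' 0" "nmem s0 ''op'' 0 = op" using b u by (simp_all add: u0 op_def[symmetric])
      define sb where "sb = fex me_push s0"
      note pu = fex_push[OF op0(1,2), folded sb_def]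
      have ub: "nmem sb a = nmem s0 a" if "a \<notin> {''wB'', ''op''}" for a
        using pu(5) that by (auto simp: unch_def me_push_def)
      have urb: "rmem sb a = rmem s0 a" if "a \<notin> {''bB'', ''eB''}" for a
        using pu(5) that by (auto simp: unch_def me_push_def)
      define sd where "sd = fex (inc ia) sb"
      have nsb: "nmem sb ia 0 = n" using n by (auto simp: ub u0)
      have sd: "fex (me_copy ia) s1 = sd" "nmem sd ia 0 = Suc n"
        using nsb by (simp_all add: sd_def sb_def s0_def me_copy_def)
      have udn: "nmem sd a = nmem sb a" if "a \<noteq> ia" for a using that by (simp add: sd_def)
      have udr: "rmem sd = rmem sb" by (simp add: sd_def)
      have sgA: "segA sd = segA s1" using n(2) by (auto simp: segA_def fun_eq_iff udn udr ub urb u0 ur0)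
      have sgB: "segB sd = segB sb" using n(2) by (auto simp: segB_def fun_eq_iff udn udr)
      have opd: "nmem sd ''op'' 0 = nmem sb ''op'' 0" using n(2) by (auto simp: udn)
      have Z: "segB sd p (nmem sd ''op'' 0) = push (segB s1 p op) (nmem s1 ''wA'' n, rmem s1 ''bA'' n, rmem s1 ''eA'' n)"
        using pu(1) by (simp add: sgB opd sg0 s0 op0)
      have hi': "if il then i < l \<and> (segA s1 h l3 = [] \<or> cid P < cid (fst (hd (segA s1 h l3))))
         else h < l3 \<and> (segA s1 i l = [] \<or> cid Q < cid (fst (hd (segA s1 i l))))"
      proof -
        have "i < l \<Longrightarrow> fst (hd (segA s1 i l)) = P" "h < l3 \<Longrightarrow> fst (hd (segA s1 h l3)) = Q"
          "\<not> i < l \<Longrightarrow> segA s1 i l = []" "\<not> h < l3 \<Longrightarrow> segA s1 h l3 = []"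
          by (auto simp: segA_Cons segA_Nil P_def Q_def)
        then show ?thesis using nb c by (cases "i < l"; cases "h < l3") (auto simp: il_def)
      qed
      have idx: "nmem sd ''i'' 0 = (if il then Suc i else i)" "nmem sd ''h'' 0 = (if il then h else Suc h)"
        using sd(2) by (auto simp: ia_def n_def udn ub u0 i_def h_def)
      have M': "ME G1 G2 (segA sd (nmem sd ''i'' 0) l) (segA sd (nmem sd ''h'' 0) l3) (segB sd p (nmem sd ''op'' 0))"
      proof (cases il)
        case True
        then have "i < l" and o: "segA s1 h l3 = [] \<or> cid P < cid (fst (hd (segA s1 h l3)))" using hi' by auto
        note M1 = M[unfolded segA_Cons[OF \<open>i < l\<close>]]
        show ?thesis unfolding Z sgA idx using ME_copy[OF M1 o[unfolded P_def]] True by (simp add: n_def)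
      next
        case False
        then have "h < l3" and o: "segA s1 i l = [] \<or> cid Q < cid (fst (hd (segA s1 i l)))" using hi' by auto
        note M1 = ME_sym[OF M, unfolded segA_Cons[OF \<open>h < l3\<close>]]
        show ?thesis unfolding Z sgA idx using ME_sym[OF ME_copy[OF M1 o[unfolded Q_def]]] False by (simp add: n_def)
      qed
      have opB': "nmem sb ''op'' 0 \<le> B" using opB[OF M'] opd by simp
      have wB: "nmem s0 ''w'' 0 \<le> B" using 3(3) by (simp add: s0 nbnd_def)
      have nB: "Suc n \<le> B" using hi' le b by (auto simp: n_def split: if_splits)
      have ok: "okw B (me_copy ia) s1"
      proof -
        have iaw: "ia \<noteq> ''w''" using n(2) by auto
        show ?thesis using wB pu(4)[OF opB' wB] nB nsb unfolding s0(1) unfolding sb_def s0_def by (simp add: me_copy_def iaw n(1))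
      qed
      have Inv: "Inv sd" unfolding Inv_def
      proof (intro conjI allI impI)
        show "segB sd l' u = segB s l' u" if "u \<le> p" for l' u using pu(3)[OF that] frB[OF that] by (simp add: sgB sg0)
        show "segA sd l' u = segA s l' u" if o: "u \<le> i0 \<or> l3 \<le> l'" for l' u
          using frA[OF o] by (simp add: sgA)
      qed (use M' idx b hi' pu(2) opd in \<open>auto split: if_splits\<close>)
      have ps: "\<psi> sd < \<psi> s1"
      proof -
        have "length (segA sd (nmem sd ''i'' 0) l) + length (segA sd (nmem sd ''h'' 0) l3) < length (segA s1 i l) + length (segA s1 h l3)"
          using hi' unfolding sgA idx by (auto simp: segA_def split: if_splits)
        then show ?thesis unfolding \<psi>_def i_def[symmetric] h_def[symmetric]
          by (rule meas_less)
      qed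
      show ?thesis using ok Inv ps unfolding body sd by simp
    qed
  next
    case (4 s')
    have u: "stat s'" "nmem s' ''l2'' 0 = l" "nmem s' ''l3'' 0 = l3"
      using 4(2) J st by (auto simp: unch_def stat_def me_body_def me_copy_def me_prep_def me_prep1_def me_prep2_def me_root_def me_push_def me_adv_def)
    have "nmem s' ''i'' 0 = l" "nmem s' ''h'' 0 = l3" using 4(1,4) u by (auto simp: Inv_def)
    then have "ME G1 G2 [] [] (segB s' p (nmem s' ''op'' 0))" using 4(1) by (simp add: Inv_def segA_Nil)
    then show ?case using ME_fin u 4(1) by (auto simp: Inv_def)
  next
    case 5
    have "length (segA s i0 l) + length (segA s l l3) = l3 - i0" using le by (simp add: segA_def)
    then have "\<psi> s \<le> 3 * (l3 - i0) + 2" unfolding \<psi>_def using meas_le[of "segA s i0 l" "segA s l l3"] st by simp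
    then have "kw ?c me_body * Suc (\<psi> s) \<le> kw ?c me_body * (3 * Suc (l3 - i0))" by (intro mult_le_mono2) simp
    then show ?case unfolding kme_def mult.assoc .
  qed
qed

lemma dcl_me: "dcl me B kme envrel stat"
proof (unfold_locales, goal_cases)
  case 1 then show ?case by (simp add: me_def me_body_def me_copy_def me_prep_def me_prep1_def me_prep2_def me_root_def me_push_def me_adv_def)
next
  case (2 s) then show ?case by (simp add: envrel_def env_def atend_def)
next
  case (3 s G X) then show ?case by (simp add: envrel_def env_length)
next
  case (4 s s') then show ?case by (simp add: eqout_def dcr_def dcn_def stat_def)
next
  case (5 s G X s') then show ?case by (simp add: envrel_def)
next
  case (6 s i l l3 p G1 G2)
  then show ?case unfolding envrel_def by (intro run_mono[OF run_me[where l = l and p = p]]) auto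
qed

end

section \<open>Emitting edges by a sweep\<close>

definition edge :: "(nat \<Rightarrow> real) \<Rightarrow> (nat \<Rightarrow> real) \<Rightarrow> (nat \<Rightarrow> real) \<Rightarrow> nat \<Rightarrow> nat \<Rightarrow> bool" where
  "edge x y r p q \<longleftrightarrow> p \<noteq> q \<and> sqrt ((x p - x q) * (x p - x q) + (y p - y q) * (y p - y q)) \<le> r p"

text \<open>Every candidate is tested with the original coordinates and radii, so the output
  contains only edges of the transmission graph whatever the searches return.\<close>

definition emit :: com where
  "emit = If (And (Not (NEq (V ''p'') (V ''q''))) (Not (RLess (RRead ''r'' (V ''p''))
      (RSqrt (RAdd (RMul (RSub (RRead ''x'' (V ''p'')) (RRead ''x'' (V ''q''))) (RSub (RRead ''x'' (V ''p'')) (RRead ''x'' (V ''q''))))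
        (RMul (RSub (RRead ''y'' (V ''p'')) (RRead ''y'' (V ''q''))) (RSub (RRead ''y'' (V ''p'')) (RRead ''y'' (V ''q''))))))))) 
     (NAssign ''src'' (V ''m'') (V ''p'');; NAssign ''dst'' (V ''m'') (V ''q'');; inc ''m'') Skip"

definition outs :: "store \<Rightarrow> (nat \<times> nat) set" where
  "outs s = {(nmem s ''src'' k, nmem s ''dst'' k) | k. k < nmem s ''m'' 0}"

lemma outs_alt: "outs s = (\<lambda>k. (nmem s ''src'' k, nmem s ''dst'' k)) ` {..<nmem s ''m'' 0}"
  by (auto simp: outs_def)

lemma image_upd_lessThan:
  "(\<lambda>k. ((f(m := p)) k, (g(m := q)) k)) ` {..<Suc m} = (\<lambda>k. (f k, g k)) ` {..<m} \<union> {(p, q)}" for m :: nat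
proof -
  have "(\<lambda>k. ((f(m := p)) k, (g(m := q)) k)) ` {..<m} = (\<lambda>k. (f k, g k)) ` {..<m}" by (intro image_cong) auto
  then show ?thesis by (simp add: lessThan_Suc)
qed

lemma fex_emit:
  defines "e \<equiv> (\<lambda>s. edge (rmem s ''x'') (rmem s ''y'') (rmem s ''r'') (nmem s ''p'' 0) (nmem s ''q'' 0))"
  shows "outs (fex emit s) = outs s \<union> (if e s then {(nmem s ''p'' 0, nmem s ''q'' 0)} else {})"
    "nmem (fex emit s) ''m'' 0 \<le> Suc (nmem s ''m'' 0)" "lf emit"
    "a \<notin> {''src'', ''dst'', ''m''} \<Longrightarrow> nmem (fex emit s) a = nmem s a" "rmem (fex emit s) = rmem s"
    "nmem s ''p'' 0 \<le> B \<Longrightarrow> nmem s ''q'' 0 \<le> B \<Longrightarrow> Suc (nmem s ''m'' 0) \<le> B \<Longrightarrow> okw B emit s"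
proof -
  show "outs (fex emit s) = outs s \<union> (if e s then {(nmem s ''p'' 0, nmem s ''q'' 0)} else {})"
  proof (cases "e s")
    case True
    then have "nmem (fex emit s) ''src'' = (nmem s ''src'')(nmem s ''m'' 0 := nmem s ''p'' 0)"
      "nmem (fex emit s) ''dst'' = (nmem s ''dst'')(nmem s ''m'' 0 := nmem s ''q'' 0)" "nmem (fex emit s) ''m'' 0 = Suc (nmem s ''m'' 0)"
      by (simp_all add: emit_def e_def edge_def)
    then show ?thesis using True unfolding outs_alt by (simp only: image_upd_lessThan if_True)
  next
    case False
    then have "fex emit s = s" by (auto simp: emit_def e_def edge_def)
    then show ?thesis using False by simp
  qed
qed (auto simp: emit_def)

section \<open>Sorting, and the edges to the recorded sites\<close>

definition sort_init :: "(nexp \<Rightarrow> rexp) \<Rightarrow> com" where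
  "sort_init ke = While (NLess (V ''k'') (V ''n'')) (NAssign ''wA'' (V ''k'') (NRead ''pi'' (V ''k''));;
     RAssign ''eA'' (V ''k'') (ke (NRead ''pi'' (V ''k'')));; NAssign ''best'' (V ''k'') (NConst 0);; inc ''k'';;
     NAssign ''bd'' (V ''k'') (V ''k''))"
text \<open>The result goes both to \<open>d\<close> and back to \<open>pi\<close>, so the next sort
  starts from this order; the dominance search depends on that.\<close>

definition sort_out :: "name \<Rightarrow> com" where
  "sort_out d = While (NLess (V ''k'') (V ''n'')) (NAssign ''pi'' (V ''k'') (NRead ''wA'' (V ''k''));;
     NAssign d (V ''k'') (NRead ''wA'' (V ''k''));; inc ''k'')"
definition sort_pre :: com where
  "sort_pre = (setn ''k'' (NConst 0);; setn ''nb'' (V ''n'');; setn ''bd'' (NConst 0))"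

definition keyexp :: "(nexp \<Rightarrow> rexp) \<Rightarrow> (real \<Rightarrow> real \<Rightarrow> real) \<Rightarrow> bool" where
  "keyexp ke g \<longleftrightarrow> (\<forall>x s. rval (ke x) s = g (rmem s ''X'' (nval x s)) (rmem s ''Y'' (nval x s)))"

lemma keyexp_X: "keyexp (RRead ''X'') (\<lambda>x y. x)" by (simp add: keyexp_def)
lemma keyexp_Y: "keyexp (RRead ''Y'') (\<lambda>x y. y)" by (simp add: keyexp_def)
lemma run_sort_init:
  assumes n: "nmem s ''n'' 0 = n" "Suc n \<le> B" and k: "nmem s ''k'' 0 = 0" and b0: "nmem s ''bd'' 0 = 0" and ke: "keyexp ke g"
  shows "run B (sort_init ke) s (kw (NLess (V ''k'') (V ''n'')) (NAssign ''wA'' (V ''k'') (NRead ''pi'' (V ''k''));;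
     RAssign ''eA'' (V ''k'') (ke (NRead ''pi'' (V ''k'')));; NAssign ''best'' (V ''k'') (NConst 0);; inc ''k'';;
     NAssign ''bd'' (V ''k'') (V ''k'')) * Suc n)
     (\<lambda>s'. (\<forall>j<n. nmem s' ''wA'' j = nmem s ''pi'' j \<and> rmem s' ''eA'' j = g (rmem s ''X'' (nmem s ''pi'' j)) (rmem s ''Y'' (nmem s ''pi'' j)) \<and>
        nmem s' ''best'' j = 0) \<and> (\<forall>j\<le>n. nmem s' ''bd'' j = j))"
proof -
  show "run B (sort_init ke) s (kw (NLess (V ''k'') (V ''n'')) (NAssign ''wA'' (V ''k'') (NRead ''pi'' (V ''k''));;
     RAssign ''eA'' (V ''k'') (ke (NRead ''pi'' (V ''k'')));; NAssign ''best'' (V ''k'') (NConst 0);; inc ''k'';;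
     NAssign ''bd'' (V ''k'') (V ''k'')) * Suc n)
     (\<lambda>s'. (\<forall>j<n. nmem s' ''wA'' j = nmem s ''pi'' j \<and> rmem s' ''eA'' j = g (rmem s ''X'' (nmem s ''pi'' j)) (rmem s ''Y'' (nmem s ''pi'' j)) \<and>
        nmem s' ''best'' j = 0) \<and> (\<forall>j\<le>n. nmem s' ''bd'' j = j))"
    unfolding sort_init_def
  proof (rule run_while_lf[where I = "\<lambda>s'. nmem s' ''k'' 0 \<le> n \<and> (\<forall>j<nmem s' ''k'' 0. nmem s' ''wA'' j = nmem s ''pi'' j \<and>
        rmem s' ''eA'' j = g (rmem s ''X'' (nmem s ''pi'' j)) (rmem s ''Y'' (nmem s ''pi'' j)) \<and>
        nmem s' ''best'' j = 0) \<and> (\<forall>j\<le>nmem s' ''k'' 0. nmem s' ''bd'' j = j)" and \<psi> = "\<lambda>s'. n - nmem s' ''k'' 0"], goal_cases)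
    case (3 s')
    have u: "nmem s' ''n'' 0 = n" "nmem s' ''pi'' = nmem s ''pi''" "rmem s' ''X'' = rmem s ''X''" "rmem s' ''Y'' = rmem s ''Y''"
      using 3(2) n by (simp_all add: unch_def)
    have pB: "nmem s ''pi'' j \<le> B" for j using 3(3) u by (metis nbnd_def)
    have kv: "rval (ke x) s'' = g (rmem s'' ''X'' (nval x s'')) (rmem s'' ''Y'' (nval x s''))" for x s'' using ke by (simp add: keyexp_def)
    define k where "k = nmem s' ''k'' 0"
    have kn: "k < n" using 3(4) u by (simp add: k_def)
    let ?s = "fex (NAssign ''wA'' (V ''k'') (NRead ''pi'' (V ''k''));;
     RAssign ''eA'' (V ''k'') (ke (NRead ''pi'' (V ''k'')));; NAssign ''best'' (V ''k'') (NConst 0);; inc ''k'';;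
     NAssign ''bd'' (V ''k'') (V ''k'')) s'"
    have f: "nmem ?s ''wA'' = (nmem s' ''wA'')(k := nmem s ''pi'' k)" "nmem ?s ''best'' = (nmem s' ''best'')(k := 0)"
      "nmem ?s ''bd'' = (nmem s' ''bd'')(Suc k := Suc k)" "nmem ?s ''k'' 0 = Suc k"
      "rmem ?s ''eA'' = (rmem s' ''eA'')(k := g (rmem s ''X'' (nmem s ''pi'' k)) (rmem s ''Y'' (nmem s ''pi'' k)))"
      by (simp_all add: kv u k_def)
    have o: "okw B (NAssign ''wA'' (V ''k'') (NRead ''pi'' (V ''k''));;
     RAssign ''eA'' (V ''k'') (ke (NRead ''pi'' (V ''k'')));; NAssign ''best'' (V ''k'') (NConst 0);; inc ''k'';;
     NAssign ''bd'' (V ''k'') (V ''k'')) s'"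
      using pB kn n by (simp add: u k_def)
    show ?case using 3(1) o kn unfolding f k_def[symmetric] by (auto simp: less_Suc_eq le_Suc_eq)
  next
    case (4 s')
    have u: "nmem s' ''n'' 0 = n" using 4(2) n by (simp_all add: unch_def)
    then have "nmem s' ''k'' 0 = n" using 4(1,4) by simp
    then show ?case using 4(1) by simp
  qed (use assms in auto)
qed

lemma run_sort_out:
  assumes n: "nmem s ''n'' 0 = n" "Suc n \<le> B" and k: "nmem s ''k'' 0 = 0" and d: "d \<in> {''px'', ''py'', ''pz''}"
  shows "run B (sort_out d) s (kw (NLess (V ''k'') (V ''n'')) (NAssign ''pi'' (V ''k'') (NRead ''wA'' (V ''k''));;
     NAssign d (V ''k'') (NRead ''wA'' (V ''k''));; inc ''k'') * Suc n)
     (\<lambda>s'. \<forall>j<n. nmem s' ''pi'' j = nmem s ''wA'' j \<and> nmem s' d j = nmem s ''wA'' j)"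
  unfolding sort_out_def
proof (rule run_while_lf[where I = "\<lambda>s'. nmem s' ''k'' 0 \<le> n \<and> (\<forall>j<nmem s' ''k'' 0. nmem s' ''pi'' j = nmem s ''wA'' j \<and> nmem s' d j = nmem s ''wA'' j)"
   and \<psi> = "\<lambda>s'. n - nmem s' ''k'' 0"], goal_cases)
  case (3 s')
  have dd: "d \<noteq> ''wA''" "d \<noteq> ''n''" "d \<noteq> ''k''" "d \<noteq> ''pi''" "''wA'' \<noteq> d" "''n'' \<noteq> d" "''k'' \<noteq> d" "''pi'' \<noteq> d" using d by auto
  have u: "nmem s' ''n'' 0 = n" "nmem s' ''wA'' = nmem s ''wA''"
    using unch_n[OF 3(2), of "''n''"] unch_n[OF 3(2), of "''wA''"] n dd by simp_all
  have pB: "nmem s ''wA'' j \<le> B" for j using 3(3) u by (metis nbnd_def)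
  define k where "k = nmem s' ''k'' 0"
  have kn: "k < n" using 3(4) u by (simp add: k_def)
  let ?c = "NAssign ''pi'' (V ''k'') (NRead ''wA'' (V ''k''));; NAssign d (V ''k'') (NRead ''wA'' (V ''k''));; inc ''k''"
  have f: "nmem (fex ?c s') ''pi'' = (nmem s' ''pi'')(k := nmem s ''wA'' k)" "nmem (fex ?c s') d = (nmem s' d)(k := nmem s ''wA'' k)"
    "nmem (fex ?c s') ''k'' 0 = Suc k" "okw B ?c s'"
    using pB kn n by (simp_all add: dd u k_def)
  show ?case using 3(1) f(4) kn unfolding f(1-3) k_def[symmetric] by (auto simp: less_Suc_eq)
next
  case (4 s')
  have u: "nmem s' ''n'' 0 = n" using unch_n[OF 4(2), of "''n''"] n d by auto
  then have "nmem s' ''k'' 0 = n" using 4(1,4) by simp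
  then show ?case using 4(1) by simp
qed (use assms in auto)

definition part1 :: com where
  "part1 = While (NLess (V ''k'') (V ''n'')) (If (NEq (NRead ''best'' (V ''k'')) (NConst 0)) Skip
     (setn ''p'' (NSub (NRead ''best'' (V ''k'')) (NConst 1));; setn ''q'' (V ''k'');; emit);; inc ''k'')"

definition static :: "(nat \<Rightarrow> real) \<Rightarrow> (nat \<Rightarrow> real) \<Rightarrow> (nat \<Rightarrow> real) \<Rightarrow> store \<Rightarrow> bool" where
  "static x y r s \<longleftrightarrow> rmem s ''x'' = x \<and> rmem s ''y'' = y \<and> rmem s ''r'' = r"

definition kpart1 :: nat where
  "kpart1 = kw (NLess (V ''k'') (V ''n'')) (If (NEq (NRead ''best'' (V ''k'')) (NConst 0)) Skip
     (setn ''p'' (NSub (NRead ''best'' (V ''k'')) (NConst 1));; setn ''q'' (V ''k'');; emit);; inc ''k'')"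

lemma run_part1:
  assumes n: "nmem s ''n'' 0 = n" "Suc n \<le> B" and k: "nmem s ''k'' 0 = 0" and st: "static x y r s"
    and m: "nmem s ''m'' 0 + n \<le> B"
  shows "run B part1 s (kpart1 * Suc n) (\<lambda>s'. outs s' = outs s \<union> {(p, q). q < n \<and> nmem s ''best'' q = Suc p \<and> edge x y r p q} \<and>
     nmem s' ''m'' 0 \<le> nmem s ''m'' 0 + n)"
  unfolding part1_def kpart1_def
proof (rule run_while_lf[where I = "\<lambda>s'. nmem s' ''k'' 0 \<le> n \<and>
    outs s' = outs s \<union> {(p, q). q < nmem s' ''k'' 0 \<and> nmem s ''best'' q = Suc p \<and> edge x y r p q} \<and>
    nmem s' ''m'' 0 \<le> nmem s ''m'' 0 + nmem s' ''k'' 0" and \<psi> = "\<lambda>s'. n - nmem s' ''k'' 0"], goal_cases)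
  case 2 show ?case by (simp add: fex_emit)
next
  case (3 s')
  have u: "nmem s' ''n'' 0 = n" "nmem s' ''best'' = nmem s ''best''" "rmem s' ''x'' = x" "rmem s' ''y'' = y" "rmem s' ''r'' = r"
    using 3(2) n st by (simp_all add: unch_def static_def emit_def)
  define k where "k = nmem s' ''k'' 0"
  have kn: "k < n" using 3(4) u by (simp add: k_def)
  have bB: "nmem s ''best'' k \<le> B" using 3(3) u by (metis nbnd_def)
  show ?case
  proof (cases "nmem s ''best'' k")
    case 0
    have "{(p, q). q < Suc k \<and> nmem s ''best'' q = Suc p \<and> edge x y r p q} = {(p, q). q < k \<and> nmem s ''best'' q = Suc p \<and> edge x y r p q}"
      using 0 by (auto simp: less_Suc_eq)
    then show ?thesis using 3(1) u 0 kn n by (auto simp: k_def[symmetric] outs_def)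
  next
    case (Suc p)
    let ?s1 = "nwrite ''q'' 0 k (nwrite ''p'' 0 p s')"
    have o1: "outs ?s1 = outs s'" by (simp add: outs_def)
    have oo: "outs (nwrite ''k'' 0 v s0) = outs s0" for v s0 by (simp add: outs_def)
    have new: "{(p, q). q < Suc k \<and> nmem s ''best'' q = Suc p \<and> edge x y r p q} = {(p, q). q < k \<and> nmem s ''best'' q = Suc p \<and> edge x y r p q}
       \<union> (if edge x y r p k then {(p, k)} else {})"
      using Suc by (auto simp: less_Suc_eq)
    have mB: "Suc (nmem s' ''m'' 0) \<le> B" using 3(1) kn m by (simp add: k_def[symmetric])
    have ml: "nmem (fex emit ?s1) ''m'' 0 \<le> Suc (nmem s' ''m'' 0)" using fex_emit(2)[of ?s1] by simp
    show ?thesis using 3(1) u Suc kn n bB mB ml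
      by (auto simp: k_def[symmetric] fex_emit o1 oo new)
  qed
next
  case (4 s')
  have u: "nmem s' ''n'' 0 = n" using 4(2) n by (auto simp: unch_def emit_def)
  then have "nmem s' ''k'' 0 = n" using 4(1,4) by simp
  then show ?case using 4(1) by simp
qed (use assms in auto)

section \<open>Locating all sites for one cell offset\<close>

definition lex3 :: "real \<times> real \<times> real \<Rightarrow> real \<times> real \<times> real \<Rightarrow> bool" where
  "lex3 u v \<longleftrightarrow> fst u < fst v \<or> fst u = fst v \<and> (fst (snd u) < fst (snd v) \<or> fst (snd u) = fst (snd v) \<and> snd (snd u) < snd (snd v))"

lemma lex3_neg_trans: "lex3 u v \<Longrightarrow> \<not> lex3 w v \<Longrightarrow> lex3 u w" by (auto simp: lex3_def)

definition blex :: "rexp \<Rightarrow> rexp \<Rightarrow> bexp \<Rightarrow> bexp" where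
  "blex a b c = Or (RLess a b) (And (Not (RLess b a)) c)"

text \<open>Shifting by the offset \<open>(a, b)\<close> makes the cells of item and site
  comparable; within equal cells the end of the piece is compared with the ordinate of the
  site.\<close>

definition qless :: "rat \<Rightarrow> rat \<Rightarrow> bexp" where
  "qless a b = blex (RAdd (RRead ''cc'' (V ''p'')) (RConst a)) (RRead ''cc'' (V ''q''))
     (blex (RAdd (RRead ''cw'' (V ''p'')) (RConst b)) (RRead ''cw'' (V ''q''))
       (RLess (RRead ''eA'' (V ''i'')) (RRead ''Y'' (V ''q''))))"

definition qpre :: com where
  "qpre = (setn ''p'' (NRead ''wA'' (V ''i''));; setn ''q'' (NRead ''ord'' (V ''k'')))"
definition qbody :: "rat \<Rightarrow> rat \<Rightarrow> com" where
  "qbody a b = (qpre;; If (qless a b) (inc ''i'') (emit;; inc ''k''))"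

definition qcond :: bexp where "qcond = And (NLess (V ''i'') (V ''len'')) (NLess (V ''k'') (V ''n''))"

text \<open>A simultaneous scan: either the item lies below the site and is passed for good, or it
  is the candidate for this site, which is then tested and passed.\<close>

definition query :: "rat \<times> rat \<Rightarrow> com" where
  "query ab = ((setn ''i'' (NConst 0);; setn ''k'' (NConst 0));; While qcond (qbody (fst ab) (snd ab)))"

definition kquery :: "rat \<times> rat \<Rightarrow> nat" where
  "kquery ab = tmax (setn ''i'' (NConst 0);; setn ''k'' (NConst 0)) + kw qcond (qbody (fst ab) (snd ab))"

definition Tq :: "store \<Rightarrow> nat \<Rightarrow> real \<times> real \<times> real" where
  "Tq s q = (rmem s ''cc'' q, rmem s ''cw'' q, rmem s ''Y'' q)"
definition Ti :: "store \<Rightarrow> real \<Rightarrow> real \<Rightarrow> nat \<Rightarrow> real \<times> real \<times> real" where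
  "Ti s a b i = (rmem s ''cc'' (nmem s ''wA'' i) + a, rmem s ''cw'' (nmem s ''wA'' i) + b, rmem s ''eA'' i)"

text \<open>Sites come in increasing order, so an item below one site is below all later ones and
  the item pointer never returns. When a site is tested, the pointer stands at the first item not
  below it, and the time is linear in the two lists together.\<close>

lemma run_query:
  assumes n: "nmem s ''n'' 0 = n" "Suc n \<le> B" and L: "nmem s ''len'' 0 = L" "Suc L \<le> B" and st: "static x y r s"
    and so: "\<And>j k. j \<le> k \<Longrightarrow> k < n \<Longrightarrow> \<not> lex3 (Tq s (nmem s ''ord'' k)) (Tq s (nmem s ''ord'' j))"
    and m: "nmem s ''m'' 0 + n \<le> B" and wn: "\<And>i. i < L \<Longrightarrow> nmem s ''wA'' i < n" and on: "\<And>i. i < n \<Longrightarrow> nmem s ''ord'' i < n"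
  shows "run B (query (a, b)) s (kquery (a, b) * Suc (L + n)) (\<lambda>s'. outs s \<subseteq> outs s' \<and>
     outs s' \<subseteq> outs s \<union> {(p, q). p < n \<and> q < n \<and> edge x y r p q} \<and> nmem s' ''m'' 0 \<le> nmem s ''m'' 0 + n \<and>
     (\<forall>k<n. \<forall>i<L. (\<forall>i'<i. lex3 (Ti s (of_rat a) (of_rat b) i') (Tq s (nmem s ''ord'' k))) \<longrightarrow>
        \<not> lex3 (Ti s (of_rat a) (of_rat b) i) (Tq s (nmem s ''ord'' k)) \<longrightarrow> edge x y r (nmem s ''wA'' i) (nmem s ''ord'' k) \<longrightarrow>
        (nmem s ''wA'' i, nmem s ''ord'' k) \<in> outs s'))"
proof -
  let ?T = "Ti s (of_rat a) (of_rat b)" and ?w = "nmem s ''wA''" and ?o = "nmem s ''ord''"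
  define I where "I = (\<lambda>s' :: store. nmem s' ''i'' 0 \<le> L \<and> nmem s' ''k'' 0 \<le> n \<and> outs s \<subseteq> outs s' \<and>
     outs s' \<subseteq> outs s \<union> {(p, q). p < n \<and> q < n \<and> edge x y r p q} \<and> nmem s' ''m'' 0 \<le> nmem s ''m'' 0 + nmem s' ''k'' 0 \<and>
     (\<forall>i'<nmem s' ''i'' 0. \<forall>k. nmem s' ''k'' 0 \<le> k \<longrightarrow> k < n \<longrightarrow> lex3 (?T i') (Tq s (?o k))) \<and>
     (\<forall>k<nmem s' ''k'' 0. \<forall>i<L. (\<forall>i'<i. lex3 (?T i') (Tq s (?o k))) \<longrightarrow>
        \<not> lex3 (?T i) (Tq s (?o k)) \<longrightarrow> edge x y r (?w i) (?o k) \<longrightarrow> (?w i, ?o k) \<in> outs s'))"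
  have oo: "outs (nwrite a' j v s0) = outs s0" if "a' \<in> {''k'', ''i'', ''p'', ''q''}" for a' j v s0 using that by (auto simp: outs_def)
  show ?thesis unfolding query_def fst_conv snd_conv
  proof (rule run_lf_seq[OF _ _ run_while_lf[where I = I and \<psi> = "\<lambda>s'. (L - nmem s' ''i'' 0) + (n - nmem s' ''k'' 0)" and
     T = "kw qcond (qbody a b) * Suc (L + n)"]], goal_cases)
    case 3 then show ?case by (simp add: I_def oo)
  next
    case 4 show ?case by (simp add: qbody_def qpre_def fex_emit)
  next
    case (5 s1)
    have un: "nmem s1 a' = nmem s a'" if "a' \<in> {''n'', ''len'', ''wA'', ''ord''}" for a'
      using unch_n[OF 5(3), of a'] that by (auto simp: qbody_def qpre_def emit_def)
    have ur: "rmem s1 a' = rmem s a'" for a'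
      using unch_r[OF 5(3), of a'] by (simp add: qbody_def qpre_def emit_def)
    define i where "i = nmem s1 ''i'' 0"
    define k where "k = nmem s1 ''k'' 0"
    have ik: "i < L" "k < n" using 5(5) n L by (auto simp: qcond_def i_def k_def un)
    have J: "outs s \<subseteq> outs s1" "outs s1 \<subseteq> outs s \<union> {(p, q). p < n \<and> q < n \<and> edge x y r p q}" "nmem s1 ''m'' 0 \<le> nmem s ''m'' 0 + k"
     "\<forall>i'<i. \<forall>k'. k \<le> k' \<longrightarrow> k' < n \<longrightarrow> lex3 (?T i') (Tq s (?o k'))"
     "\<forall>k'<k. \<forall>i<L. (\<forall>i'<i. lex3 (?T i') (Tq s (?o k'))) \<longrightarrow>
        \<not> lex3 (?T i) (Tq s (?o k')) \<longrightarrow> edge x y r (?w i) (?o k') \<longrightarrow> (?w i, ?o k') \<in> outs s1"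
      using 5(2)[unfolded I_def] unfolding i_def k_def by - (elim conjE, assumption)+
    have I1: "outs s \<subseteq> outs s1" "outs s1 \<subseteq> outs s \<union> {(p, q). p < n \<and> q < n \<and> edge x y r p q}" "nmem s1 ''m'' 0 \<le> nmem s ''m'' 0 + k"
     "\<And>i' k'. i' < i \<Longrightarrow> k \<le> k' \<Longrightarrow> k' < n \<Longrightarrow> lex3 (?T i') (Tq s (?o k'))"
     "\<And>k' i. k' < k \<Longrightarrow> i < L \<Longrightarrow> (\<forall>i'<i. lex3 (?T i') (Tq s (?o k'))) \<Longrightarrow>
        \<not> lex3 (?T i) (Tq s (?o k')) \<Longrightarrow> edge x y r (?w i) (?o k') \<Longrightarrow> (?w i, ?o k') \<in> outs s1"
      using J(1,2,3) J(4)[rule_format] J(5)[rule_format] by simp_all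
    define s2 where "s2 = nwrite ''q'' 0 (?o k) (nwrite ''p'' 0 (?w i) s1)"
    have s2: "fex qpre s1 = s2"
      by (simp add: s2_def i_def k_def un qpre_def)
    have B: "?w i \<le> B" "?o k \<le> B" using wn[of i] on[of k] ik n by auto
    have op: "okw B qpre s1" using B by (simp add: qpre_def un i_def[symmetric] k_def[symmetric])
    have kk: "nmem s2 ''i'' 0 = i" "nmem s2 ''k'' 0 = k" by (simp_all add: s2_def i_def k_def)
    have ql: "bval (qless a b) s2 \<longleftrightarrow> lex3 (?T i) (Tq s (?o k))"
      by (auto simp: qless_def blex_def lex3_def Ti_def Tq_def s2_def ur un i_def[symmetric])
    show ?case
    proof (cases "lex3 (?T i) (Tq s (?o k))")
      case True
      have f: "fex (qbody a b) s1 = nwrite ''i'' 0 (Suc i) s2"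
        using True ql kk by (simp add: qbody_def s2)
      have ok: "okw B (qbody a b) s1" using True ql op ik L kk
        by (simp add: qbody_def s2)
      have "lex3 (?T i') (Tq s (?o k'))" if "i' < Suc i" "k \<le> k'" "k' < n" for i' k'
      proof (cases "i' = i")
        case True2: True
        have "\<not> lex3 (Tq s (?o k')) (Tq s (?o k))" using so[OF that(2,3)] .
        then show ?thesis using True True2 lex3_neg_trans by blast
      next
        case False then show ?thesis using I1(4) that by simp
      qed
      then have "I (nwrite ''i'' 0 (Suc i) s2)" using I1 ik by (simp add: I_def oo s2_def k_def[symmetric])
      then show ?thesis using ok f ik by (simp add: s2_def i_def k_def)
    next
      case False
      define s3 where "s3 = fex emit s2"
      have k3: "nmem s3 ''k'' 0 = k" using kk by (simp add: s3_def fex_emit)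
      have f: "fex (qbody a b) s1 = nwrite ''k'' 0 (Suc k) s3"
        using False ql k3 by (simp add: qbody_def s2 s3_def[symmetric])
      have m3: "Suc (nmem s1 ''m'' 0) \<le> B" using I1(3) ik m by simp
      have "okw B emit s2" by (rule fex_emit(6)) (use B m3 in \<open>auto simp: s2_def\<close>)
      then have ok: "okw B (qbody a b) s1" using False ql op ik n k3
        by (simp add: qbody_def s2 s3_def[symmetric])
      have o3: "outs s3 = outs s1 \<union> (if edge x y r (?w i) (?o k) then {(?w i, ?o k)} else {})"
        using st by (simp add: s3_def fex_emit) (simp add: s2_def oo ur static_def)
      have m4: "nmem s3 ''m'' 0 \<le> Suc (nmem s1 ''m'' 0)" using fex_emit(2)[of s2] by (simp add: s3_def) (simp add: s2_def)
      have i3: "nmem s3 ''i'' 0 = i" by (simp add: s3_def fex_emit) (simp add: s2_def i_def)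
      have dn: "(?w i2, ?o k') \<in> outs s3" if "k' < Suc k" "i2 < L" "\<forall>i'<i2. lex3 (?T i') (Tq s (?o k'))"
        "\<not> lex3 (?T i2) (Tq s (?o k'))" "edge x y r (?w i2) (?o k')" for k' i2
      proof (cases "k' = k")
        case True
        \<comment> \<open>Both are the first item not below the site.\<close>
        have "i2 = i"
        proof (rule linorder_cases[of i2 i])
          assume "i2 < i" then show ?thesis using I1(4)[of i2 k] that(4) True ik by auto
        next
          assume "i < i2" then show ?thesis using that(3) False True by auto
        qed
        then show ?thesis using that(5) True by (simp add: o3)
      next
        case False2: False then show ?thesis using I1(5)[of k' i2] that by (simp add: o3)
      qed
      have "outs s3 \<subseteq> outs s \<union> {(p, q). p < n \<and> q < n \<and> edge x y r p q}"
        using I1(2) wn[OF ik(1)] on[OF ik(2)] unfolding o3 by auto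
      then have "I (nwrite ''k'' 0 (Suc k) s3)" using I1(1,3,4) m4 i3 ik dn by (auto simp: I_def oo o3)
      then show ?thesis using ok f ik i3 by (simp add: i_def k_def)
    qed
  next
    case (6 s')
    have un: "nmem s' a' = nmem s a'" if "a' \<in> {''n'', ''len'', ''wA'', ''ord''}" for a'
      using unch_n[OF 6(3), of a'] that by (auto simp: qbody_def qpre_def emit_def)
    have c: "nmem s' ''i'' 0 \<ge> L \<or> nmem s' ''k'' 0 \<ge> n" using 6(5) n L by (auto simp: qcond_def un)
    have I: "nmem s' ''i'' 0 \<le> L" "nmem s' ''k'' 0 \<le> n" "outs s \<subseteq> outs s'" "outs s' \<subseteq> outs s \<union> {(p, q). p < n \<and> q < n \<and> edge x y r p q}" "nmem s' ''m'' 0 \<le> nmem s ''m'' 0 + nmem s' ''k'' 0"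
      "\<forall>i'<nmem s' ''i'' 0. \<forall>k. nmem s' ''k'' 0 \<le> k \<longrightarrow> k < n \<longrightarrow> lex3 (?T i') (Tq s (?o k))"
      "\<forall>k<nmem s' ''k'' 0. \<forall>i<L. (\<forall>i'<i. lex3 (?T i') (Tq s (?o k))) \<longrightarrow>
        \<not> lex3 (?T i) (Tq s (?o k)) \<longrightarrow> edge x y r (?w i) (?o k) \<longrightarrow> (?w i, ?o k) \<in> outs s'"
      using 6(2)[unfolded I_def] by - (elim conjE, assumption)+
    have "(?w i, ?o k) \<in> outs s'" if "k < n" "i < L" "\<forall>i'<i. lex3 (?T i') (Tq s (?o k))"
        "\<not> lex3 (?T i) (Tq s (?o k))" "edge x y r (?w i) (?o k)" for k i
    proof (cases "k < nmem s' ''k'' 0")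
      case True then show ?thesis using I(7)[rule_format, OF True] that by blast
    next
      case False
      then have "L \<le> nmem s' ''i'' 0" using c that by auto
      then show ?thesis using I(6)[rule_format, of i k] that False by auto
    qed
    moreover have "nmem s' ''m'' 0 \<le> nmem s ''m'' 0 + n" using I(2,5) by linarith
    ultimately show ?case using I(3,4) by blast
  next
    case 7 then show ?case by simp
  next
    case 8
    have "tmax (setn ''i'' (NConst 0);; setn ''k'' (NConst 0)) * 1 \<le> tmax (setn ''i'' (NConst 0);; setn ''k'' (NConst 0)) * Suc (L + n)" by (rule mult_le_mono2) simp
    then show ?case unfolding kquery_def add_mult_distrib fst_conv snd_conv by simp
  qed (auto simp: qbody_def qpre_def)
qed


section \<open>Counting sort of the sites by grid cell\<close>

text \<open>For nondecreasing \<open>C\<close> this is the start of the run of equal values around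
  \<open>k\<close>. Being a natural number, it can stand in as an address for a column, whose index
  is available only as a real.\<close>

fun gs :: "(nat \<Rightarrow> real) \<Rightarrow> nat \<Rightarrow> nat" where
  "gs C 0 = 0"
| "gs C (Suc k) = (if C k < C (Suc k) then Suc k else gs C k)"

lemma gs_le: "gs C k \<le> k" by (induction k) (auto intro: le_SucI)

lemma gs_props:
  assumes "\<And>i j. i \<le> j \<Longrightarrow> j \<le> k \<Longrightarrow> C i \<le> C j"
  shows "C (gs C k) = C k \<and> (\<forall>i<gs C k. C i < C k)"
  using assms
proof (induction k)
  case (Suc k)
  have IH: "C (gs C k) = C k" "\<forall>i<gs C k. C i < C k" using Suc by auto
  have le: "C k \<le> C (Suc k)" using Suc.prems by simp
  show ?case
  proof (cases "C k < C (Suc k)")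
    case True
    have "C i < C (Suc k)" if "i < Suc k" for i using Suc.prems[of i k] that True by simp
    then show ?thesis using True by simp
  next
    case False then show ?thesis using IH le by simp
  qed
qed simp

lemma gs_less_iff:
  assumes m: "\<And>i j. i \<le> j \<Longrightarrow> j < n \<Longrightarrow> C i \<le> C j" and k: "k < n" "k' < n"
  shows "gs C k' < gs C k \<longleftrightarrow> k' < gs C k" "gs C k' < gs C k \<longleftrightarrow> C k' < C k" "gs C k' = gs C k \<longleftrightarrow> C k' = C k"
proof -
  have P: "C (gs C j) = C j" "i < gs C j \<Longrightarrow> C i < C j" if "j < n" for i j
    using gs_props[of j C] m that by auto
  have 1: "gs C k' < gs C k \<longleftrightarrow> k' < gs C k" if k: "k < n" "k' < n" for k k'
  proof
    assume "gs C k' < gs C k"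
    then have "C k' < C k" using P(2)[OF k(1)] P(1)[OF k(2)] by metis
    then show "k' < gs C k" using m[of "gs C k" k'] P(1)[OF k(1)] k by force
  qed (use gs_le[of C k'] in auto)
  have 2: "gs C k' < gs C k \<longleftrightarrow> C k' < C k" if k: "k < n" "k' < n" for k k'
  proof
    assume "gs C k' < gs C k"
    then show "C k' < C k" using P(2)[OF k(1)] P(1)[OF k(2)] by metis
  next
    assume "C k' < C k"
    then have "k' < gs C k" using m[of "gs C k" k'] P(1)[OF k(1)] k by force
    then show "gs C k' < gs C k" using 1 k by blast
  qed
  show "gs C k' < gs C k \<longleftrightarrow> k' < gs C k" "gs C k' < gs C k \<longleftrightarrow> C k' < C k" using 1 2 k by blast+
  show "gs C k' = gs C k \<longleftrightarrow> C k' = C k" using 2[OF k] 2[OF k(2,1)] by (metis less_irrefl linorder_neqE)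
qed

text \<open>The position of \<open>j\<close> under a stable sort by \<open>\<kappa>\<close>.\<close>

definition rk :: "(nat \<Rightarrow> nat) \<Rightarrow> nat \<Rightarrow> nat \<Rightarrow> nat" where
  "rk \<kappa> n j = card {i. i < n \<and> (\<kappa> i < \<kappa> j \<or> \<kappa> i = \<kappa> j \<and> i < j)}"

lemma rk_less:
  assumes "\<kappa> j < \<kappa> j' \<or> \<kappa> j = \<kappa> j' \<and> j < j'" "j < n" shows "rk \<kappa> n j < rk \<kappa> n j'"
  unfolding rk_def
proof (rule psubset_card_mono)
  show "{i. i < n \<and> (\<kappa> i < \<kappa> j \<or> \<kappa> i = \<kappa> j \<and> i < j)} \<subset> {i. i < n \<and> (\<kappa> i < \<kappa> j' \<or> \<kappa> i = \<kappa> j' \<and> i < j')}"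
    using assms by (intro psubsetI) auto
qed simp

lemma rk_less_iff:
  assumes "j < n" "j' < n" shows "rk \<kappa> n j < rk \<kappa> n j' \<longleftrightarrow> \<kappa> j < \<kappa> j' \<or> \<kappa> j = \<kappa> j' \<and> j < j'"
  using rk_less[of \<kappa> j j' n] rk_less[of \<kappa> j' j n] assms by (metis less_asym linorder_neqE_nat less_irrefl)

lemma rk_bij: "bij_betw (rk \<kappa> n) {..<n} {..<n}"
proof -
  have inj: "inj_on (rk \<kappa> n) {..<n}"
  proof (rule inj_onI)
    fix i j assume ij: "i \<in> {..<n}" "j \<in> {..<n}" "rk \<kappa> n i = rk \<kappa> n j"
    then show "i = j" using rk_less[of \<kappa> i j n] rk_less[of \<kappa> j i n] by (metis lessThan_iff linorder_neqE_nat less_irrefl)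
  qed
  have "rk \<kappa> n j < n" if "j < n" for j
  proof -
    have "rk \<kappa> n j < card {..<n}" unfolding rk_def by (rule psubset_card_mono) (use that in auto)
    then show ?thesis by simp
  qed
  then have "rk \<kappa> n ` {..<n} \<subseteq> {..<n}" by auto
  then have "rk \<kappa> n ` {..<n} = {..<n}" using card_image[OF inj] by (intro card_subset_eq) auto
  then show ?thesis using inj by (simp add: bij_betw_def)
qed

text \<open>In a counting sort the next free slot of a class is the number of elements in smaller
  classes plus the number of members already placed. Naming each class by its start position makes
  the first summand the key itself.\<close>

lemma rk_pos:
  assumes "\<kappa> j = card {i. i < n \<and> \<kappa> i < \<kappa> j}" "j \<le> n"
  shows "\<kappa> j + card {i. i < j \<and> \<kappa> i = \<kappa> j} = rk \<kappa> n j"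
proof -
  have "{i. i < n \<and> (\<kappa> i < \<kappa> j \<or> \<kappa> i = \<kappa> j \<and> i < j)} = {i. i < n \<and> \<kappa> i < \<kappa> j} \<union> {i. i < j \<and> \<kappa> i = \<kappa> j}"
    using assms(2) by auto
  moreover have "card ({i. i < n \<and> \<kappa> i < \<kappa> j} \<union> {i. i < j \<and> \<kappa> i = \<kappa> j}) = card {i. i < n \<and> \<kappa> i < \<kappa> j} + card {i. i < j \<and> \<kappa> i = \<kappa> j}"
    by (rule card_Un_disjoint) auto
  ultimately have "rk \<kappa> n j = card {i. i < n \<and> \<kappa> i < \<kappa> j} + card {i. i < j \<and> \<kappa> i = \<kappa> j}"
    unfolding rk_def by simp
  then show ?thesis using arg_cong2[where f = "(+)", OF assms(1) refl] by (rule trans[OF _ sym, rotated])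
qed

text \<open>In the order of \<open>X\<close> the columns form runs; this pass computes the cell of
  each site and records where the run of its column starts.\<close>

definition lv1_pre :: com where
  "lv1_pre = (setn ''p'' (NRead ''px'' (V ''k''));; RAssign ''cc'' (V ''p'') (RCell (RRead ''X'' (V ''p'')) (V ''lev''));;
     RAssign ''cw'' (V ''p'') (RCell (RRead ''Y'' (V ''p'')) (V ''lev'')))"
definition lv1_cond :: bexp where
  "lv1_cond = And (NLess (NConst 0) (V ''k'')) (Not (RLess (RRead ''cc'' (NRead ''px'' (NSub (V ''k'') (NConst 1)))) (RRead ''cc'' (V ''p''))))"
definition lv1_post :: com where
  "lv1_post = (NAssign ''cs'' (V ''p'') (V ''st'');; NAssign ''pos'' (V ''k'') (V ''k'');; inc ''k'')"
definition lv1_body :: com where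
  "lv1_body = (lv1_pre;; If lv1_cond Skip (setn ''st'' (V ''k''));; lv1_post)"
lemmas lv1_defs = lv1_body_def lv1_pre_def lv1_cond_def lv1_post_def
text \<open>Sites are taken in the order of \<open>Y\<close>, and each is put into the next free
  slot of its column, so the result is ordered by column and then by \<open>Y\<close>.\<close>

definition lv2_body :: com where
  "lv2_body = (setn ''q'' (NRead ''py'' (V ''k''));; setn ''p'' (NRead ''cs'' (V ''q''));;
     NAssign ''ord'' (NRead ''pos'' (V ''p'')) (V ''q'');; NAssign ''pos'' (V ''p'') (NAdd (NRead ''pos'' (V ''p'')) (NConst 1));; inc ''k'')"
definition lv3_pre :: com where
  "lv3_pre = (setn ''q'' (NRead ''ord'' (V ''k''));; setn ''p'' (NRead ''ord'' (NSub (V ''k'') (NConst 1))))"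
definition lv3_cond :: bexp where
  "lv3_cond = And (NLess (NConst 0) (V ''k'')) (Or (RLess (RRead ''cc'' (V ''p'')) (RRead ''cc'' (V ''q'')))
          (RLess (RRead ''cw'' (V ''p'')) (RRead ''cw'' (V ''q''))))"
definition lv3_post :: com where
  "lv3_post = (NAssign ''cid'' (V ''q'') (V ''id'');; inc ''k'')"
definition lv3_body :: com where
  "lv3_body = (lv3_pre;; If lv3_cond (inc ''id'') Skip;; lv3_post)"
lemmas lv3_defs = lv3_body_def lv3_pre_def lv3_cond_def lv3_post_def
definition kn :: bexp where "kn = NLess (V ''k'') (V ''n'')"

lemma run_lv1:
  assumes n: "nmem s ''n'' 0 = n" "Suc n \<le> B" and k: "nmem s ''k'' 0 = 0" and px: "bij_betw (nmem s ''px'') {..<n} {..<n}"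
  defines "Cx \<equiv> (\<lambda>q. real_of_int (cell_index (rmem s ''X'' q) (nmem s ''lev'' 0)))" and "Cy \<equiv> (\<lambda>q. real_of_int (cell_index (rmem s ''Y'' q) (nmem s ''lev'' 0)))"
  defines "C \<equiv> (\<lambda>k. Cx (nmem s ''px'' k))"
  shows "run B (While kn lv1_body) s (kw kn lv1_body * Suc n) (\<lambda>s'.
     (\<forall>j<n. nmem s' ''cs'' (nmem s ''px'' j) = gs C j \<and> nmem s' ''pos'' j = j) \<and> (\<forall>q<n. rmem s' ''cc'' q = Cx q \<and> rmem s' ''cw'' q = Cy q))"
proof -
  define px where "px = nmem s ''px''"
  have inj: "px i = px j \<longleftrightarrow> i = j" if "i < n" "j < n" for i j
    using px that unfolding px_def bij_betw_def inj_on_def by blast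
  have pn: "px i < n" if "i < n" for i using px that unfolding px_def bij_betw_def by blast
  define I where "I = (\<lambda>s' :: store. nmem s' ''k'' 0 \<le> n \<and> (0 < nmem s' ''k'' 0 \<longrightarrow> nmem s' ''st'' 0 = gs C (nmem s' ''k'' 0 - 1)) \<and>
     (\<forall>j<nmem s' ''k'' 0. nmem s' ''cs'' (px j) = gs C j \<and> nmem s' ''pos'' j = j \<and> rmem s' ''cc'' (px j) = Cx (px j) \<and> rmem s' ''cw'' (px j) = Cy (px j)))"
  show ?thesis
  proof (rule run_while_lf[where I = I and \<psi> = "\<lambda>s'. n - nmem s' ''k'' 0"], goal_cases)
    case 1 show ?case using k by (simp add: I_def)
  next
    case 2 show ?case by (simp add: lv1_defs)
  next
    case (3 s')
    have u: "nmem s' ''n'' 0 = n" "nmem s' ''px'' = px" "rmem s' ''X'' = rmem s ''X''" "rmem s' ''Y'' = rmem s ''Y''" "nmem s' ''lev'' 0 = nmem s ''lev'' 0"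
      using 3(2) n by (simp_all add: unch_def lv1_defs px_def)
    define k where "k = nmem s' ''k'' 0"
    have kn: "k < n" using 3(4) u by (simp add: k_def kn_def)
    define st where "st = nmem s' ''st'' 0"
    have I: "0 < k \<longrightarrow> st = gs C (k - 1)"
      "\<forall>j<k. nmem s' ''cs'' (px j) = gs C j \<and> nmem s' ''pos'' j = j \<and> rmem s' ''cc'' (px j) = Cx (px j) \<and> rmem s' ''cw'' (px j) = Cy (px j)"
      using 3(1) unfolding I_def k_def st_def by simp_all
    have pk: "px (k - 1) \<noteq> px k" if "0 < k" using inj[of "k-1" k] kn that by simp
    have cp: "rmem s' ''cc'' (px (k - 1)) = C (k - 1)" if "0 < k" using I(2) that by (simp add: C_def px_def)
    have gk: "(if 0 < k \<and> \<not> C (k - 1) < C k then st else k) = gs C k" using I(1) by (cases k) auto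
    have stB: "nmem s' a i \<le> B" for a i using 3(3) by (simp add: nbnd_def)
    let ?s = "fex lv1_body s'"
    define s1 where "s1 = fex lv1_pre s'"
    have s1n: "nmem s1 = (nmem s')(''p'' := (nmem s' ''p'')(0 := px k))"
      by (simp add: s1_def lv1_pre_def u k_def[symmetric] fun_eq_iff)
    have s1r: "rmem s1 ''cc'' = (rmem s' ''cc'')(px k := Cx (px k))" "rmem s1 ''cw'' = (rmem s' ''cw'')(px k := Cy (px k))"
      by (simp_all add: s1_def lv1_pre_def u k_def[symmetric] Cx_def Cy_def)
    have Ck: "C k = Cx (px k)" by (simp add: C_def px_def)
    have cnd: "bval lv1_cond s1 \<longleftrightarrow> 0 < k \<and> \<not> C (k - 1) < C k"
      using pk cp by (auto simp: lv1_cond_def s1n s1r u k_def[symmetric] Ck)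
    define s2 where "s2 = (if bval lv1_cond s1 then s1 else nwrite ''st'' 0 k s1)"
    have s2: "fex lv1_body s' = fex lv1_post s2" by (simp add: lv1_body_def s1_def[symmetric] s2_def) (simp add: s1n k_def)
    have s2n: "nmem s2 ''p'' 0 = px k" "nmem s2 ''k'' 0 = k" "nmem s2 ''cs'' = nmem s' ''cs''" "nmem s2 ''pos'' = nmem s' ''pos''" "rmem s2 = rmem s1"
      by (simp_all add: s2_def s1n k_def)
    have s2st: "nmem s2 ''st'' 0 = gs C k" using gk unfolding s2_def cnd by (auto simp: s1n st_def split: if_splits)
    have f: "nmem ?s ''k'' 0 = Suc k" "nmem ?s ''cs'' = (nmem s' ''cs'')(px k := gs C k)" "nmem ?s ''pos'' = (nmem s' ''pos'')(k := k)"
      "rmem ?s ''cc'' = (rmem s' ''cc'')(px k := Cx (px k))" "rmem ?s ''cw'' = (rmem s' ''cw'')(px k := Cy (px k))" "nmem ?s ''st'' 0 = gs C k"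
      by (simp_all add: s2 lv1_post_def s2n s2st s1r)
    have "gs C k \<le> B" "px k \<le> B" using gs_le[of C k] pn[of k] kn n by auto
    then have "okw B lv1_pre s'" "okw B lv1_post s2" "k \<le> B" using kn n
      by (simp_all add: lv1_pre_def lv1_post_def u k_def[symmetric] s2n s2st)
    moreover have fi: "fex (If lv1_cond Skip (setn ''st'' (V ''k''))) s1 = s2" by (simp add: s2_def s1n k_def)
    ultimately have ok: "okw B lv1_body s'" unfolding lv1_body_def okw.simps(4) s1_def[symmetric] fi by (simp add: s1n k_def)
    have "I ?s" unfolding I_def f using I(2) kn inj by (auto simp: less_Suc_eq)
    then show ?case using ok f kn by (simp add: k_def)
  next
    case (4 s')
    have u: "nmem s' ''n'' 0 = n" using 4(2) n by (simp_all add: unch_def lv1_defs)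
    then have kk: "nmem s' ''k'' 0 = n" using 4(1,4) by (simp add: I_def kn_def)
    have "rmem s' ''cc'' q = Cx q \<and> rmem s' ''cw'' q = Cy q" if "q < n" for q
    proof -
      have "q \<in> px ` {..<n}" using px that unfolding px_def bij_betw_def by simp
      then obtain j where "j < n" "q = px j" by auto
      then show ?thesis using 4(1) kk by (simp add: I_def)
    qed
    then show ?case using 4(1) kk by (simp add: I_def px_def)
  next
    case 5 show ?case using k by simp
  qed
qed

lemma run_lv2:
  assumes n: "nmem s ''n'' 0 = n" "2 * n + 1 \<le> B" and k: "nmem s ''k'' 0 = 0"
    and po: "\<forall>j<n. nmem s ''pos'' j = j"
  defines "\<kappa> \<equiv> (\<lambda>j. nmem s ''cs'' (nmem s ''py'' j))"
  assumes \<kappa>: "\<And>j. j < n \<Longrightarrow> \<kappa> j < n" "\<And>j. j < n \<Longrightarrow> \<kappa> j = card {i. i < n \<and> \<kappa> i < \<kappa> j}"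
  shows "run B (While kn lv2_body) s (kw kn lv2_body * Suc n) (\<lambda>s'. \<forall>j<n. nmem s' ''ord'' (rk \<kappa> n j) = nmem s ''py'' j)"
proof -
  define I where "I = (\<lambda>s' :: store. nmem s' ''k'' 0 \<le> n \<and>
     (\<forall>c<n. nmem s' ''pos'' c = c + card {i. i < nmem s' ''k'' 0 \<and> \<kappa> i = c}) \<and>
     (\<forall>j<nmem s' ''k'' 0. nmem s' ''ord'' (rk \<kappa> n j) = nmem s ''py'' j))"
  have rki: "rk \<kappa> n i = rk \<kappa> n j \<longleftrightarrow> i = j" if "i < n" "j < n" for i j
    using rk_bij[of \<kappa> n] that unfolding bij_betw_def inj_on_def by blast
  show ?thesis
  proof (rule run_while_lf[where I = I and \<psi> = "\<lambda>s'. n - nmem s' ''k'' 0"], goal_cases)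
    case 1 show ?case using k po by (simp add: I_def)
  next
    case 2 show ?case by (simp add: lv2_body_def)
  next
    case (3 s')
    have u: "nmem s' ''n'' 0 = n" "nmem s' ''py'' = nmem s ''py''" "nmem s' ''cs'' = nmem s ''cs''"
      using 3(2) n by (simp_all add: unch_def lv2_body_def)
    define k where "k = nmem s' ''k'' 0"
    have kn: "k < n" using 3(4) u by (simp add: k_def kn_def)
    have I: "\<forall>c<n. nmem s' ''pos'' c = c + card {i. i < k \<and> \<kappa> i = c}" "\<forall>j<k. nmem s' ''ord'' (rk \<kappa> n j) = nmem s ''py'' j"
      using 3(1) unfolding I_def k_def by simp_all
    have stB: "nmem s' a i \<le> B" for a i using 3(3) by (simp add: nbnd_def)
    have c: "nmem s ''cs'' (nmem s ''py'' k) = \<kappa> k" by (simp add: \<kappa>_def)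
    have pk: "nmem s' ''pos'' (\<kappa> k) = rk \<kappa> n k" using I(1) \<kappa>[OF kn] rk_pos[of \<kappa> k n] kn by simp
    have rn: "rk \<kappa> n k < n" using rk_bij[of \<kappa> n] kn unfolding bij_betw_def by blast
    let ?s = "fex lv2_body s'"
    have f: "nmem ?s ''k'' 0 = Suc k" "nmem ?s ''ord'' = (nmem s' ''ord'')(rk \<kappa> n k := nmem s ''py'' k)"
       "nmem ?s ''pos'' = (nmem s' ''pos'')(\<kappa> k := Suc (rk \<kappa> n k))"
      by (simp_all add: lv2_body_def u k_def[symmetric] c pk)
    have ok: "okw B lv2_body s'" using stB[of "''py''" k] stB[of "''cs''" "nmem s ''py'' k"] kn n rn
      by (simp add: lv2_body_def u k_def[symmetric] c pk)
    have "card {i. i < Suc k \<and> \<kappa> i = c} = (if c = \<kappa> k then Suc (card {i. i < k \<and> \<kappa> i = c}) else card {i. i < k \<and> \<kappa> i = c})" for c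
    proof (cases "c = \<kappa> k")
      case True
      then have "{i. i < Suc k \<and> \<kappa> i = c} = insert k {i. i < k \<and> \<kappa> i = c}" by (auto simp: less_Suc_eq)
      then show ?thesis using True by simp
    next
      case False
      then have "{i. i < Suc k \<and> \<kappa> i = c} = {i. i < k \<and> \<kappa> i = c}" by (auto simp: less_Suc_eq)
      then show ?thesis using False by simp
    qed
    then have "I ?s" unfolding I_def f using I kn \<kappa>(1)[OF kn] pk rki by (auto simp: less_Suc_eq)
    then show ?case using ok f kn by (simp add: k_def)
  next
    case (4 s')
    have u: "nmem s' ''n'' 0 = n" using 4(2) n by (simp_all add: unch_def lv2_body_def)
    then have kk: "nmem s' ''k'' 0 = n" using 4(1,4) by (simp add: I_def kn_def)
    then show ?case using 4(1) by (simp add: I_def)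
  next
    case 5 show ?case using k by simp
  qed
qed

fun gi :: "(nat \<Rightarrow> bool) \<Rightarrow> nat \<Rightarrow> nat" where
  "gi D 0 = 0"
| "gi D (Suc k) = (if D (Suc k) then Suc (gi D k) else gi D k)"

lemma gi_le: "gi D k \<le> k" by (induction k) (auto intro: le_SucI)

lemma gi_mono: "i \<le> j \<Longrightarrow> gi D i \<le> gi D j"
  by (induction j) (auto simp: le_Suc_eq)

lemma gi_eq: "i \<le> j \<Longrightarrow> gi D i = gi D j \<longleftrightarrow> (\<forall>k. i < k \<and> k \<le> j \<longrightarrow> \<not> D k)"
proof (induction j)
  case (Suc j)
  show ?case
  proof (cases "i = Suc j")
    case False
    then have "i \<le> j" using Suc.prems by simp
    moreover from this have "(\<forall>k. i < k \<and> k \<le> Suc j \<longrightarrow> \<not> D k) \<longleftrightarrow> (\<forall>k. i < k \<and> k \<le> j \<longrightarrow> \<not> D k) \<and> \<not> D (Suc j)"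
      by (metis le_Suc_eq le_imp_less_Suc)
    ultimately show ?thesis using Suc.IH gi_mono[of i j D] by simp
  qed auto
qed simp

lemma run_lv3:
  assumes n: "nmem s ''n'' 0 = n" "Suc n \<le> B" and k: "nmem s ''k'' 0 = 0" "nmem s ''id'' 0 = 0"
    and o: "bij_betw (nmem s ''ord'') {..<n} {..<n}"
  defines "D \<equiv> (\<lambda>k. rmem s ''cc'' (nmem s ''ord'' (k - 1)) < rmem s ''cc'' (nmem s ''ord'' k) \<or> rmem s ''cw'' (nmem s ''ord'' (k - 1)) < rmem s ''cw'' (nmem s ''ord'' k))"
  shows "run B (While kn lv3_body) s (kw kn lv3_body * Suc n) (\<lambda>s'. \<forall>j<n. nmem s' ''cid'' (nmem s ''ord'' j) = gi D j)"
proof -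
  define od where "od = nmem s ''ord''"
  have inj: "od i = od j \<longleftrightarrow> i = j" if "i < n" "j < n" for i j
    using o that unfolding od_def bij_betw_def inj_on_def by blast
  \<comment> \<open>At \<open>k = 0\<close> truncated subtraction yields \<open>gi D 0 = 0\<close>,
    the initial value of \<open>id\<close>.\<close>
  define I where "I = (\<lambda>s' :: store. nmem s' ''k'' 0 \<le> n \<and> nmem s' ''id'' 0 = gi D (nmem s' ''k'' 0 - 1) \<and>
     (\<forall>j<nmem s' ''k'' 0. nmem s' ''cid'' (od j) = gi D j))"
  show ?thesis
  proof (rule run_while_lf[where I = I and \<psi> = "\<lambda>s'. n - nmem s' ''k'' 0"], goal_cases)
    case 1 show ?case using k by (simp add: I_def)
  next
    case 2 show ?case by (simp add: lv3_defs)
  next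
    case (3 s')
    have u: "nmem s' ''n'' 0 = n" "nmem s' ''ord'' = od" "rmem s' ''cc'' = rmem s ''cc''" "rmem s' ''cw'' = rmem s ''cw''"
      using 3(2) n by (simp_all add: unch_def lv3_defs od_def)
    define k where "k = nmem s' ''k'' 0"
    have kn: "k < n" using 3(4) u by (simp add: k_def kn_def)
    have I: "nmem s' ''id'' 0 = gi D (k - 1)" "\<forall>j<k. nmem s' ''cid'' (od j) = gi D j"
      using 3(1) unfolding I_def k_def by simp_all
    have stB: "nmem s' a i \<le> B" for a i using 3(3) by (simp add: nbnd_def)
    have Dk: "D k \<longleftrightarrow> rmem s ''cc'' (od (k - 1)) < rmem s ''cc'' (od k) \<or> rmem s ''cw'' (od (k - 1)) < rmem s ''cw'' (od k)"
      by (simp add: D_def od_def)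
    have g: "0 < k \<Longrightarrow> D k \<Longrightarrow> gi D k = Suc (gi D (k - 1))" "\<not> (0 < k \<and> D k) \<Longrightarrow> gi D k = gi D (k - 1)" by (cases k; auto)+
    let ?s = "fex lv3_body s'"
    define s1 where "s1 = fex lv3_pre s'"
    have s1n: "nmem s1 = (nmem s')(''q'' := (nmem s' ''q'')(0 := od k), ''p'' := (nmem s' ''p'')(0 := od (k - 1)))" and s1r: "rmem s1 = rmem s'"
      by (simp_all add: s1_def lv3_pre_def u k_def[symmetric] fun_eq_iff)
    have cnd: "bval lv3_cond s1 \<longleftrightarrow> 0 < k \<and> D k"
      by (auto simp: lv3_cond_def s1n s1r u k_def[symmetric] Dk)
    define s2 where "s2 = (if bval lv3_cond s1 then nwrite ''id'' 0 (Suc (gi D (k - 1))) s1 else s1)"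
    have fi: "fex (If lv3_cond (inc ''id'') Skip) s1 = s2" by (simp add: s2_def s1n I)
    have s2: "fex lv3_body s' = fex lv3_post s2" unfolding lv3_body_def fex.simps(4) s1_def[symmetric] fi ..
    have s2n: "nmem s2 ''q'' 0 = od k" "nmem s2 ''k'' 0 = k" "nmem s2 ''cid'' = nmem s' ''cid''"
      by (simp_all add: s2_def s1n k_def)
    have s2i: "nmem s2 ''id'' 0 = gi D k" using g I(1) unfolding s2_def cnd by (auto simp: s1n)
    have f: "nmem ?s ''k'' 0 = Suc k" "nmem ?s ''cid'' = (nmem s' ''cid'')(od k := gi D k)" "nmem ?s ''id'' 0 = gi D k"
      by (simp_all add: s2 lv3_post_def s2n s2i)
    have gB: "gi D k \<le> B" using gi_le[of D k] kn n by simp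
    have oB: "od j \<le> B" for j using stB[of "''ord''" j] by (simp add: u)
    have "okw B lv3_pre s'" "okw B lv3_post s2" using kn n gB oB
      by (simp_all add: lv3_pre_def lv3_post_def u k_def[symmetric] s2n s2i)
    moreover have "bval lv3_cond s1 \<Longrightarrow> Suc (gi D (k - 1)) \<le> B" using g gB unfolding cnd by simp
    ultimately have ok: "okw B lv3_body s'" unfolding lv3_body_def okw.simps(4) s1_def[symmetric] fi by (simp add: s1n I)
    have "I ?s" unfolding I_def f using I kn inj by (auto simp: less_Suc_eq)
    then show ?case using ok f kn by (simp add: k_def)
  next
    case (4 s')
    have u: "nmem s' ''n'' 0 = n" using 4(2) n by (simp_all add: unch_def lv3_defs)
    then have kk: "nmem s' ''k'' 0 = n" using 4(1,4) by (simp add: I_def kn_def)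
    then show ?case using 4(1) by (simp add: I_def od_def)
  next
    case 5 show ?case using k by simp
  qed
qed

section \<open>Grid cells\<close>

primrec qs :: "(rat \<times> rat) list \<Rightarrow> com" where
  "qs [] = Skip"
| "qs (ab # os) = (query ab;; qs os)"

primrec kqs :: "(rat \<times> rat) list \<Rightarrow> nat" where
  "kqs [] = 1"
| "kqs (ab # os) = kquery ab + kqs os"

definition qfound :: "store \<Rightarrow> (nat \<Rightarrow> nat \<Rightarrow> bool) \<Rightarrow> nat \<Rightarrow> nat \<Rightarrow> rat \<times> rat \<Rightarrow> (nat \<times> nat) set \<Rightarrow> bool" where
  "qfound s E n L ab F \<longleftrightarrow> (\<forall>k<n. \<forall>i<L. (\<forall>i'<i. lex3 (Ti s (of_rat (fst ab)) (of_rat (snd ab)) i') (Tq s (nmem s ''ord'' k))) \<longrightarrow>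
        \<not> lex3 (Ti s (of_rat (fst ab)) (of_rat (snd ab)) i) (Tq s (nmem s ''ord'' k)) \<longrightarrow> E (nmem s ''wA'' i) (nmem s ''ord'' k) \<longrightarrow>
        (nmem s ''wA'' i, nmem s ''ord'' k) \<in> F)"

lemma query_nw: "nw (query ab) = {''p'', ''q'', ''i'', ''k'', ''src'', ''dst'', ''m''}" "rw (query ab) = {}"
  by (auto simp: query_def qbody_def qpre_def emit_def)

lemma qs_nw: "nw (qs os) \<subseteq> {''p'', ''q'', ''i'', ''k'', ''src'', ''dst'', ''m''}" "rw (qs os) = {}"
  by (induction os) (auto simp: query_nw)

lemma run_qs:
  assumes n: "nmem s ''n'' 0 = n" "Suc n \<le> B" and L: "nmem s ''len'' 0 = L" "Suc L \<le> B" and st: "static x y r s"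
    and so: "\<And>j k. j \<le> k \<Longrightarrow> k < n \<Longrightarrow> \<not> lex3 (Tq s (nmem s ''ord'' k)) (Tq s (nmem s ''ord'' j))"
    and m: "nmem s ''m'' 0 + length os * n \<le> B" and wn: "\<And>i. i < L \<Longrightarrow> nmem s ''wA'' i < n" and on: "\<And>i. i < n \<Longrightarrow> nmem s ''ord'' i < n"
  shows "run B (qs os) s (kqs os * Suc (L + n)) (\<lambda>s'. outs s \<subseteq> outs s' \<and>
     outs s' \<subseteq> outs s \<union> {(p, q). p < n \<and> q < n \<and> edge x y r p q} \<and> nmem s' ''m'' 0 \<le> nmem s ''m'' 0 + length os * n \<and>
     (\<forall>ab\<in>set os. qfound s (edge x y r) n L ab (outs s')))"
  using n L st so m wn on
proof (induction os arbitrary: s)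
  case Nil
  show ?case unfolding qs.simps by (rule run_lf) auto
next
  case (Cons ab os)
  obtain a b where ab: "ab = (a, b)" by (cases ab)
  let ?E = "edge x y r"
  have 1: "run B (query ab) s (kquery ab * Suc (L + n)) (\<lambda>s'. outs s \<subseteq> outs s' \<and>
     outs s' \<subseteq> outs s \<union> {(p, q). p < n \<and> q < n \<and> ?E p q} \<and> nmem s' ''m'' 0 \<le> nmem s ''m'' 0 + n \<and> qfound s ?E n L ab (outs s'))"
    unfolding ab qfound_def fst_conv snd_conv by (rule run_query) (use Cons.prems in auto)
  show ?case unfolding qs.simps
  proof (rule run_seq[OF 1])
    fix s1 assume u: "unch (query ab) s s1" and Q: "outs s \<subseteq> outs s1 \<and>
     outs s1 \<subseteq> outs s \<union> {(p, q). p < n \<and> q < n \<and> ?E p q} \<and> nmem s1 ''m'' 0 \<le> nmem s ''m'' 0 + n \<and> qfound s ?E n L ab (outs s1)"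
    have un: "nmem s1 ''n'' = nmem s ''n''" "nmem s1 ''len'' = nmem s ''len''" "nmem s1 ''ord'' = nmem s ''ord''" "nmem s1 ''wA'' = nmem s ''wA''"
      using u by (simp_all add: unch_def query_nw)
    have ur: "rmem s1 = rmem s" using u by (auto simp: unch_def query_nw)
    have T: "Tq s1 = Tq s" "Ti s1 = Ti s" by (simp_all add: fun_eq_iff Tq_def Ti_def ur un)
    have qf: "qfound s1 = qfound s" by (simp add: fun_eq_iff qfound_def T un)
    show "run B (qs os) s1 (kqs os * Suc (L + n)) (\<lambda>s'. outs s \<subseteq> outs s' \<and>
     outs s' \<subseteq> outs s \<union> {(p, q). p < n \<and> q < n \<and> ?E p q} \<and> nmem s' ''m'' 0 \<le> nmem s ''m'' 0 + length (ab # os) * n \<and>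
     (\<forall>ab\<in>set (ab # os). qfound s ?E n L ab (outs s')))"
    proof (rule run_mono[OF Cons.IH[of s1]])
      show "static x y r s1" using Cons.prems(5) ur by (simp add: static_def)
      show "nmem s1 ''m'' 0 + length os * n \<le> B" using Cons.prems(7) Q by simp
      fix s' assume Q': "outs s1 \<subseteq> outs s' \<and>
     outs s' \<subseteq> outs s1 \<union> {(p, q). p < n \<and> q < n \<and> ?E p q} \<and> nmem s' ''m'' 0 \<le> nmem s1 ''m'' 0 + length os * n \<and>
     (\<forall>ab\<in>set os. qfound s1 ?E n L ab (outs s'))"
      have "qfound s ?E n L ab (outs s')" using Q Q' unfolding qfound_def by (meson subsetD)
      then show "outs s \<subseteq> outs s' \<and>
     outs s' \<subseteq> outs s \<union> {(p, q). p < n \<and> q < n \<and> ?E p q} \<and> nmem s' ''m'' 0 \<le> nmem s ''m'' 0 + length (ab # os) * n \<and>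
     (\<forall>ab\<in>set (ab # os). qfound s ?E n L ab (outs s'))" using Q Q' unfolding qf by auto
    qed (use Cons.prems un T in simp_all)
  qed (simp add: add_mult_distrib)
qed

section \<open>Initial items, and searching an envelope\<close>

text \<open>A selected site starts as a one-piece envelope over the strip from \<open>b0\<close>
  rows below its cell to \<open>b0\<close> rows above, which contains all rows an offset can
  reach.\<close>

definition bu_new :: "rat \<Rightarrow> com" where
  "bu_new b0 = (NAssign ''wA'' (V ''len'') (V ''q'');;
     RAssign ''bA'' (V ''len'') (RMul (RSub (RRead ''cw'' (V ''q'')) (RConst b0)) (RV ''s''));;
     RAssign ''eA'' (V ''len'') (RMul (RAdd (RRead ''cw'' (V ''q'')) (RConst (b0 + 1))) (RV ''s''));;
     inc ''len'';; NAssign ''bd'' (V ''len'') (V ''len''))"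
definition bu_body :: "bexp \<Rightarrow> rat \<Rightarrow> com" where
  "bu_body c b0 = (setn ''q'' (NRead ''ord'' (V ''k''));; If c (bu_new b0) Skip;; inc ''k'')"
definition build :: "bexp \<Rightarrow> rat \<Rightarrow> com" where
  "build c b0 = ((setn ''k'' (NConst 0);; setn ''len'' (NConst 0);; setn ''bd'' (NConst 0));; While kn (bu_body c b0))"
definition kbu :: "bexp \<Rightarrow> rat \<Rightarrow> nat" where
  "kbu c b0 = tmax (setn ''k'' (NConst 0);; setn ''len'' (NConst 0);; setn ''bd'' (NConst 0)) + kw kn (bu_body c b0)"

lemma run_build:
  assumes n: "nmem s ''n'' 0 = n" "Suc n \<le> B"
    and c: "\<And>s'. rmem s' ''ro'' = rmem s ''ro'' \<Longrightarrow> rmem s' ''s'' 0 = \<sigma> \<Longrightarrow> bval c s' \<longleftrightarrow> P (nmem s' ''q'' 0)" and sg: "rmem s ''s'' 0 = \<sigma>"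
  shows "run B (build c b0) s (kbu c b0 * Suc n) (\<lambda>s'. \<exists>L. nmem s' ''len'' 0 = L \<and> L \<le> n \<and>
     map (nmem s' ''wA'') [0..<L] = filter P (map (nmem s ''ord'') [0..<n]) \<and> (\<forall>j\<le>L. nmem s' ''bd'' j = j) \<and>
     (\<forall>i<L. rmem s' ''bA'' i = (rmem s ''cw'' (nmem s' ''wA'' i) - of_rat b0) * \<sigma> \<and>
        rmem s' ''eA'' i = (rmem s ''cw'' (nmem s' ''wA'' i) + (of_rat b0 + 1)) * \<sigma>))"
proof -
  define I where "I = (\<lambda>s' :: store. nmem s' ''k'' 0 \<le> n \<and> nmem s' ''len'' 0 \<le> nmem s' ''k'' 0 \<and>
     map (nmem s' ''wA'') [0..<nmem s' ''len'' 0] = filter P (map (nmem s ''ord'') [0..<nmem s' ''k'' 0]) \<and> (\<forall>j\<le>nmem s' ''len'' 0. nmem s' ''bd'' j = j) \<and>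
     (\<forall>i<nmem s' ''len'' 0. rmem s' ''bA'' i = (rmem s ''cw'' (nmem s' ''wA'' i) - of_rat b0) * \<sigma> \<and>
        rmem s' ''eA'' i = (rmem s ''cw'' (nmem s' ''wA'' i) + (of_rat b0 + 1)) * \<sigma>))"
  show ?thesis unfolding build_def
  proof (rule run_lf_seq[OF _ _ run_while_lf[where I = I and \<psi> = "\<lambda>s'. n - nmem s' ''k'' 0" and T = "kw kn (bu_body c b0) * Suc n"]], goal_cases)
    case 3 show ?case by (simp add: I_def)
  next
    case 4 show ?case by (simp add: bu_body_def bu_new_def)
  next
    case (5 s')
    have u: "nmem s' ''n'' 0 = n" "nmem s' ''ord'' = nmem s ''ord''" "rmem s' ''cw'' = rmem s ''cw''" "rmem s' ''ro'' = rmem s ''ro''" "rmem s' ''s'' 0 = \<sigma>"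
      using 5(3) n sg by (simp_all add: unch_def bu_body_def bu_new_def)
    define k where "k = nmem s' ''k'' 0"
    define L where "L = nmem s' ''len'' 0"
    define q where "q = nmem s ''ord'' k"
    have k: "k < n" using 5(5) u by (simp add: k_def kn_def)
    have I: "L \<le> k" "map (nmem s' ''wA'') [0..<L] = filter P (map (nmem s ''ord'') [0..<k])" "\<forall>j\<le>L. nmem s' ''bd'' j = j"
     "\<forall>i<L. rmem s' ''bA'' i = (rmem s ''cw'' (nmem s' ''wA'' i) - of_rat b0) * \<sigma> \<and>
        rmem s' ''eA'' i = (rmem s ''cw'' (nmem s' ''wA'' i) + (of_rat b0 + 1)) * \<sigma>"
      using 5(2)[unfolded I_def] unfolding k_def L_def by - (elim conjE, assumption)+
    define s1 where "s1 = nwrite ''q'' 0 q s'"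
    have s1: "fex (setn ''q'' (NRead ''ord'' (V ''k''))) s' = s1" by (simp add: s1_def u k_def q_def)
    have qB: "q \<le> B" using 5(4) u unfolding q_def by (metis nbnd_def)
    have cP: "bval c s1 \<longleftrightarrow> P q" using c[of s1] u by (simp add: s1_def)
    show ?case
    proof (cases "P q")
      case True
      define s2 where "s2 = fex (bu_new b0) s1"
      have s2n: "nmem s2 ''k'' 0 = k" "nmem s2 ''len'' 0 = Suc L" "nmem s2 ''wA'' = (nmem s' ''wA'')(L := q)" "nmem s2 ''bd'' = (nmem s' ''bd'')(Suc L := Suc L)"
        "rmem s2 ''bA'' = (rmem s' ''bA'')(L := (rmem s ''cw'' q - of_rat b0) * \<sigma>)"
        "rmem s2 ''eA'' = (rmem s' ''eA'')(L := (rmem s ''cw'' q + (of_rat b0 + 1)) * \<sigma>)"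
        by (simp_all add: s2_def bu_new_def s1_def L_def k_def u of_rat_add)
      have f: "fex (bu_body c b0) s' = nwrite ''k'' 0 (Suc k) s2"
        using True cP by (simp add: bu_body_def s1[simplified] s2_def[symmetric] s2n)
      have "okw B (bu_new b0) s1" using qB I(1) k n by (simp add: bu_new_def s1_def L_def[symmetric])
      then have ok: "okw B (bu_body c b0) s'"
        using True cP qB k n by (simp add: bu_body_def s1[simplified] s2_def[symmetric] s2n) (simp add: u k_def[symmetric] q_def[symmetric])
      have mw: "map (nmem s2 ''wA'') [0..<Suc L] = map (nmem s' ''wA'') [0..<L] @ [q]" by (simp add: s2n)
      have "map (nmem s2 ''wA'') [0..<Suc L] = filter P (map (nmem s ''ord'') [0..<Suc k])"
        unfolding mw I(2) using True by (simp add: q_def)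
      then have "I (nwrite ''k'' 0 (Suc k) s2)" using I k by (simp add: I_def s2n less_Suc_eq le_Suc_eq) linarith
      then show ?thesis using ok f k by (simp add: k_def)
    next
      case False
      have f: "fex (bu_body c b0) s' = nwrite ''k'' 0 (Suc k) s1"
        using False cP by (simp add: bu_body_def s1[simplified]) (simp add: s1_def k_def)
      have ok: "okw B (bu_body c b0) s'"
        using False cP qB k n by (simp add: bu_body_def s1[simplified]) (simp add: u k_def[symmetric] q_def[symmetric] s1_def)
      have "I (nwrite ''k'' 0 (Suc k) s1)" using I k False by (simp add: I_def s1_def L_def[symmetric] q_def)
      then show ?thesis using ok f k by (simp add: k_def)
    qed
  next
    case (6 s')
    have u: "nmem s' ''n'' 0 = n" using 6(3) n by (simp_all add: unch_def bu_body_def bu_new_def)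
    then have kk: "nmem s' ''k'' 0 = n" using 6(2,5) by (simp add: I_def kn_def)
    then show ?case using 6(2) by (simp add: I_def)
  next
    case 7 show ?case by simp
  next
    case 8
    have "tmax (setn ''k'' (NConst 0);; setn ''len'' (NConst 0);; setn ''bd'' (NConst 0)) * 1 \<le> tmax (setn ''k'' (NConst 0);; setn ''len'' (NConst 0);; setn ''bd'' (NConst 0)) * Suc n" by (rule mult_le_mono2) simp
    then show ?case unfolding kbu_def add_mult_distrib by simp
  qed auto
qed

context arcs begin

text \<open>Within the cell of \<open>p\<close> the pieces cover the whole strip in order, so the
  first piece ending at or above \<open>y\<close> contains \<open>y\<close>, and its site dominates
  \<open>p\<close> there. This is just the item at which the sweep stops.\<close>

lemma env_query:
  assumes e: "env G xs" and p: "p \<in> set G" and y: "lo (cid p) \<le> y" "y \<le> hi (cid p)"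
  shows "\<exists>i<length xs. cid (fst (xs ! i)) = cid p \<and> y \<le> snd (snd (xs ! i)) \<and> f p y \<le> f (fst (xs ! i)) y \<and>
    (\<forall>i'<i. cid (fst (xs ! i')) < cid p \<or> cid (fst (xs ! i')) = cid p \<and> snd (snd (xs ! i')) < y)"
proof -
  define w b en where "w i = fst (xs ! i)" and "b i = fst (snd (xs ! i))" and "en i = snd (snd (xs ! i))" for i
  have pc: "piece G (xs ! i)" if "i < length xs" for i using e that by (auto simp: env_def)
  have ad: "adj (xs ! i) (xs ! Suc i)" if "Suc i < length xs" for i using e that by (auto simp: env_def successively_conv_nth)
  have so: "sorted_wrt (\<lambda>(w, b, e) (w', b', e'). cid w < cid w' \<or> cid w = cid w' \<and> e \<le> b') xs"
    by (rule adj_sorted) (use e in \<open>auto simp: env_def piece_def\<close>)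
  have so: "cid (w i) \<le> cid (w j)" if "i < j" "j < length xs" for i j
    using sorted_wrt_nth_less[OF so that] by (auto simp: case_prod_unfold w_def)
  define S where "S = {i. i < length xs \<and> cid (w i) = cid p}"
  have "cid p \<in> cells xs" using e p by (auto simp: env_def)
  then obtain it where "it \<in> set xs" "cid (fst it) = cid p" by (auto simp: cells_def)
  then have Sne: "S \<noteq> {}" by (auto simp: S_def w_def in_set_conv_nth)
  have finS: "finite S" by (simp add: S_def)
  define j where "j = Max S"
  have jS: "j \<in> S" "\<And>i. i \<in> S \<Longrightarrow> i \<le> j" using finS Sne by (auto simp: j_def)
  \<comment> \<open>The last piece of the cell ends at \<open>hi\<close>, so the search for a piece
    ending at or above \<open>y\<close> succeeds.\<close>
  have ej: "en j = hi (cid p)"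
  proof (cases "Suc j < length xs")
    case True
    have "Suc j \<notin> S" using jS(2)[of "Suc j"] by auto
    then have "cid (w (Suc j)) \<noteq> cid (w j)" using True jS(1) by (simp add: S_def)
    then show ?thesis using ad[OF True] jS(1) by (auto simp: adj_def case_prod_unfold w_def en_def S_def)
  next
    case False
    then have j: "j = length xs - 1" "xs \<noteq> []" using jS(1) by (auto simp: S_def)
    then show ?thesis using e jS(1) by (auto simp: env_def atend_def case_prod_unfold last_conv_nth en_def w_def S_def)
  qed
  define i where "i = (LEAST i. i \<in> S \<and> y \<le> en i)"
  have ex: "j \<in> S \<and> y \<le> en j" using jS ej y by simp
  have i: "i \<in> S" "y \<le> en i" using LeastI[of "\<lambda>i. i \<in> S \<and> y \<le> en i", OF ex] by (simp_all add: i_def)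
  have min: "en k < y" if "k \<in> S" "k < i" for k using not_less_Least[OF that(2)[unfolded i_def]] that(1) by auto
  have iS: "i < length xs" "cid (w i) = cid p" using i by (auto simp: S_def)
  have bi: "b i \<le> y"
  proof (cases i)
    case 0
    then obtain x xs' where "xs = x # xs'" using iS by (cases xs) auto
    then have "b i = lo (cid (w i))" using e 0 by (cases x) (auto simp: env_def b_def w_def)
    then show ?thesis using iS y by simp
  next
    case (Suc k)
    have a: "adj (xs ! k) (xs ! Suc k)" using ad iS Suc by simp
    show ?thesis
    proof (cases "cid (w k) = cid p")
      case True
      then have "en k < y" using min[of k] iS Suc by (simp add: S_def)
      then show ?thesis using a True iS Suc by (auto simp: adj_def case_prod_unfold w_def en_def b_def)
    next
      case False
      then show ?thesis using a iS Suc y by (auto simp: adj_def case_prod_unfold w_def en_def b_def)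
    qed
  qed
  have "f p y \<le> f (w i) y" using pc[OF iS(1)] bi i(2) p iS(2) by (auto simp: piece_def case_prod_unfold w_def en_def b_def)
  moreover have "cid (w i') < cid p \<or> cid (w i') = cid p \<and> en i' < y" if "i' < i" for i'
    using so[OF that iS(1)] iS min[of i'] that by (auto simp: S_def)
  ultimately show ?thesis using iS i unfolding w_def en_def by blast
qed

end


lemma card_bij_lessThan:
  assumes "bij_betw f {..<n} {..<n::nat}" shows "card {i. i < n \<and> Q (f i)} = card {q. q < n \<and> Q q}"
proof (rule bij_betw_same_card[of f])
  show "bij_betw f {i. i < n \<and> Q (f i)} {q. q < n \<and> Q q}"
    unfolding bij_betw_def
  proof
    show "inj_on f {i. i < n \<and> Q (f i)}" using assms unfolding bij_betw_def inj_on_def by auto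
    have "f ` {..<n} = {..<n}" using assms by (simp add: bij_betw_def)
    note img = this
    show "f ` {i. i < n \<and> Q (f i)} = {q. q < n \<and> Q q}"
    proof (intro set_eqI iffI)
      fix q assume "q \<in> f ` {i. i < n \<and> Q (f i)}"
      then obtain i where "i < n" "Q (f i)" "q = f i" by auto
      moreover have "f i \<in> {..<n}" using imageI[of i "{..<n}" f] \<open>i < n\<close> unfolding img by simp
      ultimately show "q \<in> {q. q < n \<and> Q q}" by simp
    next
      fix q assume "q \<in> {q. q < n \<and> Q q}"
      then have "q \<in> f ` {..<n}" "Q q" unfolding img by auto
      then show "q \<in> f ` {i. i < n \<and> Q (f i)}" by auto
    qed
  qed
qed

lemma cell_index_bounds:
  "real_of_int (cell_index x i) * (2 ^ i / sqrt 2) \<le> x" "x < (real_of_int (cell_index x i) + 1) * (2 ^ i / sqrt 2)"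
proof -
  have p: "0 < 2 ^ i / sqrt 2" by simp
  have "real_of_int (cell_index x i) \<le> x / (2 ^ i / sqrt 2)" "x / (2 ^ i / sqrt 2) < real_of_int (cell_index x i) + 1"
    unfolding cell_index_def by linarith+
  then show "real_of_int (cell_index x i) * (2 ^ i / sqrt 2) \<le> x" "x < (real_of_int (cell_index x i) + 1) * (2 ^ i / sqrt 2)"
    using pos_le_divide_eq[OF p] pos_divide_less_eq[OF p] by blast+
qed

lemma cell_index_mono: "x \<le> y \<Longrightarrow> cell_index x i \<le> cell_index y i"
  unfolding cell_index_def by (intro floor_mono divide_right_mono) auto

section \<open>Order and numbering of the cells\<close>

definition order_phase :: com where
  "order_phase = ((setn ''id'' (NConst 0);; setn ''k'' (NConst 0));; While kn lv1_body;; setn ''k'' (NConst 0);; While kn lv2_body;;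
     setn ''k'' (NConst 0);; While kn lv3_body)"

definition korder :: nat where
  "korder = 5 + kw kn lv1_body + tmax (setn ''k'' (NConst 0)) + kw kn lv2_body + tmax (setn ''k'' (NConst 0)) + kw kn lv3_body + tmax (setn ''id'' (NConst 0);; setn ''k'' (NConst 0))"

definition lex2 :: "store \<Rightarrow> nat \<Rightarrow> nat \<Rightarrow> bool" where
  "lex2 s p q \<longleftrightarrow> rmem s ''cc'' p < rmem s ''cc'' q \<or> rmem s ''cc'' p = rmem s ''cc'' q \<and> rmem s ''cw'' p < rmem s ''cw'' q"

definition ordered :: "nat \<Rightarrow> store \<Rightarrow> bool" where
  "ordered n s \<longleftrightarrow> bij_betw (nmem s ''ord'') {..<n} {..<n} \<and>
     (\<forall>j k. j \<le> k \<longrightarrow> k < n \<longrightarrow> \<not> lex3 (Tq s (nmem s ''ord'' k)) (Tq s (nmem s ''ord'' j))) \<and>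
     (\<forall>p<n. \<forall>q<n. nmem s ''cid'' p < nmem s ''cid'' q \<longleftrightarrow> lex2 s p q)"

text \<open>In a lexicographically sorted list the cell changes exactly where the column or the row
  increases. The counter is therefore constant on a cell and grows from each cell to the
  next.\<close>

lemma cid_order:
  fixes od cid :: "nat \<Rightarrow> nat" and cc cw Y :: "nat \<Rightarrow> real"
  defines "L \<equiv> (\<lambda>p q. cc p < cc q \<or> cc p = cc q \<and> cw p < cw q)"
  defines "D \<equiv> (\<lambda>k. cc (od (k - 1)) < cc (od k) \<or> cw (od (k - 1)) < cw (od k))"
  assumes o: "bij_betw od {..<n} {..<n}" and so: "\<And>j k. j \<le> k \<Longrightarrow> k < n \<Longrightarrow> \<not> L (od k) (od j)"
    and cid: "\<And>j. j < n \<Longrightarrow> cid (od j) = gi D j" and pq: "p < n" "q < n"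
  shows "cid p < cid q \<longleftrightarrow> L p q"
proof -
  have ex: "\<exists>j<n. q = od j" if "q < n" for q
  proof -
    have "q \<in> od ` {..<n}" using o that by (simp add: bij_betw_def)
    then show ?thesis by auto
  qed
  have lt: "gi D j < gi D k" if jk: "j < n" "k < n" "L (od j) (od k)" for j k
  proof -
    have "j < k" using so[of k j] jk by force
    have "gi D j \<noteq> gi D k"
    proof
      assume "gi D j = gi D k"
      then have nD: "\<not> D i" if "j < i" "i \<le> k" for i using gi_eq[of j k D] \<open>j < k\<close> that by simp
      have "cc (od i) = cc (od j) \<and> cw (od i) = cw (od j)" if "j \<le> i" "i \<le> k" for i
        using that
      proof (induction i rule: dec_induct)
        case (step i)
        have "\<not> L (od (Suc i)) (od i)" using so[of i "Suc i"] step jk by simp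
        then show ?case using nD[of "Suc i"] step by (auto simp: D_def L_def)
      qed simp
      from this[of k] show False using jk \<open>j < k\<close> by (auto simp: L_def)
    qed
    then show ?thesis using gi_mono[of j k D] \<open>j < k\<close> by simp
  qed
  have eq: "gi D j = gi D k" if jk: "j \<le> k" "k < n" "cc (od j) = cc (od k)" "cw (od j) = cw (od k)" for j k
  proof -
    have "\<not> D i" if i: "j < i" "i \<le> k" for i
    proof -
      have "\<not> L (od (i - 1)) (od j)" "\<not> L (od i) (od (i - 1))" "\<not> L (od k) (od i)"
        using so[of j "i - 1"] so[of "i - 1" i] so[of i k] i jk by auto
      then show ?thesis using jk by (auto simp: L_def D_def)
    qed
    then show ?thesis using gi_eq[of j k D] jk by simp
  qed
  obtain j k where j: "j < n" "p = od j" and k: "k < n" "q = od k" using ex pq by metis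
  show ?thesis
  proof
    assume c: "cid p < cid q"
    show "L p q"
    proof (rule ccontr)
      assume n: "\<not> L p q"
      have "\<not> L q p" using lt[of k j] c j k cid by auto
      then have "cc p = cc q" "cw p = cw q" using n by (auto simp: L_def)
      then have "gi D j = gi D k" using eq[of j k] eq[of k j] j k by (metis nat_le_linear)
      then show False using c j k cid by simp
    qed
  next
    assume "L p q" then show "cid p < cid q" using lt j k cid by simp
  qed
qed

text \<open>Ordering a column by \<open>Y\<close> also orders it by row, because
  \<open>cell_index\<close> is monotone; so two presorted lists and a counting sort give the
  lexicographic order in linear time per level.\<close>

lemma run_order:
  assumes n: "nmem s ''n'' 0 = n" "2 * n + 2 \<le> B"
    and px: "bij_betw (nmem s ''px'') {..<n} {..<n}" "\<And>i j. i \<le> j \<Longrightarrow> j < n \<Longrightarrow> rmem s ''X'' (nmem s ''px'' i) \<le> rmem s ''X'' (nmem s ''px'' j)"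
    and py: "bij_betw (nmem s ''py'') {..<n} {..<n}" "\<And>i j. i \<le> j \<Longrightarrow> j < n \<Longrightarrow> rmem s ''Y'' (nmem s ''py'' i) \<le> rmem s ''Y'' (nmem s ''py'' j)"
  shows "run B order_phase s (korder * Suc n) (\<lambda>s'. ordered n s' \<and>
     (\<forall>q<n. rmem s' ''cc'' q = real_of_int (cell_index (rmem s ''X'' q) (nmem s ''lev'' 0)) \<and> rmem s' ''cw'' q = real_of_int (cell_index (rmem s ''Y'' q) (nmem s ''lev'' 0))))"
proof -
  define s1 where "s1 = fex (setn ''id'' (NConst 0);; setn ''k'' (NConst 0)) s"
  have s1: "nmem s1 a = nmem s a" if "a \<notin> {''id'', ''k''}" for a using that by (simp add: s1_def)
  have s1r: "rmem s1 = rmem s" by (simp add: s1_def)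
  have s1k: "nmem s1 ''k'' 0 = 0" "nmem s1 ''id'' 0 = 0" by (simp_all add: s1_def)
  define CX CY where "CX q = real_of_int (cell_index (rmem s ''X'' q) (nmem s ''lev'' 0))" and "CY q = real_of_int (cell_index (rmem s ''Y'' q) (nmem s ''lev'' 0))" for q
  define px where "px = nmem s ''px''"
  define py where "py = nmem s ''py''"
  define C where "C k = CX (px k)" for k
  have pn: "px i < n" "py i < n" if "i < n" for i
    using px(1) py(1) that unfolding bij_betw_def px_def py_def by blast+
  have Cm: "C i \<le> C j" if "i \<le> j" "j < n" for i j
    using cell_index_mono[OF px(2)[OF that]] by (simp add: C_def CX_def px_def)
  have pxs: "\<exists>k<n. q = px k" if "q < n" for q
  proof -
    have "q \<in> px ` {..<n}" using px(1) that by (simp add: bij_betw_def px_def)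
    then show ?thesis by auto
  qed
  define P1 where "P1 = (\<lambda>s' :: store. (\<forall>j<n. nmem s' ''cs'' (px j) = gs C j \<and> nmem s' ''pos'' j = j) \<and> (\<forall>q<n. rmem s' ''cc'' q = CX q \<and> rmem s' ''cw'' q = CY q))"
  have r1: "run B (While kn lv1_body) s1 (kw kn lv1_body * Suc n) P1"
    using run_lv1[of s1 n B] n s1k px(1) unfolding P1_def px_def C_def CX_def CY_def by (simp add: s1 s1r)
  have r2: "run B (While kn lv2_body) s2 (kw kn lv2_body * Suc n) (\<lambda>s'. \<forall>j<n. nmem s' ''ord'' (rk (\<lambda>j. nmem s2 ''cs'' (py j)) n j) = py j)"
    and K: "\<And>j. j < n \<Longrightarrow> nmem s2 ''cs'' (py j) < n" "\<And>i j. i < n \<Longrightarrow> j < n \<Longrightarrow> nmem s2 ''cs'' (py i) < nmem s2 ''cs'' (py j) \<longleftrightarrow> CX (py i) < CX (py j)"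
      "\<And>i j. i < n \<Longrightarrow> j < n \<Longrightarrow> nmem s2 ''cs'' (py i) = nmem s2 ''cs'' (py j) \<longleftrightarrow> CX (py i) = CX (py j)"
    if P: "P1 s2" and k2: "nmem s2 ''k'' 0 = 0" "nmem s2 ''n'' 0 = n" "nmem s2 ''py'' = py" for s2
  proof -
    have cs: "nmem s2 ''cs'' (px k) = gs C k" if "k < n" for k using P that by (simp add: P1_def)
    show Kn: "nmem s2 ''cs'' (py j) < n" if "j < n" for j
      using pxs[OF pn(2)[OF that]] cs gs_le[of C] by (metis le_less_trans)
    show "nmem s2 ''cs'' (py i) < nmem s2 ''cs'' (py j) \<longleftrightarrow> CX (py i) < CX (py j)"
      "nmem s2 ''cs'' (py i) = nmem s2 ''cs'' (py j) \<longleftrightarrow> CX (py i) = CX (py j)" if ij: "i < n" "j < n" for i j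
    proof -
      obtain a b where ab: "a < n" "py i = px a" "b < n" "py j = px b" using pxs pn(2) ij by metis
      show "nmem s2 ''cs'' (py i) < nmem s2 ''cs'' (py j) \<longleftrightarrow> CX (py i) < CX (py j)"
        "nmem s2 ''cs'' (py i) = nmem s2 ''cs'' (py j) \<longleftrightarrow> CX (py i) = CX (py j)"
        using gs_less_iff(2,3)[of n C b a] Cm ab cs by (simp_all add: C_def)
    qed
    \<comment> \<open>The start of a column is the number of sites in smaller columns, and this
      count is the same along either sorted order.\<close>
    have Kc: "nmem s2 ''cs'' (py j) = card {i. i < n \<and> nmem s2 ''cs'' (py i) < nmem s2 ''cs'' (py j)}" if j: "j < n" for j
    proof -
      obtain b where b: "b < n" "py j = px b" using pxs pn(2) j by metis
      let ?Q = "\<lambda>q. nmem s2 ''cs'' q < gs C b"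
      have "card {i. i < n \<and> ?Q (py i)} = card {i. i < n \<and> ?Q (px i)}"
        using card_bij_lessThan[OF py(1), of ?Q] card_bij_lessThan[OF px(1), of ?Q] by (simp add: px_def py_def)
      also have "{i. i < n \<and> ?Q (px i)} = {..<gs C b}"
        using cs gs_less_iff(1)[of n C b] Cm b gs_le[of C b] by auto
      finally show ?thesis using b cs by simp
    qed
    show "run B (While kn lv2_body) s2 (kw kn lv2_body * Suc n) (\<lambda>s'. \<forall>j<n. nmem s' ''ord'' (rk (\<lambda>j. nmem s2 ''cs'' (py j)) n j) = py j)"
      using run_lv2[of s2 n B] P k2 n Kn Kc by (simp add: P1_def)
  qed
  have post: "bij_betw (nmem s3 ''ord'') {..<n} {..<n} \<and> (\<forall>j k. j \<le> k \<longrightarrow> k < n \<longrightarrow> \<not> lex3 (Tq s3 (nmem s3 ''ord'' k)) (Tq s3 (nmem s3 ''ord'' j)))"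
    if P: "P1 s2" and k2: "nmem s2 ''k'' 0 = 0" "nmem s2 ''n'' 0 = n" "nmem s2 ''py'' = py"
      and o: "\<forall>j<n. nmem s3 ''ord'' (rk (\<lambda>j. nmem s2 ''cs'' (py j)) n j) = py j"
      and r: "rmem s3 ''cc'' = rmem s2 ''cc''" "rmem s3 ''cw'' = rmem s2 ''cw''" "rmem s3 ''Y'' = rmem s ''Y''" for s2 s3
  proof -
    let ?\<kappa> = "\<lambda>j. nmem s2 ''cs'' (py j)"
    have rb: "bij_betw (rk ?\<kappa> n) {..<n} {..<n}" by (rule rk_bij)
    have "bij_betw (nmem s3 ''ord'' \<circ> rk ?\<kappa> n) {..<n} {..<n} \<longleftrightarrow> bij_betw py {..<n} {..<n}"
      by (rule bij_betw_cong) (use o in auto)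
    then have ob: "bij_betw (nmem s3 ''ord'') {..<n} {..<n}"
      using bij_betw_comp_iff[OF rb, of "nmem s3 ''ord''" "{..<n}"] py(1) by (simp add: py_def)
    have "\<not> lex3 (Tq s3 (nmem s3 ''ord'' k)) (Tq s3 (nmem s3 ''ord'' j))" if jk: "j \<le> k" "k < n" for j k
    proof (cases "j = k")
      case True then show ?thesis by (simp add: lex3_def)
    next
      case False
      have "j \<in> rk ?\<kappa> n ` {..<n}" "k \<in> rk ?\<kappa> n ` {..<n}" using rb jk by (simp_all add: bij_betw_def)
      then obtain a b where ab: "a < n" "j = rk ?\<kappa> n a" "b < n" "k = rk ?\<kappa> n b" by auto
      have ord: "nmem s3 ''ord'' j = py a" "nmem s3 ''ord'' k = py b" using o ab by auto
      have "?\<kappa> a < ?\<kappa> b \<or> ?\<kappa> a = ?\<kappa> b \<and> a < b" using rk_less_iff[of a n b ?\<kappa>] ab jk False by auto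
      then have c: "CX (py a) < CX (py b) \<or> CX (py a) = CX (py b) \<and> a < b" using K[OF P k2] ab by auto
      have cc: "rmem s3 ''cc'' (py a) = CX (py a)" "rmem s3 ''cc'' (py b) = CX (py b)" "rmem s3 ''cw'' (py a) = CY (py a)" "rmem s3 ''cw'' (py b) = CY (py b)"
        using P pn ab r by (simp_all add: P1_def)
      have "a < b \<Longrightarrow> rmem s ''Y'' (py a) \<le> rmem s ''Y'' (py b)" using py(2)[of a b] ab by (simp add: py_def)
      moreover from this have "a < b \<Longrightarrow> CY (py a) \<le> CY (py b)" using cell_index_mono by (simp add: CY_def)
      ultimately show ?thesis using c unfolding ord lex3_def Tq_def r(3) cc by auto
    qed
    then show ?thesis using ob by blast
  qed
  show ?thesis unfolding order_phase_def
  proof (rule run_lf_seq[where ?T2.0 = "(kw kn lv1_body + (tmax (setn ''k'' (NConst 0)) + (kw kn lv2_body + (tmax (setn ''k'' (NConst 0)) + kw kn lv3_body)))) * Suc n"], goal_cases)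
    case 3
    show ?case unfolding s1_def[symmetric]
    proof (rule run_seq[OF r1, where ?T2.0 = "(tmax (setn ''k'' (NConst 0)) + (kw kn lv2_body + (tmax (setn ''k'' (NConst 0)) + kw kn lv3_body))) * Suc n"])
      fix s2 assume u2: "unch (While kn lv1_body) s1 s2" and P: "P1 s2"
      define t2 where "t2 = fex (setn ''k'' (NConst 0)) s2"
      have Pt: "P1 t2" using P by (simp add: P1_def t2_def)
      have t2: "nmem t2 ''k'' 0 = 0" "nmem t2 ''n'' 0 = n" "nmem t2 ''py'' = py" "nmem t2 ''id'' 0 = 0" "rmem t2 ''Y'' = rmem s ''Y''"
        using u2 n s1k by (simp_all add: t2_def unch_def lv1_defs s1 s1r py_def)
      show "run B (setn ''k'' (NConst 0);; While kn lv2_body;; setn ''k'' (NConst 0);; While kn lv3_body) s2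
        ((tmax (setn ''k'' (NConst 0)) + (kw kn lv2_body + (tmax (setn ''k'' (NConst 0)) + kw kn lv3_body))) * Suc n) (\<lambda>s'. ordered n s' \<and>
         (\<forall>q<n. rmem s' ''cc'' q = real_of_int (cell_index (rmem s ''X'' q) (nmem s ''lev'' 0)) \<and> rmem s' ''cw'' q = real_of_int (cell_index (rmem s ''Y'' q) (nmem s ''lev'' 0))))"
      proof (rule run_lf_seq[where ?T2.0 = "(kw kn lv2_body + (tmax (setn ''k'' (NConst 0)) + kw kn lv3_body)) * Suc n"], goal_cases)
        case 3
        show ?case unfolding t2_def[symmetric]
        proof (rule run_seq[OF r2[OF Pt t2(1-3)], where ?T2.0 = "(tmax (setn ''k'' (NConst 0)) + kw kn lv3_body) * Suc n"])
          fix s3 assume u3: "unch (While kn lv2_body) t2 s3" and Q: "\<forall>j<n. nmem s3 ''ord'' (rk (\<lambda>j. nmem t2 ''cs'' (py j)) n j) = py j"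
          define t3 where "t3 = fex (setn ''k'' (NConst 0)) s3"
          have r3: "rmem t3 = rmem t2" using u3 by (auto simp: t3_def unch_def lv2_body_def)
          have t3: "nmem t3 ''k'' 0 = 0" "nmem t3 ''n'' 0 = n" "nmem t3 ''id'' 0 = 0" "nmem t3 ''ord'' = nmem s3 ''ord''"
            using u3 t2 by (simp_all add: t3_def unch_def lv2_body_def)
          have po: "bij_betw (nmem t3 ''ord'') {..<n} {..<n}" "\<And>j k. j \<le> k \<Longrightarrow> k < n \<Longrightarrow> \<not> lex3 (Tq t3 (nmem t3 ''ord'' k)) (Tq t3 (nmem t3 ''ord'' j))"
            using post[OF Pt t2(1-3), of t3] Q r3 t2 t3 by auto
          show "run B (setn ''k'' (NConst 0);; While kn lv3_body) s3
        ((tmax (setn ''k'' (NConst 0)) + kw kn lv3_body) * Suc n) (\<lambda>s'. ordered n s' \<and>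
         (\<forall>q<n. rmem s' ''cc'' q = real_of_int (cell_index (rmem s ''X'' q) (nmem s ''lev'' 0)) \<and> rmem s' ''cw'' q = real_of_int (cell_index (rmem s ''Y'' q) (nmem s ''lev'' 0))))"
          proof (rule run_lf_seq[where ?T2.0 = "kw kn lv3_body * Suc n"], goal_cases)
            case 3
            show ?case unfolding t3_def[symmetric]
            proof (rule run_mono[OF run_lv3[of t3 n B]])
              fix s4 assume u4: "unch (While kn lv3_body) t3 s4"
                and G: "\<forall>j<n. nmem s4 ''cid'' (nmem t3 ''ord'' j) = gi (\<lambda>k. rmem t3 ''cc'' (nmem t3 ''ord'' (k - 1)) < rmem t3 ''cc'' (nmem t3 ''ord'' k) \<or>
                     rmem t3 ''cw'' (nmem t3 ''ord'' (k - 1)) < rmem t3 ''cw'' (nmem t3 ''ord'' k)) j"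
              have r4: "rmem s4 = rmem t3" "nmem s4 ''ord'' = nmem t3 ''ord''" using u4 by (auto simp: unch_def lv3_defs)
              have T4: "Tq s4 = Tq t3" by (simp add: Tq_def r4 fun_eq_iff)
              have "nmem s4 ''cid'' p < nmem s4 ''cid'' q \<longleftrightarrow> lex2 s4 p q" if "p < n" "q < n" for p q
                unfolding lex2_def r4
                by (rule cid_order[OF po(1)]) (use po(2) G that in \<open>auto simp: lex3_def Tq_def\<close>)
              then have "ordered n s4" using po unfolding ordered_def r4 T4 by blast
              moreover have "rmem s4 ''cc'' = rmem t2 ''cc''" "rmem s4 ''cw'' = rmem t2 ''cw''" using r4 r3 by auto
              ultimately show "ordered n s4 \<and>
         (\<forall>q<n. rmem s4 ''cc'' q = real_of_int (cell_index (rmem s ''X'' q) (nmem s ''lev'' 0)) \<and> rmem s4 ''cw'' q = real_of_int (cell_index (rmem s ''Y'' q) (nmem s ''lev'' 0)))"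
                using Pt by (simp add: P1_def CX_def CY_def)
            qed (use t3 n po in auto)
          qed (auto simp: add_mult_distrib)
        qed (simp add: add_mult_distrib)
      qed (auto simp: add_mult_distrib)
    qed (simp add: add_mult_distrib)
  next
    case 4 then show ?case by (simp add: korder_def add_mult_distrib)
  qed auto
qed


section \<open>Medium and huge radii at one level\<close>

definition huge :: "nat \<Rightarrow> bexp" where
  "huge A = RLess (RMul (RConst (of_nat (4 * A))) (RV ''s'')) (RRead ''ro'' (V ''q''))"
definition mid :: "nat \<Rightarrow> bexp" where
  "mid A = And (RLess (RMul (RConst (of_nat A)) (RV ''s'')) (RRead ''ro'' (V ''q''))) (Not (huge A))"

text \<open>\<open>X\<close>, \<open>Y\<close> and \<open>\<rho>\<close> are the rotated and scaled
  data, which by \<open>iso\<close> define the same edges. Of the inequalities on \<open>A\<close>,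
  \<open>b0 + 3 \<le> 2 * A\<close> serves the huge radii and \<open>b0 + 1 \<le> A\<close> the
  medium ones.\<close>

locale lvl =
  fixes n A b0 :: nat and x y r X Y \<rho> :: "nat \<Rightarrow> real" and os :: "(rat \<times> rat) list" and lev :: nat
  assumes A: "b0 + 3 \<le> 2 * A" "b0 + 1 \<le> A"
    and iso: "p < n \<Longrightarrow> q < n \<Longrightarrow> edge x y r p q \<longleftrightarrow> p \<noteq> q \<and> sqrt ((X p - X q) * (X p - X q) + (Y p - Y q) * (Y p - Y q)) \<le> \<rho> p"
    and inj: "p < n \<Longrightarrow> q < n \<Longrightarrow> X p = X q \<Longrightarrow> Y p = Y q \<Longrightarrow> p = q"
    and os: "(a, b) \<in> set os \<Longrightarrow> \<exists>a' b' :: int. a = of_int a' \<and> b = of_int b' \<and> 1 \<le> a' \<and> a' \<le> 2 * int A + 1 \<and> \<bar>b'\<bar> \<le> int b0"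
begin

definition \<sigma> :: real where "\<sigma> = 2 ^ lev / sqrt 2"
definition CX where "CX q = real_of_int (cell_index (X q) lev)"
definition CY where "CY q = real_of_int (cell_index (Y q) lev)"

lemma sp: "0 < \<sigma>" by (simp add: \<sigma>_def)

lemma CX: "CX q * \<sigma> \<le> X q" "X q < (CX q + 1) * \<sigma>" and CY: "CY q * \<sigma> \<le> Y q" "Y q < (CY q + 1) * \<sigma>"
  using cell_index_bounds[of _ lev] by (auto simp: CX_def CY_def \<sigma>_def)

definition off :: "nat \<Rightarrow> nat \<Rightarrow> rat \<times> rat \<Rightarrow> bool" where
  "off p q ab \<longleftrightarrow> CX q = CX p + of_rat (fst ab) \<and> CY q = CY p + of_rat (snd ab)"

lemma off_near:
  assumes ab: "ab \<in> set os" and o: "off p q ab"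
  shows "0 < X q - X p" "X q - X p \<le> (2 * A + 2) * \<sigma>" "\<bar>Y q - Y p\<bar> \<le> (b0 + 1) * \<sigma>" "Y q < (CY p + (b0 + 1)) * \<sigma>" "(CY p - b0) * \<sigma> \<le> Y q"
proof -
  obtain a b :: int where i: "fst ab = of_int a" "snd ab = of_int b" "1 \<le> a" "a \<le> 2 * int A + 1" "\<bar>b\<bar> \<le> int b0"
    using os[of "fst ab" "snd ab"] ab by auto
  have c: "CX q = CX p + of_int a" "CY q = CY p + of_int b" using o i by (simp_all add: off_def)
  have r: "1 \<le> real_of_int a" "real_of_int a \<le> 2 * A + 1" "\<bar>real_of_int b\<bar> \<le> b0"
    using i(3)[folded of_int_le_iff[where 'a = real]] i(4)[folded of_int_le_iff[where 'a = real]] i(5)[folded of_int_le_iff[where 'a = real]] by simp_all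
  have m: "u * \<sigma> \<le> v * \<sigma>" if "u \<le> v" for u v using that sp by simp
  have "(CX p + 1) * \<sigma> \<le> CX q * \<sigma>" using m c r by simp
  then show "0 < X q - X p" using CX(2)[of p] CX(1)[of q] by linarith
  have "(CX q + 1) * \<sigma> \<le> (CX p + (2 * A + 2)) * \<sigma>" using m c r by simp
  then show "X q - X p \<le> (2 * A + 2) * \<sigma>" using CX(1)[of p] CX(2)[of q] by (simp add: algebra_simps)
  have "(CY q + 1) * \<sigma> \<le> (CY p + (b0 + 1)) * \<sigma>" "(CY p - b0) * \<sigma> \<le> CY q * \<sigma>" using m c r by simp_all
  then show 1: "Y q < (CY p + (b0 + 1)) * \<sigma>" "(CY p - b0) * \<sigma> \<le> Y q" using CY[of q] by linarith+
  show "\<bar>Y q - Y p\<bar> \<le> (b0 + 1) * \<sigma>" using 1 CY[of p] by (simp add: algebra_simps abs_le_iff)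
qed

text \<open>For a point to the right of the centre and within the vertical extent of the disc, lying
  in the disc means lying left of its right boundary. This is why an envelope of right boundaries
  decides reachability.\<close>

lemma edge_dist:
  assumes "p < n" "q < n" "0 < X q - X p" "\<bar>Y q - Y p\<bar> < \<rho> p"
  shows "edge x y r p q \<longleftrightarrow> X q \<le> X p + sqrt (\<rho> p * \<rho> p - (Y q - Y p) * (Y q - Y p))"
proof -
  have ne: "p \<noteq> q" using assms by auto
  have r0: "0 \<le> \<rho> p" using assms(4) by linarith
  have sw: "(X p - X q) * (X p - X q) + (Y p - Y q) * (Y p - Y q) = (X q - X p)\<^sup>2 + (Y q - Y p)\<^sup>2"
    by (simp add: power2_eq_square algebra_simps)
  have "edge x y r p q \<longleftrightarrow> (X q - X p)\<^sup>2 + (Y q - Y p)\<^sup>2 \<le> (\<rho> p)\<^sup>2"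
    unfolding iso[OF assms(1,2)] sw using ne r0 real_sqrt_le_iff[of "(X q - X p)\<^sup>2 + (Y q - Y p)\<^sup>2" "(\<rho> p)\<^sup>2"] by simp
  also have "\<dots> \<longleftrightarrow> (X q - X p)\<^sup>2 \<le> (\<rho> p)\<^sup>2 - (Y q - Y p)\<^sup>2" by linarith
  also have "\<dots> \<longleftrightarrow> X q - X p \<le> sqrt ((\<rho> p)\<^sup>2 - (Y q - Y p)\<^sup>2)"
  proof
    assume "(X q - X p)\<^sup>2 \<le> (\<rho> p)\<^sup>2 - (Y q - Y p)\<^sup>2"
    then show "X q - X p \<le> sqrt ((\<rho> p)\<^sup>2 - (Y q - Y p)\<^sup>2)" by (rule real_le_rsqrt)
  next
    assume a: "X q - X p \<le> sqrt ((\<rho> p)\<^sup>2 - (Y q - Y p)\<^sup>2)"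
    \<comment> \<open>The root exceeds a positive number, so the radicand is positive and squaring
      is legitimate.\<close>
    then have "0 < (\<rho> p)\<^sup>2 - (Y q - Y p)\<^sup>2" using assms(3) by (metis less_le_trans real_sqrt_gt_0_iff)
    moreover have "(X q - X p)\<^sup>2 \<le> (sqrt ((\<rho> p)\<^sup>2 - (Y q - Y p)\<^sup>2))\<^sup>2" using a assms(3) by (intro power_mono) auto
    ultimately show "(X q - X p)\<^sup>2 \<le> (\<rho> p)\<^sup>2 - (Y q - Y p)\<^sup>2" by simp
  qed
  finally show ?thesis by (simp add: power2_eq_square algebra_simps)
qed

text \<open>An offset bounds the horizontal distance by \<open>(2 * A + 2) * \<sigma>\<close> and
  the vertical one by \<open>(b0 + 1) * \<sigma>\<close>; their sum is at most
  \<open>4 * A * \<sigma>\<close> because \<open>b0 + 3 \<le> 2 * A\<close>.\<close>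

lemma huge_edge:
  assumes "w < n" "q < n" "ab \<in> set os" "off w q ab" "4 * A * \<sigma> < \<rho> w"
  shows "edge x y r w q"
proof -
  note nr = off_near[OF assms(3,4)]
  have "sqrt ((X w - X q)\<^sup>2 + (Y w - Y q)\<^sup>2) \<le> \<bar>X w - X q\<bar> + \<bar>Y w - Y q\<bar>" by (rule sqrt_sum_squares_le_sum_abs)
  also have "\<dots> \<le> (2 * A + 2) * \<sigma> + (b0 + 1) * \<sigma>" using nr by (simp add: abs_minus_commute)
  also have "\<dots> = (2 * A + b0 + 3) * \<sigma>" by (simp add: algebra_simps)
  also have "\<dots> \<le> (4 * A) * \<sigma>" using A sp by (intro mult_right_mono) auto
  finally show ?thesis using iso[OF assms(1,2)] assms(5) nr(1) by (auto simp: power2_eq_square)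
qed

definition ctx :: "store \<Rightarrow> bool" where
  "ctx s \<longleftrightarrow> nmem s ''n'' 0 = n \<and> static x y r s \<and> rmem s ''X'' = X \<and> rmem s ''Y'' = Y \<and> rmem s ''ro'' = \<rho> \<and> rmem s ''s'' 0 = \<sigma> \<and>
    ordered n s \<and> (\<forall>q<n. rmem s ''cc'' q = CX q \<and> rmem s ''cw'' q = CY q)"

definition found :: "(nat \<Rightarrow> bool) \<Rightarrow> (nat \<times> nat) set \<Rightarrow> bool" where
  "found P F \<longleftrightarrow> (\<forall>p<n. \<forall>q<n. \<forall>ab\<in>set os. P p \<longrightarrow> edge x y r p q \<longrightarrow> off p q ab \<longrightarrow> (\<exists>w<n. (w, q) \<in> F \<and> CX w = CX p \<and> CY w = CY p))"

lemma ctx_cong: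
  assumes "ctx s" "\<And>a. a \<in> {''n'', ''ord'', ''cid''} \<Longrightarrow> nmem s' a = nmem s a"
    "\<And>a. a \<in> {''x'', ''y'', ''r'', ''X'', ''Y'', ''ro'', ''s'', ''cc'', ''cw''} \<Longrightarrow> rmem s' a = rmem s a"
  shows "ctx s'"
proof -
  have e: "nmem s' ''n'' = nmem s ''n''" "nmem s' ''ord'' = nmem s ''ord''" "nmem s' ''cid'' = nmem s ''cid''"
    "rmem s' ''x'' = rmem s ''x''" "rmem s' ''y'' = rmem s ''y''" "rmem s' ''r'' = rmem s ''r''" "rmem s' ''X'' = rmem s ''X''"
    "rmem s' ''Y'' = rmem s ''Y''" "rmem s' ''ro'' = rmem s ''ro''" "rmem s' ''s'' = rmem s ''s''" "rmem s' ''cc'' = rmem s ''cc''" "rmem s' ''cw'' = rmem s ''cw''"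
    using assms(2,3) by auto
  have "Tq s' = Tq s" "lex2 s' = lex2 s" by (simp_all add: fun_eq_iff Tq_def lex2_def e)
  then show ?thesis using assms(1) by (simp add: ctx_def static_def ordered_def e)
qed

lemma ctx_cid: "ctx s \<Longrightarrow> p < n \<Longrightarrow> q < n \<Longrightarrow> nmem s ''cid'' p < nmem s ''cid'' q \<longleftrightarrow> lex2 s p q"
  unfolding ctx_def ordered_def by blast

lemma ctx_cc: "ctx s \<Longrightarrow> q < n \<Longrightarrow> rmem s ''cc'' q = CX q" "ctx s \<Longrightarrow> q < n \<Longrightarrow> rmem s ''cw'' q = CY q"
  unfolding ctx_def by blast+

lemma ord_n: "ctx s \<Longrightarrow> i < n \<Longrightarrow> nmem s ''ord'' i < n"
  unfolding ctx_def ordered_def bij_betw_def by blast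

lemma ord_ex: "ctx s \<Longrightarrow> q < n \<Longrightarrow> \<exists>k<n. q = nmem s ''ord'' k"
proof -
  assume "ctx s" "q < n"
  then have "q \<in> nmem s ''ord'' ` {..<n}" by (simp add: ctx_def ordered_def bij_betw_def)
  then show ?thesis by auto
qed

text \<open>The item of \<open>p\<close> itself is not below \<open>q\<close>, so the first such
  item comes no later, in the cell of \<open>p\<close> or an earlier one; not being below
  \<open>q\<close>, it cannot be in an earlier one. It is thus a huge site in the cell of
  \<open>p\<close>, and such a site reaches \<open>q\<close>.\<close>

lemma found_huge:
  assumes c: "ctx s" and L: "L \<le> n" and w: "map (nmem s ''wA'') [0..<L] = filter (\<lambda>q. 4 * A * \<sigma> < \<rho> q) (map (nmem s ''ord'') [0..<n])"
    and e: "\<And>i. i < L \<Longrightarrow> rmem s ''eA'' i = (rmem s ''cw'' (nmem s ''wA'' i) + (of_rat (of_nat b0) + 1)) * \<sigma>"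
    and q: "\<forall>ab\<in>set os. qfound s (edge x y r) n L ab F"
  shows "found (\<lambda>q. 4 * A * \<sigma> < \<rho> q) F"
  unfolding found_def
proof (intro allI ballI impI)
  fix p q ab assume pq: "p < n" "q < n" "ab \<in> set os" "4 * A * \<sigma> < \<rho> p" "edge x y r p q" "off p q ab"
  let ?w = "nmem s ''wA''"
  obtain k where k: "k < n" "q = nmem s ''ord'' k" using ord_ex[OF c pq(2)] by blast
  have "p \<in> set (map ?w [0..<L])" unfolding w using pq ord_ex[OF c pq(1)] by auto
  then obtain ip where ip: "ip < L" "p = ?w ip" by auto
  have wi: "?w i < n \<and> 4 * A * \<sigma> < \<rho> (?w i)" if "i < L" for i
  proof -
    have "?w i \<in> set (map ?w [0..<L])" using that by simp
    then show ?thesis unfolding w using ord_n[OF c] by auto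
  qed
  have cc: "rmem s ''cc'' v = CX v" "rmem s ''cw'' v = CY v" if "v < n" for v using ctx_cc[OF c] that by simp_all
  have "sorted_wrt (\<lambda>u v. \<not> lex2 s v u) (map (nmem s ''ord'') [0..<n])"
    using c by (auto simp: sorted_wrt_iff_nth_less ctx_def ordered_def lex3_def Tq_def lex2_def)
  then have so: "sorted_wrt (\<lambda>u v. \<not> lex2 s v u) (map ?w [0..<L])" unfolding w by (rule sorted_wrt_filter)
  let ?a = "of_rat (fst ab)" and ?b = "of_rat (snd ab)"
  have nl: "\<not> lex3 (Ti s ?a ?b ip) (Tq s q)"
  proof -
    have Ys: "rmem s ''Y'' = Y" using c by (simp add: ctx_def)
    have "Y q < (CY p + (b0 + 1)) * \<sigma>" by (rule off_near(4)[OF pq(3,6)])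
    also have "\<dots> = rmem s ''eA'' ip" using e[OF ip(1)] cc[OF pq(1)] by (simp add: ip(2)[symmetric] algebra_simps)
    finally show ?thesis using pq(6) cc[OF pq(1)] cc[OF pq(2)] by (auto simp: lex3_def Ti_def Tq_def ip(2)[symmetric] off_def Ys)
  qed
  define i where "i = (LEAST i. \<not> lex3 (Ti s ?a ?b i) (Tq s q))"
  have i: "\<not> lex3 (Ti s ?a ?b i) (Tq s q)" "i \<le> ip" unfolding i_def using nl by (rule LeastI, intro Least_le)
  have min: "lex3 (Ti s ?a ?b i') (Tq s q)" if "i' < i" for i' using not_less_Least[OF that[unfolded i_def]] by simp
  have iL: "i < L" using i ip by simp
  have "\<not> lex2 s p (?w i)"
  proof (cases "i = ip")
    case True then show ?thesis using ip by (simp add: lex2_def)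
  next
    case False
    then show ?thesis using sorted_wrt_nth_less[OF so, of i ip] i(2) ip by simp
  qed
  then have cw: "CX (?w i) = CX p" "CY (?w i) = CY p"
    using i(1) pq(6) cc[OF pq(1)] cc[OF pq(2)] cc[of "?w i"] wi[OF iL] by (auto simp: lex2_def lex3_def Ti_def Tq_def off_def)
  have "off (?w i) q ab" using pq(6) cw by (simp add: off_def)
  then have "edge x y r (?w i) q" using huge_edge wi[OF iL] pq by simp
  then have "(?w i, q) \<in> F" using q pq(3) k iL i(1) min unfolding qfound_def by blast
  then show "\<exists>w<n. (w, q) \<in> F \<and> CX w = CX p \<and> CY w = CY p" using wi[OF iL] cw by blast
qed

definition isMid :: "nat \<Rightarrow> bool" where "isMid q \<longleftrightarrow> A * \<sigma> < \<rho> q \<and> \<not> 4 * A * \<sigma> < \<rho> q"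

text \<open>All sites with the same cell number share a row, so any of them determines the
  strip.\<close>

definition lo :: "(nat \<Rightarrow> nat) \<Rightarrow> nat \<Rightarrow> real" where "lo cid c = (CY (SOME q. q < n \<and> cid q = c) - b0) * \<sigma>"
definition hi :: "(nat \<Rightarrow> nat) \<Rightarrow> nat \<Rightarrow> real" where "hi cid c = (CY (SOME q. q < n \<and> cid q = c) + (b0 + 1)) * \<sigma>"

lemma cid_eq:
  assumes c: "ctx s" and pq: "p < n" "q < n" "nmem s ''cid'' p = nmem s ''cid'' q"
  shows "CX p = CX q \<and> CY p = CY q"
proof -
  have "\<not> lex2 s p q" "\<not> lex2 s q p" using ctx_cid[OF c pq(1,2)] ctx_cid[OF c pq(2,1)] pq(3) by simp_all
  moreover have "rmem s ''cc'' p = CX p" "rmem s ''cw'' p = CY p" "rmem s ''cc'' q = CX q" "rmem s ''cw'' q = CY q"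
    using ctx_cc[OF c] pq by simp_all
  ultimately show ?thesis by (auto simp: lex2_def)
qed

lemma lo_cid: "ctx s \<Longrightarrow> w < n \<Longrightarrow> lo (nmem s ''cid'') (nmem s ''cid'' w) = (CY w - b0) * \<sigma>"
  and hi_cid: "ctx s \<Longrightarrow> w < n \<Longrightarrow> hi (nmem s ''cid'') (nmem s ''cid'' w) = (CY w + (b0 + 1)) * \<sigma>"
proof -
  assume c: "ctx s" and w: "w < n"
  have "(SOME q. q < n \<and> nmem s ''cid'' q = nmem s ''cid'' w) < n \<and> nmem s ''cid'' (SOME q. q < n \<and> nmem s ''cid'' q = nmem s ''cid'' w) = nmem s ''cid'' w"
    by (rule someI[of _ w]) (use w in simp)
  then have "CY (SOME q. q < n \<and> nmem s ''cid'' q = nmem s ''cid'' w) = CY w" using cid_eq[OF c _ w] by blast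
  then show "lo (nmem s ''cid'') (nmem s ''cid'' w) = (CY w - b0) * \<sigma>" "hi (nmem s ''cid'') (nmem s ''cid'' w) = (CY w + (b0 + 1)) * \<sigma>"
    by (simp_all add: lo_def hi_def)
qed

text \<open>A radius above \<open>A * \<sigma>\<close> exceeds the vertical distance from the site
  to any point of its strip, since \<open>b0 + 1 \<le> A\<close>; hence the arc is defined on the
  whole strip.\<close>

lemma arcs_mid: assumes c: "ctx s"
  shows "arcs X Y \<rho> (nmem s ''cid'') (lo (nmem s ''cid'')) (hi (nmem s ''cid'')) {q. q < n \<and> isMid q}"
proof (unfold_locales, goal_cases)
  case (1 w) then show ?case using lo_cid[OF c] hi_cid[OF c] sp by auto
next
  case (2 w z)
  then have "(CY w - b0) * \<sigma> \<le> z" "z \<le> (CY w + (b0 + 1)) * \<sigma>" using lo_cid[OF c] hi_cid[OF c] by auto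
  then have "\<bar>z - Y w\<bar> \<le> (b0 + 1) * \<sigma>" using CY[of w] by (simp add: algebra_simps abs_le_iff)
  also have "\<dots> \<le> A * \<sigma>" using A sp by (intro mult_right_mono) auto
  finally show ?case using 2 by (auto simp: isMid_def)
next
  case (3 v w) then show ?case using inj by auto
qed

text \<open>By \<open>env_query\<close> the sweep stops at a site of the same cell whose right
  boundary, at the ordinate of \<open>q\<close>, lies no further left than that of \<open>p\<close>.
  By \<open>edge_dist\<close> this site reaches \<open>q\<close> because \<open>p\<close>
  does.\<close>

lemma found_mid:
  assumes c: "ctx s" and G: "set G = {q. q < n \<and> isMid q}"
    and env: "arcs.env X Y \<rho> (nmem s ''cid'') (lo (nmem s ''cid'')) (hi (nmem s ''cid'')) {q. q < n \<and> isMid q} G (segA s 0 L)"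
    and q: "\<forall>ab\<in>set os. qfound s (edge x y r) n L ab F"
  shows "found isMid F"
  unfolding found_def
proof (intro allI ballI impI)
  interpret arcs X Y \<rho> "nmem s ''cid''" "lo (nmem s ''cid'')" "hi (nmem s ''cid'')" "{q. q < n \<and> isMid q}" by (rule arcs_mid[OF c])
  fix p q ab assume pq: "p < n" "q < n" "ab \<in> set os" "isMid p" "edge x y r p q" "off p q ab"
  let ?w = "nmem s ''wA''" and ?cid = "nmem s ''cid''"
  obtain k where k: "k < n" "q = nmem s ''ord'' k" using ord_ex[OF c pq(2)] by blast
  note nr = off_near[OF pq(3,6)]
  have yq: "lo ?cid (?cid p) \<le> Y q" "Y q \<le> hi ?cid (?cid p)" using nr(4,5) lo_cid[OF c pq(1)] hi_cid[OF c pq(1)] by auto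
  have pG: "p \<in> set G" using G pq by simp
  obtain i where i: "i < L" "?cid (?w i) = ?cid p" "Y q \<le> rmem s ''eA'' i" "f p (Y q) \<le> f (?w i) (Y q)"
     "\<And>i'. i' < i \<Longrightarrow> ?cid (?w i') < ?cid p \<or> ?cid (?w i') = ?cid p \<and> rmem s ''eA'' i' < Y q"
    using env_query[OF env pG yq] by (auto simp: segA_def)
  have wG: "?w j < n \<and> isMid (?w j)" if "j < L" for j
  proof -
    have "(?w j, rmem s ''bA'' j, rmem s ''eA'' j) \<in> set (segA s 0 L)" using that by (auto simp: segA_def)
    then show ?thesis using env G by (auto simp: env_def piece_def)
  qed
  have w: "?w i < n" "isMid (?w i)" using wG i by auto
  have cw: "CX (?w i) = CX p" "CY (?w i) = CY p" using cid_eq[OF c w(1) pq(1) i(2)] by auto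
  have o: "off (?w i) q ab" using pq(6) cw by (simp add: off_def)
  note nw = off_near[OF pq(3) o]
  have dm: "\<bar>Y q - Y v\<bar> < \<rho> v" if "v < n" "isMid v" "?cid v = ?cid p" for v
    using dom[of v "Y q"] that yq by simp
  have "X q \<le> f p (Y q)" using edge_dist[OF pq(1,2) nr(1) dm] pq by (simp add: f_def)
  then have "X q \<le> f (?w i) (Y q)" using i(4) by linarith
  then have E: "edge x y r (?w i) q" using edge_dist[OF w(1) pq(2) nw(1) dm] w i(2) by (simp add: f_def)
  have cc: "rmem s ''cc'' v = CX v" "rmem s ''cw'' v = CY v" if "v < n" for v using ctx_cc[OF c] that by simp_all
  have Ys: "rmem s ''Y'' = Y" using c by (simp add: ctx_def)
  have n1: "\<not> lex3 (Ti s (of_rat (fst ab)) (of_rat (snd ab)) i) (Tq s q)"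
    using o i(3) cc[OF w(1)] cc[OF pq(2)] by (auto simp: lex3_def Ti_def Tq_def off_def Ys)
  have n2: "lex3 (Ti s (of_rat (fst ab)) (of_rat (snd ab)) i') (Tq s q)" if i': "i' < i" for i'
  proof -
    have w': "?w i' < n" using wG i' i(1) by simp
    from i(5)[OF i'] show ?thesis
    proof
      assume "?cid (?w i') < ?cid p"
      then have "lex2 s (?w i') p" using ctx_cid[OF c w' pq(1)] by simp
      then show ?thesis using pq(6) cc[OF w'] cc[OF pq(1)] cc[OF pq(2)] by (auto simp: lex2_def lex3_def Ti_def Tq_def off_def)
    next
      assume e: "?cid (?w i') = ?cid p \<and> rmem s ''eA'' i' < Y q"
      then have "CX (?w i') = CX p" "CY (?w i') = CY p" using cid_eq[OF c w' pq(1)] by auto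
      then show ?thesis using e pq(6) cc[OF w'] cc[OF pq(1)] cc[OF pq(2)] by (auto simp: lex3_def Ti_def Tq_def off_def Ys)
    qed
  qed
  have "(?w i, q) \<in> F" using q pq(3) k i(1) n1 n2 E unfolding qfound_def by blast
  then show "\<exists>w<n. (w, q) \<in> F \<and> CX w = CX p \<and> CY w = CY p" using w cw by blast
qed

end

section \<open>One grid level\<close>

definition hugephase :: "nat \<Rightarrow> nat \<Rightarrow> (rat \<times> rat) list \<Rightarrow> com" where
  "hugephase A b0 os = (build (huge A) (of_nat b0);; qs os)"
definition midphase :: "nat \<Rightarrow> nat \<Rightarrow> (rat \<times> rat) list \<Rightarrow> com" where
  "midphase A b0 os = (build (mid A) (of_nat b0);; setn ''nb'' (V ''len'');; dc me;; setn ''len'' (NRead ''bd'' (V ''nb''));; qs os)"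
definition level :: "nat \<Rightarrow> nat \<Rightarrow> (rat \<times> rat) list \<Rightarrow> com" where
  "level A b0 os = (order_phase;; hugephase A b0 os;; midphase A b0 os)"

lemma nw_order: "nw order_phase = {''id'', ''k'', ''p'', ''st'', ''cs'', ''pos'', ''q'', ''ord'', ''cid''}" "rw order_phase = {''cc'', ''cw''}"
  by (auto simp: order_phase_def lv1_defs lv2_body_def lv3_defs)
lemma nw_build: "nw (build c b0) = {''k'', ''len'', ''bd'', ''q'', ''wA''}" "rw (build c b0) = {''bA'', ''eA''}"
  by (auto simp: build_def bu_body_def bu_new_def)
lemma nw_dcme: "nw (dc me) \<subseteq> {''wA'', ''wB'', ''bd'', ''nb'', ''j'', ''jo'', ''op'', ''op0'', ''i'', ''h'', ''l2'', ''l3'', ''k'', ''p'', ''q'', ''w''}"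
  "rw (dc me) \<subseteq> {''bA'', ''eA'', ''bB'', ''eB'', ''bb'', ''dx'', ''dy'', ''d2'', ''K'', ''sq'', ''ee'', ''rt'', ''md''}"
  by (simp_all add: dc_def dc_round_def dc_pre_def dc_post_def dc_copy_def me_def me_body_def me_copy_def me_prep_def me_prep1_def me_prep2_def me_root_def me_push_def me_adv_def)
lemma outs_unch: "unch c s s' \<Longrightarrow> nw c \<inter> {''src'', ''dst'', ''m''} = {} \<Longrightarrow> outs s' = outs s \<and> nmem s' ''m'' = nmem s ''m''"
  by (auto simp: outs_def unch_n)

lemma disjointE1: "A \<inter> B = {} \<Longrightarrow> x \<in> B \<Longrightarrow> x \<notin> A" by blast

context lvl begin

lemma ctx_unch:
  assumes "ctx s" "unch c s s'" "nw c \<inter> {''n'', ''ord'', ''cid''} = {}" "rw c \<inter> {''x'', ''y'', ''r'', ''X'', ''Y'', ''ro'', ''s'', ''cc'', ''cw''} = {}"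
  shows "ctx s'"
proof (rule ctx_cong[OF assms(1)])
  show "nmem s' a = nmem s a" if "a \<in> {''n'', ''ord'', ''cid''}" for a by (rule unch_n[OF assms(2)]) (rule disjointE1[OF assms(3) that])
  show "rmem s' a = rmem s a" if "a \<in> {''x'', ''y'', ''r'', ''X'', ''Y'', ''ro'', ''s'', ''cc'', ''cw''}" for a
    by (rule unch_r[OF assms(2)]) (rule disjointE1[OF assms(4) that])
qed

abbreviation "Eset \<equiv> {(p, q). p < n \<and> q < n \<and> edge x y r p q}"

lemma run_qs_ctx:
  assumes c: "ctx s" and L: "nmem s ''len'' 0 = L" "L \<le> 2 * n" and w: "\<And>i. i < L \<Longrightarrow> nmem s ''wA'' i < n"
    and B: "3 * n + 3 \<le> B" and m: "nmem s ''m'' 0 + length os * n \<le> B"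
  shows "run B (qs os) s (3 * kqs os * Suc n) (\<lambda>s'. ctx s' \<and> outs s \<subseteq> outs s' \<and> outs s' \<subseteq> outs s \<union> Eset \<and>
     nmem s' ''m'' 0 \<le> nmem s ''m'' 0 + length os * n \<and> (\<forall>ab\<in>set os. qfound s (edge x y r) n L ab (outs s')))"
proof (rule run_mono[OF run_qs[of s n B L x y r os]])
  show "nmem s ''n'' 0 = n" "static x y r s" using c by (auto simp: ctx_def)
  show "\<not> lex3 (Tq s (nmem s ''ord'' k)) (Tq s (nmem s ''ord'' j))" if "j \<le> k" "k < n" for j k
    using c that unfolding ctx_def ordered_def by blast
  show "nmem s ''ord'' i < n" if "i < n" for i using ord_n[OF c that] .
  have "kqs os * Suc (L + n) \<le> kqs os * (3 * Suc n)" using L by (intro mult_le_mono2) simp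
  then show "kqs os * Suc (L + n) \<le> 3 * kqs os * Suc n" by (simp only: mult.assoc mult.left_commute)
  fix s' assume u: "unch (qs os) s s'" and Q: "outs s \<subseteq> outs s' \<and> outs s' \<subseteq> outs s \<union> Eset \<and>
     nmem s' ''m'' 0 \<le> nmem s ''m'' 0 + length os * n \<and> (\<forall>ab\<in>set os. qfound s (edge x y r) n L ab (outs s'))"
  have "ctx s'" by (rule ctx_unch[OF c u]) (use qs_nw[of os] in auto)
  then show "ctx s' \<and> outs s \<subseteq> outs s' \<and> outs s' \<subseteq> outs s \<union> Eset \<and>
     nmem s' ''m'' 0 \<le> nmem s ''m'' 0 + length os * n \<and> (\<forall>ab\<in>set os. qfound s (edge x y r) n L ab (outs s'))" using Q by blast
qed (use assms in auto)

lemma huge_sem: "rmem s' ''ro'' = \<rho> \<Longrightarrow> rmem s' ''s'' 0 = \<sigma> \<Longrightarrow> bval (huge A) s' \<longleftrightarrow> 4 * A * \<sigma> < \<rho> (nmem s' ''q'' 0)"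
  unfolding huge_def bval.simps rval.simps nval.simps of_rat_of_nat_eq by simp
lemma mid_sem: "rmem s' ''ro'' = \<rho> \<Longrightarrow> rmem s' ''s'' 0 = \<sigma> \<Longrightarrow> bval (mid A) s' \<longleftrightarrow> isMid (nmem s' ''q'' 0)"
  unfolding mid_def bval.simps isMid_def using huge_sem[of s'] by simp

lemma run_hugephase:
  assumes c: "ctx s" and B: "3 * n + 3 \<le> B" and m: "nmem s ''m'' 0 + length os * n \<le> B"
  shows "run B (hugephase A b0 os) s ((kbu (huge A) (of_nat b0) + 3 * kqs os) * Suc n) (\<lambda>s'. ctx s' \<and> outs s \<subseteq> outs s' \<and> outs s' \<subseteq> outs s \<union> Eset \<and>
     nmem s' ''m'' 0 \<le> nmem s ''m'' 0 + length os * n \<and> found (\<lambda>q. 4 * A * \<sigma> < \<rho> q) (outs s'))"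
  unfolding hugephase_def
proof (rule run_seq[OF run_build[of s n B \<sigma> "huge A" "\<lambda>q. 4 * A * \<sigma> < \<rho> q" "of_nat b0"]])
  fix s1 assume u: "unch (build (huge A) (of_nat b0)) s s1" and Q: "\<exists>L. nmem s1 ''len'' 0 = L \<and> L \<le> n \<and>
     map (nmem s1 ''wA'') [0..<L] = filter (\<lambda>q. 4 * A * \<sigma> < \<rho> q) (map (nmem s ''ord'') [0..<n]) \<and> (\<forall>j\<le>L. nmem s1 ''bd'' j = j) \<and>
     (\<forall>i<L. rmem s1 ''bA'' i = (rmem s ''cw'' (nmem s1 ''wA'' i) - of_rat (of_nat b0)) * \<sigma> \<and>
        rmem s1 ''eA'' i = (rmem s ''cw'' (nmem s1 ''wA'' i) + (of_rat (of_nat b0) + 1)) * \<sigma>)"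
  then obtain L where L: "nmem s1 ''len'' 0 = L" "L \<le> n" "map (nmem s1 ''wA'') [0..<L] = filter (\<lambda>q. 4 * A * \<sigma> < \<rho> q) (map (nmem s ''ord'') [0..<n])"
    "\<forall>i<L. rmem s1 ''eA'' i = (rmem s ''cw'' (nmem s1 ''wA'' i) + (of_rat (of_nat b0) + 1)) * \<sigma>" by blast
  have c1: "ctx s1" by (rule ctx_unch[OF c u]) (auto simp: nw_build)
  have e1: "nmem s1 ''ord'' = nmem s ''ord''" "rmem s1 ''cw'' = rmem s ''cw''" using u by (auto intro: unch_n unch_r simp: nw_build)
  have o1: "outs s1 = outs s" "nmem s1 ''m'' = nmem s ''m''" using outs_unch[OF u] by (auto simp: nw_build)
  have w: "nmem s1 ''wA'' i < n" if "i < L" for i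
  proof -
    have "nmem s1 ''wA'' i \<in> set (map (nmem s1 ''wA'') [0..<L])" using that by simp
    then show ?thesis unfolding L(3) using ord_n[OF c] by auto
  qed
  show "run B (qs os) s1 (3 * kqs os * Suc n) (\<lambda>s'. ctx s' \<and> outs s \<subseteq> outs s' \<and> outs s' \<subseteq> outs s \<union> Eset \<and>
     nmem s' ''m'' 0 \<le> nmem s ''m'' 0 + length os * n \<and> found (\<lambda>q. 4 * A * \<sigma> < \<rho> q) (outs s'))"
  proof (rule run_mono[OF run_qs_ctx[OF c1 L(1)]])
    fix s' assume Q': "ctx s' \<and> outs s1 \<subseteq> outs s' \<and> outs s' \<subseteq> outs s1 \<union> Eset \<and>
     nmem s' ''m'' 0 \<le> nmem s1 ''m'' 0 + length os * n \<and> (\<forall>ab\<in>set os. qfound s1 (edge x y r) n L ab (outs s'))"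
    have "found (\<lambda>q. 4 * A * \<sigma> < \<rho> q) (outs s')"
      by (rule found_huge[OF c1 L(2)]) (use L Q' e1 in auto)
    then show "ctx s' \<and> outs s \<subseteq> outs s' \<and> outs s' \<subseteq> outs s \<union> Eset \<and>
     nmem s' ''m'' 0 \<le> nmem s ''m'' 0 + length os * n \<and> found (\<lambda>q. 4 * A * \<sigma> < \<rho> q) (outs s')" using Q' o1 by auto
  qed (use L w B m o1 in auto)
next
  show "nmem s ''n'' 0 = n" "rmem s ''s'' 0 = \<sigma>" using c by (auto simp: ctx_def)
  show "Suc n \<le> B" using B by simp
  fix s' :: store assume "rmem s' ''ro'' = rmem s ''ro''" "rmem s' ''s'' 0 = \<sigma>"
  then show "bval (huge A) s' \<longleftrightarrow> 4 * A * \<sigma> < \<rho> (nmem s' ''q'' 0)" using huge_sem c by (simp add: ctx_def)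
qed (simp add: add_mult_distrib)

end


section \<open>Sorting as a whole, with the dominating sites\<close>

definition sort :: "(nexp \<Rightarrow> rexp) \<Rightarrow> name \<Rightarrow> com" where
  "sort ke d = (sort_pre;; sort_init ke;; dc ms;; setn ''k'' (NConst 0);; sort_out d)"

definition ksort1 :: "(nexp \<Rightarrow> rexp) \<Rightarrow> nat" where
  "ksort1 ke = kw (NLess (V ''k'') (V ''n'')) (NAssign ''wA'' (V ''k'') (NRead ''pi'' (V ''k''));;
     RAssign ''eA'' (V ''k'') (ke (NRead ''pi'' (V ''k'')));; NAssign ''best'' (V ''k'') (NConst 0);; inc ''k'';;
     NAssign ''bd'' (V ''k'') (V ''k''))"
definition ksort2 :: "name \<Rightarrow> nat" where
  "ksort2 d = kw (NLess (V ''k'') (V ''n'')) (NAssign ''pi'' (V ''k'') (NRead ''wA'' (V ''k''));;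
     NAssign d (V ''k'') (NRead ''wA'' (V ''k''));; inc ''k'')"
definition ksort :: "(nexp \<Rightarrow> rexp) \<Rightarrow> name \<Rightarrow> nat" where
  "ksort ke d = tmax sort_pre + ksort1 ke + dcl.kdc kms + tmax (setn ''k'' (NConst 0)) + ksort2 d"

text \<open>\<open>bok\<close> refers to the order of \<open>pi\<close> before the call: sorting by
  one key while remembering the previous order supplies both conditions of dominance.\<close>

lemma run_sort:
  assumes n: "nmem s ''n'' 0 = n" "2 * n + 2 \<le> B" and pi: "distinct (map (nmem s ''pi'') [0..<n])" "set (map (nmem s ''pi'') [0..<n]) \<subseteq> {..<n}"
    and ke: "keyexp ke g" and d: "d \<in> {''px'', ''py'', ''pz''}"
  defines "key \<equiv> (\<lambda>q. g (rmem s ''X'' q) (rmem s ''Y'' q))"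
  shows "run B (sort ke d) s (ksort ke d * Suc n + dcl.kdc kms * (n * lg n)) (\<lambda>s'.
     mset (map (nmem s' ''pi'') [0..<n]) = mset (map (nmem s ''pi'') [0..<n]) \<and> sorted (map (\<lambda>k. key (nmem s' ''pi'' k)) [0..<n]) \<and>
     (\<forall>k<n. nmem s' d k = nmem s' ''pi'' k) \<and> bok (nmem s' ''best'') key (rmem s ''X'') (map (nmem s ''pi'') [0..<n]))"
proof -
  define G where "G = map (nmem s ''pi'') [0..<n]"
  have lG: "length G = n" by (simp add: G_def)
  let ?rel = "msrel key (rmem s ''X'') n"
  interpret D: dcl ms B kms ?rel "\<lambda>s'. rmem s' ''X'' = rmem s ''X''" by (rule dcl_ms) (use n in simp)
  let ?R = "\<lambda>s'. mset (map (nmem s' ''pi'') [0..<n]) = mset G \<and> sorted (map (\<lambda>k. key (nmem s' ''pi'' k)) [0..<n]) \<and>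
     (\<forall>k<n. nmem s' d k = nmem s' ''pi'' k) \<and> bok (nmem s' ''best'') key (rmem s ''X'') G"
  define s1 where "s1 = fex sort_pre s"
  have s1: "nmem s1 a = nmem s a" if "a \<notin> {''k'', ''nb'', ''bd''}" for a using that by (simp add: s1_def sort_pre_def)
  have s1r: "rmem s1 = rmem s" and s1k: "nmem s1 ''k'' 0 = 0" "nmem s1 ''nb'' 0 = n" "nmem s1 ''bd'' 0 = 0"
    by (simp_all add: s1_def sort_pre_def n)
  define Gs where "Gs = map (\<lambda>g. [g]) G"
  have Gs: "concat Gs = G" "length Gs = n" by (simp_all add: Gs_def lG)
  have pn: "nmem s ''pi'' k < n" if "k < n" for k using subsetD[OF pi(2), of "nmem s ''pi'' k"] that by simp
  have fin: "run B (setn ''k'' (NConst 0);; sort_out d) s3 ((tmax (setn ''k'' (NConst 0)) + ksort2 d) * Suc n) ?R"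
    if u3: "unch (dc ms) s2 s3" and n2: "nmem s2 ''n'' 0 = n" and Q3: "rmem s3 ''X'' = rmem s ''X'' \<and> ?rel s3 G (segA s3 0 (nmem s3 ''bd'' (nmem s3 ''nb'' 0)))" for s2 s3
  proof (rule run_lf_seq[where ?T2.0 = "ksort2 d * Suc n"], goal_cases)
    case 3
    define s4 where "s4 = fex (setn ''k'' (NConst 0)) s3"
    have s4: "nmem s4 a = nmem s3 a" if "a \<noteq> ''k''" for a using that by (simp add: s4_def)
    have "nmem s3 ''n'' = nmem s2 ''n''" by (rule unch_n[OF u3]) (simp add: dc_def dc_round_def dc_pre_def dc_post_def dc_copy_def ms_def ms_body_def ms_left_def ms_right_def)
    then have n4: "nmem s4 ''n'' 0 = n" using n2 by (simp add: s4)
    let ?L = "nmem s3 ''bd'' (nmem s3 ''nb'' 0)"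
    have rel: "?rel s3 G (segA s3 0 ?L)" using Q3 by blast
    have w: "map fst (segA s3 0 ?L) = map (nmem s3 ''wA'') [0..<?L]" by (simp add: segA_def)
    have m: "mset (map (nmem s3 ''wA'') [0..<?L]) = mset G" using rel by (simp add: msrel_def w)
    have "size (mset (map (nmem s3 ''wA'') [0..<?L])) = size (mset G)" using m by (rule arg_cong)
    \<comment> \<open>The number of items follows from the equality of multisets, as sorting keeps
      every site exactly once.\<close>
    then have L: "?L = n" using lG by (simp only: size_mset length_map length_upt diff_zero)
    have ek: "rmem s3 ''eA'' k = key (nmem s3 ''wA'' k)" if "k < n" for k
      using rel that L by (auto simp: msrel_def segA_def)
    have "sorted (map (rmem s3 ''eA'') [0..<n])" using rel L by (simp add: msrel_def segA_def comp_def)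
    also have "map (rmem s3 ''eA'') [0..<n] = map (\<lambda>k. key (nmem s3 ''wA'' k)) [0..<n]" using ek by simp
    finally have so: "sorted (map (\<lambda>k. key (nmem s3 ''wA'' k)) [0..<n])" .
    have bk: "bok (nmem s3 ''best'') key (rmem s ''X'') G" using rel by (simp add: msrel_def)
    show ?case unfolding s4_def[symmetric]
    proof (rule run_mono[OF run_sort_out[OF n4 _ _ d, folded ksort2_def]])
      fix s' assume u: "unch (sort_out d) s4 s'" and Q: "\<forall>j<n. nmem s' ''pi'' j = nmem s4 ''wA'' j \<and> nmem s' d j = nmem s4 ''wA'' j"
      have b: "nmem s' ''best'' = nmem s3 ''best''" using unch_n[OF u, of "''best''"] d by (auto simp: sort_out_def s4)
      have e: "map (nmem s' ''pi'') [0..<n] = map (nmem s3 ''wA'') [0..<n]" "map (\<lambda>k. key (nmem s' ''pi'' k)) [0..<n] = map (\<lambda>k. key (nmem s3 ''wA'' k)) [0..<n]"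
        using Q by (simp_all add: s4)
      show "?R s'" unfolding e b using m L so bk Q by simp
    qed (use n in \<open>simp_all add: s4_def\<close>)
  next
    case 4 then show ?case by (simp add: add_mult_distrib)
  qed auto
  have mid: "run B (dc ms;; setn ''k'' (NConst 0);; sort_out d) s2 ((dcl.kdc kms + (tmax (setn ''k'' (NConst 0)) + ksort2 d)) * Suc n + dcl.kdc kms * (n * lg n)) ?R"
    if u2: "unch (sort_init ke) s1 s2" and Q2: "(\<forall>j<n. nmem s2 ''wA'' j = nmem s1 ''pi'' j \<and> rmem s2 ''eA'' j = g (rmem s1 ''X'' (nmem s1 ''pi'' j)) (rmem s1 ''Y'' (nmem s1 ''pi'' j)) \<and>
        nmem s2 ''best'' j = 0) \<and> (\<forall>j\<le>n. nmem s2 ''bd'' j = j)" for s2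
  proof -
    have un: "nmem s2 ''n'' = nmem s ''n''" "nmem s2 ''nb'' 0 = n" "rmem s2 ''X'' = rmem s ''X''"
      using unch_n[OF u2, of "''n''"] unch_n[OF u2, of "''nb''"] unch_r[OF u2, of "''X''"] s1k by (simp_all add: sort_init_def s1 s1r)
    have bl: "D.blocks s2 Gs" unfolding D.blocks_def
    proof (intro conjI allI impI)
      fix k assume k: "k < length Gs"
      then have kn: "k < n" using Gs by simp
      let ?g = "nmem s ''pi'' k"
      have gk: "Gs ! k = [?g]" using kn by (simp add: Gs_def G_def)
      have sg: "segA s2 (nmem s2 ''bd'' k) (nmem s2 ''bd'' (Suc k)) = [(?g, rmem s2 ''bA'' k, key ?g)]"
        using Q2 kn by (simp add: segA_def s1 s1r key_def)
      show "?rel s2 (Gs ! k) (segA s2 (nmem s2 ''bd'' k) (nmem s2 ''bd'' (Suc k)))"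
        unfolding gk sg using pn[OF kn] Q2 by (simp add: msrel_def bok_def before_def)
      show "nmem s2 ''bd'' k \<le> nmem s2 ''bd'' (Suc k)" using Q2 kn by simp
    qed (use Q2 un Gs in simp_all)
    have "run B (dc ms) s2 (dcl.kdc kms * (n * lg n + 1)) (\<lambda>s'. rmem s' ''X'' = rmem s ''X'' \<and> ?rel s' G (segA s' 0 (nmem s' ''bd'' (nmem s' ''nb'' 0))))"
      using D.run_dc[OF un(3) bl] Gs pi(1) lG n(2) by (simp add: G_def)
    then show ?thesis
    proof (rule run_seq[OF _ fin])
      show "nmem s2 ''n'' 0 = n" using un n by simp
    qed (simp_all add: add_mult_distrib distrib_left)
  qed
  show ?thesis unfolding sort_def G_def[symmetric]
  proof (rule run_lf_seq[where ?T2.0 = "(ksort1 ke + (dcl.kdc kms + (tmax (setn ''k'' (NConst 0)) + ksort2 d))) * Suc n + dcl.kdc kms * (n * lg n)"], goal_cases)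
    case 2 then show ?case using n by (simp add: sort_pre_def)
  next
    case 3
    have "run B (sort_init ke) s1 (ksort1 ke * Suc n) (\<lambda>s2. (\<forall>j<n. nmem s2 ''wA'' j = nmem s1 ''pi'' j \<and> rmem s2 ''eA'' j = g (rmem s1 ''X'' (nmem s1 ''pi'' j)) (rmem s1 ''Y'' (nmem s1 ''pi'' j)) \<and>
        nmem s2 ''best'' j = 0) \<and> (\<forall>j\<le>n. nmem s2 ''bd'' j = j))"
      unfolding ksort1_def by (rule run_sort_init) (use n s1k ke in \<open>simp_all add: s1\<close>)
    then show ?case unfolding s1_def[symmetric] by (rule run_seq[OF _ mid]) (simp_all add: add_mult_distrib)
  next
    case 4 then show ?case by (simp add: ksort_def add_mult_distrib)
  qed (simp add: sort_pre_def)
qed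

lemma nw_sort: "nw (sort ke d) \<subseteq> {d, ''k'', ''pi'', ''wA'', ''wB'', ''bd'', ''nb'', ''j'', ''jo'', ''op'', ''op0'', ''i'', ''h'', ''l2'', ''l3'', ''cur'', ''best''}"
  "rw (sort ke d) \<subseteq> {''bA'', ''eA'', ''bB'', ''eB''}"
  by (simp_all add: sort_def sort_pre_def sort_init_def sort_out_def dc_def dc_round_def dc_pre_def dc_post_def dc_copy_def ms_def ms_body_def ms_left_def ms_right_def)


context lvl begin

section \<open>The envelope phase and a complete level\<close>

definition midset :: "nat set" where "midset = {q. q < n \<and> isMid q}"

definition kmid :: nat where
  "kmid = kbu (mid A) (of_nat b0) + tmax (setn ''nb'' (V ''len'')) + dcl.kdc kme + tmax (setn ''len'' (NRead ''bd'' (V ''nb''))) + 3 * kqs os"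

lemma run_midphase:
  assumes c: "ctx s" and B: "3 * n + 3 \<le> B" and m: "nmem s ''m'' 0 + length os * n \<le> B"
  shows "run B (midphase A b0 os) s (kmid * Suc n + dcl.kdc kme * (card midset * lg n)) (\<lambda>s'. ctx s' \<and> outs s \<subseteq> outs s' \<and> outs s' \<subseteq> outs s \<union> Eset \<and>
     nmem s' ''m'' 0 \<le> nmem s ''m'' 0 + length os * n \<and> found isMid (outs s'))"
  unfolding midphase_def
proof (rule run_seq[OF run_build[of s n B \<sigma> "mid A" isMid "of_nat b0"]])
  let ?R = "\<lambda>s'. ctx s' \<and> outs s \<subseteq> outs s' \<and> outs s' \<subseteq> outs s \<union> Eset \<and>
     nmem s' ''m'' 0 \<le> nmem s ''m'' 0 + length os * n \<and> found isMid (outs s')"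
  fix s1 assume u: "unch (build (mid A) (of_nat b0)) s s1" and Q: "\<exists>L. nmem s1 ''len'' 0 = L \<and> L \<le> n \<and>
     map (nmem s1 ''wA'') [0..<L] = filter isMid (map (nmem s ''ord'') [0..<n]) \<and> (\<forall>j\<le>L. nmem s1 ''bd'' j = j) \<and>
     (\<forall>i<L. rmem s1 ''bA'' i = (rmem s ''cw'' (nmem s1 ''wA'' i) - of_rat (of_nat b0)) * \<sigma> \<and>
        rmem s1 ''eA'' i = (rmem s ''cw'' (nmem s1 ''wA'' i) + (of_rat (of_nat b0) + 1)) * \<sigma>)"
  then obtain L where L: "nmem s1 ''len'' 0 = L" "L \<le> n" "map (nmem s1 ''wA'') [0..<L] = filter isMid (map (nmem s ''ord'') [0..<n])"
    "\<forall>j\<le>L. nmem s1 ''bd'' j = j"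
    "\<forall>i<L. rmem s1 ''bA'' i = (rmem s ''cw'' (nmem s1 ''wA'' i) - b0) * \<sigma> \<and> rmem s1 ''eA'' i = (rmem s ''cw'' (nmem s1 ''wA'' i) + (real b0 + 1)) * \<sigma>"
    unfolding of_rat_of_nat_eq by blast
  have c1: "ctx s1" by (rule ctx_unch[OF c u]) (auto simp: nw_build)
  have e1: "nmem s1 ''ord'' = nmem s ''ord''" "rmem s1 ''cw'' = rmem s ''cw''" using u by (auto intro: unch_n unch_r simp: nw_build)
  have o1: "outs s1 = outs s" "nmem s1 ''m'' = nmem s ''m''" using outs_unch[OF u] by (auto simp: nw_build)
  define G where "G = map (nmem s1 ''wA'') [0..<L]"
  have oi: "inj_on (nmem s ''ord'') {..<n}" "nmem s ''ord'' ` {..<n} = {..<n}" using c by (auto simp: ctx_def ordered_def bij_betw_def)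
  have "distinct (map (nmem s ''ord'') [0..<n])" using oi(1) by (simp add: distinct_map atLeast0LessThan)
  then have dG: "distinct G" unfolding G_def L(3) by (rule distinct_filter)
  have sG: "set G = midset" unfolding G_def L(3) midset_def using oi(2) by (auto simp: atLeast0LessThan[symmetric] image_iff set_eq_iff)
  have lG: "length G = L" by (simp add: G_def)
  have cardG: "card midset = L" using distinct_card[OF dG] sG lG by simp
  define s2 where "s2 = fex (setn ''nb'' (V ''len'')) s1"
  have s2: "nmem s2 a = nmem s1 a" if "a \<noteq> ''nb''" for a using that by (simp add: s2_def)
  have s2r: "rmem s2 = rmem s1" and s2b: "nmem s2 ''nb'' 0 = L" by (simp_all add: s2_def L)
  have c2: "ctx s2" by (rule ctx_cong[OF c1]) (auto simp: s2 s2r)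
  let ?cid = "nmem s2 ''cid''"
  interpret E: arcs X Y \<rho> ?cid "lo ?cid" "hi ?cid" midset using arcs_mid[OF c2] by (simp add: midset_def)
  interpret D: dcl me B kme E.envrel E.stat by (rule E.dcl_me)
  define Gs where "Gs = map (\<lambda>g. [g]) G"
  have Gs: "concat Gs = G" "length Gs = L" by (simp_all add: Gs_def lG)
  have st2: "E.stat s2" using c2 by (simp add: E.stat_def ctx_def)
  have wm: "nmem s1 ''wA'' k \<in> midset" if "k < L" for k
  proof -
    have "nmem s1 ''wA'' k \<in> set G" using that by (simp add: G_def)
    then show ?thesis using sG by simp
  qed
  have bl: "D.blocks s2 Gs" unfolding D.blocks_def
  proof (intro conjI allI impI)
    fix k assume k: "k < length Gs"
    then have kL: "k < L" using Gs by simp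
    let ?g = "nmem s1 ''wA'' k"
    have gk: "Gs ! k = [?g]" using kL by (simp add: Gs_def G_def)
    have gm: "?g \<in> midset" "?g < n" using wm[OF kL] by (auto simp: midset_def)
    have cwg: "rmem s ''cw'' ?g = CY ?g" using ctx_cc(2)[OF c1 gm(2)] e1 by simp
    have "rmem s1 ''bA'' k = (CY ?g - b0) * \<sigma>" "rmem s1 ''eA'' k = (CY ?g + (real b0 + 1)) * \<sigma>" using L(5) kL cwg by simp_all
    then have bk: "rmem s1 ''bA'' k = lo ?cid (?cid ?g)" "rmem s1 ''eA'' k = hi ?cid (?cid ?g)"
      unfolding lo_cid[OF c2 gm(2)] hi_cid[OF c2 gm(2)] by (simp_all add: add.commute)
    have sg: "segA s2 (nmem s2 ''bd'' k) (nmem s2 ''bd'' (Suc k)) = [(?g, lo ?cid (?cid ?g), hi ?cid (?cid ?g))]"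
      using L(4) kL unfolding bk[symmetric] by (simp add: segA_def s2 s2r)
    have "E.env [?g] [(?g, lo ?cid (?cid ?g), hi ?cid (?cid ?g))]"
      using gm E.lohi[OF gm(1)] by (simp add: E.env_def E.piece_def E.atend_def)
    then show "E.envrel s2 (Gs ! k) (segA s2 (nmem s2 ''bd'' k) (nmem s2 ''bd'' (Suc k)))" unfolding gk sg E.envrel_def .
    show "nmem s2 ''bd'' k \<le> nmem s2 ''bd'' (Suc k)" using L(4) kL by (simp add: s2)
  qed (use L s2b Gs in \<open>simp_all add: s2\<close>)
  have rd: "run B (dc me) s2 (dcl.kdc kme * (L * lg L + 1)) (\<lambda>s'. E.stat s' \<and> E.envrel s' G (segA s' 0 (nmem s' ''bd'' (nmem s' ''nb'' 0))))"
    using D.run_dc[OF st2 bl] Gs dG lG L(2) B by simp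
  have kd: "dcl.kdc kme * (L * lg L + 1) \<le> dcl.kdc kme * Suc n + dcl.kdc kme * (card midset * lg n)"
  proof -
    have "L * lg L \<le> card midset * lg n" using cardG lg_mono[OF L(2)] by simp
    then have "dcl.kdc kme * (L * lg L) \<le> dcl.kdc kme * (card midset * lg n)" by (rule mult_le_mono2)
    then show ?thesis unfolding distrib_left mult_1_right mult_Suc_right by linarith
  qed
  have fin: "run B (setn ''len'' (NRead ''bd'' (V ''nb''));; qs os) s3 ((tmax (setn ''len'' (NRead ''bd'' (V ''nb''))) + 3 * kqs os) * Suc n) ?R"
    if u3: "unch (dc me) s2 s3" and Q3: "E.stat s3 \<and> E.envrel s3 G (segA s3 0 (nmem s3 ''bd'' (nmem s3 ''nb'' 0)))" for s3
  proof -
    define L' where "L' = nmem s3 ''bd'' (nmem s3 ''nb'' 0)"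
    define s4 where "s4 = fex (setn ''len'' (NRead ''bd'' (V ''nb''))) s3"
    have s4: "nmem s4 a = nmem s3 a" if "a \<noteq> ''len''" for a using that by (simp add: s4_def)
    have s4r: "rmem s4 = rmem s3" and s4l: "nmem s4 ''len'' 0 = L'" by (simp_all add: s4_def L'_def)
    have c3: "ctx s3" by (rule ctx_unch[OF c2 u3]) (use nw_dcme in auto)
    have c4: "ctx s4" by (rule ctx_cong[OF c3]) (auto simp: s4 s4r)
    have env3: "E.env G (segA s3 0 L')" using Q3 by (simp add: E.envrel_def L'_def)
    have sA: "segA s4 = segA s3" by (simp add: fun_eq_iff segA_def s4 s4r)
    have "length (segA s3 0 L') \<le> 2 * length G" using E.env_length[OF env3] .
    then have L': "L' \<le> 2 * n" using lG L(2) by (simp add: segA_def)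
    have ci: "nmem s4 ''cid'' = ?cid" using Q3 by (simp add: s4 E.stat_def)
    have env4: "arcs.env X Y \<rho> (nmem s4 ''cid'') (lo (nmem s4 ''cid'')) (hi (nmem s4 ''cid'')) {q. q < n \<and> isMid q} G (segA s4 0 L')"
      unfolding ci sA midset_def[symmetric] by (rule env3)
    have di: "nw (dc me) \<inter> {''src'', ''dst'', ''m''} = {}" using nw_dcme(1) by auto
    have o2: "outs s2 = outs s1" "nmem s2 ''m'' = nmem s1 ''m''" by (simp_all add: outs_def s2)
    have o3: "outs s3 = outs s" "nmem s3 ''m'' = nmem s ''m''" using outs_unch[OF u3 di] o2 o1 by simp_all
    have o4: "outs s4 = outs s" "nmem s4 ''m'' = nmem s ''m''" using o3 by (auto simp: outs_def s4)
    have w4: "nmem s4 ''wA'' i < n" if "i < L'" for i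
    proof -
      have "(nmem s4 ''wA'' i, rmem s4 ''bA'' i, rmem s4 ''eA'' i) \<in> set (segA s3 0 L')" using that unfolding sA[symmetric] by (auto simp: segA_def)
      then have "nmem s4 ''wA'' i \<in> set G" using env3 by (auto simp: E.env_def E.piece_def)
      then show ?thesis using sG by (auto simp: midset_def)
    qed
    show ?thesis
    proof (rule run_lf_seq[where ?T2.0 = "3 * kqs os * Suc n"], goal_cases)
      case 2 then show ?case by (simp add: nbnd_def)
    next
      case 3
      show ?case unfolding s4_def[symmetric]
      proof (rule run_mono[OF run_qs_ctx[OF c4 s4l L' w4 B]])
        fix s' assume Q': "ctx s' \<and> outs s4 \<subseteq> outs s' \<and> outs s' \<subseteq> outs s4 \<union> Eset \<and>
          nmem s' ''m'' 0 \<le> nmem s4 ''m'' 0 + length os * n \<and> (\<forall>ab\<in>set os. qfound s4 (edge x y r) n L' ab (outs s'))"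
        have "found isMid (outs s')"
          by (rule found_mid[OF c4 _ env4]) (use sG Q' in \<open>auto simp: midset_def\<close>)
        then show "?R s'" using Q' o4 by auto
      qed (use m o4 in auto)
    next
      case 4 then show ?case by (simp add: add_mult_distrib)
    qed simp
  qed
  show "run B (setn ''nb'' (V ''len'');; dc me;; setn ''len'' (NRead ''bd'' (V ''nb''));; qs os) s1
     ((tmax (setn ''nb'' (V ''len'')) + dcl.kdc kme + (tmax (setn ''len'' (NRead ''bd'' (V ''nb''))) + 3 * kqs os)) * Suc n + dcl.kdc kme * (card midset * lg n)) ?R"
  proof (rule run_lf_seq[where ?T2.0 = "(dcl.kdc kme + (tmax (setn ''len'' (NRead ''bd'' (V ''nb''))) + 3 * kqs os)) * Suc n + dcl.kdc kme * (card midset * lg n)"], goal_cases)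
    case 2 then show ?case by (simp add: nbnd_def)
  next
    case 3
    show ?case unfolding s2_def[symmetric] by (rule run_seq[OF rd fin]) (use kd in \<open>simp_all add: add_mult_distrib\<close>)
  next
    case 4 then show ?case by (simp add: add_mult_distrib)
  qed simp
next
  show "nmem s ''n'' 0 = n" "rmem s ''s'' 0 = \<sigma>" using c by (auto simp: ctx_def)
  show "Suc n \<le> B" using B by simp
  fix s' :: store assume "rmem s' ''ro'' = rmem s ''ro''" "rmem s' ''s'' 0 = \<sigma>"
  then show "bval (mid A) s' \<longleftrightarrow> isMid (nmem s' ''q'' 0)" using mid_sem c by (simp add: ctx_def)
qed (simp add: kmid_def add_mult_distrib)

definition klev :: nat where "klev = korder + (kbu (huge A) (of_nat b0) + 3 * kqs os) + kmid"

lemma found_mono: "found P F \<Longrightarrow> F \<subseteq> F' \<Longrightarrow> found P F'" unfolding found_def by (meson subsetD)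

lemma run_level:
  assumes n: "nmem s ''n'' 0 = n" "3 * n + 3 \<le> B" and st: "static x y r s" "rmem s ''X'' = X" "rmem s ''Y'' = Y" "rmem s ''ro'' = \<rho>" "rmem s ''s'' 0 = \<sigma>"
    "nmem s ''lev'' 0 = lev"
    and px: "bij_betw (nmem s ''px'') {..<n} {..<n}" "\<And>i j. i \<le> j \<Longrightarrow> j < n \<Longrightarrow> X (nmem s ''px'' i) \<le> X (nmem s ''px'' j)"
    and py: "bij_betw (nmem s ''py'') {..<n} {..<n}" "\<And>i j. i \<le> j \<Longrightarrow> j < n \<Longrightarrow> Y (nmem s ''py'' i) \<le> Y (nmem s ''py'' j)"
    and m: "nmem s ''m'' 0 + 2 * length os * n \<le> B"
  shows "run B (level A b0 os) s (klev * Suc n + dcl.kdc kme * (card midset * lg n)) (\<lambda>s'. outs s \<subseteq> outs s' \<and> outs s' \<subseteq> outs s \<union> Eset \<and>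
     nmem s' ''m'' 0 \<le> nmem s ''m'' 0 + 2 * length os * n \<and> found (\<lambda>q. A * \<sigma> < \<rho> q) (outs s'))"
  unfolding level_def
proof (rule run_seq[OF run_order[of s n B]])
  let ?T2 = "((kbu (huge A) (of_nat b0) + 3 * kqs os) + kmid) * Suc n + dcl.kdc kme * (card midset * lg n)"
  fix s1 assume u: "unch order_phase s s1" and Q: "ordered n s1 \<and>
     (\<forall>q<n. rmem s1 ''cc'' q = real_of_int (cell_index (rmem s ''X'' q) (nmem s ''lev'' 0)) \<and> rmem s1 ''cw'' q = real_of_int (cell_index (rmem s ''Y'' q) (nmem s ''lev'' 0)))"
  have en: "nmem s1 a = nmem s a" if "a \<in> {''n'', ''m''}" for a by (rule unch_n[OF u]) (use that in \<open>auto simp: nw_order\<close>)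
  have er: "rmem s1 a = rmem s a" if "a \<in> {''x'', ''y'', ''r'', ''X'', ''Y'', ''ro'', ''s''}" for a by (rule unch_r[OF u]) (use that in \<open>auto simp: nw_order\<close>)
  have c1: "ctx s1" using Q n st by (simp add: ctx_def static_def en er CX_def CY_def)
  have o1: "outs s1 = outs s" using outs_unch[OF u] by (auto simp: nw_order)
  have m1: "nmem s1 ''m'' = nmem s ''m''" by (simp add: en)
  show "run B (hugephase A b0 os;; midphase A b0 os) s1 ?T2 (\<lambda>s'. outs s \<subseteq> outs s' \<and> outs s' \<subseteq> outs s \<union> Eset \<and>
     nmem s' ''m'' 0 \<le> nmem s ''m'' 0 + 2 * length os * n \<and> found (\<lambda>q. A * \<sigma> < \<rho> q) (outs s'))"
  proof (rule run_seq[OF run_hugephase[OF c1 n(2)]])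
    show "nmem s1 ''m'' 0 + length os * n \<le> B" using m m1 by simp
    fix s2 assume Q2: "ctx s2 \<and> outs s1 \<subseteq> outs s2 \<and> outs s2 \<subseteq> outs s1 \<union> Eset \<and>
     nmem s2 ''m'' 0 \<le> nmem s1 ''m'' 0 + length os * n \<and> found (\<lambda>q. 4 * A * \<sigma> < \<rho> q) (outs s2)"
    show "run B (midphase A b0 os) s2 (kmid * Suc n + dcl.kdc kme * (card midset * lg n)) (\<lambda>s'. outs s \<subseteq> outs s' \<and> outs s' \<subseteq> outs s \<union> Eset \<and>
     nmem s' ''m'' 0 \<le> nmem s ''m'' 0 + 2 * length os * n \<and> found (\<lambda>q. A * \<sigma> < \<rho> q) (outs s'))"
    proof (rule run_mono[OF run_midphase[OF _ n(2)]])
      show "ctx s2" using Q2 by blast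
      show "nmem s2 ''m'' 0 + length os * n \<le> B" using m m1 Q2 by simp
      fix s' assume Q3: "ctx s' \<and> outs s2 \<subseteq> outs s' \<and> outs s' \<subseteq> outs s2 \<union> Eset \<and>
     nmem s' ''m'' 0 \<le> nmem s2 ''m'' 0 + length os * n \<and> found isMid (outs s')"
      have "found (\<lambda>q. 4 * A * \<sigma> < \<rho> q) (outs s')" using Q2 Q3 found_mono by blast
      then have "found (\<lambda>q. A * \<sigma> < \<rho> q) (outs s')" using Q3 unfolding found_def isMid_def by blast
      moreover have "nmem s' ''m'' 0 \<le> nmem s ''m'' 0 + 2 * length os * n" using Q2 Q3 m1 by simp
      moreover have "outs s \<subseteq> outs s'" "outs s' \<subseteq> outs s \<union> Eset" using Q2 Q3 o1 by auto
      ultimately show "outs s \<subseteq> outs s' \<and> outs s' \<subseteq> outs s \<union> Eset \<and>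
     nmem s' ''m'' 0 \<le> nmem s ''m'' 0 + 2 * length os * n \<and> found (\<lambda>q. A * \<sigma> < \<rho> q) (outs s')" by blast
    qed simp
  qed (simp add: add_mult_distrib)
next
  show "korder * Suc n + (((kbu (huge A) (of_nat b0) + 3 * kqs os) + kmid) * Suc n + dcl.kdc kme * (card midset * lg n)) \<le> klev * Suc n + dcl.kdc kme * (card midset * lg n)"
    by (simp add: klev_def add_mult_distrib)
qed (use n st px py in auto)

end

section \<open>Cones, scales and a criterion for spanners\<close>

definition DD :: "(nat \<Rightarrow> real) \<Rightarrow> (nat \<Rightarrow> real) \<Rightarrow> nat \<Rightarrow> nat \<Rightarrow> real" where
  "DD X Y p q = sqrt ((X p - X q) * (X p - X q) + (Y p - Y q) * (Y p - Y q))"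

lemma edge_DD: "edge x y r p q \<longleftrightarrow> p \<noteq> q \<and> DD x y p q \<le> r p" by (simp add: edge_def DD_def)

lemma DD_eq: "DD X Y p q = sqrt ((X p - X q)\<^sup>2 + (Y p - Y q)\<^sup>2)" by (simp add: DD_def power2_eq_square)

lemma DD_tri: "DD X Y p q \<le> DD X Y p w + DD X Y w q"
  using real_sqrt_sum_squares_triangle_ineq[of "X p - X w" "X w - X q" "Y p - Y w" "Y w - Y q"] by (simp add: DD_eq)
lemma DD_sym: "DD X Y p q = DD X Y q p" by (simp add: DD_eq power2_commute)
lemma DD_le: "DD X Y p q \<le> \<bar>X p - X q\<bar> + \<bar>Y p - Y q\<bar>" unfolding DD_eq by (rule sqrt_sum_squares_le_sum_abs)
lemma DD_ge: "\<bar>X p - X q\<bar> \<le> DD X Y p q" unfolding DD_eq by (rule real_sqrt_ge_abs1)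
text \<open>Compare \<open>p'\<close> with the point of the segment \<open>p q\<close> at the same
  abscissa. Both lie in the narrow backward cone of \<open>q\<close>, so they differ by at most
  \<open>2 * \<kappa>\<close> times the horizontal distance \<open>a'\<close> from \<open>p'\<close>
  to \<open>q\<close>. Hence passing to \<open>p'\<close> shortens the distance from
  \<open>p\<close> by at least \<open>a' * (1 - 2 * \<kappa>)\<close>, while the remaining arc to
  \<open>q\<close> has length at most \<open>(1 + \<kappa>) * a'\<close>; the assumption on
  \<open>t\<close> balances the two.\<close>

lemma cone_nearer:
  fixes \<kappa> t :: real
  assumes k: "0 < \<kappa>" "1 + \<kappa> \<le> t * (1 - 2 * \<kappa>)" "1 < t" "\<kappa> \<le> 1/8"
    and u: "\<kappa> * X p' + Y p' \<le> \<kappa> * X q + Y q" and v: "\<kappa> * X p' - Y p' \<le> \<kappa> * X q - Y q"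
    and x: "X p \<le> X p'" "0 < X q - X p" and y: "\<bar>Y q - Y p\<bar> \<le> \<kappa> * (X q - X p)"
  shows "DD X Y p' q \<le> (1 + \<kappa>) * (X q - X p')" "t * DD X Y p p' + DD X Y p' q \<le> t * DD X Y p q" "DD X Y p p' \<le> DD X Y p q"
    "X p' \<le> X q"
proof -
  define a a' where "a = X q - X p" and "a' = X q - X p'"
  have "\<kappa> * X p' \<le> \<kappa> * X q" using u v by linarith
  then show le: "X p' \<le> X q" using k by simp
  have a: "0 < a" "0 \<le> a'" "a' \<le> a" using x le by (simp_all add: a_def a'_def)
  have y': "\<bar>Y q - Y p'\<bar> \<le> \<kappa> * a'" using u v by (simp add: a'_def algebra_simps abs_if)
  show d: "DD X Y p' q \<le> (1 + \<kappa>) * (X q - X p')"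
    using DD_le[of X Y p' q] y' a by (simp add: a'_def algebra_simps abs_if split: if_splits)
  \<comment> \<open>\<open>l\<close> locates the point of the segment with the abscissa of
    \<open>p'\<close>; \<open>e\<close> below is the vertical deviation of \<open>p'\<close> from
    it.\<close>
  define l where "l = a' / a"
  have l: "0 \<le> l" "l \<le> 1" "l * a = a'" using a by (simp_all add: l_def)
  define e where "e = l * (Y q - Y p) - (Y q - Y p')"
  have "\<bar>l * (Y q - Y p)\<bar> \<le> l * (\<kappa> * a)" unfolding abs_mult using l y by (simp add: a_def mult_left_mono)
  then have "\<bar>l * (Y q - Y p)\<bar> \<le> \<kappa> * a'" using l(3) by (simp add: algebra_simps)
  then have e: "\<bar>e\<bar> \<le> 2 * \<kappa> * a'" using y' unfolding e_def by linarith
  have X: "X p - X p' = (1 - l) * (X p - X q) + 0" using l(3) unfolding a_def a'_def by (simp add: algebra_simps)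
  have Y: "Y p - Y p' = (1 - l) * (Y p - Y q) + (- e)" by (simp add: e_def algebra_simps)
  have "DD X Y p p' \<le> sqrt (((1 - l) * (X p - X q))\<^sup>2 + ((1 - l) * (Y p - Y q))\<^sup>2) + sqrt (0\<^sup>2 + (- e)\<^sup>2)"
    unfolding DD_eq X Y by (rule real_sqrt_sum_squares_triangle_ineq)
  also have "sqrt (((1 - l) * (X p - X q))\<^sup>2 + ((1 - l) * (Y p - Y q))\<^sup>2) = (1 - l) * DD X Y p q"
    unfolding DD_eq power_mult_distrib distrib_left[symmetric] real_sqrt_mult using l by simp
  finally have "DD X Y p p' \<le> (1 - l) * DD X Y p q + \<bar>e\<bar>" by simp
  moreover have "l * a \<le> l * DD X Y p q" by (rule mult_left_mono) (use DD_ge[of X p q Y] l in \<open>simp_all add: a_def\<close>)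
  ultimately have p: "DD X Y p p' \<le> DD X Y p q - a' * (1 - 2 * \<kappa>)" using e l(3) by (simp add: algebra_simps)
  moreover have "0 \<le> a' * (1 - 2 * \<kappa>)" using a k by simp
  ultimately show "DD X Y p p' \<le> DD X Y p q" by linarith
  have "t * DD X Y p p' \<le> t * (DD X Y p q - a' * (1 - 2 * \<kappa>))" by (rule mult_left_mono[OF p]) (use k in simp)
  moreover have "(1 + \<kappa>) * a' \<le> t * (1 - 2 * \<kappa>) * a'" by (rule mult_right_mono[OF k(2) a(2)])
  ultimately show "t * DD X Y p p' + DD X Y p' q \<le> t * DD X Y p q" using d unfolding a'_def[symmetric] by (simp add: algebra_simps)
qed

section \<open>Levels and offsets of long edges\<close>

text \<open>Cell sides double from level to level, so the half-open ranges leave no gap. They start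
  low enough because cells of level 0 have side \<open>1 / sqrt 2\<close>, which is less than
  one.\<close>

lemma level_exists:
  fixes D A :: real
  assumes "A < D" "0 < A"
  shows "\<exists>i. A * (2 ^ i / sqrt 2) < D \<and> D \<le> 2 * A * (2 ^ i / sqrt 2)"
proof -
  obtain j where j: "D * sqrt 2 / (2 * A) < 2 ^ j" using real_arch_pow[of 2 "D * sqrt 2 / (2 * A)"] by auto
  then have e: "\<exists>j. D \<le> 2 * A * (2 ^ j / sqrt 2)" using assms by (intro exI[of _ j]) (simp add: field_simps)
  define i where "i = (LEAST j. D \<le> 2 * A * (2 ^ j / sqrt 2))"
  have i: "D \<le> 2 * A * (2 ^ i / sqrt 2)" unfolding i_def by (rule LeastI_ex[OF e])
  have "A * (2 ^ i / sqrt 2) < D"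
  proof (cases i)
    case 0
    have "A / sqrt 2 < A" using assms by (simp add: divide_less_eq)
    then show ?thesis using 0 assms by simp
  next
    case (Suc k)
    then have "\<not> D \<le> 2 * A * (2 ^ k / sqrt 2)" unfolding i_def by (intro not_less_Least) simp
    moreover have "A * (2 ^ i / sqrt 2) = 2 * A * (2 ^ k / sqrt 2)" using Suc by simp
    ultimately show ?thesis by linarith
  qed
  then show ?thesis using i by blast
qed

lemma cell_diff: "\<bar>real_of_int (cell_index u i) - real_of_int (cell_index v i) - (u - v) / (2 ^ i / sqrt 2)\<bar> < 1"
  unfolding cell_index_def diff_divide_distrib
  using floor_correct[of "u / (2 ^ i / sqrt 2)"] floor_correct[of "v / (2 ^ i / sqrt 2)"] by linarith

text \<open>In a narrow cone most of the length is horizontal: the horizontal distance lies between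
  the cell side and \<open>2 * A\<close> times it, the vertical one is at most
  \<open>2 * A * \<kappa>\<close> times it. Rounding to cells changes each quotient by less than
  one.\<close>

lemma far_offset:
  fixes \<kappa> :: real and A b0 p q :: nat and X Y :: "nat \<Rightarrow> real"
  defines "a \<equiv> \<lambda>i. cell_index (X q) i - cell_index (X p) i" and "b \<equiv> \<lambda>i. cell_index (Y q) i - cell_index (Y p) i"
  assumes x: "0 < X q - X p" and y: "\<bar>Y q - Y p\<bar> \<le> \<kappa> * (X q - X p)" and k: "0 < \<kappa>" "\<kappa> \<le> 1/8" "2 * A * \<kappa> + 1 \<le> b0" "4 \<le> A"
    and D: "A * (2 ^ i / sqrt 2) < DD X Y p q" "DD X Y p q \<le> 2 * A * (2 ^ i / sqrt 2)"
  shows "1 \<le> a i \<and> a i \<le> 2 * int A + 1 \<and> \<bar>b i\<bar> \<le> int b0"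
proof -
  define s :: real where "s = 2 ^ i / sqrt 2"
  have s: "0 < s" by (simp add: s_def)
  let ?d = "X q - X p"
  have "?d \<le> 2 * A * s" using DD_ge[of X p q Y] D(2) x by (simp add: s_def)
  then have d1: "?d / s \<le> 2 * A" using s by (simp add: divide_le_eq)
  have e1: "DD X Y p q \<le> ?d + \<kappa> * ?d" using DD_le[of X Y p q] x y by linarith
  have e2: "\<kappa> * ?d \<le> 1/8 * ?d" by (rule mult_right_mono) (use k x in auto)
  \<comment> \<open>The horizontal part is at least 8/9 of the length; that it exceeds one half is
    enough.\<close>
  have "b < 2 * e" if "a \<le> e + f" "f \<le> 1/8 * e" "0 < e" "b < a" for a b e f :: real using that by linarith
  from this[OF e1 e2 x D(1)] have "A * s < 2 * ?d" unfolding s_def .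
  moreover have "4 * s \<le> A * s" by (rule mult_right_mono) (use k s in auto)
  ultimately have "4 * s < 2 * ?d" by (rule le_less_trans[rotated])
  then have "s < ?d" using s by simp
  then have d2: "1 < ?d / s" using s by (simp add: less_divide_eq)
  have "\<bar>Y q - Y p\<bar> / s \<le> \<kappa> * ?d / s" by (rule divide_right_mono[OF y]) (use s in simp)
  also have "\<dots> \<le> \<kappa> * (2 * A)" using mult_left_mono[OF d1, of \<kappa>] k by simp
  finally have b: "\<bar>(Y q - Y p) / s\<bar> \<le> 2 * A * \<kappa>" using s by (simp add: abs_divide mult.commute mult.left_commute)
  have ca: "\<bar>real_of_int (a i) - ?d / s\<bar> < 1" "\<bar>real_of_int (b i) - (Y q - Y p) / s\<bar> < 1"
    using cell_diff[of "X q" i "X p"] cell_diff[of "Y q" i "Y p"] by (simp_all add: a_def b_def s_def)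
  have "0 < real_of_int (a i)" "real_of_int (a i) < real_of_int (2 * int A + 2)" "\<bar>real_of_int (b i)\<bar> < real_of_int (int b0 + 1)"
    using ca d1 d2 b k(3) by (simp_all, linarith+)
  then show ?thesis by linarith
qed

lemma same_cell_dist:
  assumes "cell_index (X w) i = cell_index (X p) i" "cell_index (Y w) i = cell_index (Y p) i"
  shows "DD X Y p w \<le> 2 * (2 ^ i / sqrt 2)"
proof -
  define s :: real where "s = 2 ^ i / sqrt 2"
  have s: "0 < s" by (simp add: s_def)
  have "\<bar>(X p - X w) / s\<bar> < 1" "\<bar>(Y p - Y w) / s\<bar> < 1" using cell_diff[of "X p" i "X w"] cell_diff[of "Y p" i "Y w"] assms by (simp_all add: s_def)
  then have "\<bar>X p - X w\<bar> < s" "\<bar>Y p - Y w\<bar> < s" using s by (simp_all add: abs_divide)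
  then show ?thesis using DD_le[of X Y p w] by (simp add: s_def)
qed

text \<open>Rounding a long multiple of \<open>(u, v)\<close> to an integer vector moves it by at
  most one in each coordinate, which is a small angle when \<open>M\<close> is large. So finitely
  many integer axes serve all directions.\<close>

lemma direction_exists:
  fixes \<kappa> u v :: real
  assumes M: "2 < \<kappa> * (real M - 2)" and k: "0 < \<kappa>" and uv: "u \<noteq> 0 \<or> v \<noteq> 0"
  shows "\<exists>c d :: int. \<bar>c\<bar> \<le> int M \<and> \<bar>d\<bar> \<le> int M \<and> (c \<noteq> 0 \<or> d \<noteq> 0) \<and> \<bar>c * v - d * u\<bar> < \<kappa> * (c * u + d * v)"
proof -
  define s where "s = max \<bar>u\<bar> \<bar>v\<bar>"
  have s: "0 < s" "\<bar>u\<bar> \<le> s" "\<bar>v\<bar> \<le> s" using uv by (auto simp: s_def)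
  \<comment> \<open>The vector is first scaled to maximum norm \<open>M\<close>.\<close>
  define c d where "c = \<lfloor>M * u / s\<rfloor>" and "d = \<lfloor>M * v / s\<rfloor>"
  define e f where "e = M * u / s - c" and "f = M * v / s - d"
  have ef: "0 \<le> e" "e \<le> 1" "0 \<le> f" "f \<le> 1" unfolding e_def f_def c_def d_def by linarith+
  have bnd: "\<bar>\<lfloor>M * z / s\<rfloor>\<bar> \<le> int M" if "\<bar>z\<bar> \<le> s" for z :: real
  proof -
    have "\<bar>M * z / s\<bar> \<le> M" using that s by (simp add: abs_mult divide_le_eq mult_left_mono)
    then show ?thesis by linarith
  qed
  have eu: "\<bar>e * z\<bar> \<le> s" "\<bar>f * z\<bar> \<le> s" if "\<bar>z\<bar> \<le> s" for z
    using mult_mono[of e 1 "\<bar>z\<bar>" s] mult_mono[of f 1 "\<bar>z\<bar>" s] that ef s by (simp_all add: abs_mult)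
  have c: "real_of_int c = M * u / s - e" and d: "real_of_int d = M * v / s - f" by (simp_all add: e_def f_def)
  have "c * v - d * u = f * u - e * v" unfolding c d by (simp add: algebra_simps)
  then have x: "\<bar>c * v - d * u\<bar> \<le> 2 * s" using eu[OF s(2)] eu[OF s(3)] by linarith
  have "s * s \<le> u * u + v * v" unfolding s_def by (cases "\<bar>u\<bar> \<le> \<bar>v\<bar>") (simp_all add: max_def)
  then have "M * (s * s) / s \<le> M * (u * u + v * v) / s" using s by (intro divide_right_mono mult_left_mono) auto
  moreover have "c * u + d * v = M * (u * u + v * v) / s - e * u - f * v" unfolding c d by (simp add: algebra_simps add_divide_distrib)
  ultimately have "(real M - 2) * s \<le> c * u + d * v" using eu[OF s(2)] eu[OF s(3)] s by (simp add: algebra_simps)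
  then have "\<kappa> * ((real M - 2) * s) \<le> \<kappa> * (c * u + d * v)" using k by simp
  moreover have "2 * s < \<kappa> * (real M - 2) * s" using M s by (intro mult_strict_right_mono)
  ultimately have "\<bar>c * v - d * u\<bar> < \<kappa> * (c * u + d * v)" using x by (simp add: mult.assoc)
  moreover have "c \<noteq> 0 \<or> d \<noteq> 0" using calculation by auto
  ultimately show ?thesis using bnd[OF s(2)] bnd[OF s(3)] unfolding c_def d_def by blast
qed


lemma nw_level:
  "nw (level A b0 os) \<subseteq> {''id'', ''k'', ''p'', ''st'', ''cs'', ''pos'', ''q'', ''ord'', ''cid'', ''len'', ''bd'', ''wA'', ''wB'', ''nb'', ''j'', ''jo'', ''op'', ''op0'', ''i'',
     ''h'', ''l2'', ''l3'', ''w'', ''src'', ''dst'', ''m''}" (is "_ \<subseteq> ?N")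
  "rw (level A b0 os) \<subseteq> {''cc'', ''cw'', ''bA'', ''eA'', ''bB'', ''eB'', ''bb'', ''dx'', ''dy'', ''d2'', ''K'', ''sq'', ''ee'', ''rt'', ''md''}" (is "_ \<subseteq> ?R")
proof -
  have d: "nw (dc me) \<subseteq> ?N" "rw (dc me) \<subseteq> ?R" by (rule order_trans[OF nw_dcme(1)], simp, rule order_trans[OF nw_dcme(2)], simp)
  have q: "nw (qs os) \<subseteq> ?N" by (rule order_trans[OF qs_nw(1)]) simp
  show "nw (level A b0 os) \<subseteq> ?N" "rw (level A b0 os) \<subseteq> ?R"
    by (simp_all add: level_def hugephase_def midphase_def nw_order nw_build qs_nw(2) d q)
qed

lemma perm_bij:
  assumes "mset (map f [0..<n]) = mset [0..<n]"
  shows "bij_betw f {..<n} {..<n}" "distinct (map f [0..<n])" "set (map f [0..<n]) = {..<n}"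
proof -
  show d: "distinct (map f [0..<n])" using mset_eq_imp_distinct_iff[OF assms] by simp
  show s: "set (map f [0..<n]) = {..<n}" using mset_eq_setD[OF assms] by (simp add: atLeast0LessThan)
  show "bij_betw f {..<n} {..<n}" using d s by (simp add: bij_betw_def distinct_map atLeast0LessThan)
qed

definition ordd :: "nat \<Rightarrow> (nat \<Rightarrow> nat) \<Rightarrow> (nat \<Rightarrow> real) \<Rightarrow> bool" where
  "ordd n f Z \<longleftrightarrow> bij_betw f {..<n} {..<n} \<and> (\<forall>i j. i \<le> j \<longrightarrow> j < n \<longrightarrow> Z (f i) \<le> Z (f j))"

lemma orddI:
  assumes "mset (map f [0..<n]) = mset [0..<n]" "sorted (map (\<lambda>k. Z (f k)) [0..<n])"
  shows "ordd n f Z"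
  unfolding ordd_def
proof (intro conjI allI impI)
  show "bij_betw f {..<n} {..<n}" by (rule perm_bij[OF assms(1)])
  fix i j :: nat assume "i \<le> j" "j < n"
  then show "Z (f i) \<le> Z (f j)" using sorted_nth_mono[OF assms(2), of i j] by simp
qed

text \<open>The contribution of one level, stated outside the locale so that the statements for
  different levels can be collected.\<close>

definition levgood :: "nat \<Rightarrow> nat \<Rightarrow> (nat \<Rightarrow> real) \<Rightarrow> (nat \<Rightarrow> real) \<Rightarrow> (nat \<Rightarrow> real) \<Rightarrow> (nat \<Rightarrow> real) \<Rightarrow> (nat \<Rightarrow> real) \<Rightarrow> (nat \<Rightarrow> real) \<Rightarrow>
    (rat \<times> rat) list \<Rightarrow> nat \<Rightarrow> (nat \<times> nat) set \<Rightarrow> bool" where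
  "levgood n A x y r X Y \<rho> os i F \<longleftrightarrow> (\<forall>p<n. \<forall>q<n. \<forall>ab\<in>set os. A * (2 ^ i / sqrt 2) < \<rho> p \<longrightarrow> edge x y r p q \<longrightarrow>
     real_of_int (cell_index (X q) i) = real_of_int (cell_index (X p) i) + of_rat (fst ab) \<longrightarrow>
     real_of_int (cell_index (Y q) i) = real_of_int (cell_index (Y p) i) + of_rat (snd ab) \<longrightarrow>
     (\<exists>w<n. (w, q) \<in> F \<and> cell_index (X w) i = cell_index (X p) i \<and> cell_index (Y w) i = cell_index (Y p) i))"

lemma levgood_mono: "levgood n A x y r X Y \<rho> os i F \<Longrightarrow> F \<subseteq> F' \<Longrightarrow> levgood n A x y r X Y \<rho> os i F'"
  unfolding levgood_def by (meson subsetD)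

definition midcard :: "nat \<Rightarrow> nat \<Rightarrow> (nat \<Rightarrow> real) \<Rightarrow> nat \<Rightarrow> nat" where
  "midcard n A \<rho> i = card {q. q < n \<and> A * (2 ^ i / sqrt 2) < \<rho> q \<and> \<not> 4 * A * (2 ^ i / sqrt 2) < \<rho> q}"

lemma (in lvl) run_level':
  assumes n: "nmem s ''n'' 0 = n" "3 * n + 3 \<le> B" and st: "static x y r s" "rmem s ''X'' = X" "rmem s ''Y'' = Y" "rmem s ''ro'' = \<rho>"
    and lv: "rmem s ''s'' 0 = 2 ^ lev / sqrt 2" "nmem s ''lev'' 0 = lev"
    and px: "ordd n (nmem s ''px'') X" and py: "ordd n (nmem s ''py'') Y"
    and m: "nmem s ''m'' 0 + 2 * length os * n \<le> B"
  shows "run B (level A b0 os) s (klev * Suc n + dcl.kdc kme * (midcard n A \<rho> lev * lg n)) (\<lambda>s'. outs s \<subseteq> outs s' \<and> outs s' \<subseteq> outs s \<union> Eset \<and>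
     nmem s' ''m'' 0 \<le> nmem s ''m'' 0 + 2 * length os * n \<and> levgood n A x y r X Y \<rho> os lev (outs s'))"
proof -
  have mc: "midcard n A \<rho> lev = card midset" by (simp add: midcard_def midset_def isMid_def \<sigma>_def)
  have lg: "levgood n A x y r X Y \<rho> os lev F" if "found (\<lambda>q. A * \<sigma> < \<rho> q) F" for F
    using that unfolding found_def levgood_def off_def \<sigma>_def CX_def CY_def of_int_eq_iff by blast
  show ?thesis unfolding mc
    by (rule run_mono[OF run_level[OF n st lv(1)[folded \<sigma>_def] lv(2) _ _ _ _ m]]) (use px py lg in \<open>auto simp: ordd_def\<close>)
qed

text \<open>The two thresholds of the range differ by a factor of four, that is by two levels, so a
  radius lies in the range for at most two consecutive levels.\<close>

lemma sum_midcard: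
  assumes A: "0 < A"
  shows "(\<Sum>i<L. midcard n A \<rho> i) \<le> 2 * n"
proof -
  define s :: "nat \<Rightarrow> real" where "s i = 2 ^ i / sqrt 2" for i
  have s: "s (Suc i) = 2 * s i" "0 < s i" for i by (simp_all add: s_def)
  have sm: "s i \<le> s j" if "i \<le> j" for i j unfolding s_def by (intro divide_right_mono power_increasing that) auto
  define P where "P i q \<longleftrightarrow> A * s i < \<rho> q \<and> \<not> 4 * A * s i < \<rho> q" for i q
  have m: "midcard n A \<rho> i = (\<Sum>q<n. if P i q then 1 else 0)" for i
  proof -
    have "midcard n A \<rho> i = card {q \<in> {..<n}. P i q}" unfolding midcard_def P_def s_def by (rule arg_cong[of _ _ card]) auto
    then show ?thesis by (simp only: card_eq_sum sum.inter_filter finite_lessThan)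
  qed
  have "(\<Sum>i<L. midcard n A \<rho> i) = (\<Sum>q<n. \<Sum>i<L. if P i q then 1 else 0)" unfolding m by (rule sum.swap)
  also have "\<dots> \<le> (\<Sum>q<n. 2)"
  proof (rule sum_mono)
    fix q
    have "(\<Sum>i<L. if P i q then 1 else 0) = card {i \<in> {..<L}. P i q}" by (simp only: card_eq_sum sum.inter_filter finite_lessThan)
    also have "\<dots> \<le> 2"
    proof (cases "\<exists>i. P i q")
      case True
      define i0 where "i0 = (LEAST i. P i q)"
      have i0: "P i0 q" unfolding i0_def by (rule LeastI_ex[OF True])
      have "{i \<in> {..<L}. P i q} \<subseteq> {i0, Suc i0}"
      proof
        fix i assume "i \<in> {i \<in> {..<L}. P i q}"
        then have i: "P i q" by simp
        have "i0 \<le> i" unfolding i0_def by (rule Least_le) (rule i)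
        moreover have "\<not> Suc (Suc i0) \<le> i"
        proof
          assume "Suc (Suc i0) \<le> i"
          \<comment> \<open>Two levels up, the lower threshold has reached the upper threshold of
            level \<open>i0\<close>.\<close>
          then have "4 * s i0 \<le> s i" using sm[of "Suc (Suc i0)" i] by (simp add: s(1))
          then have "A * (4 * s i0) \<le> A * s i" by (rule mult_left_mono) simp
          then show False using i i0 by (simp add: P_def)
        qed
        ultimately show "i \<in> {i0, Suc i0}" by auto
      qed
      then have "card {i \<in> {..<L}. P i q} \<le> card {i0, Suc i0}" by (intro card_mono) auto
      then show ?thesis by simp
    qed auto
    finally show "(\<Sum>i<L. if P i q then 1 else 0) \<le> (2 :: nat)" .
  qed
  finally show ?thesis by simp
qed

section \<open>Rotation and scaling\<close>

text \<open>The coordinate along the axis \<open>(c, d)\<close>, normalised and scaled by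
  \<open>g\<close>; the arguments \<open>- d\<close> and \<open>c\<close> give the coordinate along
  the normal.\<close>

definition rot :: "real \<Rightarrow> int \<Rightarrow> int \<Rightarrow> real \<Rightarrow> real \<Rightarrow> real" where
  "rot g c d u v = (of_int c * u + of_int d * v) * g / sqrt (of_int (c * c + d * d))"

lemma DD_rot:
  assumes g: "0 < g" and cd: "c \<noteq> 0 \<or> d \<noteq> 0"
  shows "DD (\<lambda>q. rot g c d (x q) (y q)) (\<lambda>q. rot g (- d) c (x q) (y q)) p q = g * DD x y p q"
proof -
  define h where "h = sqrt (real_of_int (c * c + d * d))"
  have "0 < real_of_int c * real_of_int c + real_of_int d * real_of_int d" using cd sum_squares_gt_zero_iff[of "real_of_int c" "real_of_int d"] by simp
  then have h: "0 < h" "h\<^sup>2 = (real_of_int c)\<^sup>2 + (real_of_int d)\<^sup>2" by (simp_all add: h_def power2_eq_square)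
  have h': "sqrt (real_of_int ((- d) * (- d) + c * c)) = h" by (simp add: h_def add.commute)
  have e: "(a * (u - u') + b * (v - v')) * g / h = (a * u + b * v) * g / h - (a * u' + b * v') * g / h" for a b u u' v v' :: real
    by (simp add: diff_divide_distrib[symmetric] left_diff_distrib[symmetric]) (simp add: algebra_simps)
  have sq: "(a * g / h)\<^sup>2 + (b * g / h)\<^sup>2 = (a\<^sup>2 + b\<^sup>2) * g\<^sup>2 / h\<^sup>2" for a b :: real
    by (simp only: power_divide power_mult_distrib add_divide_distrib[symmetric] distrib_right)
  let ?u = "x p - x q" and ?v = "y p - y q"
  have "DD (\<lambda>q. rot g c d (x q) (y q)) (\<lambda>q. rot g (- d) c (x q) (y q)) p q = sqrt (((c * ?u + d * ?v) * g / h)\<^sup>2 + ((- d * ?u + c * ?v) * g / h)\<^sup>2)"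
    unfolding DD_eq rot_def h' h_def[symmetric] e by simp
  also have "((c * ?u + d * ?v) * g / h)\<^sup>2 + ((- d * ?u + c * ?v) * g / h)\<^sup>2 = ((c * ?u + d * ?v)\<^sup>2 + (- d * ?u + c * ?v)\<^sup>2) * g\<^sup>2 / h\<^sup>2"
    by (rule sq)
  also have "(c * ?u + d * ?v)\<^sup>2 + (- d * ?u + c * ?v)\<^sup>2 = h\<^sup>2 * (?u\<^sup>2 + ?v\<^sup>2)" unfolding h(2) by (simp add: power2_eq_square algebra_simps)
  finally show ?thesis using h(1) g by (simp add: real_sqrt_mult DD_eq mult.commute)
qed

definition rotx :: "int \<Rightarrow> int \<Rightarrow> rexp" where
  "rotx c d = RDiv (RMul (RAdd (RMul (RConst (of_int c)) (RRead ''x'' (V ''k''))) (RMul (RConst (of_int d)) (RRead ''y'' (V ''k'')))) (RV ''g0''))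
     (RSqrt (RConst (of_int (c * c + d * d))))"

lemma rval_rotx: "rval (rotx c d) s = rot (rmem s ''g0'' 0) c d (rmem s ''x'' (nmem s ''k'' 0)) (rmem s ''y'' (nmem s ''k'' 0))"
  by (simp only: rotx_def rot_def rval.simps nval.simps of_rat_of_int_eq)

definition load_body :: "int \<Rightarrow> int \<Rightarrow> com" where
  "load_body c d = (RAssign ''X'' (V ''k'') (rotx c d);; RAssign ''Y'' (V ''k'') (rotx (- d) c);;
     RAssign ''ro'' (V ''k'') (RMul (RRead ''r'' (V ''k'')) (RV ''g0''));; NAssign ''pi'' (V ''k'') (V ''k'');; inc ''k'')"
definition load :: "int \<Rightarrow> int \<Rightarrow> com" where
  "load c d = (setn ''k'' (NConst 0);; While (NLess (V ''k'') (V ''n'')) (load_body c d))"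
definition kload :: "int \<Rightarrow> int \<Rightarrow> nat" where
  "kload c d = tmax (setn ''k'' (NConst 0)) + kw (NLess (V ''k'') (V ''n'')) (load_body c d)"

lemma nw_load: "nw (load c d) = {''k'', ''pi''}" "rw (load c d) = {''X'', ''Y'', ''ro''}"
  by (auto simp: load_def load_body_def)

lemma run_load:
  assumes n: "nmem s ''n'' 0 = n" "Suc n \<le> B"
  shows "run B (load c d) s (kload c d * Suc n) (\<lambda>s'. \<forall>q<n. rmem s' ''X'' q = rot (rmem s ''g0'' 0) c d (rmem s ''x'' q) (rmem s ''y'' q) \<and>
     rmem s' ''Y'' q = rot (rmem s ''g0'' 0) (- d) c (rmem s ''x'' q) (rmem s ''y'' q) \<and> rmem s' ''ro'' q = rmem s ''r'' q * rmem s ''g0'' 0 \<and> nmem s' ''pi'' q = q)"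
  unfolding load_def
proof (rule run_lf_seq[where ?T2.0 = "kw (NLess (V ''k'') (V ''n'')) (load_body c d) * Suc n"], goal_cases)
  case 3
  define s1 where "s1 = fex (setn ''k'' (NConst 0)) s"
  have s1: "nmem s1 ''n'' 0 = n" "nmem s1 ''k'' 0 = 0" "rmem s1 = rmem s" by (simp_all add: s1_def n)
  show ?case unfolding s1_def[symmetric]
  proof (rule run_while_lf[where I = "\<lambda>s'. nmem s' ''k'' 0 \<le> n \<and> (\<forall>q<nmem s' ''k'' 0. rmem s' ''X'' q = rot (rmem s ''g0'' 0) c d (rmem s ''x'' q) (rmem s ''y'' q) \<and>
     rmem s' ''Y'' q = rot (rmem s ''g0'' 0) (- d) c (rmem s ''x'' q) (rmem s ''y'' q) \<and> rmem s' ''ro'' q = rmem s ''r'' q * rmem s ''g0'' 0 \<and> nmem s' ''pi'' q = q)"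
      and \<psi> = "\<lambda>s'. n - nmem s' ''k'' 0"], goal_cases)
    case (3 s')
    have u: "nmem s' ''n'' = nmem s1 ''n''" "rmem s' ''g0'' = rmem s ''g0''" "rmem s' ''x'' = rmem s ''x''" "rmem s' ''y'' = rmem s ''y''" "rmem s' ''r'' = rmem s ''r''"
      using unch_n[OF 3(2), of "''n''"] unch_r[OF 3(2), of "''g0''"] unch_r[OF 3(2), of "''x''"] unch_r[OF 3(2), of "''y''"] unch_r[OF 3(2), of "''r''"]
      by (simp_all add: load_body_def s1)
    then show ?case using 3 n by (auto simp: load_body_def s1 rval_rotx less_Suc_eq)
  next
    case (4 s')
    have u: "nmem s' ''n'' = nmem s1 ''n''" using unch_n[OF 4(2), of "''n''"] by (simp add: load_body_def)
    then show ?case using 4 by (simp add: s1)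
  qed (simp_all add: s1 load_body_def)
next
  case 4 show ?case by (simp add: kload_def add_mult_distrib)
qed simp_all

section \<open>The criterion for spanners\<close>

text \<open>The edge \<open>p w\<close> is strictly shorter than \<open>p q\<close> because the arc
  \<open>w q\<close> has positive length and \<open>t\<close> is positive. After single edges, walks
  are replaced arc by arc, and the bound passes to the infima that define the distances.\<close>

lemma t_spanner_if_last_arc:
  fixes H :: "(real ^ 2) pair_pre_digraph" and P :: "(real ^ 2) set" and r :: "real ^ 2 \<Rightarrow> real"
  defines "G \<equiv> transmission_graph P r"
  assumes P: "finite P" and t: "1 < t" and H: "pverts H = P" "parcs H \<subseteq> parcs G"
    and step: "\<And>p q. (p, q) \<in> parcs G \<Longrightarrow>
      \<exists>w. (w, q) \<in> parcs H \<and> (w = p \<or> (p, w) \<in> parcs G \<and> t * dist p w + dist w q \<le> t * dist p q)"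
  shows "t_spanner t H G"
proof -
  let ?f = "\<lambda>(p, q). dist p q :: real"
  interpret G: wf_digraph "with_proj G" unfolding G_def by (rule wf_transmission_graph)
  have GP: "parcs G \<subseteq> P \<times> P" "pverts G = P" "\<And>p. (p, p) \<notin> parcs G" by (auto simp: G_def transmission_graph_def)
  have fG: "finite (parcs G)" using finite_subset[OF GP(1)] P by simp
  have wfH: "wf_digraph (with_proj H)" using H GP by unfold_locales auto
  interpret H: wf_digraph "with_proj H" by (rule wfH)
  have arc: "\<exists>es. H.awalk p es q \<and> sum_list (map ?f es) \<le> t * dist p q" if "(p, q) \<in> parcs G" for p q
    using that
  \<comment> \<open>Lengths are real, so the induction runs over the number of strictly shorter
    edges, which is finite.\<close>
  proof (induction "card {e \<in> parcs G. ?f e < dist p q}" arbitrary: p q rule: less_induct)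
    case less
    obtain w where w: "(w, q) \<in> parcs H" "w = p \<or> (p, w) \<in> parcs G \<and> t * dist p w + dist w q \<le> t * dist p q"
      using step[OF less.prems] by blast
    have wP: "w \<in> P" "q \<in> P" "w \<noteq> q" using w H GP by auto
    have last: "H.awalk w [(w, q)] q" using w(1) wP H(1) by (simp add: H.awalk_simps)
    show ?case
    proof (cases "w = p")
      case True
      have "1 * dist p q \<le> t * dist p q" using t by (intro mult_right_mono) auto
      then show ?thesis using last True by (intro exI[of _ "[(w, q)]"]) simp
    next
      case False
      then have pw: "(p, w) \<in> parcs G" "t * dist p w + dist w q \<le> t * dist p q" using w by auto
      have "0 < dist w q" using wP by simp
      then have "t * dist p w < t * dist p q" using pw by linarith
      then have lt: "dist p w < dist p q" using t by simp
      have "{e \<in> parcs G. ?f e < dist p w} \<subseteq> {e \<in> parcs G. ?f e < dist p q}" using lt by auto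
      moreover have "(p, w) \<in> {e \<in> parcs G. ?f e < dist p q}" "(p, w) \<notin> {e \<in> parcs G. ?f e < dist p w}" using pw lt by auto
      ultimately have "{e \<in> parcs G. ?f e < dist p w} \<subset> {e \<in> parcs G. ?f e < dist p q}" by blast
      then have "card {e \<in> parcs G. ?f e < dist p w} < card {e \<in> parcs G. ?f e < dist p q}"
        by (rule psubset_card_mono[rotated]) (use fG in simp)
      from less.hyps[OF this pw(1)] obtain es where es: "H.awalk p es w" "sum_list (map ?f es) \<le> t * dist p w" by blast
      have "H.awalk p (es @ [(w, q)]) q" by (rule H.awalk_appendI[OF es(1) last])
      then show ?thesis using es(2) pw(2) by (intro exI[of _ "es @ [(w, q)]"]) simp
    qed
  qed
  have walk: "\<exists>es'. H.awalk p es' q \<and> sum_list (map ?f es') \<le> t * sum_list (map ?f es)" if "G.awalk p es q" for p q es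
    using that
  proof (induction es arbitrary: p)
    case Nil
    have "p = q \<and> p \<in> P" using Nil GP(2) by (auto simp: G.awalk_simps)
    then show ?case using H(1) GP(2) by (intro exI[of _ "[]"]) (auto simp: G.awalk_simps H.awalk_simps)
  next
    case (Cons e es)
    obtain a b where e: "e = (a, b)" by (cases e)
    have c: "(a, b) \<in> parcs G" "p = a" "G.awalk b es q" using Cons.prems by (simp_all add: e G.awalk_simps)
    obtain es1 where 1: "H.awalk a es1 b" "sum_list (map ?f es1) \<le> t * dist a b" using arc[OF c(1)] by blast
    obtain es2 where 2: "H.awalk b es2 q" "sum_list (map ?f es2) \<le> t * sum_list (map ?f es)" using Cons.IH[OF c(3)] by blast
    have "H.awalk a (es1 @ es2) q" by (rule H.awalk_appendI[OF 1(1) 2(1)])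
    then show ?case using 1(2) 2(2) c(2) by (intro exI[of _ "es1 @ es2"]) (simp add: e distrib_left)
  qed
  have le: "graph_dist H p q \<le> ereal t * graph_dist G p q" for p q
  proof -
    \<comment> \<open>With \<open>t\<close> divided out, the right-hand side is an infimum over
      walks, and unreachable pairs need no separate case.\<close>
    have "graph_dist H p q / ereal t \<le> graph_dist G p q"
      unfolding graph_dist_def G.\<mu>_def
    proof (rule INF_greatest)
      fix es assume "es \<in> {es. G.awalk p es q}"
      then obtain es' where es': "H.awalk p es' q" "sum_list (map ?f es') \<le> t * sum_list (map ?f es)" using walk by blast
      have "H.\<mu> ?f p q \<le> ereal (sum_list (map ?f es'))"
        unfolding H.\<mu>_def H.awalk_cost_def by (rule INF_lower) (use es' in simp)
      also have "\<dots> \<le> ereal t * ereal (sum_list (map ?f es))" using es'(2) by simp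
      finally show "H.\<mu> ?f p q / ereal t \<le> ereal (G.awalk_cost ?f es)"
        unfolding G.awalk_cost_def by (subst ereal_divide_le_pos) (use t in simp_all)
    qed
    then show ?thesis by (subst (asm) ereal_divide_le_pos) (use t in simp_all)
  qed
  have "spanning (with_proj H) (with_proj G)"
    unfolding spanning_def subgraph_def using H GP(2) G.wf_digraph_axioms wfH by auto
  then show ?thesis unfolding t_spanner_def using le by blast
qed

section \<open>All levels of one cone\<close>

definition lin :: "rat \<Rightarrow> rat \<Rightarrow> nexp \<Rightarrow> rexp" where
  "lin a b = (\<lambda>e. RAdd (RMul (RConst a) (RRead ''X'' e)) (RMul (RConst b) (RRead ''Y'' e)))"

lemma keyexp_lin1: "keyexp (lin a 1) (\<lambda>x y. of_rat a * x + y)" "keyexp (lin a (- 1)) (\<lambda>x y. of_rat a * x - y)"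
  by (simp_all add: keyexp_def lin_def of_rat_minus)

definition lvnext :: com where "lvnext = (setr ''s'' (RAdd (RV ''s'') (RV ''s''));; inc ''lev'')"
text \<open>Once this fails, no scaled radius exceeds \<open>A\<close> times the cell side, so no
  edge is long enough to belong to this level or a later one.\<close>

definition lvcond :: "nat \<Rightarrow> bexp" where "lvcond A = RLess (RMul (RConst (of_nat A)) (RV ''s'')) (RMul (RV ''rmax'') (RV ''g0''))"
definition lvinit :: com where "lvinit = (setr ''s'' (RDiv (RConst 1) (RSqrt (RConst 2)));; setn ''lev'' (NConst 0))"
definition levels :: "nat \<Rightarrow> nat \<Rightarrow> (rat \<times> rat) list \<Rightarrow> com" where
  "levels A b0 os = (lvinit;; While (lvcond A) (level A b0 os;; lvnext))"
definition klevs :: "nat \<Rightarrow> nat \<Rightarrow> (rat \<times> rat) list \<Rightarrow> nat" where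
  "klevs A b0 os = tmax lvinit + (lvl.klev A b0 os + tmax lvnext + bcost (lvcond A) + 1) + 2 * dcl.kdc kme + bcost (lvcond A) + 1"

text \<open>The first two sorts keep the orders by \<open>X\<close> and \<open>Y\<close> for the
  grid levels. The last sort starts from the order by \<open>kap X + Y\<close> left by the third, so
  the \<open>best\<close> entries that \<open>part1\<close> reads are those of the backward
  cones.\<close>

definition dirprog :: "nat \<Rightarrow> nat \<Rightarrow> (rat \<times> rat) list \<Rightarrow> rat \<Rightarrow> int \<Rightarrow> int \<Rightarrow> com" where
  "dirprog A b0 os kap c d = (load c d;; sort (RRead ''X'') ''px'';; sort (RRead ''Y'') ''py'';; sort (lin kap 1) ''pz'';; sort (lin kap (- 1)) ''pz'';;
     setn ''k'' (NConst 0);; part1;; levels A b0 os)"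
definition kdir :: "nat \<Rightarrow> nat \<Rightarrow> (rat \<times> rat) list \<Rightarrow> rat \<Rightarrow> int \<Rightarrow> int \<Rightarrow> nat" where
  "kdir A b0 os kap c d = kload c d + ((ksort (RRead ''X'') ''px'' + dcl.kdc kms) + ((ksort (RRead ''Y'') ''py'' + dcl.kdc kms) +
     ((ksort (lin kap 1) ''pz'' + dcl.kdc kms) + ((ksort (lin kap (- 1)) ''pz'' + dcl.kdc kms) +
     (tmax (setn ''k'' (NConst 0)) + (kpart1 + klevs A b0 os))))))"

lemma nw_dir: "''n'' \<notin> nw (dirprog A b0 os kap c d)" "rw (dirprog A b0 os kap c d) \<inter> {''x'', ''y'', ''r'', ''rmax'', ''g0''} = {}"
proof -
  have s: "''n'' \<notin> nw (sort ke d)" "rw (sort ke d) \<inter> {''x'', ''y'', ''r'', ''rmax'', ''g0''} = {}" if "d \<in> {''px'', ''py'', ''pz''}" for ke d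
    using nw_sort(1)[of ke d] nw_sort(2)[of ke d] that by auto
  have l: "''n'' \<notin> nw (level A b0 os)" "rw (level A b0 os) \<inter> {''x'', ''y'', ''r'', ''rmax'', ''g0''} = {}"
    using nw_level(1)[of A b0 os] nw_level(2)[of A b0 os] by auto
  show "''n'' \<notin> nw (dirprog A b0 os kap c d)"
    by (simp add: dirprog_def nw_load s l levels_def lvinit_def lvnext_def part1_def emit_def)
  show "rw (dirprog A b0 os kap c d) \<inter> {''x'', ''y'', ''r'', ''rmax'', ''g0''} = {}"
    using s(2)[of "''px''" "RRead ''X''"] s(2)[of "''py''" "RRead ''Y''"] s(2)[of "''pz''" "lin kap 1"] s(2)[of "''pz''" "lin kap (- 1)"] l(2)
    by (simp add: dirprog_def nw_load Int_Un_distrib2 levels_def lvinit_def lvnext_def part1_def emit_def)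
qed

text \<open>The conditions on \<open>t\<close> come from the two kinds of edges:
  \<open>1 + kap \<le> t * (1 - 2 * kap)\<close> from short edges through
  \<open>cone_nearer\<close>, and \<open>2 * (t + 1) \<le> A * (t - 1)\<close> from long ones, where
  the detour inside a cell must be paid by the length. \<open>R\<close> bounds the radii,
  \<open>g\<close> is the scale, and \<open>L\<close> bounds the number of levels.\<close>

locale sites =
  fixes n A b0 L B :: nat and x y r :: "nat \<Rightarrow> real" and R g t :: real and os :: "(rat \<times> rat) list" and kap :: rat
  assumes A: "b0 + 3 \<le> 2 * A" "b0 + 1 \<le> A" "4 \<le> A"
    and os: "set os = {(of_int a, of_int b) | a b. 1 \<le> a \<and> a \<le> 2 * int A + 1 \<and> \<bar>b\<bar> \<le> int b0}"
    and inj: "p < n \<Longrightarrow> q < n \<Longrightarrow> x p = x q \<Longrightarrow> y p = y q \<Longrightarrow> p = q"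
    and g: "0 < g" and rmin: "q < n \<Longrightarrow> 2 * A \<le> r q * g" and rmax: "q < n \<Longrightarrow> r q \<le> R"
    and L: "R * g \<le> A * (2 ^ L / sqrt 2)"
    and kap: "0 < kap" "(of_rat kap :: real) \<le> 1/8" "2 * A * of_rat kap + 1 \<le> real b0"
    and t: "1 < t" "1 + of_rat kap \<le> t * (1 - 2 * of_rat kap)" "2 * (t + 1) \<le> A * (t - 1)"
    and B: "3 * n + 3 \<le> B" "L \<le> B"
begin

abbreviation "\<kappa> \<equiv> of_rat kap :: real"
abbreviation "E \<equiv> {(p, q). p < n \<and> q < n \<and> edge x y r p q}"
abbreviation "W \<equiv> Suc n * (1 + lg n + L)"
abbreviation "M \<equiv> 2 * length os * n"

lemma k0: "0 < \<kappa>" using kap by simp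

definition env :: "store \<Rightarrow> bool" where
  "env s \<longleftrightarrow> nmem s ''n'' 0 = n \<and> static x y r s \<and> rmem s ''rmax'' 0 = R \<and> rmem s ''g0'' 0 = g"

lemma env_cong:
  assumes "env s" "nmem s' ''n'' = nmem s ''n''" "\<And>a. a \<in> {''x'', ''y'', ''r'', ''rmax'', ''g0''} \<Longrightarrow> rmem s' a = rmem s a"
  shows "env s'"
  using assms(1,2) by (simp add: env_def static_def assms(3))

lemma env_unch:
  assumes "env s" "unch c s s'" "''n'' \<notin> nw c" "rw c \<inter> {''x'', ''y'', ''r'', ''rmax'', ''g0''} = {}"
  shows "env s'"
proof (rule env_cong[OF assms(1)])
  show "nmem s' ''n'' = nmem s ''n''" by (rule unch_n[OF assms(2,3)])
  show "rmem s' a = rmem s a" if "a \<in> {''x'', ''y'', ''r'', ''rmax'', ''g0''}" for a by (rule unch_r[OF assms(2)]) (rule disjointE1[OF assms(4) that])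
qed

definition frame :: "(nat \<Rightarrow> real) \<Rightarrow> (nat \<Rightarrow> real) \<Rightarrow> (nat \<Rightarrow> real) \<Rightarrow> bool" where
  "frame X Y \<rho> \<longleftrightarrow> (\<forall>q<n. \<rho> q = r q * g) \<and> (\<forall>p<n. \<forall>q<n. DD X Y p q = g * DD x y p q)"

lemma edge_frame: "frame X Y \<rho> \<Longrightarrow> p < n \<Longrightarrow> q < n \<Longrightarrow> edge x y r p q \<longleftrightarrow> p \<noteq> q \<and> DD X Y p q \<le> \<rho> p"
  using g by (simp add: edge_DD frame_def mult.commute)

lemma frame_lvl:
  assumes f: "frame X Y \<rho>"
  shows "lvl n A b0 x y r X Y \<rho> os"
proof
  fix p q assume pq: "p < n" "q < n"
  show "edge x y r p q \<longleftrightarrow> p \<noteq> q \<and> sqrt ((X p - X q) * (X p - X q) + (Y p - Y q) * (Y p - Y q)) \<le> \<rho> p"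
    using edge_frame[OF f pq] by (simp add: DD_def)
  assume e: "X p = X q" "Y p = Y q"
  have "DD X Y p q = 0" using e by (simp add: DD_def)
  then have "DD x y p q = 0" using f pq g by (simp add: frame_def)
  then have "x p = x q \<and> y p = y q" by (simp add: DD_eq)
  then show "p = q" using inj[OF pq] by blast
next
  fix a b assume "(a, b) \<in> set os"
  then show "\<exists>a' b'. a = of_int a' \<and> b = of_int b' \<and> 1 \<le> a' \<and> a' \<le> 2 * int A + 1 \<and> \<bar>b'\<bar> \<le> int b0" unfolding os by blast
qed (use A in auto)

text \<open>The hypothesis of \<open>t_spanner_if_last_arc\<close> for one edge, in terms of site
  indices.\<close>

definition near :: "(nat \<times> nat) set \<Rightarrow> nat \<Rightarrow> nat \<Rightarrow> bool" where
  "near F p q \<longleftrightarrow> (\<exists>w<n. (w, q) \<in> F \<and> (w = p \<or> edge x y r p w \<and> t * DD x y p w + DD x y w q \<le> t * DD x y p q))"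

lemma nearI:
  assumes f: "frame X Y \<rho>" and n: "p < n" "q < n" "w < n" and F: "(w, q) \<in> F"
    and d: "t * DD X Y p w + DD X Y w q \<le> t * DD X Y p q" "DD X Y p w \<le> \<rho> p"
  shows "near F p q"
proof (cases "w = p")
  case False
  have e: "DD X Y u v = g * DD x y u v" if "u < n" "v < n" for u v using f that by (simp add: frame_def)
  have "g * (t * DD x y p w + DD x y w q) \<le> g * (t * DD x y p q)" using d(1) n by (simp add: e algebra_simps)
  then have "t * DD x y p w + DD x y w q \<le> t * DD x y p q" using g by simp
  moreover have "edge x y r p w" using edge_frame[OF f n(1,3)] d(2) False by simp
  ultimately show ?thesis unfolding near_def using F n by blast
qed (use F n in \<open>auto simp: near_def\<close>)

lemma near_mono: "near F p q \<Longrightarrow> F \<subseteq> F' \<Longrightarrow> near F' p q" unfolding near_def by blast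

text \<open>The strict cone condition puts \<open>p\<close> strictly before \<open>q\<close> in both
  sorted coordinates, so \<open>best q\<close> names a site \<open>p'\<close> at least as far along
  \<open>X\<close> as \<open>p\<close>. Since the horizontal distance is at most \<open>A\<close>,
  the arc from \<open>p'\<close> to \<open>q\<close> is no longer than \<open>2 * A\<close>, the
  lower bound on the scaled radii.\<close>

lemma near_if_close:
  fixes X Y :: "nat \<Rightarrow> real"
  defines "u \<equiv> \<lambda>q. \<kappa> * X q + Y q" and "v \<equiv> \<lambda>q. \<kappa> * X q - Y q"
  assumes f: "frame X Y \<rho>" and G: "distinct G" "set G = {..<n}" "sorted (map u G)" and bk: "bok best v X G"
    and F: "{(p, q). q < n \<and> best q = Suc p \<and> edge x y r p q} \<subseteq> F" and pq: "p < n" "q < n"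
    and cone: "\<bar>Y q - Y p\<bar> < \<kappa> * (X q - X p)" and D: "DD X Y p q \<le> A"
  shows "near F p q"
proof -
  have "0 < \<kappa> * (X q - X p)" using cone by linarith
  then have x0: "0 < X q - X p" using k0 by (simp add: zero_less_mult_iff)
  have uv: "u p < u q" "v p < v q" using cone by (simp_all add: u_def v_def algebra_simps abs_less_iff)
  obtain i j where ij: "i < length G" "j < length G" "G ! i = p" "G ! j = q" using pq G(2) by (metis in_set_conv_nth lessThan_iff)
  have "\<not> j \<le> i" using sorted_nth_mono[OF G(3), of j i] ij uv by auto
  then have "before G p q" unfolding before_def using ij by (intro exI[of _ i] exI[of _ j]) simp
  then obtain p' where p': "best q = Suc p'" "X p \<le> X p'" using bk uv(2) unfolding bok_def by (meson less_imp_le)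
  have b: "before G p' q" "v p' \<le> v q" using bk p'(1) pq(2) G(2) unfolding bok_def by auto
  obtain i' j' where i': "i' < j'" "j' < length G" "G ! i' = p'" "G ! j' = q" using b(1) unfolding before_def by blast
  have u': "u p' \<le> u q" using sorted_nth_mono[OF G(3), of i' j'] i' by simp
  have ne: "p' \<noteq> q" using i' nth_eq_iff_index_eq[OF G(1), of i' j'] by auto
  have n': "p' < n" using i' G(2) nth_mem[of i' G] by simp
  note c = cone_nearer[OF k0 t(2) t(1) kap(2) u'[unfolded u_def] b(2)[unfolded v_def] p'(2) x0 less_imp_le[OF cone]]
  have k1: "(1 + \<kappa>) * a \<le> 2 * b" if "0 \<le> a" "a \<le> b" for a b
  proof -
    have "1 + \<kappa> \<le> 2" using kap(2) by linarith
    then have "(1 + \<kappa>) * a \<le> 2 * a" using that(1) by (rule mult_right_mono)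
    then show ?thesis using that(2) by linarith
  qed
  have "X q - X p \<le> A" using DD_ge[of X p q Y] x0 D by linarith
  then have "(1 + \<kappa>) * (X q - X p') \<le> 2 * A" using k1[of "X q - X p'" "real A"] c(4) p'(2) by simp
  then have "DD X Y p' q \<le> \<rho> p'" using c(1) rmin[OF n'] f n' by (simp add: frame_def)
  then have "edge x y r p' q" using edge_frame[OF f n' pq(2)] ne by simp
  then have "(p', q) \<in> F" using F p'(1) pq(2) by blast
  moreover have "DD X Y p p' \<le> \<rho> p" using c(3) D rmin[OF pq(1)] f pq(1) by (simp add: frame_def)
  ultimately show ?thesis using nearI[OF f pq n' _ c(2)] by blast
qed

text \<open>With cell side \<open>s\<close> and \<open>w\<close> within \<open>2 * s\<close> of
  \<open>p\<close>, the detour costs at most \<open>2 * (t + 1) * s\<close>, which is at most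
  \<open>(t - 1) * A * s\<close> and hence below \<open>t - 1\<close> times the length of the edge.
  This is where \<open>A\<close> has to be large in terms of \<open>t\<close>.\<close>

lemma near_if_far:
  assumes f: "frame X Y \<rho>" and F: "\<And>i. A * (2 ^ i / sqrt 2) < R * g \<Longrightarrow> levgood n A x y r X Y \<rho> os i F" and pq: "p < n" "q < n"
    and cone: "\<bar>Y q - Y p\<bar> < \<kappa> * (X q - X p)" and D: "A < DD X Y p q" and e: "edge x y r p q"
  shows "near F p q"
proof -
  have "0 < \<kappa> * (X q - X p)" using cone by linarith
  then have x0: "0 < X q - X p" using k0 by (simp add: zero_less_mult_iff)
  obtain i where i: "A * (2 ^ i / sqrt 2) < DD X Y p q" "DD X Y p q \<le> 2 * A * (2 ^ i / sqrt 2)" using level_exists[OF D] A by auto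
  define s :: real where "s = 2 ^ i / sqrt 2"
  have s: "0 < s" by (simp add: s_def)
  have rp: "DD X Y p q \<le> \<rho> p" using e edge_frame[OF f pq] by simp
  have "\<rho> p \<le> R * g" using f pq rmax[OF pq(1)] g by (simp add: frame_def)
  then have lg: "levgood n A x y r X Y \<rho> os i F" using i rp by (intro F) linarith
  define a b where "a = cell_index (X q) i - cell_index (X p) i" and "b = cell_index (Y q) i - cell_index (Y p) i"
  have "1 \<le> a \<and> a \<le> 2 * int A + 1 \<and> \<bar>b\<bar> \<le> int b0"
    unfolding a_def b_def by (rule far_offset[OF x0 less_imp_le[OF cone] k0 kap(2,3) A(3) i])
  then have ab: "(of_int a, of_int b) \<in> set os" unfolding os by blast
  have c: "real_of_int (cell_index (X q) i) = real_of_int (cell_index (X p) i) + of_rat (fst (of_int a :: rat, of_int b :: rat))"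
    "real_of_int (cell_index (Y q) i) = real_of_int (cell_index (Y p) i) + of_rat (snd (of_int a :: rat, of_int b :: rat))"
    unfolding fst_conv snd_conv of_rat_of_int_eq by (simp_all add: a_def b_def)
  have "A * (2 ^ i / sqrt 2) < \<rho> p" using i rp by linarith
  from lg[unfolded levgood_def, rule_format, OF pq ab this e c]
  obtain w where w: "w < n" "(w, q) \<in> F" "cell_index (X w) i = cell_index (X p) i" "cell_index (Y w) i = cell_index (Y p) i" by blast
  have d: "DD X Y p w \<le> 2 * s" using same_cell_dist[OF w(3,4)] by (simp add: s_def)
  have "DD X Y w q \<le> 2 * s + DD X Y p q" using DD_tri[of X Y w q p] DD_sym[of X Y w p] d by simp
  moreover have "t * DD X Y p w \<le> t * (2 * s)" using d t(1) by simp
  moreover have "2 * (t + 1) * s \<le> A * (t - 1) * s" using t(3) s by simp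
  moreover have "(t - 1) * (A * s) \<le> (t - 1) * DD X Y p q"
    by (rule mult_left_mono) (use i(1) t(1) in \<open>simp_all add: s_def\<close>)
  ultimately have "t * DD X Y p w + DD X Y w q \<le> t * DD X Y p q" by (simp add: algebra_simps)
  moreover have "2 * s \<le> A * s" using A(3) s by simp
  then have "DD X Y p w \<le> \<rho> p" using d i(1) rp by (simp add: s_def)
  ultimately show ?thesis using nearI[OF f pq w(1,2)] by blast
qed

lemma run_levels:
  assumes f: "frame X Y \<rho>" and e: "env s" and X: "rmem s ''X'' = X" "rmem s ''Y'' = Y" "rmem s ''ro'' = \<rho>"
    and px: "ordd n (nmem s ''px'') X" and py: "ordd n (nmem s ''py'') Y" and m: "nmem s ''m'' 0 + L * M \<le> B"
  shows "run B (levels A b0 os) s (klevs A b0 os * W) (\<lambda>s'. outs s \<subseteq> outs s' \<and> outs s' \<subseteq> outs s \<union> E \<and> nmem s' ''m'' 0 \<le> nmem s ''m'' 0 + L * M \<and>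
     (\<forall>i. A * (2 ^ i / sqrt 2) < R * g \<longrightarrow> levgood n A x y r X Y \<rho> os i (outs s')))"
proof -
  note lv = frame_lvl[OF f]
  let ?K = "lvl.klev A b0 os" let ?b = "bcost (lvcond A)"
  let ?body = "level A b0 os;; lvnext"
  define cost where "cost i = ?K * Suc n + dcl.kdc kme * (midcard n A \<rho> i * lg n) + tmax lvnext + ?b + 1" for i
  let ?I = "\<lambda>s'. nmem s' ''lev'' 0 \<le> L \<and> rmem s' ''s'' 0 = 2 ^ (nmem s' ''lev'' 0) / sqrt 2 \<and> outs s \<subseteq> outs s' \<and> outs s' \<subseteq> outs s \<union> E \<and>
     nmem s' ''m'' 0 \<le> nmem s ''m'' 0 + nmem s' ''lev'' 0 * M \<and> (\<forall>i<nmem s' ''lev'' 0. levgood n A x y r X Y \<rho> os i (outs s'))"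
  \<comment> \<open>The cost of a level depends on its number of medium sites, so the potential adds
    up the costs of the levels still to come; \<open>sum_midcard\<close> bounds the total.\<close>
  let ?Phi = "\<lambda>s'. \<Sum>i\<in>{nmem s' ''lev'' 0..<L}. cost i"
  define s2 where "s2 = fex lvinit s"
  have s2: "nmem s2 a = nmem s a" if "a \<noteq> ''lev''" for a using that by (simp add: s2_def lvinit_def)
  have s2r: "rmem s2 a = rmem s a" if "a \<noteq> ''s''" for a using that by (simp add: s2_def lvinit_def)
  have s20: "nmem s2 ''lev'' 0 = 0" "rmem s2 ''s'' 0 = 1 / sqrt 2" by (simp_all add: s2_def lvinit_def)
  have o2: "outs s2 = outs s" by (simp add: outs_def s2)
  have A0: "0 < A" using A by simp
  have "(\<Sum>i<L. cost i) = (\<Sum>i<L. ?K * Suc n + tmax lvnext + ?b + 1) + (\<Sum>i<L. dcl.kdc kme * (midcard n A \<rho> i * lg n))"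
    unfolding cost_def sum.distrib[symmetric] by (rule sum.cong) simp_all
  also have "\<dots> = L * (?K * Suc n + tmax lvnext + ?b + 1) + dcl.kdc kme * ((\<Sum>i<L. midcard n A \<rho> i) * lg n)"
    by (simp only: sum_constant card_lessThan of_nat_id sum_distrib_left[symmetric] sum_distrib_right[symmetric])
  also have "\<dots> \<le> (?K + tmax lvnext + ?b + 1) * W + (2 * dcl.kdc kme) * W"
  proof (rule add_mono)
    have "?K * Suc n + tmax lvnext + ?b + 1 \<le> (?K + tmax lvnext + ?b + 1) * Suc n" by (simp add: add_mult_distrib)
    then have "L * (?K * Suc n + tmax lvnext + ?b + 1) \<le> L * ((?K + tmax lvnext + ?b + 1) * Suc n)" by (rule mult_le_mono2)
    also have "\<dots> = (?K + tmax lvnext + ?b + 1) * (Suc n * L)" by (simp only: mult_ac)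
    also have "\<dots> \<le> (?K + tmax lvnext + ?b + 1) * W" by (intro mult_le_mono2) simp
    finally show "L * (?K * Suc n + tmax lvnext + ?b + 1) \<le> (?K + tmax lvnext + ?b + 1) * W" .
    have "(\<Sum>i<L. midcard n A \<rho> i) * lg n \<le> 2 * n * lg n" using sum_midcard[OF A0] by (rule mult_le_mono1)
    also have "\<dots> \<le> 2 * W" by (simp add: algebra_simps)
    finally have "dcl.kdc kme * ((\<Sum>i<L. midcard n A \<rho> i) * lg n) \<le> dcl.kdc kme * (2 * W)" by (rule mult_le_mono2)
    then show "dcl.kdc kme * ((\<Sum>i<L. midcard n A \<rho> i) * lg n) \<le> (2 * dcl.kdc kme) * W" by (simp only: mult_ac)
  qed
  finally have Phi: "(\<Sum>i<L. cost i) \<le> (?K + tmax lvnext + ?b + 1) * W + (2 * dcl.kdc kme) * W" .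
  have lvr: "run B (While (lvcond A) ?body) s2 ((?K + tmax lvnext + ?b + 1) * W + (2 * dcl.kdc kme) * W + ?b + 1)
      (\<lambda>s'. outs s \<subseteq> outs s' \<and> outs s' \<subseteq> outs s \<union> E \<and> nmem s' ''m'' 0 \<le> nmem s ''m'' 0 + L * M \<and>
     (\<forall>i. A * (2 ^ i / sqrt 2) < R * g \<longrightarrow> levgood n A x y r X Y \<rho> os i (outs s')))"
  proof (rule run_while[where I = ?I and \<Phi> = ?Phi])
    show "?I s2" by (simp add: s20 o2 s2)
  next
    fix s' assume I: "?I s'" and u: "unch ?body s2 s'" and b: "bval (lvcond A) s'"
    let ?l = "nmem s' ''lev'' 0"
    have un: "nmem s' a = nmem s a" if "a \<in> {''n'', ''px'', ''py''}" for a
    proof -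
      have "nmem s' a = nmem s2 a" by (rule unch_n[OF u]) (use that nw_level(1)[of A b0 os] in \<open>auto simp: lvnext_def\<close>)
      then show ?thesis using that s2 by auto
    qed
    have ur: "rmem s' a = rmem s a" if "a \<in> {''X'', ''Y'', ''ro'', ''x'', ''y'', ''r'', ''rmax'', ''g0''}" for a
    proof -
      have "rmem s' a = rmem s2 a" by (rule unch_r[OF u]) (use that nw_level(2)[of A b0 os] in \<open>auto simp: lvnext_def\<close>)
      then show ?thesis using that s2r by auto
    qed
    have e': "env s'" by (rule env_cong[OF e]) (auto simp: un ur)
    have "A * (2 ^ ?l / sqrt 2) < R * g" using b I e' by (simp add: lvcond_def env_def)
    \<comment> \<open>At level \<open>L\<close> the guard fails by the choice of \<open>L\<close>,
      so at most \<open>L\<close> levels are executed.\<close>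
    then have "?l \<noteq> L" using L by auto
    then have lL: "?l < L" using I by simp
    have "Suc ?l * M \<le> L * M" using lL by (intro mult_le_mono1) simp
    then have mm: "nmem s' ''m'' 0 + M \<le> nmem s ''m'' 0 + L * M" "nmem s ''m'' 0 + ?l * M + M \<le> nmem s ''m'' 0 + L * M" using I by simp_all
    let ?Tc = "(?K * Suc n + dcl.kdc kme * (midcard n A \<rho> ?l * lg n)) + tmax lvnext"
    have "run B ?body s' ?Tc (\<lambda>s''. ?I s'' \<and> ?Tc + ?b + 1 + ?Phi s'' \<le> ?Phi s')"
    proof (rule run_seq[OF lvl.run_level'[OF lv] _ le_refl])
      show "nmem s' ''n'' 0 = n" "static x y r s'" using e' by (simp_all add: env_def)
      show "3 * n + 3 \<le> B" by (rule B)
      show "rmem s' ''X'' = X" "rmem s' ''Y'' = Y" "rmem s' ''ro'' = \<rho>" using X by (simp_all add: ur)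
      show "rmem s' ''s'' 0 = 2 ^ ?l / sqrt 2" using I by blast
      show "nmem s' ''lev'' 0 = ?l" by (rule refl)
      show "ordd n (nmem s' ''px'') X" "ordd n (nmem s' ''py'') Y" using px py by (simp_all add: un)
      show "nmem s' ''m'' 0 + M \<le> B" using mm m by linarith
    next
      fix s3 assume u3: "unch (level A b0 os) s' s3" and Q: "outs s' \<subseteq> outs s3 \<and> outs s3 \<subseteq> outs s' \<union> E \<and>
        nmem s3 ''m'' 0 \<le> nmem s' ''m'' 0 + M \<and> levgood n A x y r X Y \<rho> os ?l (outs s3)"
      have l3: "nmem s3 ''lev'' = nmem s' ''lev''" by (rule unch_n[OF u3]) (use nw_level(1)[of A b0 os] in auto)
      have r3: "rmem s3 ''s'' = rmem s' ''s''" by (rule unch_r[OF u3]) (use nw_level(2)[of A b0 os] in auto)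
      define s4 where "s4 = fex lvnext s3"
      have o4: "outs s4 = outs s3" by (simp add: s4_def lvnext_def outs_def)
      have s4: "nmem s4 ''lev'' 0 = Suc ?l" "rmem s4 ''s'' 0 = 2 ^ Suc ?l / sqrt 2" "nmem s4 ''m'' = nmem s3 ''m''"
        using I by (simp_all add: s4_def lvnext_def l3 r3)
      have g4: "\<forall>i<Suc ?l. levgood n A x y r X Y \<rho> os i (outs s4)"
      proof (intro allI impI)
        fix i assume "i < Suc ?l"
        then consider "i < ?l" | "i = ?l" by linarith
        then show "levgood n A x y r X Y \<rho> os i (outs s4)"
        proof cases
          case 1
          then have "levgood n A x y r X Y \<rho> os i (outs s')" using I by blast
          then show ?thesis unfolding o4 by (rule levgood_mono) (use Q in blast)
        qed (use Q o4 in simp)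
      qed
      have Is: "?I s4" unfolding s4(1)
      proof (intro conjI)
        show "Suc ?l \<le> L" using lL by simp
        show "rmem s4 ''s'' 0 = 2 ^ Suc ?l / sqrt 2" by (rule s4)
        show "outs s \<subseteq> outs s4" "outs s4 \<subseteq> outs s \<union> E" unfolding o4 using I Q by blast+
        show "nmem s4 ''m'' 0 \<le> nmem s ''m'' 0 + Suc ?l * M" using I Q unfolding s4(3) by simp
        show "\<forall>i<Suc ?l. levgood n A x y r X Y \<rho> os i (outs s4)" by (rule g4)
      qed
      have "?Phi s' = cost ?l + ?Phi s4" unfolding s4(1) by (rule sum.atLeast_Suc_lessThan[OF lL])
      then have Ps: "?Tc + ?b + 1 + ?Phi s4 \<le> ?Phi s'" by (simp add: cost_def)
      show "run B lvnext s3 (tmax lvnext) (\<lambda>s''. ?I s'' \<and> ?Tc + ?b + 1 + ?Phi s'' \<le> ?Phi s')"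
      proof (rule run_lf)
        show "okw B lvnext s3" using lL B(2) by (simp add: lvnext_def l3)
        show "?I (fex lvnext s3) \<and> ?Tc + ?b + 1 + ?Phi (fex lvnext s3) \<le> ?Phi s'" unfolding s4_def[symmetric] using Is Ps by blast
      qed (simp_all add: lvnext_def)
    qed
    then show "\<exists>Tc. run B ?body s' Tc (\<lambda>s''. ?I s'' \<and> Tc + ?b + 1 + ?Phi s'' \<le> ?Phi s')" by blast
  next
    fix s' assume I: "?I s'" and u: "unch ?body s2 s'" and b: "\<not> bval (lvcond A) s'"
    let ?l = "nmem s' ''lev'' 0"
    have ur: "rmem s' a = rmem s a" if "a \<in> {''rmax'', ''g0''}" for a
    proof -
      have "rmem s' a = rmem s2 a" by (rule unch_r[OF u]) (use that nw_level(2)[of A b0 os] in \<open>auto simp: lvnext_def\<close>)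
      then show ?thesis using that s2r by auto
    qed
    have c: "\<not> A * (2 ^ ?l / sqrt 2) < R * g" using b I e by (simp add: lvcond_def env_def ur)
    have "i < ?l" if "A * (2 ^ i / sqrt 2) < R * g" for i
    proof (rule ccontr)
      assume "\<not> i < ?l"
      then have "(2 :: real) ^ ?l \<le> 2 ^ i" by simp
      then have "A * (2 ^ ?l / sqrt 2) \<le> A * (2 ^ i / sqrt 2)" by (intro mult_left_mono divide_right_mono) auto
      then show False using c that by linarith
    qed
    moreover have "?l * M \<le> L * M" using I by (intro mult_le_mono1) blast
    ultimately show "outs s \<subseteq> outs s' \<and> outs s' \<subseteq> outs s \<union> E \<and> nmem s' ''m'' 0 \<le> nmem s ''m'' 0 + L * M \<and>
       (\<forall>i. A * (2 ^ i / sqrt 2) < R * g \<longrightarrow> levgood n A x y r X Y \<rho> os i (outs s'))" using I by (meson add_left_mono order_trans)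
  next
    show "?Phi s2 + ?b + 1 \<le> (?K + tmax lvnext + ?b + 1) * W + (2 * dcl.kdc kme) * W + ?b + 1"
      using Phi by (simp only: s20 atLeast0LessThan add_le_mono1)
  qed
  have w1: "a \<le> a * W" for a by simp
  show ?thesis unfolding levels_def
  proof (rule run_lf_seq[OF _ _ lvr[unfolded s2_def]])
    show "tmax lvinit + ((?K + tmax lvnext + ?b + 1) * W + (2 * dcl.kdc kme) * W + ?b + 1) \<le> klevs A b0 os * W"
      using w1[of "tmax lvinit"] w1[of "?b + 1"] unfolding klevs_def add_mult_distrib by linarith
  qed (simp_all add: lvinit_def)
qed

end

section \<open>All cones\<close>

primrec dirs :: "nat \<Rightarrow> nat \<Rightarrow> (rat \<times> rat) list \<Rightarrow> rat \<Rightarrow> (int \<times> int) list \<Rightarrow> com" where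
  "dirs A b0 os kap [] = Skip"
| "dirs A b0 os kap (cd # ds) = (dirprog A b0 os kap (fst cd) (snd cd);; dirs A b0 os kap ds)"
primrec kdirs :: "nat \<Rightarrow> nat \<Rightarrow> (rat \<times> rat) list \<Rightarrow> rat \<Rightarrow> (int \<times> int) list \<Rightarrow> nat" where
  "kdirs A b0 os kap [] = 1"
| "kdirs A b0 os kap (cd # ds) = kdir A b0 os kap (fst cd) (snd cd) + kdirs A b0 os kap ds"

context sites begin

text \<open>What the sorts of one cone preserve: all data and the output stay fixed, and
  \<open>pi\<close> remains a permutation.\<close>

definition fr :: "(nat \<Rightarrow> real) \<Rightarrow> (nat \<Rightarrow> real) \<Rightarrow> (nat \<Rightarrow> real) \<Rightarrow> (nat \<times> nat) set \<Rightarrow> nat \<Rightarrow> store \<Rightarrow> bool" where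
  "fr X Y \<rho> F m s \<longleftrightarrow> env s \<and> rmem s ''X'' = X \<and> rmem s ''Y'' = Y \<and> rmem s ''ro'' = \<rho> \<and> mset (map (nmem s ''pi'') [0..<n]) = mset [0..<n] \<and>
     outs s = F \<and> nmem s ''m'' 0 = m"

lemma costW: "a * Suc n + b * (n * lg n) \<le> (a + b) * W"
proof -
  have "a * Suc n \<le> a * W" by (rule mult_le_mono2) simp
  moreover have "b * (n * lg n) \<le> b * W" by (rule mult_le_mono2) (simp add: algebra_simps)
  ultimately show ?thesis unfolding add_mult_distrib[of a b W] by (rule add_mono)
qed

lemma run_sort_fr:
  assumes f: "fr X Y \<rho> F m s" and ke: "keyexp ke h" and d: "d \<in> {''px'', ''py'', ''pz''}"
  shows "run B (sort ke d) s ((ksort ke d + dcl.kdc kms) * W) (\<lambda>s'. fr X Y \<rho> F m s' \<and> ordd n (nmem s' d) (\<lambda>q. h (X q) (Y q)) \<and>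
     sorted (map (\<lambda>q. h (X q) (Y q)) (map (nmem s' ''pi'') [0..<n])) \<and> bok (nmem s' ''best'') (\<lambda>q. h (X q) (Y q)) X (map (nmem s ''pi'') [0..<n]) \<and>
     (''px'' \<noteq> d \<longrightarrow> nmem s' ''px'' = nmem s ''px'') \<and> (''py'' \<noteq> d \<longrightarrow> nmem s' ''py'' = nmem s ''py''))"
proof -
  have e: "env s" and X: "rmem s ''X'' = X" "rmem s ''Y'' = Y" "rmem s ''ro'' = \<rho>" and p: "mset (map (nmem s ''pi'') [0..<n]) = mset [0..<n]"
    and o: "outs s = F" "nmem s ''m'' 0 = m" using f by (simp_all add: fr_def)
  have n: "nmem s ''n'' 0 = n" using e by (simp add: env_def)
  have B2: "2 * n + 2 \<le> B" using B by simp
  show ?thesis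
  proof (rule run_mono[OF run_sort[OF n B2 _ _ ke d] costW])
    show "distinct (map (nmem s ''pi'') [0..<n])" by (rule perm_bij[OF p])
    show "set (map (nmem s ''pi'') [0..<n]) \<subseteq> {..<n}" using perm_bij(3)[OF p] by simp
  next
    fix s' assume u: "unch (sort ke d) s s'"
      and Q: "mset (map (nmem s' ''pi'') [0..<n]) = mset (map (nmem s ''pi'') [0..<n]) \<and>
         sorted (map (\<lambda>k. h (rmem s ''X'' (nmem s' ''pi'' k)) (rmem s ''Y'' (nmem s' ''pi'' k))) [0..<n]) \<and>
         (\<forall>k<n. nmem s' d k = nmem s' ''pi'' k) \<and>
         bok (nmem s' ''best'') (\<lambda>q. h (rmem s ''X'' q) (rmem s ''Y'' q)) (rmem s ''X'') (map (nmem s ''pi'') [0..<n])"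
    have un: "nmem s' a = nmem s a" if "a \<in> {''n'', ''src'', ''dst'', ''m'', ''px'', ''py''}" "a \<noteq> d" for a
      by (rule unch_n[OF u contra_subsetD[OF nw_sort(1)]]) (use that in auto)
    have ur: "rmem s' a = rmem s a" if "a \<in> {''X'', ''Y'', ''ro'', ''x'', ''y'', ''r'', ''rmax'', ''g0''}" for a
      by (rule unch_r[OF u contra_subsetD[OF nw_sort(2)]]) (use that in auto)
    have dn: "''n'' \<noteq> d" "''src'' \<noteq> d" "''dst'' \<noteq> d" "''m'' \<noteq> d" using d by auto
    have e': "env s'" by (rule env_cong[OF e]) (use dn in \<open>auto simp: un ur\<close>)
    have p': "mset (map (nmem s' ''pi'') [0..<n]) = mset [0..<n]" using Q p by simp
    have f': "fr X Y \<rho> F m s'" unfolding fr_def using e' X p' o dn by (simp add: ur un outs_def)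
    have dl: "map (nmem s' d) [0..<n] = map (nmem s' ''pi'') [0..<n]" using Q by simp
    have so: "sorted (map (\<lambda>k. h (X (nmem s' ''pi'' k)) (Y (nmem s' ''pi'' k))) [0..<n])" using Q X by simp
    have ml: "map (\<lambda>k. h (X (nmem s' d k)) (Y (nmem s' d k))) [0..<n] = map (\<lambda>k. h (X (nmem s' ''pi'' k)) (Y (nmem s' ''pi'' k))) [0..<n]" using Q by simp
    have "ordd n (nmem s' d) (\<lambda>q. h (X q) (Y q))"
    proof (rule orddI)
      show "mset (map (nmem s' d) [0..<n]) = mset [0..<n]" unfolding dl by (rule p')
      show "sorted (map (\<lambda>k. h (X (nmem s' d k)) (Y (nmem s' d k))) [0..<n])" unfolding ml by (rule so)
    qed
    moreover have "sorted (map (\<lambda>q. h (X q) (Y q)) (map (nmem s' ''pi'') [0..<n]))" using so by (simp add: comp_def)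
    moreover have "(''px'' \<noteq> d \<longrightarrow> nmem s' ''px'' = nmem s ''px'') \<and> (''py'' \<noteq> d \<longrightarrow> nmem s' ''py'' = nmem s ''py'')" using un[of "''px''"] un[of "''py''"] by simp
    ultimately show "fr X Y \<rho> F m s' \<and> ordd n (nmem s' d) (\<lambda>q. h (X q) (Y q)) \<and>
     sorted (map (\<lambda>q. h (X q) (Y q)) (map (nmem s' ''pi'') [0..<n])) \<and> bok (nmem s' ''best'') (\<lambda>q. h (X q) (Y q)) X (map (nmem s ''pi'') [0..<n]) \<and>
     (''px'' \<noteq> d \<longrightarrow> nmem s' ''px'' = nmem s ''px'') \<and> (''py'' \<noteq> d \<longrightarrow> nmem s' ''py'' = nmem s ''py'')" using f' Q X by simp
  qed
qed

definition coned :: "(nat \<Rightarrow> real) \<Rightarrow> (nat \<Rightarrow> real) \<Rightarrow> nat \<Rightarrow> nat \<Rightarrow> bool" where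
  "coned X Y p q \<longleftrightarrow> edge x y r p q \<and> \<bar>Y q - Y p\<bar> < \<kappa> * (X q - X p)"

lemma run_tail:
  assumes f: "frame X Y \<rho>" and s: "fr X Y \<rho> F m s" and px: "ordd n (nmem s ''px'') X" and py: "ordd n (nmem s ''py'') Y" and m: "m + (n + L * M) \<le> B"
    and G: "distinct G" "set G = {..<n}" "sorted (map (\<lambda>q. \<kappa> * X q + Y q) G)" and bk: "bok (nmem s ''best'') (\<lambda>q. \<kappa> * X q - Y q) X G"
  shows "run B (setn ''k'' (NConst 0);; part1;; levels A b0 os) s ((tmax (setn ''k'' (NConst 0)) + (kpart1 + klevs A b0 os)) * W)
     (\<lambda>s'. F \<subseteq> outs s' \<and> outs s' \<subseteq> F \<union> E \<and> nmem s' ''m'' 0 \<le> m + (n + L * M) \<and> (\<forall>p<n. \<forall>q<n. coned X Y p q \<longrightarrow> near (outs s') p q))"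
proof -
  have e: "env s" and X: "rmem s ''X'' = X" "rmem s ''Y'' = Y" "rmem s ''ro'' = \<rho>"
    and o: "outs s = F" "nmem s ''m'' 0 = m" using s by (simp_all add: fr_def)
  define s1 where "s1 = fex (setn ''k'' (NConst 0)) s"
  have s1: "nmem s1 a = nmem s a" if "a \<noteq> ''k''" for a using that by (simp add: s1_def)
  have s1r: "rmem s1 = rmem s" and s1k: "nmem s1 ''k'' 0 = 0" by (simp_all add: s1_def)
  have e1: "env s1" by (rule env_cong[OF e]) (simp_all add: s1 s1r)
  have o1: "outs s1 = F" "nmem s1 ''m'' 0 = m" using o by (simp_all add: outs_def s1)
  let ?Q = "\<lambda>s'. F \<subseteq> outs s' \<and> outs s' \<subseteq> F \<union> E \<and> nmem s' ''m'' 0 \<le> m + (n + L * M) \<and> (\<forall>p<n. \<forall>q<n. coned X Y p q \<longrightarrow> near (outs s') p q)"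
  have Wn: "Suc n \<le> W" by simp
  have best: "p < n" if b: "nmem s ''best'' q = Suc p" "q < n" for p q
  proof -
    have "q \<in> set G" using b(2) G(2) by simp
    then have "before G p q" using bk b(1) unfolding bok_def by blast
    then obtain i j where "i < j" "j < length G" "G ! i = p" unfolding before_def by blast
    then show ?thesis using nth_mem[of i G] G(2) by auto
  qed
  have rest: "run B (part1;; levels A b0 os) s1 (kpart1 * Suc n + klevs A b0 os * W) ?Q"
  proof (rule run_seq[OF run_part1[of s1 n B x y r] _ le_refl])
    show "nmem s1 ''n'' 0 = n" "static x y r s1" using e1 by (simp_all add: env_def)
    show "Suc n \<le> B" using B by simp
    show "nmem s1 ''k'' 0 = 0" by (rule s1k)
    show "nmem s1 ''m'' 0 + n \<le> B" using m o1 by simp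
  next
    fix s2 assume u: "unch part1 s1 s2" and Q: "outs s2 = outs s1 \<union> {(p, q). q < n \<and> nmem s1 ''best'' q = Suc p \<and> edge x y r p q} \<and> nmem s2 ''m'' 0 \<le> nmem s1 ''m'' 0 + n"
    have n2: "nmem s2 a = nmem s a" if "a \<in> {''n'', ''px'', ''py'', ''best''}" for a
    proof -
      have "nmem s2 a = nmem s1 a" by (rule unch_n[OF u]) (use that in \<open>auto simp: part1_def emit_def\<close>)
      then show ?thesis using that s1 by auto
    qed
    have r2: "rmem s2 a = rmem s a" for a using unch_r[OF u, of a] by (simp add: part1_def emit_def s1r)
    have e2: "env s2" by (rule env_cong[OF e]) (simp_all add: n2 r2)
    define F2 where "F2 = {(p, q). q < n \<and> nmem s ''best'' q = Suc p \<and> edge x y r p q}"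
    have o2: "outs s2 = F \<union> F2" "nmem s2 ''m'' 0 \<le> m + n" using Q o1 s1 by (simp_all add: F2_def)
    have F2: "F2 \<subseteq> E" unfolding F2_def using best by blast
    show "run B (levels A b0 os) s2 (klevs A b0 os * W) ?Q"
    proof (rule run_mono[OF run_levels[OF f e2] le_refl])
      show "rmem s2 ''X'' = X" "rmem s2 ''Y'' = Y" "rmem s2 ''ro'' = \<rho>" using X by (simp_all add: r2)
      show "ordd n (nmem s2 ''px'') X" "ordd n (nmem s2 ''py'') Y" using px py by (simp_all add: n2)
      show "nmem s2 ''m'' 0 + L * M \<le> B" using o2 m by linarith
    next
      fix s' assume Q': "outs s2 \<subseteq> outs s' \<and> outs s' \<subseteq> outs s2 \<union> E \<and> nmem s' ''m'' 0 \<le> nmem s2 ''m'' 0 + L * M \<and>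
        (\<forall>i. A * (2 ^ i / sqrt 2) < R * g \<longrightarrow> levgood n A x y r X Y \<rho> os i (outs s'))"
      have nr: "near (outs s') p q" if pq: "p < n" "q < n" "coned X Y p q" for p q
      proof (cases "DD X Y p q \<le> A")
        case True
        show ?thesis
        proof (rule near_if_close[OF f G bk _ pq(1,2) _ True])
          show "{(p, q). q < n \<and> nmem s ''best'' q = Suc p \<and> edge x y r p q} \<subseteq> outs s'" using Q' o2 unfolding F2_def by blast
        qed (use pq in \<open>simp add: coned_def\<close>)
      next
        case False
        then have D: "A < DD X Y p q" by simp
        have lg: "levgood n A x y r X Y \<rho> os i (outs s')" if "A * (2 ^ i / sqrt 2) < R * g" for i using Q' that by blast
        have c: "edge x y r p q" "\<bar>Y q - Y p\<bar> < \<kappa> * (X q - X p)" using pq(3) unfolding coned_def by blast+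
        show ?thesis by (rule near_if_far[OF f lg pq(1,2) c(2) D c(1)])
      qed
      have "F \<subseteq> outs s'" "outs s' \<subseteq> F \<union> E" using Q' o2(1) F2 by blast+
      moreover have "nmem s' ''m'' 0 \<le> m + (n + L * M)" using Q' o2(2) by linarith
      ultimately show "?Q s'" using nr by blast
    qed
  qed
  show ?thesis
  proof (rule run_lf_seq[where ?T2.0 = "kpart1 * Suc n + klevs A b0 os * W"], goal_cases)
    case 3 show ?case using rest unfolding s1_def .
  next
    case 4
    have "a \<le> a * W" for a by simp
    from this[of "tmax (setn ''k'' (NConst 0))"] mult_le_mono2[OF Wn, of kpart1]
    show ?case unfolding add_mult_distrib[of _ _ W] by linarith
  qed simp_all
qed

text \<open>The cone around the axis \<open>(c, d)\<close> in original coordinates: the two sides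
  compare the components of the edge across and along the axis, both multiplied by the length of the
  axis.\<close>

definition covered :: "int \<Rightarrow> int \<Rightarrow> (nat \<times> nat) set \<Rightarrow> bool" where
  "covered c d F \<longleftrightarrow> (\<forall>p<n. \<forall>q<n. edge x y r p q \<longrightarrow>
     \<bar>c * (y q - y p) - d * (x q - x p)\<bar> < \<kappa> * (c * (x q - x p) + d * (y q - y p)) \<longrightarrow> near F p q)"

lemma run_dir:
  assumes e: "env s" and m: "nmem s ''m'' 0 + (n + L * M) \<le> B" and cd: "c \<noteq> 0 \<or> d \<noteq> 0"
  shows "run B (dirprog A b0 os kap c d) s (kdir A b0 os kap c d * W) (\<lambda>s'. env s' \<and> outs s \<subseteq> outs s' \<and> outs s' \<subseteq> outs s \<union> E \<and>
     nmem s' ''m'' 0 \<le> nmem s ''m'' 0 + (n + L * M) \<and> covered c d (outs s'))"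
proof -
  let ?m = "nmem s ''m'' 0" and ?F = "outs s"
  let ?Q = "\<lambda>s'. ?F \<subseteq> outs s' \<and> outs s' \<subseteq> ?F \<union> E \<and> nmem s' ''m'' 0 \<le> ?m + (n + L * M) \<and> covered c d (outs s')"
  have ne: "nmem s ''n'' 0 = n" "rmem s ''x'' = x" "rmem s ''y'' = y" "rmem s ''r'' = r" "rmem s ''g0'' 0 = g" using e by (simp_all add: env_def static_def)
  have kl: "kload c d * Suc n \<le> kload c d * W" by (rule mult_le_mono2) simp
  let ?T = "tmax (setn ''k'' (NConst 0)) + (kpart1 + klevs A b0 os)"
  have T: "kdir A b0 os kap c d * W = kload c d * W + ((ksort (RRead ''X'') ''px'' + dcl.kdc kms) * W + ((ksort (RRead ''Y'') ''py'' + dcl.kdc kms) * W +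
     ((ksort (lin kap 1) ''pz'' + dcl.kdc kms) * W + ((ksort (lin kap (- 1)) ''pz'' + dcl.kdc kms) * W + ?T * W))))"
    by (simp only: kdir_def add_mult_distrib[of _ _ W])
  have Bn: "Suc n \<le> B" using B by simp
  have ld: "run B (load c d) s (kload c d * W) (\<lambda>s'. \<forall>q<n. rmem s' ''X'' q = rot g c d (x q) (y q) \<and>
    rmem s' ''Y'' q = rot g (- d) c (x q) (y q) \<and> rmem s' ''ro'' q = r q * g \<and> nmem s' ''pi'' q = q)"
    using run_load[OF ne(1) Bn, of c d] unfolding ne by (rule run_mono[OF _ kl])
  have "run B (dirprog A b0 os kap c d) s (kdir A b0 os kap c d * W) ?Q"
    unfolding dirprog_def T
  proof (rule run_seq[OF ld _ le_refl])
    fix s1 assume 3: "unch (load c d) s s1" and Q1: "\<forall>q<n. rmem s1 ''X'' q = rot g c d (x q) (y q) \<and> rmem s1 ''Y'' q = rot g (- d) c (x q) (y q) \<and> rmem s1 ''ro'' q = r q * g \<and> nmem s1 ''pi'' q = q"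
    have n1: "nmem s1 a = nmem s a" if "a \<in> {''n'', ''src'', ''dst'', ''m''}" for a by (rule unch_n[OF 3]) (use that in \<open>auto simp: nw_load\<close>)
    have r1: "rmem s1 a = rmem s a" if "a \<in> {''x'', ''y'', ''r'', ''rmax'', ''g0''}" for a by (rule unch_r[OF 3]) (use that in \<open>auto simp: nw_load\<close>)
    have e1: "env s1" by (rule env_cong[OF e]) (auto simp: n1 r1)
    define X Y \<rho> where "X = rmem s1 ''X''" and "Y = rmem s1 ''Y''" and "\<rho> = rmem s1 ''ro''"
    have XY: "X q = rot g c d (x q) (y q)" "Y q = rot g (- d) c (x q) (y q)" if "q < n" for q using Q1 that by (simp_all add: X_def Y_def)
    have f: "frame X Y \<rho>" unfolding frame_def
    proof (intro conjI allI impI)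
      show "\<rho> q = r q * g" if "q < n" for q using Q1 that by (simp add: \<rho>_def)
      show "DD X Y p q = g * DD x y p q" if "p < n" "q < n" for p q
        using DD_rot[OF g cd, of x y p q] XY that by (simp add: DD_def)
    qed
    have "map (nmem s1 ''pi'') [0..<n] = [0..<n]" by (rule map_idI) (use Q1 in simp)
    then have f1: "fr X Y \<rho> ?F ?m s1" using e1 by (simp add: fr_def X_def Y_def \<rho>_def outs_def n1)
    have cov: "covered c d F" if "\<forall>p<n. \<forall>q<n. coned X Y p q \<longrightarrow> near F p q" for F
      unfolding covered_def
    proof (intro allI impI)
      fix p q assume pq: "p < n" "q < n" and ed: "edge x y r p q"
        and cn: "\<bar>c * (y q - y p) - d * (x q - x p)\<bar> < \<kappa> * (c * (x q - x p) + d * (y q - y p))"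
      define h where "h = sqrt (real_of_int (c * c + d * d))"
      have "0 < real_of_int c * real_of_int c + real_of_int d * real_of_int d" using cd sum_squares_gt_zero_iff[of "real_of_int c" "real_of_int d"] by simp
      then have k: "0 < g / h" using g by (simp add: h_def)
      have h': "sqrt (real_of_int ((- d) * (- d) + c * c)) = h" by (simp add: h_def add.commute)
      \<comment> \<open>Rotation and scaling multiply both components by this positive factor, so
        the cone condition is the same in both coordinate systems.\<close>
      define k where "k = g / h"
      have Xz: "X z = (c * x z + d * y z) * k" if "z < n" for z using XY(1)[OF that] unfolding rot_def h_def[symmetric] k_def by simp
      have Yz: "Y z = (c * y z - d * x z) * k" if "z < n" for z using XY(2)[OF that] unfolding rot_def h' k_def by simp
      have Yd: "Y q - Y p = (c * (y q - y p) - d * (x q - x p)) * k" unfolding Yz[OF pq(1)] Yz[OF pq(2)] by (simp add: algebra_simps)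
      have Xd: "X q - X p = (c * (x q - x p) + d * (y q - y p)) * k" unfolding Xz[OF pq(1)] Xz[OF pq(2)] by (simp add: algebra_simps)
      have k0: "0 < k" using k by (simp add: k_def)
      have "\<bar>c * (y q - y p) - d * (x q - x p)\<bar> * k < \<kappa> * (c * (x q - x p) + d * (y q - y p)) * k"
        by (rule mult_strict_right_mono[OF cn k0])
      then have "\<bar>Y q - Y p\<bar> < \<kappa> * (X q - X p)" unfolding Yd Xd abs_mult using k0 by (simp only: abs_of_pos mult.assoc)
      then show "near F p q" using that pq ed by (simp add: coned_def)
    qed
    have tail: "run B (setn ''k'' (NConst 0);; part1;; levels A b0 os) s5 (?T * W) ?Q"
      if "fr X Y \<rho> ?F ?m s5" "ordd n (nmem s5 ''px'') X" "ordd n (nmem s5 ''py'') Y" "distinct G" "set G = {..<n}"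
        "sorted (map (\<lambda>q. \<kappa> * X q + Y q) G)" "bok (nmem s5 ''best'') (\<lambda>q. \<kappa> * X q - Y q) X G" for s5 G
      by (rule run_mono[OF run_tail[OF f that(1-3) m that(4-7)] le_refl]) (use cov in blast)
    show "run B (sort (RRead ''X'') ''px'';; sort (RRead ''Y'') ''py'';; sort (lin kap 1) ''pz'';; sort (lin kap (- 1)) ''pz'';;
       setn ''k'' (NConst 0);; part1;; levels A b0 os) s1 ((ksort (RRead ''X'') ''px'' + dcl.kdc kms) * W + ((ksort (RRead ''Y'') ''py'' + dcl.kdc kms) * W +
     ((ksort (lin kap 1) ''pz'' + dcl.kdc kms) * W + ((ksort (lin kap (- 1)) ''pz'' + dcl.kdc kms) * W + ?T * W)))) ?Q"
    proof (rule run_seq[OF run_sort_fr[OF f1 keyexp_X] _ le_refl], goal_cases)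
      case (2 s2)
      then have f2: "fr X Y \<rho> ?F ?m s2" and x2: "ordd n (nmem s2 ''px'') X" by blast+
      show ?case
      proof (rule run_seq[OF run_sort_fr[OF f2 keyexp_Y] _ le_refl], goal_cases)
        case (2 s3)
        then have f3: "fr X Y \<rho> ?F ?m s3" and y3: "ordd n (nmem s3 ''py'') Y" and "''px'' \<noteq> ''py'' \<longrightarrow> nmem s3 ''px'' = nmem s2 ''px''" by blast+
        then have x3: "nmem s3 ''px'' = nmem s2 ''px''" by simp
        show ?case
        proof (rule run_seq[OF run_sort_fr[OF f3 keyexp_lin1(1)] _ le_refl], goal_cases)
          case (2 s4)
          then have f4: "fr X Y \<rho> ?F ?m s4" and u4: "sorted (map (\<lambda>q. \<kappa> * X q + Y q) (map (nmem s4 ''pi'') [0..<n]))"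
            and "''px'' \<noteq> ''pz'' \<longrightarrow> nmem s4 ''px'' = nmem s3 ''px''" "''py'' \<noteq> ''pz'' \<longrightarrow> nmem s4 ''py'' = nmem s3 ''py''" by blast+
          then have x4: "nmem s4 ''px'' = nmem s3 ''px''" "nmem s4 ''py'' = nmem s3 ''py''" by simp_all
          have p4: "mset (map (nmem s4 ''pi'') [0..<n]) = mset [0..<n]" using f4 by (simp add: fr_def)
          show ?case
          proof (rule run_seq[OF run_sort_fr[OF f4 keyexp_lin1(2)] _ le_refl], goal_cases)
            case (2 s5)
            then have f5: "fr X Y \<rho> ?F ?m s5" and b5: "bok (nmem s5 ''best'') (\<lambda>q. \<kappa> * X q - Y q) X (map (nmem s4 ''pi'') [0..<n])"
              and "''px'' \<noteq> ''pz'' \<longrightarrow> nmem s5 ''px'' = nmem s4 ''px''" "''py'' \<noteq> ''pz'' \<longrightarrow> nmem s5 ''py'' = nmem s4 ''py''" by blast+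
            then have x5: "nmem s5 ''px'' = nmem s4 ''px''" "nmem s5 ''py'' = nmem s4 ''py''" by simp_all
            show ?case by (rule tail[OF f5 _ _ perm_bij(2)[OF p4] perm_bij(3)[OF p4] u4 b5]) (use x2 y3 x3 x4 x5 in simp_all)
          qed simp
        qed simp
      qed simp
    qed simp
  qed
  then show ?thesis by (rule run_mono[OF _ le_refl]) (use env_unch[OF e _ nw_dir] in blast)
qed

lemma covered_mono: "covered c d F \<Longrightarrow> F \<subseteq> F' \<Longrightarrow> covered c d F'" unfolding covered_def by (meson near_mono)

lemma run_dirs:
  assumes "env s" "nmem s ''m'' 0 + length ds * (n + L * M) \<le> B" "\<forall>cd\<in>set ds. fst cd \<noteq> 0 \<or> snd cd \<noteq> 0"
  shows "run B (dirs A b0 os kap ds) s (kdirs A b0 os kap ds * W) (\<lambda>s'. outs s \<subseteq> outs s' \<and> outs s' \<subseteq> outs s \<union> E \<and>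
     (\<forall>cd\<in>set ds. covered (fst cd) (snd cd) (outs s')))"
  using assms
proof (induction ds arbitrary: s)
  case Nil show ?case by (simp, rule run_lf) simp_all
next
  case (Cons cd ds)
  have m1: "nmem s ''m'' 0 + (n + L * M) \<le> B" using Cons.prems(2) by simp
  have c1: "fst cd \<noteq> 0 \<or> snd cd \<noteq> 0" using Cons.prems(3) by simp
  show ?case unfolding dirs.simps kdirs.simps add_mult_distrib[of _ _ W]
  proof (rule run_seq[OF run_dir[OF Cons.prems(1) m1 c1] _ le_refl])
    fix s1 assume Q: "env s1 \<and> outs s \<subseteq> outs s1 \<and> outs s1 \<subseteq> outs s \<union> E \<and> nmem s1 ''m'' 0 \<le> nmem s ''m'' 0 + (n + L * M) \<and> covered (fst cd) (snd cd) (outs s1)"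
    have m2: "nmem s1 ''m'' 0 + length ds * (n + L * M) \<le> B" using Cons.prems(2) Q by simp
    show "run B (dirs A b0 os kap ds) s1 (kdirs A b0 os kap ds * W) (\<lambda>s'. outs s \<subseteq> outs s' \<and> outs s' \<subseteq> outs s \<union> E \<and>
     (\<forall>cd\<in>set (cd # ds). covered (fst cd) (snd cd) (outs s')))"
    proof (rule run_mono[OF Cons.IH[OF _ m2] le_refl])
      show "env s1" "\<forall>cd\<in>set ds. fst cd \<noteq> 0 \<or> snd cd \<noteq> 0" using Q Cons.prems(3) by auto
      fix s' assume Q': "outs s1 \<subseteq> outs s' \<and> outs s' \<subseteq> outs s1 \<union> E \<and> (\<forall>cd\<in>set ds. covered (fst cd) (snd cd) (outs s'))"
      have "covered (fst cd) (snd cd) (outs s')" by (rule covered_mono[of _ _ "outs s1"]) (use Q Q' in blast)+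
      moreover have "outs s \<subseteq> outs s'" "outs s' \<subseteq> outs s \<union> E" using Q Q' by blast+
      ultimately show "outs s \<subseteq> outs s' \<and> outs s' \<subseteq> outs s \<union> E \<and> (\<forall>cd\<in>set (cd # ds). covered (fst cd) (snd cd) (outs s'))" using Q' by simp
    qed
  qed
qed

end

section \<open>The range of the radii and the scale\<close>

definition pre_body :: com where
  "pre_body = (If (RLess (RRead ''r'' (V ''k'')) (RV ''rmin'')) (setr ''rmin'' (RRead ''r'' (V ''k''))) Skip;;
     If (RLess (RV ''rmax'') (RRead ''r'' (V ''k''))) (setr ''rmax'' (RRead ''r'' (V ''k''))) Skip;; inc ''k'')"
definition pre_init :: com where
  "pre_init = (setr ''rmin'' (RRead ''r'' (NConst 0));; setr ''rmax'' (RRead ''r'' (NConst 0));; setn ''k'' (NConst 0))"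
text \<open>Makes the smallest scaled radius exactly \<open>2 * A\<close>.\<close>

definition pre_fin :: "nat \<Rightarrow> com" where "pre_fin A = setr ''g0'' (RDiv (RConst (of_nat (2 * A))) (RV ''rmin''))"
definition pre :: "nat \<Rightarrow> com" where "pre A = (pre_init;; While (NLess (V ''k'') (V ''n'')) pre_body;; pre_fin A)"
definition kpre :: "nat \<Rightarrow> nat" where "kpre A = tmax pre_init + kw (NLess (V ''k'') (V ''n'')) pre_body + tmax (pre_fin A)"

lemma nw_pre: "nw (pre A) = {''k''}" "rw (pre A) = {''rmin'', ''rmax'', ''g0''}"
  by (auto simp: pre_def pre_init_def pre_body_def pre_fin_def)

lemma run_pre:
  assumes n: "nmem s ''n'' 0 = n" "n \<le> B" "0 < n"
  defines "r \<equiv> rmem s ''r''"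
  shows "run B (pre A) s (kpre A * Suc n) (\<lambda>s'. \<exists>i<n. \<exists>j<n. (\<forall>q<n. r i \<le> r q \<and> r q \<le> r j) \<and> rmem s' ''rmax'' 0 = r j \<and> rmem s' ''g0'' 0 = real (2 * A) / r i)"
    (is "run _ _ _ _ ?Q")
  unfolding pre_def
proof (rule run_lf_seq[where ?T2.0 = "(kw (NLess (V ''k'') (V ''n'')) pre_body + tmax (pre_fin A)) * Suc n"], goal_cases)
  case 3
  define s1 where "s1 = fex pre_init s"
  have s1: "nmem s1 ''n'' 0 = n" "nmem s1 ''k'' 0 = 0" "rmem s1 ''r'' = r" "rmem s1 ''rmin'' 0 = r 0" "rmem s1 ''rmax'' 0 = r 0"
    by (simp_all add: s1_def pre_init_def n r_def)
  have "run B (While (NLess (V ''k'') (V ''n'')) pre_body) s1 (kw (NLess (V ''k'') (V ''n'')) pre_body * Suc n)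
      (\<lambda>s'. \<exists>i<n. \<exists>j<n. (\<forall>q<n. r i \<le> r q \<and> r q \<le> r j) \<and> rmem s' ''rmax'' 0 = r j \<and> rmem s' ''rmin'' 0 = r i)"
  proof (rule run_while_lf[where I = "\<lambda>s'. nmem s' ''k'' 0 \<le> n \<and> (\<exists>i<n. \<exists>j<n. (\<forall>q<nmem s' ''k'' 0. r i \<le> r q \<and> r q \<le> r j) \<and> rmem s' ''rmax'' 0 = r j \<and> rmem s' ''rmin'' 0 = r i)"
      and \<psi> = "\<lambda>s'. n - nmem s' ''k'' 0"], goal_cases)
    case 1 show ?case using s1 n by auto
  next
    case (3 s')
    have u: "nmem s' ''n'' = nmem s1 ''n''" "rmem s' ''r'' = r"
      using unch_n[OF 3(2), of "''n''"] unch_r[OF 3(2), of "''r''"] by (simp_all add: pre_body_def s1)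
    let ?k = "nmem s' ''k'' 0"
    have k: "?k < n" using 3(4) u s1 by simp
    obtain i j where ij: "i < n" "j < n" "\<forall>q<?k. r i \<le> r q \<and> r q \<le> r j" "rmem s' ''rmax'' 0 = r j" "rmem s' ''rmin'' 0 = r i" using 3(1) by blast
    define i' j' where "i' = (if r ?k < r i then ?k else i)" and "j' = (if r j < r ?k then ?k else j)"
    have lt: "i' < n" "j' < n" using ij k by (simp_all add: i'_def j'_def)
    have al: "\<forall>q<Suc ?k. r i' \<le> r q \<and> r q \<le> r j'"
    proof (intro allI impI)
      fix q assume "q < Suc ?k"
      then consider "q < ?k" | "q = ?k" by linarith
      then show "r i' \<le> r q \<and> r q \<le> r j'"
      proof cases
        case 1
        have "r i \<le> r q" "r q \<le> r j" using ij(3) 1 by blast+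
        then show ?thesis by (auto simp: i'_def j'_def)
      qed (auto simp: i'_def j'_def)
    qed
    have st: "nmem (fex pre_body s') ''k'' 0 = Suc ?k" "rmem (fex pre_body s') ''rmax'' 0 = r j'" "rmem (fex pre_body s') ''rmin'' 0 = r i'"
      using ij(4,5) u by (simp_all add: pre_body_def i'_def j'_def)
    have "okw B pre_body s'" using k n by (simp add: pre_body_def)
    moreover have "\<exists>i<n. \<exists>j<n. (\<forall>q<Suc ?k. r i \<le> r q \<and> r q \<le> r j) \<and> r j' = r j \<and> r i' = r i"
      by (rule exI[of _ i'], rule conjI[OF lt(1)], rule exI[of _ j'], rule conjI[OF lt(2)]) (use al in simp)
    ultimately show ?case unfolding st using k by simp
  next
    case (4 s')
    have u: "nmem s' ''n'' = nmem s1 ''n''" using unch_n[OF 4(2), of "''n''"] by (simp add: pre_body_def)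
    then have "nmem s' ''k'' 0 = n" using 4(1,4) s1 by simp
    then show ?case using 4(1) by simp
  qed (simp_all add: s1 pre_body_def)
  then show ?case unfolding s1_def[symmetric]
  proof (rule run_seq)
    fix s2 :: store assume Q: "\<exists>i<n. \<exists>j<n. (\<forall>q<n. r i \<le> r q \<and> r q \<le> r j) \<and> rmem s2 ''rmax'' 0 = r j \<and> rmem s2 ''rmin'' 0 = r i"
    have f: "rmem (fex (pre_fin A) s2) ''rmax'' = rmem s2 ''rmax''" "rmem (fex (pre_fin A) s2) ''g0'' 0 = real (2 * A) / rmem s2 ''rmin'' 0"
      by (simp_all add: pre_fin_def of_rat_mult)
    show "run B (pre_fin A) s2 (tmax (pre_fin A)) ?Q"
    proof (rule run_lf)
      obtain i j where "i < n" "j < n" "\<forall>q<n. r i \<le> r q \<and> r q \<le> r j" "rmem s2 ''rmax'' 0 = r j" "rmem s2 ''rmin'' 0 = r i" using Q by blast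
      then show "?Q (fex (pre_fin A) s2)" unfolding f by (intro exI[of _ i] exI[of _ j] conjI) simp_all
    qed (simp_all add: pre_fin_def)
  qed (simp add: add_mult_distrib)
next
  case 4 show ?case by (simp add: kpre_def add_mult_distrib)
qed (simp_all add: pre_init_def)

section \<open>The complete program\<close>

definition spanner_prog :: "nat \<Rightarrow> nat \<Rightarrow> (rat \<times> rat) list \<Rightarrow> rat \<Rightarrow> (int \<times> int) list \<Rightarrow> com" where
  "spanner_prog A b0 os kap ds = (pre A;; dirs A b0 os kap ds)"

section \<open>Choice of the constants\<close>

text \<open>The last clause says that the cones around the axes in \<open>ds\<close> cover all
  directions.\<close>

definition pars :: "real \<Rightarrow> nat \<Rightarrow> nat \<Rightarrow> (rat \<times> rat) list \<Rightarrow> rat \<Rightarrow> (int \<times> int) list \<Rightarrow> bool" where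
  "pars t A b0 os kap ds \<longleftrightarrow> (b0 + 3 \<le> 2 * A \<and> b0 + 1 \<le> A \<and> 4 \<le> A) \<and>
     set os = {(of_int a, of_int b) | a b. 1 \<le> a \<and> a \<le> 2 * int A + 1 \<and> \<bar>b\<bar> \<le> int b0} \<and>
     (0 < kap \<and> (of_rat kap :: real) \<le> 1/8 \<and> 2 * real A * of_rat kap + 1 \<le> real b0) \<and>
     (1 < t \<and> 1 + of_rat kap \<le> t * (1 - 2 * of_rat kap) \<and> 2 * (t + 1) \<le> real A * (t - 1)) \<and>
     (\<forall>cd\<in>set ds. fst cd \<noteq> 0 \<or> snd cd \<noteq> 0) \<and>
     (\<forall>u v :: real. u \<noteq> 0 \<or> v \<noteq> 0 \<longrightarrow> (\<exists>cd\<in>set ds. \<bar>real_of_int (fst cd) * v - real_of_int (snd cd) * u\<bar> <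
        of_rat kap * (real_of_int (fst cd) * u + real_of_int (snd cd) * v)))"

lemma finite_offsets: "finite {(of_int a :: rat, of_int b :: rat) | a b. 1 \<le> a \<and> a \<le> u \<and> \<bar>b\<bar> \<le> v}"
proof -
  have "{(of_int a :: rat, of_int b :: rat) | a b. 1 \<le> a \<and> a \<le> u \<and> \<bar>b\<bar> \<le> v} \<subseteq> (\<lambda>(a, b). (of_int a, of_int b)) ` ({1..u} \<times> {- v..v})"
  proof clarify
    fix a b :: int assume "1 \<le> a" "a \<le> u" "\<bar>b\<bar> \<le> v"
    then have "(a, b) \<in> {1..u} \<times> {- v..v}" by auto
    then show "(of_int a :: rat, of_int b :: rat) \<in> (\<lambda>(a, b). (of_int a, of_int b)) ` ({1..u} \<times> {- v..v})" by (rule rev_image_eqI) simp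
  qed
  then show ?thesis by (rule finite_subset) simp
qed

lemma pars_exist:
  assumes t: "1 < t"
  shows "\<exists>A b0 os kap ds. pars t A b0 os kap ds"
proof -
  \<comment> \<open>\<open>K\<close> is the reciprocal of the cone width \<open>kap\<close>; the
    second bound is \<open>1 + kap \<le> t * (1 - 2 * kap)\<close> solved for it.\<close>
  obtain K :: nat where K: "max 8 ((1 + 2 * t) / (t - 1)) \<le> real K" using real_arch_simple by blast
  \<comment> \<open>\<open>N\<close> is a quarter of \<open>A\<close>; the second bound is
    \<open>2 * (t + 1) \<le> A * (t - 1)\<close> solved for it.\<close>
  obtain N :: nat where N: "max 2 ((t + 1) / (2 * (t - 1))) \<le> real N" using real_arch_simple by blast
  define kap :: rat where "kap = 1 / of_nat K"
  have k: "(of_rat kap :: real) = 1 / K" by (simp add: kap_def of_rat_divide)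
  have K8: "8 \<le> real K" and N2: "2 \<le> N" using K N by simp_all
  have "(1 + 2 * t) / (t - 1) \<le> K" using K by simp
  then have "1 + 2 * t \<le> K * (t - 1)" using t by (simp add: pos_divide_le_eq)
  then have "(1 + 2 * t) / K \<le> t - 1" using K8 by (simp add: pos_divide_le_eq mult.commute)
  moreover have "(1 + 2 * t) / K = 1 / K + t * (2 * (1 / K))" by (simp add: add_divide_distrib)
  ultimately have t2: "1 + 1 / K \<le> t * (1 - 2 * (1 / K))" by (simp add: algebra_simps)
  have "(t + 1) / (2 * (t - 1)) \<le> N" using N by simp
  then have "t + 1 \<le> N * (2 * (t - 1))" using t by (simp add: pos_divide_le_eq)
  then have t3: "2 * (t + 1) \<le> real (4 * N) * (t - 1)" by (simp add: algebra_simps)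
  have "1 / real K \<le> 1 / 8" by (rule divide_left_mono) (use K8 in auto)
  then have "8 * real N * (1 / K) \<le> 8 * real N * (1 / 8)" by (intro mult_left_mono) auto
  \<comment> \<open>\<open>kap \<le> 1/8\<close> gives \<open>2 * A * kap \<le> N\<close>, and
    \<open>N + 1 \<le> 2 * N - 1\<close> because \<open>N\<close> is at least 2; this suggests
    \<open>b0 = 2 * N - 1\<close>.\<close>
  then have b: "2 * real (4 * N) * (1 / K) + 1 \<le> real (2 * N - 1)" using N2 by (simp add: of_nat_diff)
  obtain os where os: "set os = {(of_int a :: rat, of_int b :: rat) | a b. 1 \<le> a \<and> a \<le> 2 * int (4 * N) + 1 \<and> \<bar>b\<bar> \<le> int (2 * N - 1)}"
    using finite_list[OF finite_offsets] by blast
  \<comment> \<open>\<open>direction_exists\<close> needs \<open>M - 2\<close> to exceed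
    \<open>2 * K\<close>.\<close>
  define M where "M = 2 * K + 3"
  have M: "2 < 1 / real K * (real M - 2)" using K8 by (simp add: M_def divide_simps)
  have "finite ({(c, d). \<bar>c\<bar> \<le> int M \<and> \<bar>d\<bar> \<le> int M \<and> (c \<noteq> 0 \<or> d \<noteq> 0)})"
    by (rule finite_subset[of _ "{- int M..int M} \<times> {- int M..int M}"]) auto
  then obtain ds where ds: "set ds = {(c, d). \<bar>c\<bar> \<le> int M \<and> \<bar>d\<bar> \<le> int M \<and> (c \<noteq> 0 \<or> d \<noteq> 0)}" using finite_list by blast
  have "pars t (4 * N) (2 * N - 1) os kap ds"
    unfolding pars_def k
  proof (intro conjI allI impI)
    show "set os = {(of_int a, of_int b) | a b. 1 \<le> a \<and> a \<le> 2 * int (4 * N) + 1 \<and> \<bar>b\<bar> \<le> int (2 * N - 1)}" by (rule os)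
    show "0 < kap" using K8 by (simp add: kap_def)
    show "1 / real K \<le> 1/8" by fact
    show "\<forall>cd\<in>set ds. fst cd \<noteq> 0 \<or> snd cd \<noteq> 0" unfolding ds by auto
    fix u v :: real assume uv: "u \<noteq> 0 \<or> v \<noteq> 0"
    have "0 < 1 / real K" using K8 by simp
    from direction_exists[OF M this uv] obtain c d where cd: "\<bar>c\<bar> \<le> int M" "\<bar>d\<bar> \<le> int M" "c \<noteq> 0 \<or> d \<noteq> 0"
      "\<bar>c * v - d * u\<bar> < 1 / real K * (c * u + d * v)" by blast
    then have "(c, d) \<in> set ds" unfolding ds by simp
    then show "\<exists>cd\<in>set ds. \<bar>real_of_int (fst cd) * v - real_of_int (snd cd) * u\<bar> < 1 / real K * (real_of_int (fst cd) * u + real_of_int (snd cd) * v)"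
      by (rule bexI[rotated]) (use cd(4) in simp)
  qed (use N2 t t2 t3 b in \<open>simp_all\<close>)
  then show ?thesis by blast
qed

lemma run_prog:
  fixes L :: nat and \<Psi> :: real and s :: store
  defines "x \<equiv> rmem s ''x''" and "y \<equiv> rmem s ''y''" and "r \<equiv> rmem s ''r''"
  assumes p: "pars t A b0 os kap ds" and n: "nmem s ''n'' 0 = n" "0 < n" and m: "nmem s ''m'' 0 = 0"
    and pos: "\<And>q. q < n \<Longrightarrow> 0 < r q" and inj: "\<And>p q. p < n \<Longrightarrow> q < n \<Longrightarrow> x p = x q \<Longrightarrow> y p = y q \<Longrightarrow> p = q"
    and \<Psi>: "\<And>p q. p < n \<Longrightarrow> q < n \<Longrightarrow> r p / r q \<le> \<Psi>" and L: "4 * \<Psi> \<le> 2 ^ L"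
    and B: "3 * n + 3 \<le> B" "L \<le> B" "length ds * (n + L * (2 * length os * n)) \<le> B"
  shows "run B (spanner_prog A b0 os kap ds) s ((kpre A + kdirs A b0 os kap ds) * (Suc n * (1 + lg n + L)))
    (\<lambda>s'. outs s' \<subseteq> {(p, q). p < n \<and> q < n \<and> edge x y r p q} \<and> (\<forall>p<n. \<forall>q<n. edge x y r p q \<longrightarrow>
       (\<exists>w<n. (w, q) \<in> outs s' \<and> (w = p \<or> edge x y r p w \<and> t * DD x y p w + DD x y w q \<le> t * DD x y p q))))"
proof -
  let ?W = "Suc n * (1 + lg n + L)"
  let ?Q = "\<lambda>s'. outs s' \<subseteq> {(p, q). p < n \<and> q < n \<and> edge x y r p q} \<and> (\<forall>p<n. \<forall>q<n. edge x y r p q \<longrightarrow>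
       (\<exists>w<n. (w, q) \<in> outs s' \<and> (w = p \<or> edge x y r p w \<and> t * DD x y p w + DD x y w q \<le> t * DD x y p q)))"
  have Bn: "n \<le> B" using B by simp
  have kW: "kpre A * Suc n \<le> kpre A * ?W" by (rule mult_le_mono2) simp
  have pr: "run B (pre A) s (kpre A * ?W) (\<lambda>s'. \<exists>i<n. \<exists>j<n. (\<forall>q<n. r i \<le> r q \<and> r q \<le> r j) \<and> rmem s' ''rmax'' 0 = r j \<and> rmem s' ''g0'' 0 = real (2 * A) / r i)"
    using run_pre[OF n(1) Bn n(2), of A] unfolding r_def by (rule run_mono[OF _ kW])
  show ?thesis unfolding spanner_prog_def add_mult_distrib[of "kpre A"]
  proof (rule run_seq[OF pr _ le_refl])
  fix s1 assume 6: "unch (pre A) s s1" and Q1: "\<exists>i<n. \<exists>j<n. (\<forall>q<n. r i \<le> r q \<and> r q \<le> r j) \<and> rmem s1 ''rmax'' 0 = r j \<and> rmem s1 ''g0'' 0 = real (2 * A) / r i"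
  then obtain i j where ij: "i < n" "j < n" "\<forall>q<n. r i \<le> r q \<and> r q \<le> r j" "rmem s1 ''rmax'' 0 = r j" "rmem s1 ''g0'' 0 = real (2 * A) / r i" by blast
  have ri: "0 < r i" by (rule pos[OF ij(1)])
  have A0: "0 < real A" using p by (simp add: pars_def)
  have sq: "sqrt 2 \<le> 2" by (simp add: real_le_lsqrt)
  \<comment> \<open>\<open>sqrt 2 \<le> 2\<close> is crude; of the factor four between
    \<open>2 ^ L\<close> and \<open>\<Psi>\<close>, one half pays for it and the other for scaling
    the smallest radius to \<open>2 * A\<close>.\<close>
  have "2 ^ L / 2 \<le> (2 :: real) ^ L / sqrt 2" by (rule divide_left_mono) (use sq in auto)
  moreover have "2 * a \<le> b" if "4 * a \<le> c" "c / 2 \<le> b" for a b c :: real using that by linarith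
  ultimately have "2 * \<Psi> \<le> 2 ^ L / sqrt 2" using L by blast
  then have "2 * (r j / r i) \<le> 2 ^ L / sqrt 2" using \<Psi>[OF ij(2,1)] by linarith
  then have "real A * (2 * (r j / r i)) \<le> real A * (2 ^ L / sqrt 2)" using A0 by (intro mult_left_mono) auto
  then have RL: "r j * (real (2 * A) / r i) \<le> real A * (2 ^ L / sqrt 2)" by (simp add: mult_ac)
  have g: "real (2 * A) \<le> r q * (real (2 * A) / r i)" if "q < n" for q
  proof -
    have "real (2 * A) * 1 \<le> real (2 * A) * (r q / r i)" by (rule mult_left_mono) (use ij(3) that ri in \<open>simp_all add: le_divide_eq\<close>)
    then show ?thesis by (simp add: mult_ac)
  qed
  have si: "sites n A b0 L B x y r (r j) (real (2 * A) / r i) t os kap"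
  proof (unfold_locales, goal_cases)
    case (5 p q) then show ?case using inj by blast
  next
    case 6 show ?case using A0 ri by simp
  next
    case (7 q) then show ?case using g[of q] by simp
  next
    case (8 q) then show ?case using ij(3) by blast
  next
    case 9 show ?case by (rule RL)
  qed (use p B in \<open>simp_all add: pars_def\<close>)
  have o: "outs s1 = {}" "nmem s1 ''m'' 0 = 0" using outs_unch[OF 6] m by (simp_all add: nw_pre outs_def)
  have n1: "nmem s1 ''n'' 0 = n" using unch_n[OF 6, of "''n''"] n by (simp add: nw_pre)
  have "static x y r s1" unfolding static_def using unch_r[OF 6, of "''x''"] unch_r[OF 6, of "''y''"] unch_r[OF 6, of "''r''"]
    by (simp add: nw_pre x_def y_def r_def)
  then have e: "sites.env n x y r (r j) (real (2 * A) / r i) s1" unfolding sites.env_def[OF si] using ij(4,5) n1 by blast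
  have d0: "\<forall>cd\<in>set ds. fst cd \<noteq> 0 \<or> snd cd \<noteq> 0" using p by (simp add: pars_def)
  show "run B (dirs A b0 os kap ds) s1 (kdirs A b0 os kap ds * ?W) ?Q"
  proof (rule run_mono[OF sites.run_dirs[OF si e _ d0] le_refl])
    show "nmem s1 ''m'' 0 + length ds * (n + L * (2 * length os * n)) \<le> B" using B o by simp
    fix s' assume Q: "outs s1 \<subseteq> outs s' \<and> outs s' \<subseteq> outs s1 \<union> {(p, q). p < n \<and> q < n \<and> edge x y r p q} \<and>
      (\<forall>cd\<in>set ds. sites.covered n x y r t kap (fst cd) (snd cd) (outs s'))"
    have "\<exists>w<n. (w, q) \<in> outs s' \<and> (w = p \<or> edge x y r p w \<and> t * DD x y p w + DD x y w q \<le> t * DD x y p q)"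
      if pq: "p < n" "q < n" and ed: "edge x y r p q" for p q
    proof -
      have "x q - x p \<noteq> 0 \<or> y q - y p \<noteq> 0" using inj[OF pq] ed by (auto simp: edge_def)
      then obtain cd where cd: "cd \<in> set ds" "\<bar>real_of_int (fst cd) * (y q - y p) - real_of_int (snd cd) * (x q - x p)\<bar> <
          of_rat kap * (real_of_int (fst cd) * (x q - x p) + real_of_int (snd cd) * (y q - y p))"
        using p unfolding pars_def by blast
      have "sites.covered n x y r t kap (fst cd) (snd cd) (outs s')" using Q cd(1) by blast
      from this[unfolded sites.covered_def[OF si], rule_format, OF pq ed cd(2)]
      show ?thesis unfolding sites.near_def[OF si] .
    qed
    then show "outs s' \<subseteq> {(p, q). p < n \<and> q < n \<and> edge x y r p q} \<and> (\<forall>p<n. \<forall>q<n. edge x y r p q \<longrightarrow>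
       (\<exists>w<n. (w, q) \<in> outs s' \<and> (w = p \<or> edge x y r p w \<and> t * DD x y p w + DD x y w q \<le> t * DD x y p q)))"
      using Q o by blast
  qed
  qed
qed

section \<open>From stores to points of the plane\<close>

lemma lg_le_log: "0 < n \<Longrightarrow> real (lg n) \<le> 1 + log 2 (real n)"
proof (cases "2 \<le> n")
  case True
  have "2 ^ lg n \<le> 2 * n" using lg_bound[OF True] by linarith
  then have "real (lg n) \<le> log 2 (real (2 * n))" by (rule le_log2_of_power)
  also have "\<dots> = 1 + log 2 (real n)" using True by (simp add: log_mult)
  finally show ?thesis .
next
  case False
  assume "0 < n"
  then have "n = 1" using False by simp
  then show ?thesis using lg_mono_aux[of 1 0] by simp
qed

lemma dist_real2: "dist p q = sqrt ((p $ 1 - q $ 1)\<^sup>2 + (p $ 2 - q $ 2)\<^sup>2)" for p q :: "real ^ 2"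
  by (simp add: dist_vec_def L2_set_def sum_2 dist_real_def)

lemma radius_ratio_ge:
  assumes "finite P" "p \<in> P" "q \<in> P"
  shows "r p / r q \<le> radius_ratio P r"
proof -
  have "{r p / r q | p q. p \<in> P \<and> q \<in> P} = (\<lambda>(p, q). r p / r q) ` (P \<times> P)" by auto
  then have "finite {r p / r q | p q. p \<in> P \<and> q \<in> P}" using assms(1) by simp
  then show ?thesis unfolding radius_ratio_def by (rule Max_ge) (use assms in blast)
qed

text \<open>\<open>B\<close> adds one term for each kind of number stored: positions in the buffers,
  the level counter, and the count of emitted edges. The surplus of two in \<open>L\<close> provides
  \<open>4 * \<Psi> \<le> 2 ^ L\<close>.\<close>

lemma computes_spanner_bounds:
  fixes r :: "real ^ 2 \<Rightarrow> real" and ps :: "(real ^ 2) list"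
  defines "n \<equiv> length ps" and "\<Psi> \<equiv> radius_ratio (set ps) r"
  defines "L \<equiv> nat \<lceil>log 2 \<Psi>\<rceil> + 2"
  assumes p: "pars t A b0 os kap ds" and ps: "distinct ps" "ps \<noteq> []" and r: "\<forall>p\<in>set ps. 0 < r p"
  defines "c \<equiv> spanner_prog A b0 os kap ds"
  defines "B \<equiv> 3 * n + 3 + L + length ds * (n + L * (2 * length os * n))"
  shows "\<exists>T S. computes_spanner c t r ps T S \<and> T \<le> (kpre A + kdirs A b0 os kap ds) * (Suc n * (1 + lg n + L)) \<and>
     S \<le> card (carr c \<union> {NArr ''n'', NArr ''m'', NArr ''src'', NArr ''dst'', RArr ''t'', RArr ''x'', RArr ''y'', RArr ''r''}) * Suc ((cidx c + 1) * Suc B)"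
proof -
  let ?s = "input_store t r ps"
  define x y \<rho> where "x = rmem ?s ''x''" and "y = rmem ?s ''y''" and "\<rho> = rmem ?s ''r''"
  have xy: "x q = ps ! q $ 1" "y q = ps ! q $ 2" "\<rho> q = r (ps ! q)" if "q < n" for q
    using that by (simp_all add: x_def y_def \<rho>_def input_store_def n_def)
  have n0: "0 < n" using ps by (simp add: n_def)
  have inP: "ps ! q \<in> set ps" if "q < n" for q using that by (simp add: n_def)
  have DDe: "DD x y p q = dist (ps ! p) (ps ! q)" if "p < n" "q < n" for p q
    using that by (simp add: DD_eq xy dist_real2)
  have eqi: "ps ! p = ps ! q \<longleftrightarrow> p = q" if "p < n" "q < n" for p q using nth_eq_iff_index_eq[OF ps(1)] that by (simp add: n_def)
  have ede: "edge x y \<rho> p q \<longleftrightarrow> (ps ! p, ps ! q) \<in> parcs (transmission_graph (set ps) r)" if "p < n" "q < n" for p q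
    using that inP by (simp add: edge_DD DDe xy transmission_graph_def eqi)
  have "0 < r (ps ! 0)" using r inP[OF n0] by blast
  then have "1 = r (ps ! 0) / r (ps ! 0)" by simp
  also have "\<dots> \<le> \<Psi>" unfolding \<Psi>_def by (rule radius_ratio_ge) (use inP[OF n0] in auto)
  finally have P1: "1 \<le> \<Psi>" .
  have "\<Psi> = 2 powr log 2 \<Psi>" using P1 by simp
  also have "\<dots> \<le> 2 powr real (nat \<lceil>log 2 \<Psi>\<rceil>)" by (rule powr_mono) (use real_nat_ceiling_ge in auto)
  also have "\<dots> = 2 ^ nat \<lceil>log 2 \<Psi>\<rceil>" by (simp add: powr_realpow)
  finally have L4: "4 * \<Psi> \<le> 2 ^ L" by (simp add: L_def)
  let ?T = "(kpre A + kdirs A b0 os kap ds) * (Suc n * (1 + lg n + L))"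
  have run: "run B c ?s ?T (\<lambda>s'. outs s' \<subseteq> {(p, q). p < n \<and> q < n \<and> edge x y \<rho> p q} \<and> (\<forall>p<n. \<forall>q<n. edge x y \<rho> p q \<longrightarrow>
       (\<exists>w<n. (w, q) \<in> outs s' \<and> (w = p \<or> edge x y \<rho> p w \<and> t * DD x y p w + DD x y w q \<le> t * DD x y p q))))"
    unfolding c_def x_def y_def \<rho>_def
  proof (rule run_prog[OF p _ n0 _ _ _ _ L4], unfold x_def[symmetric] y_def[symmetric] \<rho>_def[symmetric])
    show "nmem ?s ''n'' 0 = n" "nmem ?s ''m'' 0 = 0" by (simp_all add: input_store_def n_def)
    show "0 < \<rho> q" if "q < n" for q using r inP that by (simp add: xy)
    show "p = q" if "p < n" "q < n" "x p = x q" "y p = y q" for p q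
    proof -
      have "DD x y p q = 0" using that by (simp add: DD_eq)
      then show ?thesis using DDe that eqi by simp
    qed
    show "\<rho> p / \<rho> q \<le> \<Psi>" if "p < n" "q < n" for p q
      unfolding \<Psi>_def xy(3)[OF that(1)] xy(3)[OF that(2)] by (rule radius_ratio_ge) (use inP that in auto)
  qed (simp_all add: B_def)
  have nb: "nbnd B ?s" by (simp add: nbnd_def input_store_def B_def n_def)
  obtain T s' where T: "big B c ?s T s'" "T \<le> ?T" and o: "outs s' \<subseteq> {(p, q). p < n \<and> q < n \<and> edge x y \<rho> p q}"
    and sp: "\<And>p q. p < n \<Longrightarrow> q < n \<Longrightarrow> edge x y \<rho> p q \<Longrightarrow> \<exists>w<n. (w, q) \<in> outs s' \<and> (w = p \<or> edge x y \<rho> p w \<and> t * DD x y p w + DD x y w q \<le> t * DD x y p q)"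
    using run nb unfolding run_def by blast
  obtain D where D: "exec c ?s T D s'" "D \<subseteq> carr c \<times> {..cidx c * Suc B}" and nb': "nbnd B s'" using big_exec[OF T(1) nb] by blast
  let ?N = "carr c \<union> {NArr ''n'', NArr ''m'', NArr ''src'', NArr ''dst'', RArr ''t'', RArr ''x'', RArr ''y'', RArr ''r''}"
  let ?S = "space (input_cells n \<union> D \<union> output_cells (output_size s'))"
  have mB: "output_size s' \<le> B" using nb' by (simp add: output_size_def nbnd_def)
  have nB: "n \<le> B" by (simp add: B_def)
  have lB: "B \<le> (cidx c + 1) * Suc B" "cidx c * Suc B \<le> (cidx c + 1) * Suc B" by simp_all
  have "input_cells n \<subseteq> ?N \<times> {..(cidx c + 1) * Suc B}" unfolding input_cells_def using nB lB(1) by auto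
  moreover have "output_cells (output_size s') \<subseteq> ?N \<times> {..(cidx c + 1) * Suc B}" unfolding output_cells_def using mB lB(1) by auto
  moreover have "D \<subseteq> ?N \<times> {..(cidx c + 1) * Suc B}" by (rule order_trans[OF D(2)], rule Sigma_mono) (use lB(2) in auto)
  ultimately have S: "?S \<le> card ?N * Suc ((cidx c + 1) * Suc B)" by (intro space_le) (auto simp: finite_carr)
  have val: "output_valid n s'" unfolding output_valid_def
  proof (intro allI impI)
    fix k assume "k < output_size s'"
    then have "(nmem s' ''src'' k, nmem s' ''dst'' k) \<in> outs s'" by (auto simp: outs_def output_size_def)
    then show "nmem s' ''src'' k < n \<and> nmem s' ''dst'' k < n" using o by blast
  qed
  have H: "parcs (output_graph ps s') = (\<lambda>(p, q). (ps ! p, ps ! q)) ` outs s'"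
    by (auto simp: output_graph_def outs_def output_size_def image_iff)
  let ?G = "transmission_graph (set ps) r"
  have tsp: "t_spanner t (output_graph ps s') ?G"
  proof (rule t_spanner_if_last_arc)
    show "1 < t" using p by (simp add: pars_def)
    show "pverts (output_graph ps s') = set ps" by (simp add: output_graph_def)
    show "parcs (output_graph ps s') \<subseteq> parcs ?G" unfolding H
    proof (rule subsetI)
      fix z assume "z \<in> (\<lambda>(p, q). (ps ! p, ps ! q)) ` outs s'"
      then obtain a b where z: "(a, b) \<in> outs s'" "z = (ps ! a, ps ! b)" by auto
      have "(a, b) \<in> {(p, q). p < n \<and> q < n \<and> edge x y \<rho> p q}" by (rule subsetD[OF o z(1)])
      then have ab: "a < n" "b < n" "edge x y \<rho> a b" by simp_all
      show "z \<in> parcs ?G" unfolding z(2) by (rule iffD1[OF ede[OF ab(1,2)] ab(3)])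
    qed
    fix u v assume uv: "(u, v) \<in> parcs ?G"
    then have "u \<in> set ps" "v \<in> set ps" by (simp_all add: transmission_graph_def)
    then obtain p q where pq: "p < n" "q < n" "u = ps ! p" "v = ps ! q" by (auto simp: in_set_conv_nth n_def)
    have "edge x y \<rho> p q" by (rule iffD2[OF ede[OF pq(1,2)] uv[unfolded pq(3,4)]])
    from sp[OF pq(1,2) this] obtain w where w: "w < n" "(w, q) \<in> outs s'"
      "w = p \<or> edge x y \<rho> p w \<and> t * DD x y p w + DD x y w q \<le> t * DD x y p q" by blast
    have "(ps ! w, v) \<in> parcs (output_graph ps s')" unfolding H pq(4) by (rule image_eqI[of _ _ "(w, q)"]) (use w(2) in simp_all)
    moreover have "ps ! w = u \<or> (u, ps ! w) \<in> parcs ?G \<and> t * dist u (ps ! w) + dist (ps ! w) v \<le> t * dist u v"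
    proof (cases "w = p")
      case True
      then show ?thesis using pq(3) by simp
    next
      case False
      then have e: "edge x y \<rho> p w" "t * DD x y p w + DD x y w q \<le> t * DD x y p q" using w(3) by simp_all
      have "(u, ps ! w) \<in> parcs ?G" unfolding pq(3) by (rule iffD1[OF ede[OF pq(1) w(1)] e(1)])
      moreover have "t * dist u (ps ! w) + dist (ps ! w) v \<le> t * dist u v"
        using e(2) unfolding DDe[OF pq(1) w(1)] DDe[OF w(1) pq(2)] DDe[OF pq(1,2)] pq(3,4) .
      ultimately show ?thesis by (intro disjI2 conjI)
    qed
    ultimately show "\<exists>w. (w, v) \<in> parcs (output_graph ps s') \<and> (w = u \<or> (u, w) \<in> parcs ?G \<and> t * dist u w + dist w v \<le> t * dist u v)"
      by (intro exI[of _ "ps ! w"] conjI)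
  qed simp
  have cs: "computes_spanner c t r ps T ?S" unfolding computes_spanner_def n_def[symmetric]
    by (rule exI[of _ D], rule exI[of _ s'], intro conjI, rule D(1), rule refl, rule val, rule tsp)
  show ?thesis by (rule exI[of _ T], rule exI[of _ ?S], intro conjI, rule cs, rule T(2), rule S)
qed

section \<open>The final estimates\<close>

lemma bound_arith:
  fixes n L q d :: nat
  assumes "0 < n"
  shows "Suc (3 * n + 3 + L + d * (n + L * (q * n))) \<le> (7 + d * (1 + q)) * (n * (1 + L))"
proof -
  have a: "L \<le> n * L" using assms by (cases n) auto
  have f1: "3 * n + 3 + L + 1 \<le> 7 * n + 7 * (n * L)" using a assms by linarith
  have "n + L * (q * n) \<le> (1 + q) * (n + n * L)" by (simp add: algebra_simps)
  then have f2: "d * (n + L * (q * n)) \<le> d * ((1 + q) * (n + n * L))" by (rule mult_le_mono2)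
  have e: "(7 + d * (1 + q)) * (n * (1 + L)) = 7 * n + 7 * (n * L) + d * ((1 + q) * (n + n * L))" by (simp add: algebra_simps)
  show ?thesis unfolding e using f1 f2 by linarith
qed

lemma space_arith:
  fixes k ci b n L S Bn :: nat and l C :: real
  assumes S: "S \<le> k * Suc ((ci + 1) * Suc Bn)" and B: "Suc Bn \<le> b * (n * (1 + L))" and L: "real L \<le> l + 3" "0 \<le> l" and C: "real (k * (ci + 2) * b * 4) \<le> C"
  shows "real S \<le> C * real n * (1 + l)"
proof -
  have "Suc ((ci + 1) * Suc Bn) \<le> (ci + 2) * Suc Bn" by simp
  also have "\<dots> \<le> (ci + 2) * (b * (n * (1 + L)))" by (rule mult_le_mono2[OF B])
  finally have le: "Suc ((ci + 1) * Suc Bn) \<le> (ci + 2) * (b * (n * (1 + L)))" .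
  have "S \<le> k * ((ci + 2) * (b * (n * (1 + L))))" by (rule order_trans[OF S mult_le_mono2[OF le]])
  also have "\<dots> = (k * (ci + 2) * b) * (n * (1 + L))" by (simp only: mult.assoc)
  finally have "real S \<le> real ((k * (ci + 2) * b) * (n * (1 + L)))" by (simp only: of_nat_le_iff)
  also have "\<dots> = real (k * (ci + 2) * b) * (real n * (1 + real L))" by (simp only: of_nat_mult of_nat_add of_nat_1)
  also have "\<dots> \<le> real (k * (ci + 2) * b) * (real n * (4 * (1 + l)))"
  proof (intro mult_left_mono)
    have "4 * (1 + l) = 4 + 4 * l" by simp
    then show "1 + real L \<le> 4 * (1 + l)" using L by linarith
  qed simp_all
  also have "\<dots> = real (k * (ci + 2) * b * 4) * (real n * (1 + l))"
    by ((simp only: of_nat_mult of_nat_numeral mult_ac) | (simp add: algebra_simps))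
  also have "\<dots> \<le> C * (real n * (1 + l))" by (rule mult_right_mono[OF C]) (use L in simp)
  also have "\<dots> = C * real n * (1 + l)" by (simp only: mult.assoc)
  finally show ?thesis .
qed

theorem theorem3p12:
  fixes t :: real
  assumes "t > 1"
  shows "\<exists>(c :: com) (C :: real). \<forall>(P :: (real ^ 2) set) (r :: real ^ 2 \<Rightarrow> real) (ps :: (real ^ 2) list).
    finite P \<and> P \<noteq> {} \<and> (\<forall>p \<in> P. r p > 0) \<and> set ps = P \<and> distinct ps \<longrightarrow>
    (\<exists>T S. computes_spanner c t r ps T S \<and>
       real T \<le> C * real (card P) * (1 + log 2 (real (card P)) + log 2 (radius_ratio P r)) \<and>
       real S \<le> C * real (card P) * (1 + log 2 (radius_ratio P r)))"
proof -
  obtain A b0 os kap ds where p: "pars t A b0 os kap ds" using pars_exist[OF assms] by blast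
  define c where "c = spanner_prog A b0 os kap ds"
  define K where "K = kpre A + kdirs A b0 os kap ds"
  define k where "k = card (carr c \<union> {NArr ''n'', NArr ''m'', NArr ''src'', NArr ''dst'', RArr ''t'', RArr ''x'', RArr ''y'', RArr ''r''})"
  define b where "b = 7 + length ds * (1 + 2 * length os)"
  \<comment> \<open>One constant for both bounds: the first summand covers the time, the second the
    space. The 10 is the product of 2 from \<open>Suc n\<close> and 5 from the logarithmic
    factor.\<close>
  define C :: real where "C = 10 * real K + real (k * (cidx c + 2) * b * 4)"
  show ?thesis
  proof (intro exI[of _ c] exI[of _ C] allI impI, elim conjE)
    fix P :: "(real ^ 2) set" and r :: "real ^ 2 \<Rightarrow> real" and ps :: "(real ^ 2) list"
    assume P: "finite P" "P \<noteq> {}" "\<forall>p\<in>P. 0 < r p" "set ps = P" "distinct ps"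
    define n where "n = length ps"
    define l where "l = log 2 (radius_ratio P r)"
    define L where "L = nat \<lceil>l\<rceil> + 2"
    define B where "B = 3 * n + 3 + L + length ds * (n + L * (2 * length os * n))"
    have cP: "card P = n" using distinct_card[OF P(5)] P(4) by (simp add: n_def)
    have ne: "ps \<noteq> []" using P by auto
    then have n0: "0 < n" by (simp add: n_def)
    obtain p0 where p0: "p0 \<in> P" using P by blast
    have "0 < r p0" using P(3) p0 by blast
    then have "1 \<le> radius_ratio P r" using radius_ratio_ge[OF P(1) p0 p0, of r] by simp
    then have l0: "0 \<le> l" by (simp add: l_def)
    have Ll: "real L \<le> l + 3" using l0 by (simp add: L_def) linarith
    have ln0: "0 \<le> log 2 (real n)" using n0 by simp
    have r0: "\<forall>p\<in>set ps. 0 < r p" using P(3,4) by simp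
    from computes_spanner_bounds[OF p P(5) ne r0, unfolded P(4)]
    obtain T S where TS: "computes_spanner c t r ps T S" "T \<le> K * (Suc n * (1 + lg n + L))" "S \<le> k * Suc ((cidx c + 1) * Suc B)"
      unfolding c_def K_def k_def B_def n_def L_def l_def by blast
    \<comment> \<open>\<open>lg n\<close> contributes at most one and \<open>L\<close> at most three
      to the constant term, with the leading one five in all.\<close>
    have q1: "1 + real (lg n) + real L \<le> 5 * (1 + log 2 (real n) + l)" 
    proof -
      have e: "5 * (1 + log 2 (real n) + l) = 5 + 5 * log 2 (real n) + 5 * l" by simp
      show ?thesis unfolding e using lg_le_log[OF n0] Ll ln0 l0 by linarith
    qed
    have q2: "real (Suc n) \<le> 2 * real n" using n0 by auto
    have "real T \<le> real (K * (Suc n * (1 + lg n + L)))" using TS(2) by (simp only: of_nat_le_iff)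
    also have "\<dots> = real K * (real (Suc n) * (1 + real (lg n) + real L))" by (simp only: of_nat_mult of_nat_add of_nat_1)
    also have "\<dots> \<le> real K * ((2 * real n) * (5 * (1 + log 2 (real n) + l)))"
      by (intro mult_left_mono mult_mono q1 q2) auto
    also have "\<dots> = (10 * real K) * real n * (1 + log 2 (real n) + l)" by simp
    also have "\<dots> \<le> C * real n * (1 + log 2 (real n) + l)"
      by (intro mult_right_mono) (use ln0 l0 in \<open>auto simp: C_def\<close>)
    finally have T: "real T \<le> C * real n * (1 + log 2 (real n) + l)" .
    have SB: "Suc B \<le> b * (n * (1 + L))" unfolding B_def b_def by (rule bound_arith[OF n0])
    have Ck: "real (k * (cidx c + 2) * b * 4) \<le> C" unfolding C_def by simp
    have S: "real S \<le> C * real n * (1 + l)" by (rule space_arith[OF TS(3) SB Ll l0 Ck])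
    show "\<exists>T S. computes_spanner c t r ps T S \<and> real T \<le> C * real (card P) * (1 + log 2 (real (card P)) + log 2 (radius_ratio P r)) \<and>
       real S \<le> C * real (card P) * (1 + log 2 (radius_ratio P r))"
      unfolding cP l_def[symmetric] by (rule exI[of _ T], rule exI[of _ S], intro conjI, rule TS(1), rule T, rule S)
  qed
qed

end
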